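(* Let $K$ be a non-archimedean local field, $\Lambda\subset K^\times$ an open subgroup of finite index, and $f:X\subset K^n\to Y\subset K^m$ a strict $C^1$ morphism of strict $C^1$ submanifolds. Let $\Gamma$ be a closed $\Lambda$-cone in $T^*Y\setminus\{0\}$ such that $N_f\cap\Gamma=\emptyset$. Then the pullback $f^*:\mathcal{C}^\infty(Y)\to\mathcal{C}^\infty(X)$, $h\mapsto h\circ f$, has a unique continuous extension $$f^*:\mathcal{S}'_{\Gamma,\Lambda}(Y)\to\mathcal{S}'(X),$$ for $\mathcal{S}'_{\Gamma,\Lambda}$-convergence on the source and $\mathcal{S}'$-convergence on the target. Moreover, for each $u\in\mathcal{S}'_{\Gamma,\Lambda}(Y)$ one has $\operatorname{Supp}(f^*u)\subset f^{-1}(\operatorname{Supp}u)$ and $f^*(u)\in\mathcal{S}'_{f^*\Gamma,\Lambda}(X)$. Furthermore, $f^*$ induces a continuous map $\mathcal{S}'_{\Gamma,\Lambda}(Y)\to\mathcal{S}'_{f^*\Gamma,\Lambda}(X)$ for the $\mathcal{S}'_{\Gamma,\Lambda}$-convergence on the source and the $\mathcal{S}'_{f^*\Gamma,\Lambda}$-convergence on the target.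
   Context: $K$ is a finite extension of $\mathbb{Q}_p$ or $\mathbb{F}_q((t))$, with valuation ring $\mathcal{O}_K$, maximal ideal $\mathcal{M}_K$, valuation $\operatorname{ord}$, norm $|\cdot|$; a fixed additive character $\psi_K:K\to\mathbb{C}^\times$ is trivial on $\mathcal{M}_K$ and nontrivial on $\mathcal{O}_K$. **Manifolds.** $f:U\to K^m$ ($U\subset K^n$ open) is strict $C^1$ if for each $a\in U$ there is a matrix $Df(a)$ with $\lim_{(x,y)\to(a,a),x\ne y}\frac{f(x)-f(y)-Df(a)(x-y)}{|x-y|}=0$. A nonempty $X\subset K^n$ is a strict $C^1$ submanifold of dimension $\ell$ if each $x\in X$ has an open neighborhood $U\subset K^n$ and a strict $C^1$ isomorphism (strict $C^1$ bijection with strict $C^1$ inverse) $g:U\to V$ onto an open $V\subset K^n$ with $g(X\cap U)=V\cap(K^\ell\times\{0\})$. Strict $C^1$ morphisms are defined via charts. $Df(x):T_xX\to T_{f(x)}Y$ is the differential, ${}^tDf(x)$ its dual. $T^*X$ is the cotangent bundle and $T^*X\setminus\{0\}$ the set of $(x,\xi)\in T^*X$ with $\xi\ne0$. $\mu_X$ is the canonical measure on $X$: if a coordinate projection $p:K^n\to K^\ell$ restricts to an isometry from an open $U\subset X$ onto $p(U)$, then $p|_U$ transports $\mu_X|_U$ to the Haar measure giving $\mathcal{O}_K^\ell$ measure $1$. **Distributions.** $\mathcal{C}^\infty(X)$: locally constant functions $X\to\mathbb{C}$; $\mathcal{S}(X)$: those with compact support; $\mathcal{S}'(X)$: $\mathbb{C}$-linear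 maps $\mathcal{S}(X)\to\mathbb{C}$; $(\phi u)(\varphi)=u(\phi\varphi)$. $\mathcal{C}^\infty(X)$ embeds in $\mathcal{S}'(X)$ via $h\mapsto(\varphi\mapsto\int_Xh\varphi\,\mu_X)$. $\operatorname{Supp}(u)$ is the complement of the set of points having a compact open neighborhood $U$ with $\mathbf{1}_Uu=0$. **Wave front sets.** For $u$ on an open $U\subset K^n$ and $(x_0,\xi_0)\in U\times(K^n\setminus\{0\})$, $u$ is $\Lambda$-smooth at $(x_0,\xi_0)$ if there are open neighborhoods $U_0\ni x_0$, $V_0\ni\xi_0$ such that for all $\varphi\in\mathcal{S}(U_0)$ there is $N\in\mathbb{Z}$ with $\mathcal{F}(\varphi u)(\lambda\xi)=0$ for all $\lambda\in\Lambda$ with $\operatorname{ord}\lambda<N$ and all $\xi\in V_0$, where $\mathcal{F}(\varphi u)(\xi)=u(\varphi\psi_K(\cdot|\xi))$, $x|\xi=\sum x_i\xi_i$. On an $\ell$-dimensional submanifold $X$, $u$ is $\Lambda$-smooth at $(x_0,\xi_0)\in T^*X\setminus\{0\}$ if for some (equivalently every) strict $C^1$ isomorphism $g:U\to U_1\subset K^\ell$ from an open $U\ni x_0$ of $X$ onto an open set, $g_*(u|_U):\phi\mapsto u|_U(\phi\circ g)$ is $\Lambda$-smooth at $(g(x_0),({}^tDg(x_0))^{-1}\xi_0)$. $\mathrm{WF}_\Lambda(u)\subset T^*X\setminus\{0\}$ is the set of points where $u$ is not $\Lambda$-smooth. **Cones.** A $\Lambda$-cone in $T^*X\setminus\{0\}$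 is a subset stable under $(x,\xi)\mapsto(x,\lambda\xi)$, $\lambda\in\Lambda$. $N_f=\{(y,\eta)\in T^*Y\setminus\{0\}\mid\exists x\in X: f(x)=y,\ {}^tDf(x)\eta=0\}$ and $f^*\Gamma=\{(x,\xi)\in T^*X\setminus\{0\}\mid\exists(y,\eta)\in\Gamma: f(x)=y,\ \xi={}^tDf(x)\eta\}$. **Convergence.** $u_j\to u$ in the $\mathcal{S}'$-sense if $u_j(\varphi)\to u(\varphi)$ for all $\varphi\in\mathcal{S}(X)$. For a closed $\Lambda$-cone $\Gamma\subset T^*X\setminus\{0\}$, $\mathcal{S}'_{\Gamma,\Lambda}(X)=\{u\in\mathcal{S}'(X):\mathrm{WF}_\Lambda(u)\subset\Gamma\}$. A sequence $u_j\in\mathcal{S}'_{\Gamma,\Lambda}(X)$ converges to $u$ in the $\mathcal{S}'_{\Gamma,\Lambda}$-sense if (1) $u_j\to u$ in the $\mathcal{S}'$-sense and (2) for each $(x_0,\eta_0)\in T^*X\setminus\{0\}$ not in $\Gamma$ there are open neighborhoods $U_{x_0}$ of $x_0$ and $U_{\eta_0}$ of $\eta_0$ such that for any $\varphi\in\mathcal{S}(U_{x_0})$ there is $N\in\mathbb{Z}$ with $\mathcal{F}(\varphi u_j)(\lambda\eta)=0$ for all $j$, all $\eta\in U_{\eta_0}$ and all $\lambda\in\Lambda$ with $\operatorname{ord}\lambda<N$ (on a manifold, (2) is read in a strict $C^1$ chart around $x_0$, as for $\Lambda$-smoothness). Continuity of maps means preservation of convergent sequences and their limits for these notions. *)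

theory Defs
  imports "HOL-Analysis.Analysis"
begin

section \<open>Non-archimedean local fields\<close>

class discretely_valued_field = field +
  fixes ord :: "'a \<Rightarrow> int"
  assumes ord_mult: "x \<noteq> 0 \<Longrightarrow> y \<noteq> 0 \<Longrightarrow> ord (x * y) = ord x + ord y"
    and ord_add: "x \<noteq> 0 \<Longrightarrow> y \<noteq> 0 \<Longrightarrow> x + y \<noteq> 0 \<Longrightarrow> min (ord x) (ord y) \<le> ord (x + y)"
    and ord_uniformizer: "\<exists>x. x \<noteq> 0 \<and> ord x = 1"
begin

text \<open>The value \<open>ord 0\<close> is unspecified; mathematically it is \<open>+\<infinity>\<close>, so zero is treated
  separately.\<close>

definition valuation_ring :: "'a set" where
  "valuation_ring = {x. x = 0 \<or> 0 \<le> ord x}"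

definition maximal_ideal :: "'a set" where
  "maximal_ideal = {x. x = 0 \<or> 0 < ord x}"

definition residue_field :: "'a set set" where
  "residue_field = (\<lambda>x. {y. y - x \<in> maximal_ideal}) ` valuation_ring"

end

text \<open>A local field is complete for its discrete valuation and has finite residue field, of
  cardinality \<open>q\<close> say. The metric comes from the normalized norm \<open>\<bar>x\<bar> = q powi (- ord x)\<close>.\<close>

class nonarch_local_field = discretely_valued_field + complete_space +
  assumes finite_residue_field: "finite residue_field"
    and dist_ord: "dist x y = (if x = y then 0 else real (card residue_field) powi (- ord (x - y)))"

definition knorm :: "'k::nonarch_local_field \<Rightarrow> real" where
  "knorm x = dist x 0"

definition additive_character :: "('k::nonarch_local_field \<Rightarrow> complex) \<Rightarrow> bool" where
  "additive_character \<psi> \<longleftrightarrow>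
     (\<forall>x. \<psi> x \<noteq> 0) \<and> (\<forall>x y. \<psi> (x + y) = \<psi> x * \<psi> y) \<and>
     (\<forall>x\<in>maximal_ideal. \<psi> x = 1) \<and> (\<exists>x\<in>valuation_ring. \<psi> x \<noteq> 1)"

definition open_finite_index_subgroup :: "'k::nonarch_local_field set \<Rightarrow> bool" where
  "open_finite_index_subgroup \<Lambda> \<longleftrightarrow>
     \<Lambda> \<subseteq> UNIV - {0} \<and> 1 \<in> \<Lambda> \<and> (\<forall>a\<in>\<Lambda>. \<forall>b\<in>\<Lambda>. a * b \<in> \<Lambda>) \<and> (\<forall>a\<in>\<Lambda>. inverse a \<in> \<Lambda>) \<and>
     open \<Lambda> \<and> finite ((\<lambda>a. (\<lambda>b. a * b) ` \<Lambda>) ` (UNIV - {0}))"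


section \<open>The spaces \<open>K^n\<close> and strict \<open>C^1\<close> maps\<close>

text \<open>The space \<open>K^n\<close> is the set of sequences that vanish from index \<open>n\<close> on, with the topology
  induced by the product topology. So \<open>K^l\<close> is literally \<open>K^l \<times> {0}\<close> inside \<open>K^n\<close> for
  \<open>l \<le> n\<close>, dimension \<open>0\<close> is allowed, and charts in varying dimensions have the same type.\<close>

type_synonym 'k kvec = "nat \<Rightarrow> 'k"

definition Kn :: "nat \<Rightarrow> 'k::nonarch_local_field kvec set" where
  "Kn n = {x. \<forall>i\<ge>n. x i = 0}"

definition vnorm :: "nat \<Rightarrow> 'k::nonarch_local_field kvec \<Rightarrow> real" where
  "vnorm n x = Max (insert 0 ((\<lambda>i. knorm (x i)) ` {..<n}))"

definition dotp :: "nat \<Rightarrow> 'k::nonarch_local_field kvec \<Rightarrow> 'k kvec \<Rightarrow> 'k" where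
  "dotp n x \<xi> = (\<Sum>i<n. x i * \<xi> i)"

text \<open>The \<open>m \<times> n\<close> matrix \<open>A\<close> applied to \<open>v\<close> in \<open>K^n\<close>; entries outside the range are ignored.\<close>

definition mapp :: "nat \<Rightarrow> nat \<Rightarrow> (nat \<Rightarrow> nat \<Rightarrow> 'k) \<Rightarrow> 'k kvec \<Rightarrow> 'k::nonarch_local_field kvec" where
  "mapp m n A v = (\<lambda>i. if i < m then \<Sum>j<n. A i j * v j else 0)"

definition has_strict_deriv ::
  "nat \<Rightarrow> nat \<Rightarrow> 'k::nonarch_local_field kvec set \<Rightarrow> ('k kvec \<Rightarrow> 'k kvec) \<Rightarrow> (nat \<Rightarrow> nat \<Rightarrow> 'k) \<Rightarrow>
   'k kvec \<Rightarrow> bool" where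
  "has_strict_deriv n m U f A a \<longleftrightarrow>
     ((\<lambda>(x, y). vnorm m (f x - f y - mapp m n A (x - y)) / vnorm n (x - y)) \<longlongrightarrow> 0)
       (at (a, a) within {(x, y). x \<in> U \<and> y \<in> U \<and> x \<noteq> y})"

definition strict_C1 ::
  "nat \<Rightarrow> nat \<Rightarrow> 'k::nonarch_local_field kvec set \<Rightarrow> ('k kvec \<Rightarrow> 'k kvec) \<Rightarrow> bool" where
  "strict_C1 n m U f \<longleftrightarrow>
     openin (top_of_set (Kn n)) U \<and> f ` U \<subseteq> Kn m \<and> (\<forall>a\<in>U. \<exists>A. has_strict_deriv n m U f A a)"


section \<open>Strict \<open>C^1\<close> submanifolds and morphisms\<close>

definition adapted_chart ::
  "nat \<Rightarrow> nat \<Rightarrow> 'k::nonarch_local_field kvec set \<Rightarrow> 'k kvec set \<Rightarrow> 'k kvec set \<Rightarrow>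
   ('k kvec \<Rightarrow> 'k kvec) \<Rightarrow> bool" where
  "adapted_chart n l X U V g \<longleftrightarrow>
     bij_betw g U V \<and> strict_C1 n n U g \<and> strict_C1 n n V (inv_into U g) \<and>
     g ` (X \<inter> U) = V \<inter> Kn l"

definition submanifold :: "nat \<Rightarrow> nat \<Rightarrow> 'k::nonarch_local_field kvec set \<Rightarrow> bool" where
  "submanifold n l X \<longleftrightarrow>
     l \<le> n \<and> X \<subseteq> Kn n \<and> X \<noteq> {} \<and> (\<forall>x\<in>X. \<exists>U V g. x \<in> U \<and> adapted_chart n l X U V g)"

text \<open>In the chart \<open>(U, V, g)\<close> the inverse \<open>inv_into U g\<close>, restricted to the open subset
  \<open>V \<inter> Kn l\<close> of \<open>K^l\<close>, parametrizes \<open>X \<inter> U\<close>.\<close>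

definition strict_C1_morphism ::
  "nat \<Rightarrow> nat \<Rightarrow> 'k::nonarch_local_field kvec set \<Rightarrow> nat \<Rightarrow> nat \<Rightarrow> 'k kvec set \<Rightarrow>
   ('k kvec \<Rightarrow> 'k kvec) \<Rightarrow> bool" where
  "strict_C1_morphism n l X m k Y f \<longleftrightarrow>
     f ` X \<subseteq> Y \<and>
     (\<forall>x\<in>X. \<exists>U V g U' V' h.
        x \<in> U \<and> adapted_chart n l X U V g \<and> adapted_chart m k Y U' V' h \<and> f ` (X \<inter> U) \<subseteq> U' \<and>
        strict_C1 l k (V \<inter> Kn l) (h \<circ> f \<circ> inv_into U g))"

definition strict_C1_iso ::
  "nat \<Rightarrow> nat \<Rightarrow> 'k::nonarch_local_field kvec set \<Rightarrow> nat \<Rightarrow> nat \<Rightarrow> 'k kvec set \<Rightarrow>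
   ('k kvec \<Rightarrow> 'k kvec) \<Rightarrow> bool" where
  "strict_C1_iso n l X m k Y f \<longleftrightarrow>
     bij_betw f X Y \<and> strict_C1_morphism n l X m k Y f \<and>
     strict_C1_morphism m k Y n l X (inv_into X f)"

definition C1_chart ::
  "nat \<Rightarrow> nat \<Rightarrow> 'k::nonarch_local_field kvec set \<Rightarrow> 'k kvec set \<Rightarrow> 'k kvec set \<Rightarrow>
   ('k kvec \<Rightarrow> 'k kvec) \<Rightarrow> bool" where
  "C1_chart n l X U W g \<longleftrightarrow>
     openin (top_of_set X) U \<and> openin (top_of_set (Kn l)) W \<and> strict_C1_iso n l U l l W g"


section \<open>Tangent spaces, differentials and the cotangent bundle\<close>

text \<open>\<open>T_x X\<close> is the preimage of \<open>K^l\<close> under the differential at \<open>x\<close> of an adapted chart; it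
  does not depend on the chart.\<close>

definition tangent ::
  "nat \<Rightarrow> nat \<Rightarrow> 'k::nonarch_local_field kvec set \<Rightarrow> 'k kvec \<Rightarrow> 'k kvec set" where
  "tangent n l X x =
     {v \<in> Kn n. \<exists>U V g A. x \<in> U \<and> adapted_chart n l X U V g \<and> has_strict_deriv n n U g A x \<and>
        mapp n n A v \<in> Kn l}"

text \<open>For a strict \<open>C^1\<close> morphism \<open>f\<close> from \<open>X\<close> to a submanifold of \<open>K^m\<close> and \<open>v\<close> in
  \<open>T_x X\<close>, this is \<open>Df(x) v = D(f \<circ> g\<inverse>)(g x) (Dg(x) v)\<close> for any adapted chart \<open>g\<close> at \<open>x\<close>.\<close>

definition differential ::
  "nat \<Rightarrow> nat \<Rightarrow> 'k::nonarch_local_field kvec set \<Rightarrow> nat \<Rightarrow> ('k kvec \<Rightarrow> 'k kvec) \<Rightarrow>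
   'k kvec \<Rightarrow> 'k kvec \<Rightarrow> 'k kvec" where
  "differential n l X m f x v =
     (THE w. \<exists>U V g A B. x \<in> U \<and> adapted_chart n l X U V g \<and> has_strict_deriv n n U g A x \<and>
        has_strict_deriv l m (V \<inter> Kn l) (f \<circ> inv_into U g) B (g x) \<and>
        w = mapp m l B (mapp n n A v))"

text \<open>Covectors at \<open>x\<close> are linear functionals on \<open>T_x X\<close>, extended by \<open>0\<close> outside
  \<open>T_x X\<close> so that equality of functions is equality of covectors.\<close>

definition covectors ::
  "nat \<Rightarrow> nat \<Rightarrow> 'k::nonarch_local_field kvec set \<Rightarrow> 'k kvec \<Rightarrow> ('k kvec \<Rightarrow> 'k) set" where
  "covectors n l X x =
     {\<xi>. (\<forall>v\<in>tangent n l X x. \<forall>w\<in>tangent n l X x. \<xi> (\<lambda>i. v i + w i) = \<xi> v + \<xi> w) \<and>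
         (\<forall>c. \<forall>v\<in>tangent n l X x. \<xi> (\<lambda>i. c * v i) = c * \<xi> v) \<and>
         (\<forall>v. v \<notin> tangent n l X x \<longrightarrow> \<xi> v = 0)}"

text \<open>The set \<open>T*X \<setminus> {0}\<close>.\<close>

definition cotangent_nz ::
  "nat \<Rightarrow> nat \<Rightarrow> 'k::nonarch_local_field kvec set \<Rightarrow> ('k kvec \<times> ('k kvec \<Rightarrow> 'k)) set" where
  "cotangent_nz n l X = {(x, \<xi>). x \<in> X \<and> \<xi> \<in> covectors n l X x \<and> \<xi> \<noteq> (\<lambda>_. 0)}"

text \<open>The dual \<open>\<^sup>tDf(x)\<close> of the differential.\<close>

definition codifferential ::
  "nat \<Rightarrow> nat \<Rightarrow> 'k::nonarch_local_field kvec set \<Rightarrow> nat \<Rightarrow> ('k kvec \<Rightarrow> 'k kvec) \<Rightarrow>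
   'k kvec \<Rightarrow> ('k kvec \<Rightarrow> 'k) \<Rightarrow> ('k kvec \<Rightarrow> 'k)" where
  "codifferential n l X m f x \<eta> =
     (\<lambda>v. if v \<in> tangent n l X x then \<eta> (differential n l X m f x v) else 0)"

text \<open>Identification of \<open>K^l\<close> with its dual through \<open>x|\<xi>\<close>.\<close>

definition covec :: "nat \<Rightarrow> 'k::nonarch_local_field kvec \<Rightarrow> ('k kvec \<Rightarrow> 'k)" where
  "covec l \<eta> = (\<lambda>w. if w \<in> Kn l then dotp l w \<eta> else 0)"

text \<open>The point \<open>(x, \<^sup>tDg(x) \<eta>)\<close> of \<open>T*X\<close> has coordinates \<open>(g x, \<eta>)\<close> in the chart \<open>g\<close>. The
  topology of the vector bundle \<open>T*X\<close> is given by these local trivializations.\<close>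

definition chart_image ::
  "nat \<Rightarrow> nat \<Rightarrow> 'k::nonarch_local_field kvec set \<Rightarrow> ('k kvec \<Rightarrow> 'k kvec) \<Rightarrow>
   ('k kvec \<times> ('k kvec \<Rightarrow> 'k)) set \<Rightarrow> ('k kvec \<times> 'k kvec) set" where
  "chart_image n l U g \<Gamma> =
     {(g x, \<eta>) | x \<eta>. x \<in> U \<and> \<eta> \<in> Kn l - {\<lambda>_. 0} \<and>
        (x, codifferential n l U l g x (covec l \<eta>)) \<in> \<Gamma>}"

definition closed_in_cotangent_nz ::
  "nat \<Rightarrow> nat \<Rightarrow> 'k::nonarch_local_field kvec set \<Rightarrow> ('k kvec \<times> ('k kvec \<Rightarrow> 'k)) set \<Rightarrow> bool" where
  "closed_in_cotangent_nz n l X \<Gamma> \<longleftrightarrow>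
     \<Gamma> \<subseteq> cotangent_nz n l X \<and>
     (\<forall>U W g. C1_chart n l X U W g \<longrightarrow>
        closedin (top_of_set (W \<times> (Kn l - {\<lambda>_. 0}))) (chart_image n l U g \<Gamma>))"

definition closed_cone ::
  "'k set \<Rightarrow> nat \<Rightarrow> nat \<Rightarrow> 'k::nonarch_local_field kvec set \<Rightarrow>
   ('k kvec \<times> ('k kvec \<Rightarrow> 'k)) set \<Rightarrow> bool" where
  "closed_cone \<Lambda> n l X \<Gamma> \<longleftrightarrow>
     closed_in_cotangent_nz n l X \<Gamma> \<and>
     (\<forall>x \<xi> c. (x, \<xi>) \<in> \<Gamma> \<longrightarrow> c \<in> \<Lambda> \<longrightarrow> (x, \<lambda>v. c * \<xi> v) \<in> \<Gamma>)"

definition conormal_set ::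
  "nat \<Rightarrow> nat \<Rightarrow> 'k::nonarch_local_field kvec set \<Rightarrow> nat \<Rightarrow> nat \<Rightarrow> 'k kvec set \<Rightarrow>
   ('k kvec \<Rightarrow> 'k kvec) \<Rightarrow> ('k kvec \<times> ('k kvec \<Rightarrow> 'k)) set" where
  "conormal_set n l X m k Y f =
     {(y, \<eta>) \<in> cotangent_nz m k Y. \<exists>x\<in>X. f x = y \<and> codifferential n l X m f x \<eta> = (\<lambda>_. 0)}"

definition pullback_cone ::
  "nat \<Rightarrow> nat \<Rightarrow> 'k::nonarch_local_field kvec set \<Rightarrow> nat \<Rightarrow> ('k kvec \<Rightarrow> 'k kvec) \<Rightarrow>
   ('k kvec \<times> ('k kvec \<Rightarrow> 'k)) set \<Rightarrow> ('k kvec \<times> ('k kvec \<Rightarrow> 'k)) set" where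
  "pullback_cone n l X m f \<Gamma> =
     {(x, \<xi>) \<in> cotangent_nz n l X. \<exists>(y, \<eta>)\<in>\<Gamma>. f x = y \<and> \<xi> = codifferential n l X m f x \<eta>}"


section \<open>The canonical measure\<close>

definition is_haar_measure :: "nat \<Rightarrow> 'k::nonarch_local_field kvec measure \<Rightarrow> bool" where
  "is_haar_measure l \<mu> \<longleftrightarrow>
     sets \<mu> = sets (restrict_space borel (Kn l)) \<and>
     (\<forall>a\<in>Kn l. \<forall>B\<in>sets \<mu>. emeasure \<mu> ((\<lambda>x i. a i + x i) ` B) = emeasure \<mu> B) \<and>
     emeasure \<mu> {x \<in> Kn l. \<forall>i<l. x i \<in> valuation_ring} = 1"

definition haar_measure :: "nat \<Rightarrow> 'k::nonarch_local_field kvec measure" where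
  "haar_measure l = (SOME \<mu>. is_haar_measure l \<mu>)"

text \<open>The coordinate projection \<open>K^n \<rightarrow> K^l\<close> that selects the coordinates \<open>s 0 < \<dots> < s (l - 1)\<close>.\<close>

definition coord_proj :: "nat \<Rightarrow> (nat \<Rightarrow> nat) \<Rightarrow> 'k::nonarch_local_field kvec \<Rightarrow> 'k kvec" where
  "coord_proj l s x = (\<lambda>i. if i < l then x (s i) else 0)"

definition is_canonical_measure ::
  "nat \<Rightarrow> nat \<Rightarrow> 'k::nonarch_local_field kvec set \<Rightarrow> 'k kvec measure \<Rightarrow> bool" where
  "is_canonical_measure n l X \<mu> \<longleftrightarrow>
     sets \<mu> = sets (restrict_space borel X) \<and>
     (\<forall>U s. openin (top_of_set X) U \<longrightarrow> strict_mono_on {..<l} s \<longrightarrow> s ` {..<l} \<subseteq> {..<n} \<longrightarrow>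
        (\<forall>x\<in>U. \<forall>y\<in>U. vnorm l (coord_proj l s x - coord_proj l s y) = vnorm n (x - y)) \<longrightarrow>
        (\<forall>B\<in>sets \<mu>. B \<subseteq> U \<longrightarrow> emeasure \<mu> B = emeasure (haar_measure l) (coord_proj l s ` B)))"

definition canonical_measure ::
  "nat \<Rightarrow> nat \<Rightarrow> 'k::nonarch_local_field kvec set \<Rightarrow> 'k kvec measure" where
  "canonical_measure n l X = (SOME \<mu>. is_canonical_measure n l X \<mu>)"


section \<open>Distributions\<close>

definition locally_constant_on :: "'k::nonarch_local_field kvec set \<Rightarrow> ('k kvec \<Rightarrow> complex) \<Rightarrow> bool" where
  "locally_constant_on X \<phi> \<longleftrightarrow>
     (\<forall>x\<in>X. \<exists>U. openin (top_of_set X) U \<and> x \<in> U \<and> \<phi> constant_on U)"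

text \<open>Test functions on \<open>X\<close> are extended by \<open>0\<close> outside \<open>X\<close>. The set where a locally constant
  function is nonzero is closed in \<open>X\<close>, so it is the support.\<close>

definition test_functions :: "'k::nonarch_local_field kvec set \<Rightarrow> ('k kvec \<Rightarrow> complex) set" where
  "test_functions X =
     {\<phi>. locally_constant_on X \<phi> \<and> (\<forall>x. x \<notin> X \<longrightarrow> \<phi> x = 0) \<and> compact {x. \<phi> x \<noteq> 0}}"

type_synonym 'k distr = "('k kvec \<Rightarrow> complex) \<Rightarrow> complex"

text \<open>Distributions on \<open>X\<close> are extended by \<open>0\<close> outside \<open>test_functions X\<close>, so that equality of
  functions is equality of distributions.\<close>

definition distributions :: "'k::nonarch_local_field kvec set \<Rightarrow> 'k distr set" where
  "distributions X =
     {u. (\<forall>\<phi>\<in>test_functions X. \<forall>\<phi>'\<in>test_functions X. u (\<lambda>x. \<phi> x + \<phi>' x) = u \<phi> + u \<phi>') \<and>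
         (\<forall>c. \<forall>\<phi>\<in>test_functions X. u (\<lambda>x. c * \<phi> x) = c * u \<phi>) \<and>
         (\<forall>\<phi>. \<phi> \<notin> test_functions X \<longrightarrow> u \<phi> = 0)}"

definition smooth_distr ::
  "nat \<Rightarrow> nat \<Rightarrow> 'k::nonarch_local_field kvec set \<Rightarrow> ('k kvec \<Rightarrow> complex) \<Rightarrow> 'k distr" where
  "smooth_distr n l X h =
     (\<lambda>\<phi>. if \<phi> \<in> test_functions X then \<integral>x. h x * \<phi> x \<partial>canonical_measure n l X else 0)"

definition Supp :: "'k::nonarch_local_field kvec set \<Rightarrow> 'k distr \<Rightarrow> 'k kvec set" where
  "Supp X u =
     {x \<in> X. \<not> (\<exists>U. openin (top_of_set X) U \<and> compact U \<and> x \<in> U \<and>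
        (\<forall>\<phi>\<in>test_functions X. u (\<lambda>y. indicator U y * \<phi> y) = 0))}"

definition pushforward ::
  "'k::nonarch_local_field kvec set \<Rightarrow> 'k kvec set \<Rightarrow> ('k kvec \<Rightarrow> 'k kvec) \<Rightarrow> 'k distr \<Rightarrow> 'k distr" where
  "pushforward U W g u =
     (\<lambda>\<phi>. if \<phi> \<in> test_functions W then u (\<lambda>x. if x \<in> U then \<phi> (g x) else 0) else 0)"


section \<open>Wave front sets and convergence\<close>

text \<open>The Fourier transform of \<open>\<phi>u\<close> at \<open>\<xi>\<close>.\<close>

definition fourier ::
  "('k \<Rightarrow> complex) \<Rightarrow> nat \<Rightarrow> ('k::nonarch_local_field kvec \<Rightarrow> complex) \<Rightarrow> 'k distr \<Rightarrow> 'k kvec \<Rightarrow> complex" where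
  "fourier \<psi> l \<phi> u \<xi> = u (\<lambda>x. \<phi> x * \<psi> (dotp l x \<xi>))"

text \<open>Smoothness at a point, uniformly over a set \<open>D\<close> of distributions: for \<open>D = {u}\<close> this is
  \<open>\<Lambda>\<close>-smoothness of \<open>u\<close>, for \<open>D = range us\<close> it is the uniformity condition in the definition of
  convergence of the sequence \<open>us\<close>.\<close>

definition smooth_at_open ::
  "('k \<Rightarrow> complex) \<Rightarrow> 'k set \<Rightarrow> nat \<Rightarrow> 'k::nonarch_local_field kvec set \<Rightarrow> 'k distr set \<Rightarrow>
   'k kvec \<Rightarrow> 'k kvec \<Rightarrow> bool" where
  "smooth_at_open \<psi> \<Lambda> l W D x0 \<xi>0 \<longleftrightarrow>
     (\<exists>U0 V0. openin (top_of_set (Kn l)) U0 \<and> U0 \<subseteq> W \<and> x0 \<in> U0 \<and>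
        openin (top_of_set (Kn l)) V0 \<and> \<xi>0 \<in> V0 \<and>
        (\<forall>\<phi>\<in>test_functions U0. \<exists>N. \<forall>u\<in>D. \<forall>c\<in>\<Lambda>. ord c < N \<longrightarrow>
           (\<forall>\<xi>\<in>V0. fourier \<psi> l \<phi> u (\<lambda>i. c * \<xi> i) = 0)))"

definition smooth_at ::
  "('k \<Rightarrow> complex) \<Rightarrow> 'k set \<Rightarrow> nat \<Rightarrow> nat \<Rightarrow> 'k::nonarch_local_field kvec set \<Rightarrow> 'k distr set \<Rightarrow>
   'k kvec \<Rightarrow> ('k kvec \<Rightarrow> 'k) \<Rightarrow> bool" where
  "smooth_at \<psi> \<Lambda> n l X D x0 \<xi>0 \<longleftrightarrow>
     (\<exists>U W g \<eta>0. C1_chart n l X U W g \<and> x0 \<in> U \<and> \<eta>0 \<in> Kn l \<and>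
        codifferential n l U l g x0 (covec l \<eta>0) = \<xi>0 \<and>
        smooth_at_open \<psi> \<Lambda> l W (pushforward U W g ` D) (g x0) \<eta>0)"

definition WF ::
  "('k \<Rightarrow> complex) \<Rightarrow> 'k set \<Rightarrow> nat \<Rightarrow> nat \<Rightarrow> 'k::nonarch_local_field kvec set \<Rightarrow> 'k distr \<Rightarrow>
   ('k kvec \<times> ('k kvec \<Rightarrow> 'k)) set" where
  "WF \<psi> \<Lambda> n l X u = {(x, \<xi>) \<in> cotangent_nz n l X. \<not> smooth_at \<psi> \<Lambda> n l X {u} x \<xi>}"

definition distributions_WF ::
  "('k \<Rightarrow> complex) \<Rightarrow> 'k set \<Rightarrow> nat \<Rightarrow> nat \<Rightarrow> 'k::nonarch_local_field kvec set \<Rightarrow>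
   ('k kvec \<times> ('k kvec \<Rightarrow> 'k)) set \<Rightarrow> 'k distr set" where
  "distributions_WF \<psi> \<Lambda> n l X \<Gamma> = {u \<in> distributions X. WF \<psi> \<Lambda> n l X u \<subseteq> \<Gamma>}"

definition distr_converges ::
  "'k::nonarch_local_field kvec set \<Rightarrow> (nat \<Rightarrow> 'k distr) \<Rightarrow> 'k distr \<Rightarrow> bool" where
  "distr_converges X us u \<longleftrightarrow> (\<forall>\<phi>\<in>test_functions X. (\<lambda>j. us j \<phi>) \<longlonglongrightarrow> u \<phi>)"

definition WF_converges ::
  "('k \<Rightarrow> complex) \<Rightarrow> 'k set \<Rightarrow> nat \<Rightarrow> nat \<Rightarrow> 'k::nonarch_local_field kvec set \<Rightarrow>
   ('k kvec \<times> ('k kvec \<Rightarrow> 'k)) set \<Rightarrow> (nat \<Rightarrow> 'k distr) \<Rightarrow> 'k distr \<Rightarrow> bool" where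
  "WF_converges \<psi> \<Lambda> n l X \<Gamma> us u \<longleftrightarrow>
     distr_converges X us u \<and>
     (\<forall>(x, \<xi>)\<in>cotangent_nz n l X - \<Gamma>. smooth_at \<psi> \<Lambda> n l X (range us) x \<xi>)"

text \<open>A map on \<open>S\<close> that preserves convergent sequences and their limits, for the given notions of
  convergence on its source and target.\<close>

definition seq_continuous ::
  "'a set \<Rightarrow> ((nat \<Rightarrow> 'a) \<Rightarrow> 'a \<Rightarrow> bool) \<Rightarrow> ((nat \<Rightarrow> 'b) \<Rightarrow> 'b \<Rightarrow> bool) \<Rightarrow> ('a \<Rightarrow> 'b) \<Rightarrow> bool" where
  "seq_continuous S conv conv' F \<longleftrightarrow>
     (\<forall>us u. (\<forall>j. us j \<in> S) \<longrightarrow> u \<in> S \<longrightarrow> conv us u \<longrightarrow> conv' (\<lambda>j. F (us j)) (F u))"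

definition continuous_extension ::
  "('k \<Rightarrow> complex) \<Rightarrow> 'k set \<Rightarrow> nat \<Rightarrow> nat \<Rightarrow> 'k::nonarch_local_field kvec set \<Rightarrow>
   nat \<Rightarrow> nat \<Rightarrow> 'k kvec set \<Rightarrow> ('k kvec \<Rightarrow> 'k kvec) \<Rightarrow> ('k kvec \<times> ('k kvec \<Rightarrow> 'k)) set \<Rightarrow>
   ('k distr \<Rightarrow> 'k distr) \<Rightarrow> bool" where
  "continuous_extension \<psi> \<Lambda> n l X m k Y f \<Gamma> F \<longleftrightarrow>
     F \<in> distributions_WF \<psi> \<Lambda> m k Y \<Gamma> \<rightarrow> distributions X \<and>
     (\<forall>h. locally_constant_on Y h \<longrightarrow>
        F (smooth_distr m k Y h) = smooth_distr n l X (h \<circ> f)) \<and>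
     seq_continuous (distributions_WF \<psi> \<Lambda> m k Y \<Gamma>)
       (WF_converges \<psi> \<Lambda> m k Y \<Gamma>) (distr_converges X) F"

end

theory Submission
  imports Defs "HOL-Library.Function_Algebras"
begin

text \<open>Averaging \<open>u\<close> over the balls of level \<open>j\<close> gives locally constant functions \<open>u\<^sub>j\<close> that converge
  to \<open>u\<close>, with uniform smoothness outside \<open>\<Gamma>\<close>. A continuous extension must therefore send \<open>u\<close> to the
  limit of \<open>u\<^sub>j \<circ> f\<close>, and the point is that this limit exists and is uniformly smooth. Coordinate
  projections give isometric charts, and every test function is a combination of indicators of
  small balls, so one may work with a map \<open>F\<close> near a point of \<open>K^l\<close>. Expanding \<open>u\<^sub>j\<close> in characters
  turns the integral of \<open>g (u\<^sub>j \<circ> F)\<close> into a sum over the frequencies \<open>\<eta>\<close> of level at most \<open>j\<close> of the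
  Fourier coefficient of \<open>u\<close> at \<open>\<eta>\<close> times the integral of \<open>g\<close> against the character with phase
  \<open>- F x|\<eta>\<close>. The directions modulo \<open>\<Lambda>\<close> form a compact set, so a large \<open>\<eta>\<close> is of one of two kinds:
  either it is close to a direction outside \<open>\<Gamma>\<close> and the coefficient vanishes, or the transposed
  derivative of \<open>F\<close> at \<open>\<eta>\<close> is large, because \<open>N\<^sub>f\<close> does not meet \<open>\<Gamma>\<close>, and the oscillatory integral
  vanishes. Hence the integrals are eventually constant in \<open>j\<close>. The same dichotomy with the extra
  phase \<open>x|\<zeta>\<close>, for \<open>\<zeta>\<close> outside \<open>f\<^sup>*\<Gamma>\<close>, gives the bound on the wave front set.\<close>

section \<open>Valuation and topology\<close>

text \<open>All estimates are made for a set D of distributions at once: D = {u} gives existence and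
  the wave front bound, D = \<open>range us\<close> gives the uniformity behind continuity. Since
  the pairings with a fixed test function become constant from a level common to all of D, weak
  convergence of a sequence is needed at one level only. Smoothness is defined by the existence of
  some strict chart, while the computation runs in isometric charts. The transition between them is
  merely strict C^1 and makes linear phases nonlinear, so independence of the chart is itself an
  oscillatory integral argument (\<open>smooth_change\<close>). Haar and canonical measures are
  given by \<open>SOME\<close> and must be constructed. Counting does this: with q the size of the
  residue field, a ball splits into q^(l N) balls that are N levels smaller, in \<open>Kn l\<close>
  as well as in an isometric chart. Norms are replaced by integer levels. The character is trivial
  on level 1 but not on level 0, which is the origin of the shift in the duality between balls of
  level j and frequencies of level 1 - j.\<close>

context discretely_valued_field
begin

lemma ord_one [simp]: "ord 1 = 0"
  using ord_mult[of 1 1] by simp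

lemma ord_minus_one: "ord (- 1) = 0"
  using ord_mult[of "-1" "-1"] by simp

lemma ord_minus [simp]: "ord (- x) = ord x"
proof (cases "x = 0")
  case False
  then show ?thesis using ord_mult[of "-1" x] ord_minus_one by simp
qed simp

lemma ord_inverse: "x \<noteq> 0 \<Longrightarrow> ord (inverse x) = - ord x"
  using ord_mult[of x "inverse x"] by simp

text \<open>Membership in the j-th power of the maximal ideal. The disjunct for 0 stands in for the
  infinite valuation that \<open>ord 0\<close> lacks, so the rules for sums and products below carry
  no nonvanishing conditions.\<close>

definition vge :: "int \<Rightarrow> 'a \<Rightarrow> bool" where
  "vge j x \<longleftrightarrow> x = 0 \<or> j \<le> ord x"

lemma vge_0 [simp]: "vge j 0"
  by (simp add: vge_def)

lemma vge_mono: "vge j x \<Longrightarrow> i \<le> j \<Longrightarrow> vge i x"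
  by (auto simp: vge_def)

lemma vge_add: "vge j x \<Longrightarrow> vge j y \<Longrightarrow> vge j (x + y)"
  using ord_add[of x y] by (cases "x = 0"; cases "y = 0"; cases "x + y = 0") (auto simp: vge_def)

lemma vge_uminus [simp]: "vge j (- x) \<longleftrightarrow> vge j x"
  by (simp add: vge_def)

lemma vge_diff: "vge j x \<Longrightarrow> vge j y \<Longrightarrow> vge j (x - y)"
  using vge_add[of j x "- y"] by simp

lemma vge_mult: "vge i x \<Longrightarrow> vge j y \<Longrightarrow> vge (i + j) (x * y)"
  by (cases "x = 0"; cases "y = 0") (auto simp: vge_def ord_mult)

lemma vge_sum: "(\<And>i. i \<in> A \<Longrightarrow> vge j (f i)) \<Longrightarrow> vge j (sum f A)"
  by (induct A rule: infinite_finite_induct) (auto simp: vge_add)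

lemma vge_commute: "vge j (x - y) \<longleftrightarrow> vge j (y - x)"
  using vge_uminus[of j "x - y"] by simp

lemma vge_mult_iff: "c \<noteq> 0 \<Longrightarrow> vge j (c * x) \<longleftrightarrow> vge (j - ord c) x"
  by (cases "x = 0") (auto simp: vge_def ord_mult)

lemma vge_all_0: "(\<And>j. vge j x) \<Longrightarrow> x = 0"
  using vge_def[of "ord x + 1" x] by auto

lemma maximal_ideal_vge: "x \<in> maximal_ideal \<longleftrightarrow> vge 1 x"
  by (auto simp: maximal_ideal_def vge_def)

lemma valuation_ring_vge: "x \<in> valuation_ring \<longleftrightarrow> vge 0 x"
  by (auto simp: valuation_ring_def vge_def)

definition unif :: 'a where
  "unif = (SOME x. x \<noteq> 0 \<and> ord x = 1)"

lemma unif: "unif \<noteq> 0" "ord unif = 1"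
  using someI_ex[OF ord_uniformizer] by (auto simp: unif_def)

lemma ord_power: "x \<noteq> 0 \<Longrightarrow> ord (x ^ n) = int n * ord x"
  by (induct n) (auto simp: ord_mult algebra_simps)

text \<open>Integer powers of a uniformizer. Multiplication by \<open>upow j\<close> shifts every
  level by exactly j, which is how small increments in a prescribed direction are produced.\<close>

definition upow :: "int \<Rightarrow> 'a" where
  "upow j = (if 0 \<le> j then unif ^ nat j else inverse (unif ^ nat (- j)))"

lemma upow_nonzero [simp]: "upow j \<noteq> 0"
  by (simp add: upow_def unif)

lemma ord_upow [simp]: "ord (upow j) = j"
  by (simp add: upow_def unif ord_power ord_inverse)

lemma vge_upow_mult: "vge j (upow i * x) \<longleftrightarrow> vge (j - i) x"
  by (simp add: vge_mult_iff)

end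

section \<open>The norm as a power of the residue cardinality\<close>

definition rq :: "'k::nonarch_local_field itself \<Rightarrow> nat" where
  "rq _ = card (residue_field :: 'k set set)"

text \<open>The residue classes of 0 and 1 differ. A base greater than 1 is what makes powers of q
  comparable by their exponents and small for large levels.\<close>

lemma rq_ge_2: "2 \<le> rq TYPE('k::nonarch_local_field)"
proof -
  let ?C = "\<lambda>x::'k. {y. y - x \<in> maximal_ideal}"
  have "(1::'k) \<notin> ?C 0" "0 \<in> ?C 0" "0 \<in> ?C 0"
    by (auto simp: maximal_ideal_vge vge_def)
  moreover have "1 \<in> ?C 1" by (auto simp: maximal_ideal_vge)
  ultimately have ne: "?C 0 \<noteq> ?C 1" by blast
  have "{?C 0, ?C 1} \<subseteq> residue_field"
  proof -
    have "(0::'k) \<in> valuation_ring" "(1::'k) \<in> valuation_ring"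
      by (auto simp: valuation_ring_vge vge_def)
    then show ?thesis unfolding residue_field_def by blast
  qed
  then have "card {?C 0, ?C 1} \<le> rq TYPE('k)"
    unfolding rq_def by (rule card_mono[OF finite_residue_field])
  then show ?thesis using ne by simp
qed

abbreviation rqr :: "'k::nonarch_local_field itself \<Rightarrow> real" where
  "rqr k \<equiv> real (rq k)"

lemma rq_gt_1 [simp]: "1 < rqr TYPE('k::nonarch_local_field)" "0 < rqr TYPE('k)"
  "Suc 0 < rq TYPE('k)" "0 < rq TYPE('k)"
  using rq_ge_2[where 'k='k] by auto

lemma rq_powi_le_iff [simp]:
  "rqr TYPE('k::nonarch_local_field) powi i \<le> rqr TYPE('k) powi j \<longleftrightarrow> i \<le> j"
  by (metis rq_gt_1(1) power_int_increasing power_int_strict_increasing less_le_not_le linorder_not_le less_eq_real_def)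

text \<open>The norm takes no nonzero values besides powers of q, so closed balls of such radii are
  cut out by \<open>vge\<close>. This is the dictionary by which levels replace the metric.\<close>

lemma dist_le_iff: "dist x (y::'k::nonarch_local_field) \<le> rqr TYPE('k) powi (- j) \<longleftrightarrow> vge j (x - y)"
  by (auto simp: dist_ord vge_def simp flip: rq_def[of "TYPE('k)"])

lemma knorm_le_iff: "knorm (x::'k::nonarch_local_field) \<le> rqr TYPE('k) powi (- j) \<longleftrightarrow> vge j x"
  by (simp add: knorm_def dist_le_iff)

lemma rq_powi_small: "0 < e \<Longrightarrow> \<exists>j. rqr TYPE('k::nonarch_local_field) powi (- j) < e"
proof -
  assume "0 < e"
  moreover have "inverse (rqr TYPE('k)) < 1"
    by (auto simp: inverse_less_1_iff)
  ultimately obtain n where n: "inverse (rqr TYPE('k)) ^ n < e"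
    using real_arch_pow_inv by blast
  have "rqr TYPE('k) powi (- int n) = inverse (rqr TYPE('k)) ^ n"
    by (simp add: power_int_minus power_inverse)
  then show ?thesis using n by metis
qed

lemma open_vge: "open {y::'k::nonarch_local_field. vge j (y - x)}"
  unfolding open_dist
proof (intro ballI)
  fix a assume a: "a \<in> {y. vge j (y - x)}"
  show "\<exists>e>0. \<forall>y. dist y a < e \<longrightarrow> y \<in> {y. vge j (y - x)}"
  proof (intro exI conjI allI impI)
    show "0 < rqr TYPE('k) powi (- j)" by (simp add: zero_less_power_int)
    fix y assume "dist y a < rqr TYPE('k) powi (- j)"
    then have "vge j (y - a)" using dist_le_iff[of y a j] by simp
    then show "y \<in> {y. vge j (y - x)}" using a vge_add[of j "y - a" "a - x"] by simp
  qed
qed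

lemma open_contains_vge:
  assumes "open S" "x \<in> S"
  shows "\<exists>j. \<forall>y::'k::nonarch_local_field. vge j (y - x) \<longrightarrow> y \<in> S"
proof -
  obtain e where e: "e > 0" "\<And>y. dist y x < e \<Longrightarrow> y \<in> S" using assms open_dist by metis
  obtain j where "rqr TYPE('k) powi (- j) < e" using rq_powi_small e(1) by blast
  then show ?thesis using e(2) dist_le_iff[of _ x j] by (intro exI[of _ j]) (meson le_less_trans)
qed

lemma closed_vge: "closed {y::'k::nonarch_local_field. vge j (y - x)}"
  unfolding closed_def
proof (rule Topological_Spaces.openI)
  fix z assume z: "z \<in> - {y. vge j (y - x)}"
  have "\<not> vge j (y - x)" if "vge j (y - z)" for y
    using that z vge_diff[of j "y - x" "y - z"] by auto
  then have "{y. vge j (y - z)} \<subseteq> - {y. vge j (y - x)}" by blast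
  moreover have "z \<in> {y. vge j (y - z)}" by simp
  ultimately show "\<exists>T. open T \<and> z \<in> T \<and> T \<subseteq> - {y. vge j (y - x)}"
    using open_vge by blast
qed

subsection \<open>Residue representatives\<close>

text \<open>One element is chosen from each residue class. Exactness matters twice: the cardinality
  becomes the volume ratio of balls, and uniqueness makes the digit description of cells
  injective.\<close>

lemma residue_reps:
  "\<exists>T::'k::nonarch_local_field set. finite T \<and> card T = rq TYPE('k) \<and> (\<forall>t\<in>T. vge 0 t) \<and>
     (\<forall>x. vge 0 x \<longrightarrow> (\<exists>!t. t \<in> T \<and> vge 1 (x - t)))"
proof -
  define cl where "cl x = {y::'k. vge 1 (y - x)}" for x
  have rf: "residue_field = cl ` {x. vge 0 x}"
    by (auto simp: residue_field_def valuation_ring_vge maximal_ideal_vge cl_def)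
  have cl_eq: "cl x = cl y" if "vge 1 (x - y)" for x y
    unfolding cl_def
  proof (intro Collect_cong iffI)
    fix z
    show "vge 1 (z - y)" if "vge 1 (z - x)"
      using vge_add[OF that \<open>vge 1 (x - y)\<close>] by simp
    show "vge 1 (z - x)" if "vge 1 (z - y)"
      using vge_diff[OF that \<open>vge 1 (x - y)\<close>] by simp
  qed
  define r where "r C = (SOME x. x \<in> C)" for C :: "'k set"
  have r: "vge 1 (r (cl x) - x)" for x
  proof -
    have "r (cl x) \<in> cl x" unfolding r_def by (rule someI[of _ x]) (simp add: cl_def)
    then show ?thesis by (simp add: cl_def)
  qed
  have r0: "vge 0 (r (cl x))" if "vge 0 x" for x
    using vge_add[OF vge_mono[OF r[of x], of 0] that] by simp
  have clr: "cl (r (cl x)) = cl x" for x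
    using cl_eq[OF r] .
  define T where "T = r ` residue_field"
  have inj: "inj_on r residue_field"
    unfolding rf by (rule inj_onI) (metis clr imageE)
  have "finite T" "card T = rq TYPE('k)"
    using finite_residue_field[where 'a='k] card_image[OF inj] by (simp_all add: T_def rq_def)
  moreover have "\<exists>!t. t \<in> T \<and> vge 1 (x - t)" if x: "vge 0 x" for x
  proof (rule ex1I[of _ "r (cl x)"])
    show "r (cl x) \<in> T \<and> vge 1 (x - r (cl x))"
      using r[of x] x by (simp add: T_def rf vge_commute)
    fix t assume t: "t \<in> T \<and> vge 1 (x - t)"
    then obtain z where z: "t = r (cl z)" by (auto simp: T_def rf)
    then have "cl z = cl t" using clr by simp
    also have "\<dots> = cl x" using t cl_eq vge_commute by blast
    finally show "t = r (cl x)" using z by simp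
  qed
  moreover have "\<forall>t\<in>T. vge 0 t" using r0 by (auto simp: T_def rf)
  ultimately show ?thesis by blast
qed

text \<open>Digit expansion: the remainder is rescaled to level 0 and a residue representative is
  subtracted, which gains one level per step.\<close>

lemma finite_vge_net:
  "\<exists>F. finite F \<and> (\<forall>x::'k::nonarch_local_field. vge j x \<longrightarrow> (\<exists>t\<in>F. vge (j + int N) (x - t)))"
proof (induct N)
  case 0
  show ?case by (intro exI[of _ "{0}"]) simp
next
  case (Suc N)
  then obtain F where F: "finite F" "\<And>x::'k. vge j x \<Longrightarrow> \<exists>t\<in>F. vge (j + int N) (x - t)" by blast
  obtain T :: "'k set" where T: "finite T" "\<And>x. vge 0 x \<Longrightarrow> \<exists>t\<in>T. vge 1 (x - t)"
    using residue_reps[where 'k='k] by metis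
  let ?F = "(\<lambda>(f, t). f + upow (j + int N) * t) ` (F \<times> T)"
  have "\<exists>t\<in>?F. vge (j + int (Suc N)) (x - t)" if x: "vge j x" for x
  proof -
    obtain f where f: "f \<in> F" "vge (j + int N) (x - f)" using F x by blast
    let ?z = "inverse (upow (j + int N)) * (x - f)"
    have "vge 0 ?z" using f(2) by (subst vge_mult_iff) (simp_all add: ord_inverse add.commute)
    then obtain t where t: "t \<in> T" "vge 1 (?z - t)" using T by blast
    have "x - (f + upow (j + int N) * t) = upow (j + int N) * (?z - t)"
      by (simp add: right_diff_distrib flip: mult.assoc)
    then have "vge (j + int (Suc N)) (x - (f + upow (j + int N) * t))"
      using t(2) vge_upow_mult[of "j + int (Suc N)" "j + int N" "?z - t"]
      by (simp add: algebra_simps)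
    then show ?thesis using f t by force
  qed
  moreover have "finite ?F" using F T by simp
  ultimately show ?case by blast
qed

text \<open>Total boundedness comes from the finite nets, completeness from the class; here
  finiteness of the residue field becomes local compactness.\<close>

lemma compact_vge: "compact {y::'k::nonarch_local_field. vge j (y - x)}"
  unfolding compact_eq_totally_bounded
proof (intro conjI allI impI)
  show "complete {y. vge j (y - x)}" using closed_vge by (simp add: complete_eq_closed)
  fix e :: real assume "e > 0"
  then obtain i where i: "rqr TYPE('k) powi (- i) < e" using rq_powi_small by blast
  obtain F where F: "finite F" "\<And>z::'k. vge j z \<Longrightarrow> \<exists>t\<in>F. vge (j + int (nat (i - j))) (z - t)"
    using finite_vge_net[of j "nat (i - j)"] by blast
  have "{y. vge j (y - x)} \<subseteq> (\<Union>t\<in>(\<lambda>t. t + x) ` F. ball t e)"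
  proof
    fix y assume "y \<in> {y. vge j (y - x)}"
    then obtain t where t: "t \<in> F" "vge (j + int (nat (i - j))) (y - x - t)" using F by blast
    then have "vge i (y - (t + x))" using vge_mono by (fastforce simp: algebra_simps)
    then have "dist y (t + x) < e" using dist_le_iff[of y "t + x" i] i by linarith
    then show "y \<in> (\<Union>t\<in>(\<lambda>t. t + x) ` F. ball t e)" using t by (auto simp: dist_commute)
  qed
  then show "\<exists>k. finite k \<and> {y. vge j (y - x)} \<subseteq> (\<Union>x\<in>k. ball x e)" using F(1) by blast
qed

subsection \<open>Vectors\<close>

text \<open>The ball of the maximum norm around 0, written by levels. Implications between levels
  take the place of comparisons of \<open>vnorm\<close>.\<close>

definition near :: "nat \<Rightarrow> int \<Rightarrow> 'k::nonarch_local_field kvec \<Rightarrow> bool" where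
  "near n j v \<longleftrightarrow> (\<forall>i<n. vge j (v i))"

lemma near_0 [simp]: "near n j 0"
  by (simp add: near_def)

lemma near_mono: "near n j v \<Longrightarrow> i \<le> j \<Longrightarrow> near n i v"
  by (auto simp: near_def intro: vge_mono)

lemma near_add: "near n j v \<Longrightarrow> near n j w \<Longrightarrow> near n j (v + w)"
  by (auto simp: near_def vge_add)

lemma near_uminus [simp]: "near n j (- v) \<longleftrightarrow> near n j v"
  by (auto simp: near_def)

lemma near_diff: "near n j v \<Longrightarrow> near n j w \<Longrightarrow> near n j (v - w)"
  by (auto simp: near_def vge_diff)

lemma near_commute: "near n j (x - y) \<longleftrightarrow> near n j (y - x)"
  by (auto simp: near_def vge_commute)

lemma near_trans: "near n j (x - y) \<Longrightarrow> near n j (y - z) \<Longrightarrow> near n j (x - z)"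
  using near_add[of n j "x - y" "y - z"] by simp

lemma near_ex: "\<exists>j. near n j v"
proof -
  let ?S = "insert 0 ((\<lambda>i. ord (v i)) ` {..<n})"
  have "near n (Min ?S) v" unfolding near_def
  proof (intro allI impI)
    fix i assume "i < n"
    then have "Min ?S \<le> ord (v i)" by (intro Min_le) auto
    then show "vge (Min ?S) (v i)" by (simp add: vge_def)
  qed
  then show ?thesis by blast
qed

text \<open>The exact level of a vector, the substitute for its norm. Some level holds and level i
  fails, so there is a last one in between; the failure also excludes the zero vector.\<close>

lemma near_exact:
  assumes "\<not> near n i v"
  obtains j where "j < i" "near n j v" "\<not> near n (j + 1) v"
proof -
  obtain j0 where j0: "near n j0 v" using near_ex by blast
  then have lt: "j0 < i" using assms near_mono by (metis not_le)
  have "\<exists>m. near n (j0 + int m) v \<and> \<not> near n (j0 + int (Suc m)) v"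
  proof (rule ccontr)
    assume *: "\<nexists>m. near n (j0 + int m) v \<and> \<not> near n (j0 + int (Suc m)) v"
    have "near n (j0 + int m) v" for m
    proof (induct m)
      case (Suc m) then show ?case using * by blast
    qed (use j0 in simp)
    from this[of "nat (i - j0)"] show False using assms lt by simp
  qed
  then obtain m where m: "near n (j0 + int m) v" "\<not> near n (j0 + int (Suc m)) v" by blast
  have "j0 + int m < i" using m assms near_mono by (metis not_le)
  then show ?thesis using m by (intro that[of "j0 + int m"]) (auto simp: algebra_simps)
qed

lemma Kn_0 [simp]: "0 \<in> Kn n"
  by (simp add: Kn_def)

lemma Kn_add: "x \<in> Kn n \<Longrightarrow> y \<in> Kn n \<Longrightarrow> x + y \<in> Kn n"
  by (simp add: Kn_def)

lemma Kn_diff: "x \<in> Kn n \<Longrightarrow> y \<in> Kn n \<Longrightarrow> x - y \<in> Kn n"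
  by (simp add: Kn_def)

lemma Kn_scale: "x \<in> Kn n \<Longrightarrow> (\<lambda>i. c * x i) \<in> Kn n"
  by (simp add: Kn_def)

lemma Kn_mono: "l \<le> n \<Longrightarrow> Kn l \<subseteq> Kn n"
  by (auto simp: Kn_def)

lemma Kn_eqI: "x \<in> Kn n \<Longrightarrow> y \<in> Kn n \<Longrightarrow> (\<And>i. i < n \<Longrightarrow> x i = y i) \<Longrightarrow> x = y"
  by (rule ext) (metis (mono_tags, lifting) Kn_def linorder_not_le mem_Collect_eq)

lemma near_all_0: "x \<in> Kn n \<Longrightarrow> (\<And>j. near n j x) \<Longrightarrow> x = 0"
  by (rule Kn_eqI[of _ n]) (auto simp: near_def intro: vge_all_0)

lemma near_scale_iff: "c \<noteq> 0 \<Longrightarrow> near n j (\<lambda>i. c * v i) \<longleftrightarrow> near n (j - ord c) v"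
  by (simp add: near_def vge_mult_iff)

lemma vnorm_le_iff: "vnorm n (v::'k::nonarch_local_field kvec) \<le> rqr TYPE('k) powi (- j) \<longleftrightarrow> near n j v"
  unfolding vnorm_def near_def
  by (subst Max_le_iff) (auto simp: knorm_le_iff less_imp_le)

lemma vnorm_nonneg: "0 \<le> vnorm n v"
  unfolding vnorm_def by (intro Max_ge) auto

lemma vnorm_cases:
  assumes "v \<in> Kn n" "v \<noteq> 0"
  obtains j where "vnorm n (v::'k::nonarch_local_field kvec) = rqr TYPE('k) powi (- j)"
proof -
  have "vnorm n v \<in> insert 0 ((\<lambda>i. knorm (v i)) ` {..<n})"
    unfolding vnorm_def by (rule Max_in) auto
  moreover have "vnorm n v \<noteq> 0"
  proof
    assume "vnorm n v = 0"
    then have "near n j v" for j by (simp flip: vnorm_le_iff add: less_imp_le)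
    then show False using near_all_0 assms by blast
  qed
  ultimately obtain i where "vnorm n v = knorm (v i)" "knorm (v i) \<noteq> 0" by auto
  then have "vnorm n v = rqr TYPE('k) powi (- ord (v i))"
    by (auto simp: knorm_def dist_ord rq_def split: if_splits)
  then show ?thesis by (rule that)
qed

lemma vge_dotp: "near n i v \<Longrightarrow> near n j w \<Longrightarrow> vge (i + j) (dotp n v w)"
  unfolding dotp_def near_def by (intro vge_sum vge_mult) auto

lemma dotp_add_left: "dotp n (x + y) z = dotp n x z + dotp n y z"
  by (simp add: dotp_def algebra_simps sum.distrib)

lemma dotp_diff_left: "dotp n (x - y) z = dotp n x z - dotp n y z"
  by (simp add: dotp_def algebra_simps sum_subtractf)

lemma dotp_add_right: "dotp n x (y + z) = dotp n x y + dotp n x z"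
  by (simp add: dotp_def algebra_simps sum.distrib)

lemma dotp_diff_right: "dotp n x (y - z) = dotp n x y - dotp n x z"
  by (simp add: dotp_def algebra_simps sum_subtractf)

lemma dotp_uminus_right: "dotp n x (- y) = - dotp n x y"
  by (simp add: dotp_def sum_negf)

lemma dotp_scale_left: "dotp n (\<lambda>i. c * x i) y = c * dotp n x y"
  by (simp add: dotp_def sum_distrib_left algebra_simps)

lemma dotp_0 [simp]: "dotp n x 0 = 0" "dotp n 0 x = 0"
  by (simp_all add: dotp_def)

lemma dotp_commute: "dotp n x y = dotp n y x"
  by (simp add: dotp_def mult.commute)

definition unitv :: "nat \<Rightarrow> 'k::nonarch_local_field kvec" where
  "unitv i = (\<lambda>j. if j = i then 1 else 0)"

lemma unitv_Kn: "i < n \<Longrightarrow> unitv i \<in> Kn n"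
  by (auto simp: Kn_def unitv_def)

lemma dotp_unitv: "i < n \<Longrightarrow> dotp n (unitv i) y = y i"
  by (simp add: dotp_def unitv_def if_distrib[of "\<lambda>x. x * _"] cong: if_cong)

lemma mapp_Kn: "mapp m n A v \<in> Kn m"
  by (simp add: mapp_def Kn_def)

lemma mapp_add: "mapp m n A (v + w) = mapp m n A v + mapp m n A w"
  by (auto simp: mapp_def fun_eq_iff algebra_simps sum.distrib)

lemma mapp_diff: "mapp m n A (v - w) = mapp m n A v - mapp m n A w"
  by (auto simp: mapp_def fun_eq_iff algebra_simps sum_subtractf)

lemma mapp_scale: "mapp m n A (\<lambda>i. c * v i) = (\<lambda>i. c * mapp m n A v i)"
  by (auto simp: mapp_def fun_eq_iff algebra_simps sum_distrib_left)

lemma mapp_0 [simp]: "mapp m n A 0 = 0"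
  by (auto simp: mapp_def fun_eq_iff)

definition mmul :: "nat \<Rightarrow> (nat \<Rightarrow> nat \<Rightarrow> 'k::nonarch_local_field) \<Rightarrow> (nat \<Rightarrow> nat \<Rightarrow> 'k) \<Rightarrow> nat \<Rightarrow> nat \<Rightarrow> 'k" where
  "mmul m B A = (\<lambda>i j. \<Sum>k<m. B i k * A k j)"

lemma mapp_mmul: "mapp p n (mmul m B A) v = mapp p m B (mapp m n A v)"
proof (rule ext)
  fix i
  have "(\<Sum>j<n. (\<Sum>k<m. B i k * A k j) * v j) = (\<Sum>j<n. \<Sum>k<m. B i k * A k j * v j)"
    by (simp add: sum_distrib_right)
  also have "\<dots> = (\<Sum>k<m. \<Sum>j<n. B i k * A k j * v j)" by (rule sum.swap)
  also have "\<dots> = (\<Sum>k<m. B i k * (\<Sum>j<n. A k j * v j))"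
    by (simp add: sum_distrib_left mult.assoc)
  finally show "mapp p n (mmul m B A) v i = mapp p m B (mapp m n A v) i"
    by (simp add: mapp_def mmul_def)
qed

text \<open>The constant is the least valuation of an entry, capped at 0: a matrix costs a bounded
  number of levels, whatever the vector.\<close>

lemma mapp_bound: "\<exists>c. \<forall>v j. near n j v \<longrightarrow> near m (j + c) (mapp m n A v)"
proof -
  let ?S = "insert 0 ((\<lambda>(i, j). ord (A i j)) ` ({..<m} \<times> {..<n}))"
  have A: "vge (Min ?S) (A i j)" if "i < m" "j < n" for i j
  proof -
    have "Min ?S \<le> ord (A i j)" using that by (intro Min_le) force+
    then show ?thesis by (simp add: vge_def)
  qed
  show ?thesis
  proof (intro exI[of _ "Min ?S"] allI impI)
    fix v :: "'a kvec" and j assume "near n j v"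
    then show "near m (j + Min ?S) (mapp m n A v)"
      unfolding near_def mapp_def using vge_mult[OF A]
      by (auto intro!: vge_sum simp: add.commute[of j])
  qed
qed

text \<open>The transpose, which by \<open>dotp_mapp\<close> is the coordinate form of the dual of a
  differential.\<close>

definition tmapp :: "nat \<Rightarrow> nat \<Rightarrow> (nat \<Rightarrow> nat \<Rightarrow> 'k) \<Rightarrow> 'k kvec \<Rightarrow> 'k::nonarch_local_field kvec" where
  "tmapp m n A = mapp n m (\<lambda>i j. A j i)"

lemma dotp_mapp: "dotp m (mapp m n A v) w = dotp n v (tmapp m n A w)"
proof -
  have "dotp m (mapp m n A v) w = (\<Sum>i<m. \<Sum>j<n. A i j * v j * w i)"
    by (simp add: dotp_def mapp_def sum_distrib_right)
  also have "\<dots> = (\<Sum>j<n. \<Sum>i<m. A i j * v j * w i)" by (rule sum.swap)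
  also have "\<dots> = dotp n v (tmapp m n A w)"
    by (simp add: dotp_def tmapp_def mapp_def sum_distrib_left algebra_simps)
  finally show ?thesis .
qed

subsection \<open>Balls\<close>

text \<open>Relative to a set X, because balls of a manifold, of a chart domain and of
  \<open>Kn n\<close> occur side by side. Two balls are disjoint or nested, and every point of a
  ball is a centre of it.\<close>

definition bl :: "nat \<Rightarrow> 'k::nonarch_local_field kvec set \<Rightarrow> 'k kvec \<Rightarrow> int \<Rightarrow> 'k kvec set" where
  "bl n X x j = {y \<in> X. near n j (y - x)}"

lemma mem_bl: "y \<in> bl n X x j \<longleftrightarrow> y \<in> X \<and> near n j (y - x)"
  by (simp add: bl_def)

lemma bl_self: "x \<in> X \<Longrightarrow> x \<in> bl n X x j"
  by (simp add: mem_bl)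

lemma bl_subset: "bl n X x j \<subseteq> X"
  by (auto simp: mem_bl)

lemma bl_eq: "near n j (y - x) \<Longrightarrow> bl n X y j = bl n X x j"
  unfolding bl_def
  by (intro Collect_cong conj_cong refl) (metis near_commute near_trans)

lemma bl_eq_mem: "y \<in> bl n X x j \<Longrightarrow> bl n X y j = bl n X x j"
  by (rule bl_eq) (simp add: mem_bl)

lemma bl_mono: "i \<le> j \<Longrightarrow> y \<in> bl n X x i \<Longrightarrow> bl n X y j \<subseteq> bl n X x i"
  using near_trans near_mono by (fastforce simp: mem_bl)

lemma bl_disjoint: "i \<le> j \<Longrightarrow> bl n X x i \<inter> bl n X y j = {} \<or> bl n X y j \<subseteq> bl n X x i"
proof (cases "bl n X x i \<inter> bl n X y j = {}")
  case False
  assume le: "i \<le> j"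
  then obtain z where z: "z \<in> bl n X x i" "z \<in> bl n X y j" using False by blast
  then have "bl n X z j \<subseteq> bl n X x i" using bl_mono le by blast
  then show ?thesis using bl_eq_mem[OF z(2)] by simp
qed simp

lemma open_near: "open {y::'k::nonarch_local_field kvec. near n j (y - x)}"
proof -
  have "{y. near n j (y - x)} = (\<Inter>i<n. (\<lambda>y. y i) -` {t. vge j (t - x i)})"
    by (auto simp: near_def)
  moreover have "open ((\<lambda>y::'k kvec. y i) -` {t. vge j (t - x i)})" for i
    by (intro open_vimage open_vge continuous_on_product_coordinates)
  ultimately show ?thesis by auto
qed

text \<open>A basic open set of the product topology may also restrict coordinates beyond n, but
  there both vectors vanish and agree. So the maximum of the first n radii suffices.\<close>

lemma open_contains_near:
  assumes "open S" "x \<in> S" "x \<in> Kn n"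
  shows "\<exists>j. \<forall>y\<in>Kn n. near n j (y - x) \<longrightarrow> (y::'k::nonarch_local_field kvec) \<in> S"
proof -
  have "openin (product_topology (\<lambda>i. euclidean) UNIV) S"
    using assms(1) by (simp add: open_fun_def)
  from product_topology_open_contains_basis[OF this assms(2)]
  obtain X where X: "x \<in> PiE UNIV X" "\<forall>i. openin euclidean (X i)" "PiE UNIV X \<subseteq> S"
    by (elim exE conjE) rule
  have "\<exists>j. \<forall>y. vge j (y - x i) \<longrightarrow> y \<in> X i" for i
    using X(1,2) by (intro open_contains_vge) (simp_all add: PiE_iff)
  then obtain J where J: "\<And>i y. vge (J i) (y - x i) \<Longrightarrow> y \<in> X i" by metis
  let ?j = "Max (insert 0 (J ` {..<n}))"
  have "y \<in> S" if y: "y \<in> Kn n" "near n ?j (y - x)" for y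
  proof -
    have yX: "y i \<in> X i" for i
    proof (cases "i < n")
      case True
      then have "J i \<le> ?j" by (intro Max_ge) auto
      then show ?thesis using y True by (intro J) (auto simp: near_def intro: vge_mono)
    next
      case False
      then have "y i = x i" using y assms(3) by (auto simp: Kn_def)
      then show ?thesis using X by (auto simp: PiE_iff)
    qed
    have "y \<in> PiE UNIV X" using yX by (simp add: PiE_iff)
    with X(3) show ?thesis by (rule subsetD)
  qed
  then show ?thesis by blast
qed

lemma openin_iff_near:
  assumes X: "X \<subseteq> Kn n"
  shows "openin (top_of_set X) U \<longleftrightarrow> U \<subseteq> X \<and> (\<forall>x\<in>U. \<exists>j. bl n X x j \<subseteq> U)"
proof
  assume U: "openin (top_of_set X) U"
  then obtain T where T: "open T" "U = X \<inter> T" by (auto simp: openin_open)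
  have "\<exists>j. bl n X x j \<subseteq> U" if xU: "x \<in> U" for x
  proof -
    obtain j where "\<forall>y\<in>Kn n. near n j (y - x) \<longrightarrow> y \<in> T"
      using open_contains_near[OF T(1), of x n] T(2) xU X by blast
    then have "bl n X x j \<subseteq> U" using T(2) X unfolding bl_def by blast
    then show ?thesis by blast
  qed
  then show "U \<subseteq> X \<and> (\<forall>x\<in>U. \<exists>j. bl n X x j \<subseteq> U)" using T by auto
next
  assume R: "U \<subseteq> X \<and> (\<forall>x\<in>U. \<exists>j. bl n X x j \<subseteq> U)"
  then obtain J where J: "\<And>x. x \<in> U \<Longrightarrow> bl n X x (J x) \<subseteq> U" by metis
  have "U = X \<inter> (\<Union>x\<in>U. {y. near n (J x) (y - x)})"
  proof (intro equalityI subsetI)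
    fix y assume "y \<in> U"
    then show "y \<in> X \<inter> (\<Union>x\<in>U. {y. near n (J x) (y - x)})" using R by (auto intro: bexI[of _ y])
  next
    fix y assume "y \<in> X \<inter> (\<Union>x\<in>U. {y. near n (J x) (y - x)})"
    then obtain x where "x \<in> U" "y \<in> bl n X x (J x)" by (auto simp: mem_bl)
    then show "y \<in> U" using J by blast
  qed
  moreover have "open (\<Union>x\<in>U. {y. near n (J x) (y - x)})" by (intro open_UN ballI open_near)
  ultimately show "openin (top_of_set X) U" unfolding openin_open by blast
qed

lemma openin_bl: "openin (top_of_set X) (bl n X x j)"
proof -
  have "bl n X x j = X \<inter> {y. near n j (y - x)}" by (auto simp: mem_bl)
  then show ?thesis using openin_open_Int[OF open_near] by simp
qed

text \<open>Tychonoff: the ball is a product of compact balls of K in the first n coordinates and of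
  singletons in all others.\<close>

lemma compact_bl_Kn: "compact (bl n (Kn n) (x::'k::nonarch_local_field kvec) j)"
proof -
  let ?S = "\<lambda>i. if i < n then {t. vge j (t - x i)} else {0::'k}"
  have "bl n (Kn n) x j = PiE UNIV ?S"
    by (auto simp: mem_bl Kn_def near_def PiE_iff split: if_splits) (metis linorder_not_le)
  moreover have "compactin (product_topology (\<lambda>i::nat. euclidean::'k topology) UNIV) (PiE UNIV ?S)"
    unfolding compactin_PiE by (auto simp: compact_vge)
  ultimately show ?thesis by (simp add: euclidean_product_topology)
qed

section \<open>Strict derivatives\<close>

lemma continuous_on_near:
  assumes X: "X \<subseteq> Kn n" and f: "f ` X \<subseteq> Kn m"
    and c: "\<And>a i. a \<in> X \<Longrightarrow> \<exists>J. \<forall>x\<in>bl n X a J. near m i (f x - f a)"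
  shows "continuous_on X (f :: 'k::nonarch_local_field kvec \<Rightarrow> 'k kvec)"
  unfolding continuous_openin_preimage_eq
proof (intro allI impI)
  fix T :: "'k kvec set" assume T: "open T"
  show "openin (top_of_set X) (X \<inter> f -` T)"
    unfolding openin_iff_near[OF X]
  proof (intro conjI ballI)
    fix a assume a: "a \<in> X \<inter> f -` T"
    then have "f a \<in> Kn m" using f by blast
    then obtain i where i: "\<And>y. y \<in> Kn m \<Longrightarrow> near m i (y - f a) \<Longrightarrow> y \<in> T"
      using open_contains_near[OF T, of "f a" m] a by blast
    obtain J where "\<forall>x\<in>bl n X a J. near m i (f x - f a)" using c a by blast
    then have "bl n X a J \<subseteq> X \<inter> f -` T" using i f by (auto simp: bl_def image_subset_iff)
    then show "\<exists>j. bl n X a j \<subseteq> X \<inter> f -` T" by blast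
  qed auto
qed

text \<open>Strict differentiability by levels: c is the gain of the error over x - y, and J is the
  radius at which it is reached. Quantifying over all levels j of x - y replaces the division by
  \<open>vnorm n (x - y)\<close>.\<close>

definition sd ::
  "nat \<Rightarrow> nat \<Rightarrow> 'k::nonarch_local_field kvec set \<Rightarrow> ('k kvec \<Rightarrow> 'k kvec) \<Rightarrow> (nat \<Rightarrow> nat \<Rightarrow> 'k) \<Rightarrow>
   'k kvec \<Rightarrow> bool" where
  "sd n m U f A a \<longleftrightarrow>
     (\<forall>c. \<exists>J. \<forall>x\<in>bl n U a J. \<forall>y\<in>bl n U a J. \<forall>j.
        near n j (x - y) \<longrightarrow> near m (j + c) (f x - f y - mapp m n A (x - y)))"

lemma sdD:
  assumes "sd n m U f A a"
  obtains J where "\<And>x y j. x \<in> bl n U a J \<Longrightarrow> y \<in> bl n U a J \<Longrightarrow> near n j (x - y) \<Longrightarrow>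
    near m (j + c) (f x - f y - mapp m n A (x - y))"
  using assms unfolding sd_def by metis

lemma has_strict_deriv_iff:
  assumes U: "U \<subseteq> Kn n" and a: "a \<in> Kn n"
  shows "has_strict_deriv n m U f A a \<longleftrightarrow> sd n m U (f :: 'k::nonarch_local_field kvec \<Rightarrow> _) A a"
proof
  let ?q = "rqr TYPE('k)"
  let ?E = "\<lambda>x y. f x - f y - mapp m n A (x - y)"
  let ?S = "{(x, y). x \<in> U \<and> y \<in> U \<and> x \<noteq> y}"
  {
    assume h: "has_strict_deriv n m U f A a"
    show "sd n m U f A a" unfolding sd_def
    proof
      fix c
      have "eventually (\<lambda>(x, y). vnorm m (?E x y) / vnorm n (x - y) < ?q powi (- c)) (at (a, a) within ?S)"
        using order_tendstoD(2)[OF h[unfolded has_strict_deriv_def], of "?q powi (- c)"]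
        by (simp add: zero_less_power_int case_prod_unfold)
      then obtain T where T: "open T" "(a, a) \<in> T"
        and T2: "\<And>x y. (x, y) \<in> T \<Longrightarrow> (x, y) \<noteq> (a, a) \<Longrightarrow> (x, y) \<in> ?S \<Longrightarrow>
           vnorm m (?E x y) / vnorm n (x - y) < ?q powi (- c)"
        unfolding eventually_at_topological by (auto simp: Ball_def)
      \<comment> \<open>The neighbourhood of (a, a) is shrunk to a product and then to a square, so
        that one radius J serves for both points.\<close>
      obtain T1 T1' where TT: "open T1" "open T1'" "(a, a) \<in> T1 \<times> T1'" "T1 \<times> T1' \<subseteq> T"
        using open_prod_elim[OF T] by metis
      have "open (T1 \<inter> T1')" "a \<in> T1 \<inter> T1'" using TT by auto
      then obtain J where J: "\<And>y. y \<in> Kn n \<Longrightarrow> near n J (y - a) \<Longrightarrow> y \<in> T1 \<inter> T1'"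
        using open_contains_near[of "T1 \<inter> T1'" a n] a by blast
      show "\<exists>J. \<forall>x\<in>bl n U a J. \<forall>y\<in>bl n U a J. \<forall>j. near n j (x - y) \<longrightarrow> near m (j + c) (?E x y)"
      proof (intro exI[of _ J] ballI allI impI)
        fix x y j assume x: "x \<in> bl n U a J" and y: "y \<in> bl n U a J" and j: "near n j (x - y)"
        show "near m (j + c) (?E x y)"
        proof (cases "x = y")
          case False
          have "x \<in> T1 \<inter> T1'" "y \<in> T1 \<inter> T1'" using J x y U by (auto simp: mem_bl)
          then have lt: "vnorm m (?E x y) / vnorm n (x - y) < ?q powi (- c)"
            using T2 TT False x y by (auto simp: mem_bl)
          have "x - y \<in> Kn n" using U x y by (auto simp: mem_bl intro!: Kn_diff)
          then obtain i where i: "vnorm n (x - y) = ?q powi (- i)" using False vnorm_cases[of "x - y" n] by auto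
          then have "vnorm n (x - y) > 0" by (simp add: zero_less_power_int)
          then have "vnorm m (?E x y) < ?q powi (- c) * vnorm n (x - y)"
            using lt by (simp add: pos_divide_less_eq)
          also have "\<dots> \<le> ?q powi (- c) * ?q powi (- j)"
            using j by (intro mult_left_mono) (simp_all add: vnorm_le_iff)
          also have "\<dots> = ?q powi (- (j + c))" by (simp add: algebra_simps flip: power_int_add)
          finally show ?thesis using vnorm_le_iff[of m "?E x y" "j + c"] by simp
        qed simp
      qed
    qed
  }
  {
    assume h: "sd n m U f A a"
    show "has_strict_deriv n m U f A a" unfolding has_strict_deriv_def tendsto_iff
    proof (intro allI impI)
      fix e :: real assume "e > 0"
      then obtain c where c: "?q powi (- c) < e" using rq_powi_small by blast
      obtain J where J: "\<And>x y j. x \<in> bl n U a J \<Longrightarrow> y \<in> bl n U a J \<Longrightarrow> near n j (x - y) \<Longrightarrow>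
          near m (j + c) (?E x y)"
        using sdD[OF h, of c] by metis
      let ?T = "{y. near n J (y - a)}"
      have "vnorm m (?E x y) / vnorm n (x - y) < e"
        if xy: "x \<in> ?T" "y \<in> ?T" "x \<in> U" "y \<in> U" "x \<noteq> y" for x y
      proof -
        have "x - y \<in> Kn n" using U xy by (auto intro!: Kn_diff)
        then obtain i where i: "vnorm n (x - y) = ?q powi (- i)"
          using xy vnorm_cases[of "x - y" n] by auto
        then have pos: "vnorm n (x - y) > 0" by (simp add: zero_less_power_int)
        have "near n i (x - y)" using i vnorm_le_iff[of n "x - y" i] by simp
        then have "vnorm m (?E x y) \<le> ?q powi (- (i + c))"
          using J[of x y i] xy by (simp add: vnorm_le_iff mem_bl del: minus_add_distrib)
        also have "\<dots> = ?q powi (- c) * vnorm n (x - y)" by (simp add: i algebra_simps flip: power_int_add)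
        also have "\<dots> < e * vnorm n (x - y)" using c pos by simp
        finally show ?thesis using pos by (simp add: pos_divide_less_eq)
      qed
      moreover have "open (?T \<times> ?T)" by (intro open_Times open_near)
      ultimately show "\<forall>\<^sub>F p in at (a, a) within ?S.
          dist (case p of (x, y) \<Rightarrow> vnorm m (?E x y) / vnorm n (x - y)) 0 < e"
        unfolding eventually_at_topological
        by (intro exI[of _ "?T \<times> ?T"]) (auto simp: vnorm_nonneg)
    qed
  }
qed

lemma sd_mono: "sd n m U f A a \<Longrightarrow> V \<subseteq> U \<Longrightarrow> sd n m V f A a"
proof -
  assume sd: "sd n m U f A a" and "V \<subseteq> U"
  then have "bl n V a J \<subseteq> bl n U a J" for J by (auto simp: mem_bl)
  then show ?thesis using sd unfolding sd_def by (meson subsetD)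
qed

lemma sd_local:
  assumes "sd n m (bl n U a J) f A a"
  shows "sd n m U f A a"
  unfolding sd_def
proof
  fix c
  obtain J' where J': "\<And>x y j. x \<in> bl n (bl n U a J) a J' \<Longrightarrow> y \<in> bl n (bl n U a J) a J' \<Longrightarrow> near n j (x - y) \<Longrightarrow>
    near m (j + c) (f x - f y - mapp m n A (x - y))"
    using sdD[OF assms, of c] by metis
  show "\<exists>J. \<forall>x\<in>bl n U a J. \<forall>y\<in>bl n U a J. \<forall>j.
        near n j (x - y) \<longrightarrow> near m (j + c) (f x - f y - mapp m n A (x - y))"
    by (intro exI[of _ "max J J'"] ballI allI impI J') (auto simp: mem_bl intro: near_mono)
qed

lemma sd_cong: "(\<And>x. x \<in> U \<Longrightarrow> f x = g x) \<Longrightarrow> sd n m U f A a \<longleftrightarrow> sd n m U g A a"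
proof -
  assume "\<And>x. x \<in> U \<Longrightarrow> f x = g x"
  then have "\<And>x J. x \<in> bl n U a J \<Longrightarrow> f x = g x" by (simp add: mem_bl)
  then show ?thesis unfolding sd_def by (simp cong: ball_cong)
qed

text \<open>Strictness bounds the difference of any two values near a, not only differences with f
  a. The constant d is the worse of the loss in the matrix and the gain 0 demanded of the
  error.\<close>

lemma sd_lip:
  assumes "sd n m U f A a"
  obtains d J where "\<And>x y j. x \<in> bl n U a J \<Longrightarrow> y \<in> bl n U a J \<Longrightarrow> near n j (x - y) \<Longrightarrow>
    near m (j + d) (f x - f y)"
proof -
  obtain J where J: "\<And>x y j. x \<in> bl n U a J \<Longrightarrow> y \<in> bl n U a J \<Longrightarrow> near n j (x - y) \<Longrightarrow>
    near m (j + 0) (f x - f y - mapp m n A (x - y))"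
    using sdD[OF assms, of 0] by metis
  obtain c where c: "\<And>v j. near n j v \<Longrightarrow> near m (j + c) (mapp m n A v)" using mapp_bound by metis
  have "near m (j + min 0 c) (f x - f y)" if "x \<in> bl n U a J" "y \<in> bl n U a J" "near n j (x - y)" for x y j
  proof -
    have "near m (j + min 0 c) (f x - f y - mapp m n A (x - y) + mapp m n A (x - y))"
      using near_mono[OF J[OF that], of "j + min 0 c"] near_mono[OF c[OF that(3)], of "j + min 0 c"]
      by (intro near_add) auto
    then show ?thesis by simp
  qed
  then show ?thesis by (rule that)
qed

lemma sd_cont:
  assumes "sd n m U f A a" "a \<in> U"
  shows "\<exists>J. \<forall>x\<in>bl n U a J. near m i (f x - f a)"
proof -
  obtain d J where J: "\<And>x y j. x \<in> bl n U a J \<Longrightarrow> y \<in> bl n U a J \<Longrightarrow> near n j (x - y) \<Longrightarrow>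
    near m (j + d) (f x - f y)"
    using sd_lip[OF assms(1)] by metis
  show ?thesis
  proof (intro exI[of _ "max J (i - d)"] ballI)
    fix x assume x: "x \<in> bl n U a (max J (i - d))"
    then have "near m (max J (i - d) + d) (f x - f a)"
      using assms(2) by (intro J) (auto simp: mem_bl intro: near_mono)
    then show "near m i (f x - f a)" by (rule near_mono) auto
  qed
qed

text \<open>The error of g is measured on f x - f y, whose level is only known up to the shift d,
  and the error of f is pushed through B, which shifts by b. Hence the demands c - d on g and c - b
  on f.\<close>

lemma sd_comp:
  assumes f: "sd n m U f A a" and g: "sd m p V g B (f a)" and fU: "f ` U \<subseteq> V" and a: "a \<in> U"
  shows "sd n p U (\<lambda>x. g (f x)) (mmul m B A) a"
  unfolding sd_def
proof
  fix c
  obtain d J1 where d: "\<And>x y j. x \<in> bl n U a J1 \<Longrightarrow> y \<in> bl n U a J1 \<Longrightarrow> near n j (x - y) \<Longrightarrow>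
    near m (j + d) (f x - f y)"
    using sd_lip[OF f] by metis
  obtain b where b: "\<And>v j. near m j v \<Longrightarrow> near p (j + b) (mapp p m B v)" using mapp_bound by metis
  obtain J2 where J2: "\<And>x y j. x \<in> bl m V (f a) J2 \<Longrightarrow> y \<in> bl m V (f a) J2 \<Longrightarrow> near m j (x - y) \<Longrightarrow>
    near p (j + (c - d)) (g x - g y - mapp p m B (x - y))"
    using sdD[OF g, of "c - d"] by metis
  obtain J3 where J3: "\<And>x y j. x \<in> bl n U a J3 \<Longrightarrow> y \<in> bl n U a J3 \<Longrightarrow> near n j (x - y) \<Longrightarrow>
    near m (j + (c - b)) (f x - f y - mapp m n A (x - y))"
    using sdD[OF f, of "c - b"] by metis
  obtain J4 where J4: "\<And>x. x \<in> bl n U a J4 \<Longrightarrow> near m J2 (f x - f a)"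
    using sd_cont[OF f a] by metis
  let ?J = "max J1 (max J3 J4)"
  show "\<exists>J. \<forall>x\<in>bl n U a J. \<forall>y\<in>bl n U a J. \<forall>j.
        near n j (x - y) \<longrightarrow> near p (j + c) (g (f x) - g (f y) - mapp p n (mmul m B A) (x - y))"
  proof (intro exI[of _ ?J] ballI allI impI)
    fix x y j assume x: "x \<in> bl n U a ?J" and y: "y \<in> bl n U a ?J" and j: "near n j (x - y)"
    have sub: "bl n U a ?J \<subseteq> bl n U a J1" "bl n U a ?J \<subseteq> bl n U a J3" "bl n U a ?J \<subseteq> bl n U a J4"
      unfolding mem_bl[abs_def] bl_def by (auto elim: near_mono)
    have fx: "f x \<in> bl m V (f a) J2" "f y \<in> bl m V (f a) J2"
      using fU J4 x y sub by (auto simp: mem_bl)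
    have e1: "near p (j + d + (c - d)) (g (f x) - g (f y) - mapp p m B (f x - f y))"
      using x y sub j by (intro J2 fx d) auto
    have e2: "near p (j + (c - b) + b) (mapp p m B (f x - f y - mapp m n A (x - y)))"
      using x y sub j by (intro b J3) auto
    have "near p (j + c) (g (f x) - g (f y) - mapp p m B (f x - f y)
         + mapp p m B (f x - f y - mapp m n A (x - y)))"
      using e1 e2 by (intro near_add) auto
    also have "g (f x) - g (f y) - mapp p m B (f x - f y) + mapp p m B (f x - f y - mapp m n A (x - y))
        = g (f x) - g (f y) - mapp p n (mmul m B A) (x - y)"
      unfolding mapp_mmul mapp_diff[of p m B "f x - f y" "mapp m n A (x - y)"] by (simp add: algebra_simps)
    finally show "near p (j + c) (g (f x) - g (f y) - mapp p n (mmul m B A) (x - y))" .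
  qed
qed

lemma sd_linear: "(\<And>x y. x \<in> U \<Longrightarrow> y \<in> U \<Longrightarrow> near m 0 (f x - f y - mapp m n A (x - y)) \<and> f x - f y = mapp m n A (x - y)) \<Longrightarrow> sd n m U f A a"
  unfolding sd_def by (auto simp: mem_bl)

text \<open>As \<open>Kn l\<close> is literally a subset of \<open>Kn n\<close>, one matrix serves
  in both sizes: the additional columns meet zeros.\<close>

lemma mapp_Kn_le:
  assumes "v \<in> Kn l" "l \<le> n"
  shows "mapp m n A v = mapp m l A v"
proof (rule ext)
  fix i
  have "(\<Sum>j<n. A i j * v j) = (\<Sum>j<l. A i j * v j)"
    using assms by (intro sum.mono_neutral_right) (auto simp: Kn_def)
  then show "mapp m n A v i = mapp m l A v i" by (simp add: mapp_def)
qed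

lemma near_Kn_le: "near l j v \<Longrightarrow> v \<in> Kn l \<Longrightarrow> near n j v"
  unfolding near_def Kn_def by (metis (mono_tags, lifting) mem_Collect_eq not_le vge_0)

lemma sd_source_le:
  assumes "sd n m U f A a" "l \<le> n" "V \<subseteq> U \<inter> Kn l" "a \<in> Kn l"
  shows "sd l m V f A a"
  unfolding sd_def
proof
  fix c
  obtain J where J: "\<And>x y j. x \<in> bl n U a J \<Longrightarrow> y \<in> bl n U a J \<Longrightarrow> near n j (x - y) \<Longrightarrow>
    near m (j + c) (f x - f y - mapp m n A (x - y))"
    using sdD[OF assms(1), of c] by metis

  show "\<exists>J. \<forall>x\<in>bl l V a J. \<forall>y\<in>bl l V a J. \<forall>j.
        near l j (x - y) \<longrightarrow> near m (j + c) (f x - f y - mapp m l A (x - y))"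
  proof (intro exI[of _ J] ballI allI impI)
    fix x y j assume x: "x \<in> bl l V a J" and y: "y \<in> bl l V a J" and j: "near l j (x - y)"
    then have K: "x \<in> Kn l" "y \<in> Kn l" using assms by (auto simp: mem_bl)
    then have "near m (j + c) (f x - f y - mapp m n A (x - y))"
      using x y j assms by (intro J) (auto simp: mem_bl intro!: near_Kn_le[of l] Kn_diff)
    then show "near m (j + c) (f x - f y - mapp m l A (x - y))"
      using mapp_Kn_le[OF Kn_diff[OF K] assms(2)] by metis
  qed
qed

lemma sd_target_le:
  assumes "sd n m U f A a" "l \<le> m"
  shows "sd n l U f A a"
proof -
  have "near m j v \<Longrightarrow> near l j v" for j and v :: "'a kvec" using assms(2) by (auto simp: near_def)
  moreover have "near l j (v - mapp m n A w) \<longleftrightarrow> near l j (v - mapp l n A w)" for j v w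
    using assms(2) by (auto simp: near_def mapp_def)
  ultimately show ?thesis using assms(1) unfolding sd_def by meson
qed

definition idm :: "nat \<Rightarrow> nat \<Rightarrow> 'k::nonarch_local_field" where
  "idm i j = (if i = j then 1 else 0)"

lemma mapp_idm: "v \<in> Kn n \<Longrightarrow> mapp n n idm v = v"
  by (rule Kn_eqI[OF mapp_Kn]) (auto simp: mapp_def idm_def if_distrib[of "\<lambda>x. x * _"] cong: if_cong)

lemma sd_id: "U \<subseteq> Kn n \<Longrightarrow> sd n n U (\<lambda>x. x) idm a"
  by (rule sd_linear) (auto simp: mapp_idm Kn_diff subset_iff)

definition cpm :: "(nat \<Rightarrow> nat) \<Rightarrow> nat \<Rightarrow> nat \<Rightarrow> 'k::nonarch_local_field" where
  "cpm s i j = (if j = s i then 1 else 0)"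

lemma mapp_cpm: "s ` {..<l} \<subseteq> {..<n} \<Longrightarrow> mapp l n (cpm s) v = coord_proj l s v"
  by (rule ext) (auto simp: mapp_def cpm_def coord_proj_def if_distrib[of "\<lambda>x. x * _"] cong: if_cong)

lemma coord_proj_diff: "coord_proj l s (x - y) = coord_proj l s x - coord_proj l s y"
  by (auto simp: coord_proj_def fun_eq_iff)

lemma coord_proj_Kn: "coord_proj l s x \<in> Kn l"
  by (auto simp: coord_proj_def Kn_def)

lemma sd_coord_proj: "s ` {..<l} \<subseteq> {..<n} \<Longrightarrow> sd n l U (coord_proj l s) (cpm s) a"
  by (rule sd_linear) (auto simp: mapp_cpm coord_proj_diff)

text \<open>On a small multiple of v both linear parts approximate the same increment, so they
  differ by c levels more than the increment, for every c; linearity then removes the scaling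
  factor.\<close>

lemma sd_unique:
  assumes U: "openin (top_of_set (Kn n)) U" "a \<in> U" and A: "sd n m U f A a" and B: "sd n m U f B a"
    and v: "v \<in> Kn n"
  shows "mapp m n A v = mapp m n B v"
proof -
  obtain J0 where J0: "bl n (Kn n) a J0 \<subseteq> U" using U openin_iff_near[of "Kn n" n U] by auto
  then have aK: "a \<in> Kn n" using U openin_imp_subset by blast
  obtain j0 where j0: "near n j0 v" using near_ex by blast
  have "near m (j0 + c) (mapp m n A v - mapp m n B v)" for c
  proof -
    obtain J1 where J1: "\<And>x y j. x \<in> bl n U a J1 \<Longrightarrow> y \<in> bl n U a J1 \<Longrightarrow> near n j (x - y) \<Longrightarrow>
      near m (j + c) (f x - f y - mapp m n A (x - y))" using sdD[OF A, of c] by metis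
    obtain J2 where J2: "\<And>x y j. x \<in> bl n U a J2 \<Longrightarrow> y \<in> bl n U a J2 \<Longrightarrow> near n j (x - y) \<Longrightarrow>
      near m (j + c) (f x - f y - mapp m n B (x - y))" using sdD[OF B, of c] by metis
    \<comment> \<open>Scaling by \<open>upow t\<close> brings v to the level at which f is defined
      and both error bounds hold.\<close>
    define t where "t = max J0 (max J1 J2) - j0"
    define w where "w = (\<lambda>i. upow t * v i)"
    have nw: "near n (t + j0) w" using near_scale_iff[of "upow t" n "t + j0" v] j0 by (simp add: w_def)
    have x: "a + w \<in> bl n (Kn n) a (max J0 (max J1 J2))"
      using nw aK v unfolding mem_bl t_def w_def by (auto intro!: Kn_add Kn_scale)
    then have x': "a + w \<in> bl n U a J1" "a + w \<in> bl n U a J2"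
      using J0 near_mono by (fastforce simp: mem_bl)+
    have a': "a \<in> bl n U a J1" "a \<in> bl n U a J2" using U by (auto simp: mem_bl)
    have "near m (t + j0 + c) ((f (a + w) - f a - mapp m n B w) - (f (a + w) - f a - mapp m n A w))"
      using J2[OF x'(2) a'(2), of "t + j0"] J1[OF x'(1) a'(1), of "t + j0"] nw
      by (intro near_diff[of m _ "f (a + w) - f a - mapp m n B w"]) simp_all
    then have "near m (t + j0 + c) (mapp m n A w - mapp m n B w)" by simp
    also have "mapp m n A w - mapp m n B w = (\<lambda>i. upow t * (mapp m n A v - mapp m n B v) i)"
      by (auto simp: w_def mapp_scale algebra_simps)
    finally show ?thesis by (subst (asm) near_scale_iff) (auto simp: algebra_simps)
  qed
  from this[of "j - j0" for j] have "near m j (mapp m n A v - mapp m n B v)" for j by simp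
  then have "mapp m n A v - mapp m n B v = 0" by (intro near_all_0[of _ m] Kn_diff mapp_Kn)
  then show ?thesis by simp
qed

lemma strict_C1_iff:
  "strict_C1 n m U f \<longleftrightarrow>
     openin (top_of_set (Kn n)) U \<and> f ` U \<subseteq> Kn m \<and> (\<forall>a\<in>U. \<exists>A. sd n m U f A a)"
proof (cases "openin (top_of_set (Kn n)) U")
  case True
  then have "U \<subseteq> Kn n" by (rule openin_imp_subset)
  then show ?thesis unfolding strict_C1_def by (metis (no_types, lifting) has_strict_deriv_iff subsetD)
qed (simp add: strict_C1_def)

lemma strict_C1_subset:
  "strict_C1 n m U f \<Longrightarrow> openin (top_of_set (Kn n)) V \<Longrightarrow> V \<subseteq> U \<Longrightarrow> strict_C1 n m V f"
  unfolding strict_C1_iff by (meson image_mono order_trans sd_mono subsetD)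

lemma strict_C1_comp:
  assumes "strict_C1 n m U f" "strict_C1 m p V g" "f ` U \<subseteq> V"
  shows "strict_C1 n p U (\<lambda>x. g (f x))"
  unfolding strict_C1_iff
proof (intro conjI ballI)
  fix a assume a: "a \<in> U"
  obtain A where A: "sd n m U f A a" using assms(1) a by (auto simp: strict_C1_iff)
  have "f a \<in> V" using assms(3) a by blast
  then obtain B where "sd m p V g B (f a)" using assms(2) by (auto simp: strict_C1_iff)
  then show "\<exists>A. sd n p U (\<lambda>x. g (f x)) A a" using sd_comp[OF A _ assms(3) a] by blast
qed (use assms in \<open>auto simp: strict_C1_iff image_subset_iff\<close>)

lemma strict_C1_continuous: "strict_C1 n m U f \<Longrightarrow> continuous_on U f"
  unfolding strict_C1_iff
  by (rule continuous_on_near[of U n f m]) (auto dest: openin_imp_subset sd_cont)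

lemma strict_C1_id: "openin (top_of_set (Kn n)) U \<Longrightarrow> strict_C1 n n U (\<lambda>x. x)"
proof -
  assume U: "openin (top_of_set (Kn n)) U"
  then have "U \<subseteq> Kn n" by (rule openin_imp_subset)
  then show ?thesis using U sd_id[of U n] unfolding strict_C1_iff by auto
qed

subsection \<open>Maps close to the identity and linear algebra\<close>

text \<open>Newton iteration: replacing x by x + (z - \<Theta> x) stays in the ball and gains one
  level. Instead of a limit of iterates, compactness of the image is used: a point outside it has a
  whole neighbourhood outside, which the approximate solutions contradict.\<close>

lemma near_id_surj:
  fixes w0 :: "'k::nonarch_local_field kvec"
  assumes w0: "w0 \<in> Kn l" and map: "\<And>x. x \<in> bl l (Kn l) w0 J \<Longrightarrow> \<Theta> x \<in> Kn l"
    and id: "\<And>x y j. x \<in> bl l (Kn l) w0 J \<Longrightarrow> y \<in> bl l (Kn l) w0 J \<Longrightarrow> near l j (x - y) \<Longrightarrow>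
      near l (j + 1) (\<Theta> x - \<Theta> y - (x - y))"
    and z: "z \<in> bl l (Kn l) (\<Theta> w0) J"
  shows "\<exists>x\<in>bl l (Kn l) w0 J. \<Theta> x = z"
proof (rule ccontr)
  let ?B = "bl l (Kn l) w0 J"
  assume "\<not> ?thesis"
  then have zn: "z \<in> - (\<Theta> ` ?B)" by blast
  have near_B: "near l i (\<Theta> x - \<Theta> a)" if "x \<in> ?B" "a \<in> ?B" "near l i (x - a)" for x a i
    using near_add[OF near_mono[OF id[OF that], of i] that(3)] by simp
  have "continuous_on ?B \<Theta>"
  proof (rule continuous_on_near[of _ l _ l])
    fix a i assume "a \<in> ?B"
    then show "\<exists>J'. \<forall>x\<in>bl l ?B a J'. near l i (\<Theta> x - \<Theta> a)"
      using near_B by (intro exI[of _ i]) (auto simp: bl_def)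
  qed (use map in \<open>auto simp: mem_bl\<close>)
  then have "compact (\<Theta> ` ?B)" by (rule compact_continuous_image[OF _ compact_bl_Kn])
  then have "open (- (\<Theta> ` ?B))" by (simp add: compact_imp_closed open_Compl)
  moreover have zK: "z \<in> Kn l" using z by (simp add: mem_bl)
  ultimately obtain i where i: "\<And>y. y \<in> Kn l \<Longrightarrow> near l i (y - z) \<Longrightarrow> y \<in> - (\<Theta> ` ?B)"
    using open_contains_near zn by meson
  have "\<exists>x\<in>?B. near l (J + int N) (\<Theta> x - z)" for N
  proof (induct N)
    case 0
    have "near l J (\<Theta> w0 - z)" using z near_commute by (auto simp: mem_bl)
    then have "near l (J + int 0) (\<Theta> w0 - z)" by simp
    then show ?case by (rule bexI[OF _ bl_self[OF w0]])
  next
    case (Suc N)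
    then obtain x where x: "x \<in> ?B" "near l (J + int N) (\<Theta> x - z)" by blast
    define x' where "x' = x + (z - \<Theta> x)"
    have d: "near l (J + int N) (x' - x)" using x(2) by (simp add: x'_def near_commute)
    have x': "x' \<in> ?B"
      using x(1) near_mono[OF d, of J] map[OF x(1)] zK unfolding mem_bl
      by (auto simp: x'_def intro!: Kn_add Kn_diff intro: near_trans[of l J x' x w0, unfolded x'_def])
    have eq: "\<Theta> x' - z = \<Theta> x' - \<Theta> x - (x' - x)" by (simp add: x'_def)
    have "near l (J + int N + 1) (\<Theta> x' - z)" unfolding eq by (rule id[OF x' x(1) d])
    then have "near l (J + int (Suc N)) (\<Theta> x' - z)" by (simp add: algebra_simps)
    then show ?case by (rule bexI[OF _ x'])
  qed
  then obtain x where "x \<in> ?B" "near l (J + int (nat (i - J))) (\<Theta> x - z)" by blast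
  then have "x \<in> ?B" "near l i (\<Theta> x - z)"
    using near_mono[of l "J + int (nat (i - J))" "\<Theta> x - z" i] by auto
  then show False using i map by blast
qed

text \<open>One elimination step: the last coefficient is expressed through the value in row i0, and
  row i0 of the remaining matrix is zero.\<close>

lemma mapp_Suc_pivot:
  assumes "i0 < n" "B i0 l \<noteq> 0"
  shows "mapp n (Suc l) B c =
     (\<lambda>i. mapp n (Suc l) B c i0 / B i0 l * (if i < n then B i l else 0)) +
     mapp n l (\<lambda>i k. B i k - B i0 k / B i0 l * B i l) c"
proof (rule ext)
  fix i
  have "(\<Sum>k<l. (B i k - B i0 k / B i0 l * B i l) * c k)
      = (\<Sum>k<l. B i k * c k) - (\<Sum>k<l. B i0 k * c k) / B i0 l * B i l"
    by (simp add: algebra_simps sum_subtractf sum_distrib_left sum_divide_distrib)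
  then show "mapp n (Suc l) B c i = ((\<lambda>i. mapp n (Suc l) B c i0 / B i0 l * (if i < n then B i l else 0)) +
     mapp n l (\<lambda>i k. B i k - B i0 k / B i0 l * B i l) c) i"
    using assms by (simp add: mapp_def field_simps)
qed

text \<open>Gaussian elimination with a pivot of maximal norm.\<close>

lemma pivot_coordinates:
  fixes B :: "nat \<Rightarrow> nat \<Rightarrow> 'k::nonarch_local_field"
  assumes "\<And>c. c \<in> Kn l \<Longrightarrow> mapp n l B c = 0 \<Longrightarrow> c = 0"
  shows "\<exists>S\<subseteq>{..<n}. card S = l \<and>
     (\<forall>c j. (\<forall>i\<in>S. vge j (mapp n l B c i)) \<longrightarrow> near n j (mapp n l B c)) \<and>
     (\<forall>t. \<exists>c\<in>Kn l. \<forall>i\<in>S. mapp n l B c i = t i)"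
  using assms
proof (induct l arbitrary: B)
  case 0
  have *: "mapp n 0 B c = 0" for c by (auto simp: mapp_def)
  have "\<exists>c::'k kvec. c \<in> Kn 0" using Kn_0 by blast
  moreover have "near n j (mapp n 0 B c)" for j c unfolding * by (rule near_0)
  ultimately have "{} \<subseteq> {..<n} \<and> card ({} :: nat set) = 0 \<and>
     (\<forall>c j. (\<forall>i\<in>{}. vge j (mapp n 0 B c i)) \<longrightarrow> near n j (mapp n 0 B c)) \<and>
     (\<forall>t. \<exists>c\<in>Kn 0. \<forall>i\<in>{}. mapp n 0 B c i = t i)"
    by simp
  then show ?case by blast
next
  case (Suc l)
  have "mapp n (Suc l) B (unitv l) \<noteq> 0"
  proof
    assume "mapp n (Suc l) B (unitv l) = 0"
    from Suc.prems[OF unitv_Kn[OF lessI] this] have "unitv l = (0 :: 'k kvec)" .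
    then show False by (metis unitv_def zero_fun_apply zero_neq_one)
  qed
  moreover have col: "mapp n (Suc l) B (unitv l) i = (if i < n then B i l else 0)" for i
    by (simp add: mapp_def unitv_def)
  ultimately have "\<exists>i<n. B i l \<noteq> 0" by (metis (no_types, lifting) ext zero_fun_apply)
  then have "\<exists>i0<n. B i0 l \<noteq> 0 \<and> (\<forall>i<n. vge (ord (B i0 l)) (B i l))"
  proof -
    let ?I = "{i. i < n \<and> B i l \<noteq> 0}"
    assume "\<exists>i<n. B i l \<noteq> 0"
    then have I: "finite ?I" "?I \<noteq> {}" by auto
    obtain i0 where i0: "i0 \<in> ?I" "\<And>i. i \<in> ?I \<Longrightarrow> ord (B i0 l) \<le> ord (B i l)"
      using ex_min_if_finite[of "(\<lambda>i. ord (B i l)) ` ?I"] I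
      by (metis (no_types, lifting) arg_min_if_finite not_le)
    then have "vge (ord (B i0 l)) (B i l)" if "i < n" for i using that by (auto simp: vge_def)
    then show ?thesis using i0 by blast
  qed
  then obtain i0 where i0: "i0 < n" "B i0 l \<noteq> 0" "\<And>i. i < n \<Longrightarrow> vge (ord (B i0 l)) (B i l)" by blast
  define v where "v = (\<lambda>i. if i < n then B i l else 0)"
  define B' where "B' = (\<lambda>i k. B i k - B i0 k / B i0 l * B i l)"
  have dec: "mapp n (Suc l) B c = (\<lambda>i. mapp n (Suc l) B c i0 / B i0 l * v i) + mapp n l B' c" for c
    unfolding v_def B'_def by (rule mapp_Suc_pivot[of i0 n B l c]) (rule i0)+
  \<comment> \<open>The pivot is nonzero, so the last coefficient can be adjusted to give row i0 any
    value while the others stay fixed.\<close>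
  have upd: "\<exists>c'\<in>Kn (Suc l). mapp n (Suc l) B c' i0 = t \<and> (\<forall>k<l. c' k = c k)" if "c \<in> Kn l" for c t
  proof -
    let ?c = "c(l := (t - (\<Sum>k<l. B i0 k * c k)) / B i0 l)"
    have "mapp n (Suc l) B ?c i0 = t" using i0 by (simp add: mapp_def)
    then show ?thesis using that by (intro bexI[of _ ?c]) (auto simp: Kn_def)
  qed
  have B'_cong: "mapp n l B' c' = mapp n l B' c" if "\<forall>k<l. c' k = c k" for c c'
    using that by (auto simp: mapp_def)
  have inj: "c = 0" if c: "c \<in> Kn l" "mapp n l B' c = 0" for c
  proof -
    obtain c' where c': "c' \<in> Kn (Suc l)" "mapp n (Suc l) B c' i0 = 0" "\<forall>k<l. c' k = c k"
      using upd[OF c(1)] by blast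
    have "mapp n (Suc l) B c' = 0" using dec[of c'] c' c(2) B'_cong[of c' c] by (auto simp: fun_eq_iff)
    then have "c' = 0" using Suc.prems c' by blast
    then show ?thesis using c c' by (intro Kn_eqI[of c l]) auto
  qed
  obtain S where S: "S \<subseteq> {..<n}" "card S = l"
    "\<And>c j. (\<forall>i\<in>S. vge j (mapp n l B' c i)) \<Longrightarrow> near n j (mapp n l B' c)"
    "\<And>t. \<exists>c\<in>Kn l. \<forall>i\<in>S. mapp n l B' c i = t i"
    using Suc.hyps[of B'] inj by blast
  have B'0: "mapp n l B' c i0 = 0" for c
    using i0 by (simp add: mapp_def B'_def)
  have "i0 \<notin> S" using S(4)[of "\<lambda>_. 1"] B'0 by force
  moreover have finS: "finite S" using S(1) finite_subset by blast
  ultimately have "card (insert i0 S) = Suc l" using S(2) by simp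
  \<comment> \<open>Maximality of the pivot keeps the multiple of the last column at the level of
    the entry in row i0. So the bound on the selected rows passes to the smaller matrix and back to
    the sum.\<close>
  moreover have "near n j (mapp n (Suc l) B c)"
    if c: "\<forall>i\<in>insert i0 S. vge j (mapp n (Suc l) B c i)" for c j
  proof -
    let ?w = "\<lambda>i. mapp n (Suc l) B c i0 / B i0 l * v i"
    have w: "near n j ?w"
      unfolding near_def
    proof (intro allI impI)
      fix i assume "i < n"
      have "vge (j - ord (B i0 l)) (mapp n (Suc l) B c i0 / B i0 l)"
        using c vge_mult_iff[of "B i0 l" j "mapp n (Suc l) B c i0 / B i0 l"] i0 by simp
      from vge_mult[OF this i0(3)[OF \<open>i < n\<close>]] show "vge j (?w i)" using \<open>i < n\<close> by (simp add: v_def)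
    qed
    have "near n j (mapp n l B' c)"
    proof (rule S(3), intro ballI)
      fix i assume "i \<in> S"
      then have "vge j (mapp n (Suc l) B c i)" "vge j (?w i)" using c w S(1) by (auto simp: near_def)
      from vge_diff[OF this] show "vge j (mapp n l B' c i)" by (subst (asm) dec) simp
    qed
    then show ?thesis by (subst dec) (intro near_add w)
  qed
  moreover have "\<exists>c\<in>Kn (Suc l). \<forall>i\<in>insert i0 S. mapp n (Suc l) B c i = t i" for t
  proof -
    obtain c where c: "c \<in> Kn l" "\<forall>i\<in>S. mapp n l B' c i = t i - t i0 / B i0 l * v i"
      using S(4)[of "\<lambda>i. t i - t i0 / B i0 l * v i"] by blast
    obtain c' where c': "c' \<in> Kn (Suc l)" "mapp n (Suc l) B c' i0 = t i0" "\<forall>k<l. c' k = c k"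
      using upd[OF c(1)] by blast
    have "mapp n (Suc l) B c' i = t i" if "i \<in> S" for i
      using c' c(2) that B'_cong[OF c'(3)] by (subst dec) simp
    then show ?thesis using c' by blast
  qed
  ultimately show ?case using S(1) i0(1) by (intro exI[of _ "insert i0 S"]) auto
qed

text \<open>With only l rows the selected set must contain all of them, so elimination solves for
  every unit vector. The solutions are the columns of a right inverse, and injectivity makes it
  two-sided.\<close>

lemma injective_invertible:
  fixes M :: "nat \<Rightarrow> nat \<Rightarrow> 'k::nonarch_local_field"
  assumes inj: "\<And>c. c \<in> Kn l \<Longrightarrow> mapp l l M c = 0 \<Longrightarrow> c = 0"
  obtains N where "\<And>w. w \<in> Kn l \<Longrightarrow> mapp l l M (mapp l l N w) = w"
    "\<And>w. w \<in> Kn l \<Longrightarrow> mapp l l N (mapp l l M w) = w"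
proof -
  obtain S where S: "S \<subseteq> {..<l}" "card S = l" "\<And>t. \<exists>c\<in>Kn l. \<forall>i\<in>S. mapp l l M c i = t i"
    using pivot_coordinates[of l l M] inj by blast
  have "S = {..<l}" using S card_subset_eq[of "{..<l}" S] by simp
  then have "\<forall>k. \<exists>c\<in>Kn l. \<forall>i<l. mapp l l M c i = unitv k i" using S(3) by (metis lessThan_iff)
  then obtain C where C: "\<And>k. C k \<in> Kn l" "\<And>k i. i < l \<Longrightarrow> mapp l l M (C k) i = unitv k i" by metis
  define N where "N i k = C k i" for i k
  have "mmul l M N i k = idm i k" if "i < l" for i k
    using C(2)[OF that, of k] that by (simp add: mmul_def N_def mapp_def unitv_def idm_def)
  then have "mapp l l (mmul l M N) w = mapp l l idm w" for w
    by (auto simp: mapp_def)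
  then have MN: "mapp l l M (mapp l l N w) = w" if "w \<in> Kn l" for w
    using mapp_idm[OF that] by (simp add: mapp_mmul)
  moreover have "mapp l l N (mapp l l M w) = w" if "w \<in> Kn l" for w
  proof -
    have "mapp l l M (mapp l l N (mapp l l M w) - w) = 0"
      by (simp add: mapp_diff MN mapp_Kn)
    from inj[OF Kn_diff[OF mapp_Kn that] this] have "mapp l l N (mapp l l M w) - w = 0" .
    then show ?thesis by simp
  qed
  ultimately show ?thesis by (rule that)
qed

section \<open>Isometric coordinate charts\<close>

text \<open>The local section of the coordinate projection, that is the parametrization of X near x
  as a graph over l of the coordinates.\<close>

definition sec :: "nat \<Rightarrow> nat \<Rightarrow> 'k::nonarch_local_field kvec set \<Rightarrow> (nat \<Rightarrow> nat) \<Rightarrow> 'k kvec \<Rightarrow> int \<Rightarrow> 'k kvec \<Rightarrow> 'k kvec" where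
  "sec n l X s x j = inv_into (bl n X x j) (coord_proj l s)"

text \<open>Such balls carry the canonical measure by transport along an isometry, and the projection is a
  strict \<open>C^1\<close> chart on them; they replace arbitrary charts everywhere below.\<close>

definition nice :: "nat \<Rightarrow> nat \<Rightarrow> 'k::nonarch_local_field kvec set \<Rightarrow> (nat \<Rightarrow> nat) \<Rightarrow> 'k kvec \<Rightarrow> int \<Rightarrow> bool" where
  "nice n l X s x j \<longleftrightarrow>
     X \<subseteq> Kn n \<and> x \<in> X \<and> strict_mono_on {..<l} s \<and> s ` {..<l} \<subseteq> {..<n} \<and>
     (\<forall>y\<in>bl n X x j. \<forall>z\<in>bl n X x j. \<forall>i. near l i (coord_proj l s y - coord_proj l s z) \<longrightarrow> near n i (y - z)) \<and>
     coord_proj l s ` bl n X x j = bl l (Kn l) (coord_proj l s x) j \<and>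
     strict_C1 l n (bl l (Kn l) (coord_proj l s x) j) (sec n l X s x j)"

lemma near_coord_proj: "s ` {..<l} \<subseteq> {..<n} \<Longrightarrow> near n i v \<Longrightarrow> near l i (coord_proj l s v)"
  by (auto simp: near_def coord_proj_def)

lemma inj_on_isometry:
  assumes "X \<subseteq> Kn n" "b \<subseteq> X"
    and "\<And>y z i. y \<in> b \<Longrightarrow> z \<in> b \<Longrightarrow> near l i (p y - p z) \<Longrightarrow> near n i (y - z)"
  shows "inj_on p b"
proof (rule inj_onI)
  fix y z assume yz: "y \<in> b" "z \<in> b" "p y = p z"
  then have "near n i (y - z)" for i using assms(3)[of y z i] by simp
  moreover have "y - z \<in> Kn n" using yz assms by (auto intro!: Kn_diff)
  ultimately have "y - z = 0" using near_all_0 by blast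
  then show "y = z" by simp
qed

lemma strict_C1_cong:
  assumes "\<And>x. x \<in> U \<Longrightarrow> f x = g x"
  shows "strict_C1 n m U f \<longleftrightarrow> strict_C1 n m U g"
proof -
  have "f ` U = g ` U" using assms by simp
  then show ?thesis using sd_cong[of U f g n m] assms unfolding strict_C1_iff by simp
qed

context
  fixes n l :: nat and X :: "'k::nonarch_local_field kvec set" and s x j
  assumes nice: "nice n l X s x j"
begin

lemma nice_XK: "X \<subseteq> Kn n"
  and nice_x: "x \<in> X"
  and nice_s: "s ` {..<l} \<subseteq> {..<n}"
  and nice_mono_s: "strict_mono_on {..<l} s"
  and nice_img: "coord_proj l s ` bl n X x j = bl l (Kn l) (coord_proj l s x) j"
  and nice_sec_C1: "strict_C1 l n (bl l (Kn l) (coord_proj l s x) j) (sec n l X s x j)"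
  using nice unfolding nice_def by blast+

lemma nice_iso:
  assumes "y \<in> bl n X x j" "z \<in> bl n X x j"
  shows "near l i (coord_proj l s y - coord_proj l s z) \<longleftrightarrow> near n i (y - z)"
proof
  show "near l i (coord_proj l s y - coord_proj l s z)" if "near n i (y - z)"
    using near_coord_proj[OF nice_s that] by (simp add: coord_proj_diff)
qed (use nice assms in \<open>auto simp: nice_def\<close>)

lemma nice_inj: "inj_on (coord_proj l s) (bl n X x j)"
  by (rule inj_on_isometry[where l = l, OF nice_XK bl_subset]) (rule iffD1[OF nice_iso])

lemma sec_mem: "w \<in> bl l (Kn l) (coord_proj l s x) j \<Longrightarrow> sec n l X s x j w \<in> bl n X x j"
  unfolding sec_def by (rule inv_into_into) (simp add: nice_img)

lemma cp_sec: "w \<in> bl l (Kn l) (coord_proj l s x) j \<Longrightarrow> coord_proj l s (sec n l X s x j w) = w"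
  using f_inv_into_f[of w "coord_proj l s" "bl n X x j"] by (simp add: sec_def nice_img)

lemma sec_cp: "y \<in> bl n X x j \<Longrightarrow> sec n l X s x j (coord_proj l s y) = y"
  unfolding sec_def by (rule inv_into_f_f[OF nice_inj])

lemma cp_mem: "y \<in> bl n X x j \<Longrightarrow> coord_proj l s y \<in> bl l (Kn l) (coord_proj l s x) j"
  using nice_img by blast

lemma nice_img_sub:
  assumes y: "y \<in> bl n X x j" and le: "j \<le> j'"
  shows "coord_proj l s ` bl n X y j' = bl l (Kn l) (coord_proj l s y) j'"
proof (intro equalityI subsetI)
  fix w assume "w \<in> coord_proj l s ` bl n X y j'"
  then obtain z where z: "z \<in> bl n X y j'" "w = coord_proj l s z" by blast
  then have "z \<in> bl n X x j" using bl_mono[OF le y] by blast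
  then show "w \<in> bl l (Kn l) (coord_proj l s y) j'"
    using z y nice_iso[of z y j'] by (simp add: mem_bl coord_proj_Kn)
next
  fix w assume w: "w \<in> bl l (Kn l) (coord_proj l s y) j'"
  then have "w \<in> bl l (Kn l) (coord_proj l s x) j" using bl_mono[OF le cp_mem[OF y]] by blast
  then obtain z where z: "z \<in> bl n X x j" "w = coord_proj l s z" using nice_img by blast
  then have "z \<in> bl n X y j'" using w y nice_iso[of z y j'] by (simp add: mem_bl)
  then show "w \<in> coord_proj l s ` bl n X y j'" using z by blast
qed

lemma sec_sub_eq:
  assumes y: "y \<in> bl n X x j" and le: "j \<le> j'" and w: "w \<in> bl l (Kn l) (coord_proj l s y) j'"
  shows "sec n l X s y j' w = sec n l X s x j w"
proof -
  obtain z where z: "z \<in> bl n X y j'" "w = coord_proj l s z" using w nice_img_sub[OF y le] by blast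
  have sub: "bl n X y j' \<subseteq> bl n X x j" by (rule bl_mono[OF le y])
  have "sec n l X s y j' w = z"
    unfolding sec_def z(2) by (rule inv_into_f_f[OF inj_on_subset[OF nice_inj sub] z(1)])
  then show ?thesis using sec_cp[of z] sub z by auto
qed

lemma nice_sub:
  assumes y: "y \<in> bl n X x j" and le: "j \<le> j'"
  shows "nice n l X s y j'"
proof -
  have sub: "bl n X y j' \<subseteq> bl n X x j" by (rule bl_mono[OF le y])
  have sub2: "bl l (Kn l) (coord_proj l s y) j' \<subseteq> bl l (Kn l) (coord_proj l s x) j"
    by (rule bl_mono[OF le cp_mem[OF y]])
  have "strict_C1 l n (bl l (Kn l) (coord_proj l s y) j') (sec n l X s x j)"
    by (rule strict_C1_subset[OF nice_sec_C1 openin_bl sub2])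
  moreover have "strict_C1 l n (bl l (Kn l) (coord_proj l s y) j') (sec n l X s y j') \<longleftrightarrow>
      strict_C1 l n (bl l (Kn l) (coord_proj l s y) j') (sec n l X s x j)"
    by (rule strict_C1_cong) (rule sec_sub_eq[OF y le])
  ultimately have "strict_C1 l n (bl l (Kn l) (coord_proj l s y) j') (sec n l X s y j')" by blast
  then show ?thesis
    unfolding nice_def using nice_XK nice_mono_s nice_s y nice_iso sub nice_img_sub[OF y le]
    by (auto simp: mem_bl[of y] subset_iff)
qed

lemma nice_compact: "compact (bl n X x j)"
proof -
  have "bl n X x j = sec n l X s x j ` bl l (Kn l) (coord_proj l s x) j"
    using sec_mem sec_cp cp_mem by (force simp: image_iff)
  moreover have "compact (sec n l X s x j ` bl l (Kn l) (coord_proj l s x) j)"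
    by (rule compact_continuous_image[OF strict_C1_continuous[OF nice_sec_C1] compact_bl_Kn])
  ultimately show ?thesis by simp
qed

end

lemma coord_proj_id: "x \<in> Kn l \<Longrightarrow> coord_proj l id x = x"
  by (rule Kn_eqI[of _ l]) (auto simp: coord_proj_def Kn_def)

text \<open>An open part of \<open>Kn l\<close> is regarded as a manifold with the identity as
  projection, so that results about isometric balls also apply to the targets of charts.\<close>

lemma nice_open_Kn:
  assumes W: "W \<subseteq> Kn l" and x: "x \<in> Kn l" and b: "bl l (Kn l) x j \<subseteq> W"
  shows "nice l l W id x j" and "\<And>w. w \<in> bl l (Kn l) x j \<Longrightarrow> sec l l W id x j w = w"
    and "bl l W x j = bl l (Kn l) x j"
proof -
  show eq: "bl l W x j = bl l (Kn l) x j" using W b by (auto simp: mem_bl)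
  have cp: "coord_proj l id y = y" if "y \<in> bl l W x j" for y
    using that eq by (simp add: mem_bl coord_proj_id)
  have img: "coord_proj l id ` bl l W x j = bl l W x j" using cp by force
  have inj: "inj_on (coord_proj l id) (bl l W x j)" using cp by (metis inj_onI)
  show sec: "sec l l W id x j w = w" if "w \<in> bl l (Kn l) x j" for w
    unfolding sec_def using that inv_into_f_f[OF inj, of w] cp[of w] eq by simp
  have "strict_C1 l l (bl l (Kn l) x j) (\<lambda>w. w)" by (rule strict_C1_id[OF openin_bl])
  moreover have "strict_C1 l l (bl l (Kn l) x j) (sec l l W id x j) \<longleftrightarrow>
      strict_C1 l l (bl l (Kn l) x j) (\<lambda>w. w)"
    by (rule strict_C1_cong) (rule sec)
  ultimately have "strict_C1 l l (bl l (Kn l) x j) (sec l l W id x j)" by blast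
  then show "nice l l W id x j"
    unfolding nice_def using W x img eq cp coord_proj_id[OF x] bl_self[OF x, of l j] b
    by (auto simp: strict_mono_on_def)
qed

subsection \<open>Existence\<close>

lemma enumerate_finite_set:
  fixes S :: "nat set"
  assumes "finite S" "card S = l"
  obtains s where "strict_mono_on {..<l} s" "s ` {..<l} = S"
proof -
  let ?s = "\<lambda>i. sorted_list_of_set S ! i"
  have len: "length (sorted_list_of_set S) = l" using assms by simp
  have "strict_mono_on {..<l} ?s"
    by (rule strict_mono_onI) (use len in \<open>simp add: sorted_wrt_nth_less[OF strict_sorted_list_of_set]\<close>)
  moreover have "?s ` {..<l} = S"
    using nth_image[of l "sorted_list_of_set S"] len assms by (simp add: atLeast0LessThan)
  ultimately show ?thesis by (rule that)
qed

text \<open>A plays the role of the derivative of \<tau> at a; the projection is isometric on its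
  image, and N inverts the projected matrix. As N shifts levels by d, the error is required to gain
  1 - d: it is then one level smaller than the linear part, and this margin carries the isometry
  from the tangent space over to X.\<close>

lemma nice_of_parametrization:
  fixes \<tau> :: "'k::nonarch_local_field kvec \<Rightarrow> 'k kvec"
  assumes X: "X \<subseteq> Kn n" and x: "x \<in> X"
    and s: "strict_mono_on {..<l} s" "s ` {..<l} \<subseteq> {..<n}"
    and a: "a \<in> Kn l" "\<tau> a = x" and W: "W = bl l (Kn l) a J"
    and tau: "strict_C1 l n W \<tau>" "\<tau> ` W \<subseteq> X"
    and cover: "\<And>y. y \<in> bl n X x j1 \<Longrightarrow> y \<in> \<tau> ` W"
    and A: "\<And>c. c \<in> Kn l \<Longrightarrow> mapp n l A c = 0 \<Longrightarrow> c = 0"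
      "\<And>c j. near l j (coord_proj l s (mapp n l A c)) \<Longrightarrow> near n j (mapp n l A c)"
    and N: "\<And>w. w \<in> Kn l \<Longrightarrow> coord_proj l s (mapp n l A (mapp l l N w)) = w"
      "\<And>w. w \<in> Kn l \<Longrightarrow> mapp l l N (coord_proj l s (mapp n l A w)) = w"
    and d: "\<And>v j. near l j v \<Longrightarrow> near l (j + d) (mapp l l N v)"
    and err: "\<And>w w' j. w \<in> W \<Longrightarrow> w' \<in> W \<Longrightarrow> near l j (w - w') \<Longrightarrow>
       near n (j + 1 - d) (\<tau> w - \<tau> w' - mapp n l A (w - w'))"
  shows "\<exists>j. nice n l X s x j"
proof -
  let ?p = "coord_proj l s"
  have pn: "near n i v \<Longrightarrow> near l i (?p v)" for i v using near_coord_proj[OF s(2)] .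
  have WK: "w \<in> Kn l" if "w \<in> W" for w using that W by (simp add: mem_bl)
  have aW: "a \<in> W" using a W bl_self by blast
  have iso: "near n i (\<tau> w - \<tau> w')" if w: "w \<in> W" "w' \<in> W" and i: "near l i (?p (\<tau> w) - ?p (\<tau> w'))" for w w' i
  proof (rule ccontr)
    assume not: "\<not> near n i (\<tau> w - \<tau> w')"
    let ?D = "mapp n l A (w - w')" let ?e = "\<tau> w - \<tau> w' - ?D"
    have De: "near n (t + 1) ?e" if "near n t ?D" for t
    proof -
      have "near l (t + d) (mapp l l N (?p ?D))" by (intro d pn that)
      then have "near l (t + d) (w - w')" using N(2) WK w Kn_diff by metis
      from err[OF w this] show ?thesis by (simp add: algebra_simps)
    qed
    show False
    proof (cases "near n i ?D")
      case True
      have "near n i (?e + ?D)" using near_mono[OF De[OF True], of i] True by (intro near_add) auto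
      then show False using not by simp
    next
      case False
      \<comment> \<open>At the exact level of the linear part the error is one level better. So the
        projection of the linear part would also be one level too small, against the isometry on the
        image of A.\<close>
      then obtain t where t: "t < i" "near n t ?D" "\<not> near n (t + 1) ?D" by (rule near_exact)
      have "near l (t + 1) (?p (\<tau> w) - ?p (\<tau> w'))" using near_mono[OF i] t(1) by simp
      from near_diff[OF this pn[OF De[OF t(2)]]]
      have "near l (t + 1) (?p (\<tau> w) - ?p (\<tau> w') - ?p ?e)" .
      then have "near l (t + 1) (?p ?D)" by (simp add: coord_proj_diff)
      then show False using A(2) t(3) by blast
    qed
  qed
  \<comment> \<open>Read in the parameter w, the projection after \<tau> differs from the identity
    by one level only, so \<open>near_id_surj\<close> applies.\<close>
  define \<Theta> where "\<Theta> w = mapp l l N (?p (\<tau> w))" for w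
  have \<Theta>: "near l (j + 1) (\<Theta> w - \<Theta> w' - (w - w'))" if w: "w \<in> W" "w' \<in> W" and j: "near l j (w - w')" for w w' j
  proof -
    have e: "near l (j + 1 - d + d) (mapp l l N (?p (\<tau> w - \<tau> w' - mapp n l A (w - w'))))"
      by (intro d pn err w j)
    have "mapp l l N (?p (mapp n l A (w - w'))) = w - w'" using N(2) WK w Kn_diff by metis
    then have "mapp l l N (?p (\<tau> w - \<tau> w' - mapp n l A (w - w'))) = \<Theta> w - \<Theta> w' - (w - w')"
      unfolding coord_proj_diff[of _ _ _ "mapp n l A (w - w')"] mapp_diff[of _ _ _ _ "?p (mapp n l A (w - w'))"]
      by (simp add: coord_proj_diff mapp_diff \<Theta>_def)
    then show ?thesis using e by simp
  qed
  \<comment> \<open>A map that is the identity up to one level preserves exact levels. Undoing N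
    gives a Lipschitz bound for the inverse of the projection after \<tau>.\<close>
  have expand: "near l (i + d) (w - w')" if w: "w \<in> W" "w' \<in> W" and i: "near l i (?p (\<tau> w) - ?p (\<tau> w'))" for w w' i
  proof (rule ccontr)
    assume "\<not> near l (i + d) (w - w')"
    then obtain t where t: "t < i + d" "near l t (w - w')" "\<not> near l (t + 1) (w - w')" by (rule near_exact)
    have "near l (i + d) (\<Theta> w - \<Theta> w')" using d[OF i] by (simp add: \<Theta>_def mapp_diff)
    then have "near l (t + 1) (\<Theta> w - \<Theta> w')" by (rule near_mono) (use t(1) in simp)
    from near_diff[OF this \<Theta>[OF w t(2)]] show False using t(3) by simp
  qed
  \<comment> \<open>The bound j1 keeps the ball inside the image of \<tau>; J - d makes N map the
    projected ball into the ball of level J, which \<Theta> fills.\<close>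
  define j where "j = max j1 (J - d)"
  have surj: "\<exists>w\<in>W. ?p (\<tau> w) = z" if z: "z \<in> bl l (Kn l) (?p x) j" for z
  proof -
    have "near l (j + d) (mapp l l N (z - ?p x))" using z by (intro d) (simp add: mem_bl)
    then have "near l J (mapp l l N (z - ?p x))" by (rule near_mono) (simp add: j_def)
    then have "near l J (mapp l l N z - \<Theta> a)" by (simp add: mapp_diff \<Theta>_def a)
    then have Nz: "mapp l l N z \<in> bl l (Kn l) (\<Theta> a) J" by (simp add: mem_bl mapp_Kn)
    have "\<exists>w\<in>bl l (Kn l) a J. \<Theta> w = mapp l l N z"
    proof (rule near_id_surj[of a l J \<Theta>])
      show "a \<in> Kn l" "mapp l l N z \<in> bl l (Kn l) (\<Theta> a) J" by fact+
      show "\<Theta> w \<in> Kn l" for w by (simp add: \<Theta>_def mapp_Kn)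
      show "near l (j + 1) (\<Theta> w - \<Theta> w' - (w - w'))"
        if "w \<in> bl l (Kn l) a J" "w' \<in> bl l (Kn l) a J" "near l j (w - w')" for w w' j
        using \<Theta>[of w w' j] that W by simp
    qed
    then obtain w where w: "w \<in> W" "\<Theta> w = mapp l l N z" using W by blast
    have "?p (\<tau> w) = ?p (mapp n l A (\<Theta> w))" unfolding \<Theta>_def by (rule N(1)[symmetric]) (rule coord_proj_Kn)
    also have "\<dots> = z" unfolding w(2) using z by (intro N(1)) (simp add: mem_bl)
    finally show ?thesis using w by blast
  qed
  have img: "?p ` bl n X x j = bl l (Kn l) (?p x) j"
  proof (intro equalityI subsetI)
    fix z assume "z \<in> ?p ` bl n X x j"
    then show "z \<in> bl l (Kn l) (?p x) j"
      using pn by (auto simp: mem_bl coord_proj_Kn simp flip: coord_proj_diff)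
  next
    fix z assume z: "z \<in> bl l (Kn l) (?p x) j"
    then obtain w where w: "w \<in> W" "?p (\<tau> w) = z" using surj by blast
    have "near n j (\<tau> w - \<tau> a)" using z w by (intro iso w aW) (simp add: mem_bl a)
    then have "\<tau> w \<in> bl n X x j" using w tau by (auto simp: mem_bl a)
    then show "z \<in> ?p ` bl n X x j" using w by blast
  qed
  have b_sub: "y \<in> \<tau> ` W" if "y \<in> bl n X x j" for y
    using that near_mono by (intro cover) (fastforce simp: mem_bl j_def)
  have b_iso: "near n i (y - z)" if "y \<in> bl n X x j" "z \<in> bl n X x j" "near l i (?p y - ?p z)" for y z i
    using b_sub[OF that(1)] b_sub[OF that(2)] that(3) iso by auto
  have inj: "inj_on ?p (bl n X x j)" by (rule inj_on_isometry[OF X bl_subset b_iso])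
  let ?B = "bl l (Kn l) (?p x) j" let ?\<sigma> = "sec n l X s x j"
  have sec: "?\<sigma> z \<in> bl n X x j" "?p (?\<sigma> z) = z" if "z \<in> ?B" for z
    using that img inv_into_into[of z ?p "bl n X x j"] f_inv_into_f[of z ?p "bl n X x j"] by (auto simp: sec_def)
  have lift: "\<exists>w\<in>W. \<tau> w = ?\<sigma> z" if "z \<in> ?B" for z
    using b_sub[OF sec(1)[OF that]] by auto
  have "strict_C1 l n ?B ?\<sigma>"
    unfolding strict_C1_iff
  proof (intro conjI ballI openin_bl)
    show "?\<sigma> ` ?B \<subseteq> Kn n" using sec X by (auto simp: mem_bl)
    fix z assume z: "z \<in> ?B"
    then obtain w0 where w0: "w0 \<in> W" "\<tau> w0 = ?\<sigma> z" using lift by blast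
    obtain A1 where A1: "sd l n W \<tau> A1 w0" using tau(1) w0 by (auto simp: strict_C1_iff)
    \<comment> \<open>The matrix A does not control the derivative A1 at other points. Still M1 is
      injective: for a kernel vector scaled into W the projection moves only by the error term, so
      \<open>expand\<close> improves its level by one, again and again.\<close>
    define M1 where "M1 = mmul n (cpm s) A1"
    have M1: "mapp l l M1 v = ?p (mapp n l A1 v)" for v by (simp add: M1_def mapp_mmul mapp_cpm[OF s(2)])
    have M1inj: "v = 0" if v: "v \<in> Kn l" "mapp l l M1 v = 0" for v
    proof -
      obtain J1 where J1: "\<And>w w' j. w \<in> bl l W w0 J1 \<Longrightarrow> w' \<in> bl l W w0 J1 \<Longrightarrow> near l j (w - w') \<Longrightarrow>
          near n (j + (1 - d)) (\<tau> w - \<tau> w' - mapp n l A1 (w - w'))" using sdD[OF A1, of "1 - d"] by metis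
      obtain i0 where i0: "near l i0 v" using near_ex by blast
      define t where "t = max J J1 - i0"
      define v' where "v' = (\<lambda>i. upow t * v i)"
      have v': "near l (max J J1) v'" "v' \<in> Kn l"
        using i0 v near_scale_iff[of "upow t" l "max J J1" v] by (auto simp: v'_def t_def intro!: Kn_scale)
      have "w0 + v' \<in> W"
        using w0 v' near_mono[OF v'(1), of J] unfolding W mem_bl
        by (auto intro!: Kn_add intro: near_trans[of l J "w0 + v'" w0 a])
      then have w1: "w0 + v' \<in> bl l W w0 J1" using near_mono[OF v'(1), of J1] by (auto simp: mem_bl)
      have M0: "?p (mapp n l A1 v') = 0"
        using v(2) M1[of v'] by (simp add: v'_def mapp_scale fun_eq_iff)
      have step: "near l (i + 1) v'" if "near l i v'" for i
      proof -
        have "near n (i + (1 - d)) (\<tau> (w0 + v') - \<tau> w0 - mapp n l A1 (w0 + v' - w0))"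
          using that by (intro J1 w1 bl_self w0) simp
        then have "near l (i + (1 - d)) (?p (\<tau> (w0 + v') - \<tau> w0 - mapp n l A1 v'))"
          by (intro pn) simp
        then have "near l (i + (1 - d)) (?p (\<tau> (w0 + v')) - ?p (\<tau> w0))"
          using M0 by (simp add: coord_proj_diff)
        then have "near l (i + (1 - d) + d) (w0 + v' - w0)" using w1 w0 by (intro expand) (auto simp: mem_bl)
        then show ?thesis by (simp add: algebra_simps)
      qed
      have all: "near l (max J J1 + int N) v'" for N
      proof (induct N)
        case (Suc N) then show ?case using step[of "max J J1 + int N"] by (simp add: algebra_simps)
      qed (use v' in simp)
      have "near l i v'" for i
      proof (rule near_mono[OF all[of "nat (i - max J J1)"]])
        show "i \<le> max J J1 + int (nat (i - max J J1))" by linarith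
      qed
      then have "v' = 0" using v' near_all_0 by blast
      then show ?thesis by (auto simp: v'_def fun_eq_iff)
    qed
    obtain N1 where N1: "\<And>w. w \<in> Kn l \<Longrightarrow> mapp l l N1 (mapp l l M1 w) = w"
      using injective_invertible[OF M1inj] by metis
    \<comment> \<open>The section is \<tau> after the inverse of the projected parametrization, so
      the chain rule predicts A1 times the inverse of M1.\<close>
    define C where "C = mmul l A1 N1"
    obtain b where b: "\<And>v j. near l j v \<Longrightarrow> near n (j + b) (mapp n l C v)" using mapp_bound by metis
    have "sd l n ?B ?\<sigma> C z"
      unfolding sd_def
    proof
      fix c
      obtain J1 where J1: "\<And>w w' j. w \<in> bl l W w0 J1 \<Longrightarrow> w' \<in> bl l W w0 J1 \<Longrightarrow> near l j (w - w') \<Longrightarrow>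
          near n (j + (c - d - min 0 b)) (\<tau> w - \<tau> w' - mapp n l A1 (w - w'))"
        using sdD[OF A1, of "c - d - min 0 b"] by metis
      show "\<exists>J. \<forall>x\<in>bl l ?B z J. \<forall>y\<in>bl l ?B z J. \<forall>j.
          near l j (x - y) \<longrightarrow> near n (j + c) (?\<sigma> x - ?\<sigma> y - mapp n l C (x - y))"
      proof (intro exI[of _ "J1 - d"] ballI allI impI)
        fix z1 z2 i assume z1: "z1 \<in> bl l ?B z (J1 - d)" and z2: "z2 \<in> bl l ?B z (J1 - d)" and i: "near l i (z1 - z2)"
        have zB: "z1 \<in> ?B" "z2 \<in> ?B" using z1 z2 by (auto simp: mem_bl)
        obtain w1 w2 where w1: "w1 \<in> W" "\<tau> w1 = ?\<sigma> z1" and w2: "w2 \<in> W" "\<tau> w2 = ?\<sigma> z2"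
          using lift zB by meson
        have pz: "?p (\<tau> w1) = z1" "?p (\<tau> w2) = z2" "?p (\<tau> w0) = z"
          using w0 w1 w2 sec zB z by auto
        have "near l (J1 - d + d) (w1 - w0)"
          by (rule expand[OF w1(1) w0(1)]) (use z1 pz in \<open>simp add: mem_bl\<close>)
        moreover have "near l (J1 - d + d) (w2 - w0)"
          by (rule expand[OF w2(1) w0(1)]) (use z2 pz in \<open>simp add: mem_bl\<close>)
        ultimately have wb: "w1 \<in> bl l W w0 J1" "w2 \<in> bl l W w0 J1" using w1 w2 by (auto simp: mem_bl)
        have "near l (i + d) (w1 - w2)" using i w1 w2 pz by (intro expand) auto
        define e where "e = \<tau> w1 - \<tau> w2 - mapp n l A1 (w1 - w2)"
        have e: "near n (i + c - min 0 b) e"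
          using J1[OF wb \<open>near l (i + d) (w1 - w2)\<close>] by (simp add: e_def algebra_simps)
        have "mapp n l C (?p e) = mapp n l C (z1 - z2) - mapp n l C (?p (mapp n l A1 (w1 - w2)))"
          by (simp add: e_def coord_proj_diff mapp_diff pz)
        also have "mapp n l C (?p (mapp n l A1 (w1 - w2))) = mapp n l A1 (w1 - w2)"
          using N1[OF Kn_diff[OF WK[OF w1(1)] WK[OF w2(1)]]] by (simp add: C_def mapp_mmul M1)
        finally have Cpe: "mapp n l C (?p e) = mapp n l C (z1 - z2) - mapp n l A1 (w1 - w2)" .
        have eq: "?\<sigma> z1 - ?\<sigma> z2 - mapp n l C (z1 - z2) = e - mapp n l C (?p e)"
          unfolding Cpe unfolding e_def w1(2) w2(2) by simp
        show "near n (i + c) (?\<sigma> z1 - ?\<sigma> z2 - mapp n l C (z1 - z2))"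
          unfolding eq using near_mono[OF e, of "i + c"] near_mono[OF b[OF pn[OF e]], of "i + c"]
          by (intro near_diff) auto
      qed
    qed
    then show "\<exists>A. sd l n ?B ?\<sigma> A z" by blast
  qed
  then have "nice n l X s x j"
    unfolding nice_def using X x s img b_iso by blast
  then show ?thesis by blast
qed

lemma adapted_chartD:
  assumes "adapted_chart n l X U V g"
  shows "bij_betw g U V" "strict_C1 n n U g" "strict_C1 n n V (inv_into U g)"
    "g ` (X \<inter> U) = V \<inter> Kn l" "openin (top_of_set (Kn n)) U" "openin (top_of_set (Kn n)) V"
    "\<And>y. y \<in> U \<Longrightarrow> inv_into U g (g y) = y" "\<And>w. w \<in> V \<Longrightarrow> g (inv_into U g w) = w"
    "\<And>w. w \<in> V \<Longrightarrow> inv_into U g w \<in> U" "\<And>w. w \<in> V \<inter> Kn l \<Longrightarrow> inv_into U g w \<in> X \<inter> U"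
    "\<And>y. y \<in> X \<inter> U \<Longrightarrow> g y \<in> V \<inter> Kn l"
proof -
  show *: "bij_betw g U V" "strict_C1 n n U g" "strict_C1 n n V (inv_into U g)" "g ` (X \<inter> U) = V \<inter> Kn l"
    using assms by (auto simp: adapted_chart_def)
  then show "openin (top_of_set (Kn n)) U" "openin (top_of_set (Kn n)) V" by (auto simp: strict_C1_def)
  show inv: "\<And>y. y \<in> U \<Longrightarrow> inv_into U g (g y) = y" using * by (simp add: bij_betw_def)
  show "\<And>w. w \<in> V \<Longrightarrow> g (inv_into U g w) = w" using * by (simp add: bij_betw_inv_into_right)
  show "\<And>w. w \<in> V \<Longrightarrow> inv_into U g w \<in> U"
    by (rule bij_betw_apply[OF bij_betw_inv_into[OF *(1)]])
  show "inv_into U g w \<in> X \<inter> U" if "w \<in> V \<inter> Kn l" for w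
  proof -
    have "w \<in> g ` (X \<inter> U)" using *(4) that by simp
    then show ?thesis using inv by auto
  qed
  show "\<And>y. y \<in> X \<inter> U \<Longrightarrow> g y \<in> V \<inter> Kn l" using * by blast
qed

lemma openin_Int_Kn: "openin (top_of_set (Kn n)) V \<Longrightarrow> l \<le> n \<Longrightarrow> openin (top_of_set (Kn l)) (V \<inter> Kn l)"
proof -
  assume V: "openin (top_of_set (Kn n)) V" and le: "l \<le> n"
  then obtain T where "open T" "V = Kn n \<inter> T" by (auto simp: openin_open)
  then have "V \<inter> Kn l = Kn l \<inter> T" using Kn_mono[OF le] by auto
  then show ?thesis using \<open>open T\<close> by (auto simp: openin_open)
qed

lemma strict_C1_Int_Kn:
  assumes "strict_C1 n m V f" "l \<le> n"
  shows "strict_C1 l m (V \<inter> Kn l) f"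
  using assms openin_Int_Kn[of n V l] sd_source_le[of n m V f _ _ l "V \<inter> Kn l"]
  unfolding strict_C1_iff by (metis IntD1 IntD2 image_subset_iff order_refl)

text \<open>The chain rule for the two composites, compared with the derivative of the identity by
  \<open>sd_unique\<close>.\<close>

lemma adapted_chart_deriv_inverse:
  assumes "adapted_chart n l X U V g" "x \<in> U" "sd n n U g A x" "sd n n V (inv_into U g) A' (g x)" "v \<in> Kn n"
  shows "mapp n n A (mapp n n A' v) = v" "mapp n n A' (mapp n n A v) = v"
proof -
  note ch = adapted_chartD[OF assms(1)]
  have gx: "g x \<in> V" "inv_into U g (g x) = x"
    using ch(7)[OF assms(2)] bij_betw_apply[OF ch(1) assms(2)] by auto
  have "sd n n V (\<lambda>w. g (inv_into U g w)) (mmul n A A') (g x)"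
    using assms gx ch by (intro sd_comp[where V = U]) auto
  moreover have "sd n n V (\<lambda>w. g (inv_into U g w)) idm (g x)"
    using sd_id[OF openin_imp_subset[OF ch(6)]] ch(8) sd_cong by (metis (no_types, lifting))
  ultimately have "mapp n n (mmul n A A') v = mapp n n idm v" by (rule sd_unique[OF ch(6) gx(1) _ _ assms(5)])
  then show "mapp n n A (mapp n n A' v) = v" by (simp add: mapp_mmul mapp_idm[OF assms(5)])
  have "sd n n U (\<lambda>w. inv_into U g (g w)) (mmul n A' A) x"
    using assms gx ch bij_betwE[OF ch(1)] by (intro sd_comp[where V = V]) auto
  moreover have "sd n n U (\<lambda>w. inv_into U g (g w)) idm x"
    using sd_id[OF openin_imp_subset[OF ch(5)]] ch(7) sd_cong by (metis (no_types, lifting))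
  ultimately have "mapp n n (mmul n A' A) v = mapp n n idm v" by (rule sd_unique[OF ch(5) assms(2) _ _ assms(5)])
  then show "mapp n n A' (mapp n n A v) = v" by (simp add: mapp_mmul mapp_idm[OF assms(5)])
qed

text \<open>The inverse of an adapted chart, restricted to \<open>Kn l\<close>, parametrizes X near
  x. Elimination with maximal pivots, applied to its derivative, selects l coordinates in which the
  tangent space projects isometrically.\<close>

theorem nice_exists:
  assumes "submanifold n l X" "x \<in> X"
  shows "\<exists>s j. nice n l X s x j"
proof -
  have ln: "l \<le> n" and XK: "X \<subseteq> Kn n" using assms by (auto simp: submanifold_def)
  have "\<exists>U V g. x \<in> U \<and> adapted_chart n l X U V g"
    using assms unfolding submanifold_def by blast
  then obtain U V g where xU: "x \<in> U" and ac: "adapted_chart n l X U V g" by blast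
  note ch = adapted_chartD[OF ac]
  let ?\<tau> = "inv_into U g"
  define a where "a = g x"
  have a: "a \<in> V" "a \<in> Kn l" "?\<tau> a = x" using ch(7,11) assms(2) xU by (auto simp: a_def)
  obtain A0 where A0: "sd n n U g A0 x" using ch(2) xU by (auto simp: strict_C1_iff)
  obtain A where A: "sd n n V ?\<tau> A a" using ch(3) a by (auto simp: strict_C1_iff)
  have Ale: "mapp n n A c = mapp n l A c" if "c \<in> Kn l" for c using mapp_Kn_le that ln by blast
  have Ainj: "c = 0" if c: "c \<in> Kn l" "mapp n l A c = 0" for c
    using adapted_chart_deriv_inverse(1)[OF ac xU A0 A[unfolded a_def], of c] c Kn_mono[OF ln] Ale by auto
  obtain S where S: "S \<subseteq> {..<n}" "card S = l"
      "\<And>c j. (\<forall>i\<in>S. vge j (mapp n l A c i)) \<Longrightarrow> near n j (mapp n l A c)"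
    using pivot_coordinates[of l n A] Ainj by blast
  obtain s where s: "strict_mono_on {..<l} s" "s ` {..<l} = S"
    using enumerate_finite_set[of S l] S finite_subset by blast
  let ?p = "coord_proj l s"
  have pA: "near n j (mapp n l A c)" if "near l j (?p (mapp n l A c))" for c j
    using that s(2) by (intro S(3)) (auto simp: near_def coord_proj_def)
  define M where "M = mmul n (cpm s) A"
  have M: "mapp l l M c = ?p (mapp n l A c)" for c using s S by (simp add: M_def mapp_mmul mapp_cpm)
  have Minj: "c = 0" if c: "c \<in> Kn l" "mapp l l M c = 0" for c
  proof -
    have "near n j (mapp n l A c)" for j using c(2) by (intro pA) (simp add: M)
    then show ?thesis using near_all_0 mapp_Kn Ainj c by blast
  qed
  obtain N where N: "\<And>w. w \<in> Kn l \<Longrightarrow> ?p (mapp n l A (mapp l l N w)) = w"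
      "\<And>w. w \<in> Kn l \<Longrightarrow> mapp l l N (?p (mapp n l A w)) = w"
    using injective_invertible[of l M] Minj M by metis
  obtain d where d: "\<And>v j. near l j v \<Longrightarrow> near l (j + d) (mapp l l N v)" using mapp_bound by metis
  have tC1: "strict_C1 l n (V \<inter> Kn l) ?\<tau>" by (rule strict_C1_Int_Kn[OF ch(3) ln])
  have "sd l n (V \<inter> Kn l) ?\<tau> A a" by (rule sd_source_le[OF A ln]) (use a in auto)
  then obtain J1 where J1: "\<And>w w' j. w \<in> bl l (V \<inter> Kn l) a J1 \<Longrightarrow> w' \<in> bl l (V \<inter> Kn l) a J1 \<Longrightarrow>
      near l j (w - w') \<Longrightarrow> near n (j + (1 - d)) (?\<tau> w - ?\<tau> w' - mapp n l A (w - w'))"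
    using sdD[of l n "V \<inter> Kn l" ?\<tau> A a "1 - d"] by metis
  obtain J2 where J2: "bl l (Kn l) a J2 \<subseteq> V \<inter> Kn l"
    using openin_Int_Kn[OF ch(6) ln] a openin_iff_near[of "Kn l" l] by blast
  let ?J = "max J1 J2" let ?W = "bl l (Kn l) a ?J"
  have WV: "?W \<subseteq> V \<inter> Kn l" using J2 bl_mono[of J2 ?J a l "Kn l" a] bl_self[OF a(2)] by auto
  have W1: "?W \<subseteq> bl l (V \<inter> Kn l) a J1"
    using WV near_mono[of l ?J _ J1] unfolding bl_def by auto
  obtain J3 where J3: "bl n (Kn n) x J3 \<subseteq> U"
    using ch(5) xU openin_iff_near[of "Kn n" n] by blast
  obtain J4 where J4: "\<And>y. y \<in> bl n U x J4 \<Longrightarrow> near n ?J (g y - a)"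
    using sd_cont[OF A0 xU, of ?J] by (auto simp: a_def)
  have cover: "y \<in> ?\<tau> ` ?W" if y: "y \<in> bl n X x (max J3 J4)" for y
  proof -
    have "y \<in> bl n (Kn n) x J3" using y XK by (auto simp: mem_bl intro: near_mono)
    then have yU: "y \<in> X \<inter> U" using J3 y by (auto simp: mem_bl)
    then have "y \<in> bl n U x J4" using y by (auto simp: mem_bl intro: near_mono)
    then have "near n ?J (g y - a)" by (rule J4)
    then have "near l ?J (g y - a)" using ln by (auto simp: near_def)
    then have "g y \<in> ?W" using ch(11)[OF yU] by (simp add: mem_bl)
    then show ?thesis using ch(7)[of y] yU by (auto simp: image_iff intro!: bexI[of _ "g y"])
  qed
  have "\<exists>j. nice n l X s x j"
  proof (rule nice_of_parametrization[where \<tau> = ?\<tau> and a = a and W = ?W and J = ?J and A = A and N = N and d = d])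
    show "strict_C1 l n ?W ?\<tau>" by (rule strict_C1_subset[OF tC1 openin_bl WV])
    show "?\<tau> ` ?W \<subseteq> X" using ch(10) WV by blast
    show "near n (j + 1 - d) (?\<tau> w - ?\<tau> w' - mapp n l A (w - w'))"
      if "w \<in> ?W" "w' \<in> ?W" "near l j (w - w')" for w w' j
      using J1[of w w' j] that W1 by (auto simp: algebra_simps)
    show "y \<in> ?\<tau> ` ?W" if "y \<in> bl n X x (max J3 J4)" for y using cover[OF that] .
  qed (use XK assms(2) a s S in \<open>simp_all add: Ainj pA N d\<close>)
  then show ?thesis by blast
qed

section \<open>Tangent spaces in isometric charts\<close>

lemma has_strict_deriv_sd:
  "openin (top_of_set (Kn n)) U \<Longrightarrow> a \<in> U \<Longrightarrow> has_strict_deriv n m U f A a \<longleftrightarrow> sd n m U f A a"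
  using openin_imp_subset by (intro has_strict_deriv_iff) blast+

lemma nice_open:
  assumes "X' \<subseteq> X" "bl n X x j \<subseteq> X'" "nice n l X s x j"
  shows "nice n l X' s x j" "sec n l X' s x j = sec n l X s x j" "bl n X' x j = bl n X x j"
proof -
  show eq: "bl n X' x j = bl n X x j" using assms by (auto simp: mem_bl)
  show sec: "sec n l X' s x j = sec n l X s x j" by (simp add: sec_def eq)
  have "x \<in> X'" using assms bl_self[of x X n j] nice_x by blast
  then show "nice n l X' s x j" using assms(1,3) unfolding nice_def eq sec by blast
qed

lemma sd_open_subset:
  assumes "sd n m V f A a" "openin (top_of_set (Kn n)) V" "a \<in> V" "V \<subseteq> U" "U \<subseteq> Kn n"
  shows "sd n m U f A a"
proof -
  obtain J where "bl n (Kn n) a J \<subseteq> V" using assms openin_iff_near[of "Kn n" n V] by blast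
  moreover have "bl n U a J \<subseteq> bl n (Kn n) a J" using assms(5) by (auto simp: mem_bl)
  ultimately have "bl n U a J \<subseteq> V" by blast
  then show ?thesis using sd_mono[OF assms(1)] sd_local by blast
qed

context
  fixes n l :: nat and X :: "'k::nonarch_local_field kvec set" and s x j S
  assumes nice: "nice n l X s x j"
    and S: "sd l n (bl l (Kn l) (coord_proj l s x) j) (sec n l X s x j) S (coord_proj l s x)"
begin

abbreviation (input) "pp \<equiv> coord_proj l s"
abbreviation (input) "BB \<equiv> bl l (Kn l) (coord_proj l s x) j"
abbreviation (input) "sg \<equiv> sec n l X s x j"

lemma px_BB: "pp x \<in> BB"
  by (simp add: bl_self coord_proj_Kn)

lemma x_b: "x \<in> bl n X x j"
  by (rule bl_self[OF nice_x[OF nice]])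

lemma sg_px: "sg (pp x) = x"
  by (rule sec_cp[OF nice x_b])

lemma sec_ball:
  assumes "j \<le> i"
  shows "sg ` bl l (Kn l) (pp x) i = bl n X x i" "bl l (Kn l) (pp x) i \<subseteq> BB" "bl n X x i \<subseteq> bl n X x j"
proof -
  show 1: "bl l (Kn l) (pp x) i \<subseteq> BB" by (rule bl_mono[OF assms px_BB])
  show 2: "bl n X x i \<subseteq> bl n X x j" by (rule bl_mono[OF assms x_b])
  have "sg (pp y) = y" if "y \<in> bl n X x i" for y using sec_cp[OF nice] 2 that by blast
  then have "sg ` pp ` bl n X x i = bl n X x i" by (force simp: image_image)
  then show "sg ` bl l (Kn l) (pp x) i = bl n X x i"
    using nice_img_sub[OF nice x_b assms] by simp
qed

text \<open>The chain rule for the identity \<open>cp_sec\<close>. It shows that S is injective and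
  that its image is a graph over \<open>Kn l\<close>.\<close>

lemma cp_S: "v \<in> Kn l \<Longrightarrow> pp (mapp n l S v) = v"
proof -
  assume v: "v \<in> Kn l"
  have "sd l l BB (\<lambda>w. pp (sg w)) (mmul n (cpm s) S) (pp x)"
    by (rule sd_comp[OF S sd_coord_proj[OF nice_s[OF nice], of UNIV]]) (auto simp: px_BB)
  moreover have "sd l l BB (\<lambda>w. pp (sg w)) idm (pp x)"
  proof -
    have "sd l l BB (\<lambda>w. pp (sg w)) idm (pp x) \<longleftrightarrow> sd l l BB (\<lambda>w. w) idm (pp x)"
      by (rule sd_cong) (rule cp_sec[OF nice])
    then show ?thesis using sd_id[OF bl_subset] by blast
  qed
  ultimately have "mapp l l (mmul n (cpm s) S) v = mapp l l idm v"
    by (rule sd_unique[OF openin_bl px_BB _ _ v])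
  then show ?thesis by (simp add: mapp_mmul mapp_cpm[OF nice_s[OF nice]] mapp_idm[OF v])
qed

lemma sd_sec_comp:
  assumes h: "sd n m U h C x" and U: "openin (top_of_set X) (X \<inter> U)" "x \<in> U"
  shows "sd l m BB (\<lambda>w. h (sg w)) (mmul n C S) (pp x)"
proof -
  obtain i where i: "bl n X x i \<subseteq> U"
    using U nice_x[OF nice] openin_iff_near[OF nice_XK[OF nice], of "X \<inter> U"] by blast
  let ?i = "max i j"
  have sub: "bl n X x ?i \<subseteq> U" using i bl_mono[of i ?i x n X x] bl_self[OF nice_x[OF nice]] by auto
  have "sd l m (bl l (Kn l) (pp x) ?i) (\<lambda>w. h (sg w)) (mmul n C S) (pp x)"
  proof (rule sd_comp[where f = sg and g = h and V = U and m = n])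
    show "sd l n (bl l (Kn l) (pp x) ?i) sg S (pp x)" by (rule sd_mono[OF S sec_ball(2)]) simp
    show "sd n m U h C (sg (pp x))" using h by (simp only: sg_px)
    show "sg ` bl l (Kn l) (pp x) ?i \<subseteq> U" using sec_ball(1)[of ?i] sub by simp
  qed (simp add: bl_self coord_proj_Kn)
  then show ?thesis by (rule sd_open_subset[OF _ openin_bl]) (auto simp: bl_self coord_proj_Kn sec_ball(2) bl_subset)
qed

text \<open>The components of h from r on vanish, so the corresponding rows may be set to zero.
  Together with \<open>sd_unique\<close> this places the image of a derivative in
  \<open>Kn r\<close>.\<close>

lemma sd_truncate:
  assumes "sd l m U h C a" "\<And>w. w \<in> U \<Longrightarrow> h w \<in> Kn r"
  shows "sd l m U h (\<lambda>i k. if i < r then C i k else 0) a"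
proof -
  have "near m i (h w - h w' - mapp m l (\<lambda>i k. if i < r then C i k else 0) (w - w'))"
    if "w \<in> U" "w' \<in> U" "near m i (h w - h w' - mapp m l C (w - w'))" for i w w'
    unfolding near_def
  proof (intro allI impI)
    fix t assume t: "t < m"
    show "vge i ((h w - h w' - mapp m l (\<lambda>i k. if i < r then C i k else 0) (w - w')) t)"
    proof (cases "t < r")
      case True
      then show ?thesis using that(3) t by (auto simp: near_def mapp_def)
    next
      case False
      then have "h w t = 0" "h w' t = 0" using assms(2)[OF that(1)] assms(2)[OF that(2)] by (auto simp: Kn_def)
      then show ?thesis using False by (simp add: mapp_def)
    qed
  qed
  then show ?thesis using assms(1) unfolding sd_def by (meson bl_subset subsetD)
qed

text \<open>After the section the chart g takes values in \<open>Kn l\<close>, so its derivative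
  there may be truncated to l rows: the image of S is tangent in the sense of every adapted
  chart.\<close>

lemma chart_S_Kn:
  assumes ac: "adapted_chart n l X U V g" and xU: "x \<in> U" and A: "sd n n U g A x" and v: "v \<in> Kn l"
  shows "mapp n n A (mapp n l S v) \<in> Kn l"
proof -
  note ch = adapted_chartD[OF ac]
  have oXU: "openin (top_of_set X) (X \<inter> U)"
  proof -
    obtain T where "open T" "U = Kn n \<inter> T" using ch(5) by (auto simp: openin_open)
    then show ?thesis using nice_XK[OF nice] by (auto simp: openin_open)
  qed
  obtain i where i: "bl n X x i \<subseteq> X \<inter> U"
    using oXU xU nice_x[OF nice] openin_iff_near[OF nice_XK[OF nice], of "X \<inter> U"] by blast
  let ?B = "bl l (Kn l) (pp x) (max i j)"
  have sub: "bl n X x (max i j) \<subseteq> X \<inter> U"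
    using i bl_mono[of i "max i j" x n X x] bl_self[OF nice_x[OF nice]] by auto
  have d: "sd l n ?B (\<lambda>w. g (sg w)) (mmul n A S) (pp x)"
    by (rule sd_mono[OF sd_sec_comp[OF A oXU xU] sec_ball(2)]) simp
  have "g (sg w) \<in> Kn l" if "w \<in> ?B" for w
  proof -
    have "sg w \<in> bl n X x (max i j)" using sec_ball(1)[of "max i j"] that by auto
    then show ?thesis using sub ch(11) by blast
  qed
  from sd_truncate[OF d this] have "sd l n ?B (\<lambda>w. g (sg w)) (\<lambda>i k. if i < l then mmul n A S i k else 0) (pp x)" .
  from sd_unique[OF openin_bl _ d this v]
  have "mapp n l (mmul n A S) v = mapp n l (\<lambda>i k. if i < l then mmul n A S i k else 0) v"
    by (simp add: bl_self coord_proj_Kn)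
  also have "\<dots> \<in> Kn l" by (auto simp: Kn_def mapp_def)
  finally show ?thesis by (simp add: mapp_mmul)
qed

lemma chart_nbhd:
  assumes ac: "adapted_chart n l X U V g" and xU: "x \<in> U" and ln: "l \<le> n"
  obtains i where "bl l (Kn l) (g x) i \<subseteq> V \<inter> Kn l"
    "\<And>w. w \<in> bl l (Kn l) (g x) i \<Longrightarrow> inv_into U g w \<in> bl n X x j" "g x \<in> Kn l" "g x \<in> V"
proof -
  note ch = adapted_chartD[OF ac]
  have gx: "g x \<in> V \<inter> Kn l" "inv_into U g (g x) = x" using ch(7,11) xU nice_x[OF nice] by auto
  have o: "openin (top_of_set (Kn l)) (V \<inter> Kn l)" by (rule openin_Int_Kn[OF ch(6) ln])
  obtain i1 where i1: "bl l (Kn l) (g x) i1 \<subseteq> V \<inter> Kn l"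
    using o gx openin_iff_near[of "Kn l" l "V \<inter> Kn l"] by blast
  obtain A' where "sd l n (V \<inter> Kn l) (inv_into U g) A' (g x)"
    using strict_C1_Int_Kn[OF ch(3) ln] gx by (auto simp: strict_C1_iff)
  from sd_cont[OF this gx(1), of j] obtain i2 where
    i2: "\<And>w. w \<in> bl l (V \<inter> Kn l) (g x) i2 \<Longrightarrow> near n j (inv_into U g w - x)" using gx(2) by auto
  show ?thesis
  proof (rule that[of "max i1 i2"])
    show sub: "bl l (Kn l) (g x) (max i1 i2) \<subseteq> V \<inter> Kn l"
      using i1 near_mono[of l "max i1 i2" _ i1] unfolding bl_def by auto
    fix w assume w: "w \<in> bl l (Kn l) (g x) (max i1 i2)"
    then have wV: "w \<in> V \<inter> Kn l" using sub by blast
    then have "w \<in> bl l (V \<inter> Kn l) (g x) i2" using w near_mono[of l "max i1 i2" _ i2] by (auto simp: mem_bl)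
    then show "inv_into U g w \<in> bl n X x j" using i2 ch(10)[OF wV] by (auto simp: mem_bl)
  qed (use gx in auto)
qed

text \<open>Points of X near x are recovered from their projection, so f after the inverse chart is
  f after the section, preceded by the projection of the inverse chart; then the chain rule.\<close>

lemma sd_chart_factor:
  assumes ac: "adapted_chart n l X U V g" and xU: "x \<in> U" and ln: "l \<le> n"
    and A': "sd n n V (inv_into U g) A' (g x)" and C: "sd l m BB (\<lambda>w. f (sg w)) C (pp x)"
  shows "sd l m (V \<inter> Kn l) (\<lambda>w. f (inv_into U g w)) (mmul l C (mmul n (cpm s) A')) (g x)"
proof -
  obtain i where i: "bl l (Kn l) (g x) i \<subseteq> V \<inter> Kn l"
    "\<And>w. w \<in> bl l (Kn l) (g x) i \<Longrightarrow> inv_into U g w \<in> bl n X x j" and gx: "g x \<in> Kn l" "g x \<in> V"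
    using chart_nbhd[OF ac xU ln] by metis
  let ?W = "bl l (Kn l) (g x) i"
  note ch = adapted_chartD[OF ac]
  have gxW: "g x \<in> ?W" using gx by (simp add: bl_self)
  have tx: "inv_into U g (g x) = x" using ch(7) xU by blast
  have t: "sd l n ?W (inv_into U g) A' (g x)" by (rule sd_source_le[OF A' ln]) (use i gx in auto)
  have pt: "sd l l ?W (\<lambda>w. pp (inv_into U g w)) (mmul n (cpm s) A') (g x)"
    by (rule sd_comp[OF t sd_coord_proj[OF nice_s[OF nice], of UNIV]]) (auto simp: gxW)
  have "sd l m ?W (\<lambda>w. f (sg (pp (inv_into U g w)))) (mmul l C (mmul n (cpm s) A')) (g x)"
  proof (rule sd_comp[where g = "\<lambda>w. f (sg w)", OF pt _ _ gxW])
    show "sd l m BB (\<lambda>w. f (sg w)) C (pp (inv_into U g (g x)))" using C tx by simp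
    show "(\<lambda>w. pp (inv_into U g w)) ` ?W \<subseteq> BB" using i(2) cp_mem[OF nice] by blast
  qed
  also have "?this \<longleftrightarrow> sd l m ?W (\<lambda>w. f (inv_into U g w)) (mmul l C (mmul n (cpm s) A')) (g x)"
    by (rule sd_cong) (use i(2) sec_cp[OF nice] in simp)
  finally show ?thesis
    by (rule sd_open_subset[OF _ openin_bl gxW i(1)]) auto
qed

text \<open>The factorization for the identity map gives a second derivative of the inverse chart,
  and this one passes through S. Uniqueness then forces every tangent vector into the image of
  S.\<close>

lemma chart_tangent:
  assumes ac: "adapted_chart n l X U V g" and xU: "x \<in> U" and ln: "l \<le> n"
    and A: "sd n n U g A x" and v: "v \<in> Kn n" "mapp n n A v \<in> Kn l"
  shows "v = mapp n l S (pp v)"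
proof -
  note ch = adapted_chartD[OF ac]
  obtain i where gx: "g x \<in> Kn l" "g x \<in> V" using chart_nbhd[OF ac xU ln] by metis
  obtain A' where A': "sd n n V (inv_into U g) A' (g x)" using ch(3) gx by (auto simp: strict_C1_iff)
  have "sd l n (V \<inter> Kn l) (inv_into U g) (mmul l S (mmul n (cpm s) A')) (g x)"
    by (rule sd_chart_factor[OF ac xU ln A', of n "\<lambda>x. x"]) (rule S)
  moreover have "sd l n (V \<inter> Kn l) (inv_into U g) A' (g x)"
    by (rule sd_source_le[OF A' ln]) (use gx in auto)
  ultimately have "mapp n l (mmul l S (mmul n (cpm s) A')) (mapp n n A v) = mapp n l A' (mapp n n A v)"
    using gx v by (intro sd_unique[OF openin_Int_Kn[OF ch(6) ln]]) auto
  moreover have "mapp n l A' (mapp n n A v) = v"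
    using adapted_chart_deriv_inverse(2)[OF ac xU A A' v(1)] mapp_Kn_le[OF v(2) ln] by metis
  moreover have "mapp l l (mmul n (cpm s) A') (mapp n n A v) = pp (mapp n l A' (mapp n n A v))"
    by (simp add: mapp_mmul mapp_cpm[OF nice_s[OF nice]])
  ultimately show ?thesis by (simp add: mapp_mmul)
qed

context
  assumes sub: "submanifold n l X"
begin

lemma ln: "l \<le> n"
  using sub by (simp add: submanifold_def)

lemma chart_at_x:
  obtains U V g A A' where "adapted_chart n l X U V g" "x \<in> U" "g x \<in> V" "g x \<in> Kn l" "sd n n U g A x"
    "sd n n V (inv_into U g) A' (g x)"
proof -
  have "\<exists>U V g. x \<in> U \<and> adapted_chart n l X U V g"
    using sub nice_x[OF nice] unfolding submanifold_def by blast
  then obtain U V g where xU: "x \<in> U" and ac: "adapted_chart n l X U V g" by blast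
  note ch = adapted_chartD[OF ac]
  have gx: "g x \<in> V \<inter> Kn l" using ch(11) xU nice_x[OF nice] by blast
  obtain A where "sd n n U g A x" using ch(2) xU by (auto simp: strict_C1_iff)
  moreover obtain A' where "sd n n V (inv_into U g) A' (g x)" using ch(3) gx by (auto simp: strict_C1_iff)
  ultimately show ?thesis using that ac xU gx by blast
qed

lemma tangent_nice: "tangent n l X x = mapp n l S ` Kn l"
proof (intro equalityI subsetI)
  fix v assume "v \<in> tangent n l X x"
  then obtain U V g A where *: "v \<in> Kn n" "x \<in> U" "adapted_chart n l X U V g"
      "has_strict_deriv n n U g A x" "mapp n n A v \<in> Kn l"
    by (auto simp: tangent_def)
  have "sd n n U g A x"
    using has_strict_deriv_sd[OF adapted_chartD(5)[OF *(3)] *(2)] *(4) by blast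
  then have "v = mapp n l S (pp v)" by (rule chart_tangent[OF *(3,2) ln _ *(1,5)])
  then show "v \<in> mapp n l S ` Kn l" using coord_proj_Kn by blast
next
  fix v assume "v \<in> mapp n l S ` Kn l"
  then obtain w where w: "w \<in> Kn l" "v = mapp n l S w" by blast
  obtain U V g A where *: "adapted_chart n l X U V g" "x \<in> U" "sd n n U g A x" using chart_at_x by metis
  moreover have "has_strict_deriv n n U g A x"
    using has_strict_deriv_sd[OF adapted_chartD(5)[OF *(1)] *(2)] *(3) by blast
  moreover have "mapp n n A v \<in> Kn l" using chart_S_Kn[OF * w(1)] w by simp
  ultimately show "v \<in> tangent n l X x" using w(2) mapp_Kn unfolding tangent_def by blast
qed

text \<open>The \<open>THE\<close> in \<open>differential\<close> is well defined: a chart at x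
  exists, and every adapted chart with every choice of derivatives leads to the vector computed by
  C.\<close>

lemma differential_nice:
  assumes C: "sd l m BB (\<lambda>w. f (sg w)) C (pp x)" and w: "w \<in> Kn l"
  shows "differential n l X m f x (mapp n l S w) = mapp m l C w"
proof -
  have key: "mapp m l B (mapp n n A (mapp n l S w)) = mapp m l C w"
    if ac: "adapted_chart n l X U V g" and xU: "x \<in> U" and A: "sd n n U g A x"
      and B: "sd l m (V \<inter> Kn l) (f \<circ> inv_into U g) B (g x)" for U V g A B
  proof -
    note ch = adapted_chartD[OF ac]
    obtain i where gx: "g x \<in> Kn l" "g x \<in> V" using chart_nbhd[OF ac xU ln] by metis
    obtain A' where A': "sd n n V (inv_into U g) A' (g x)" using ch(3) gx by (auto simp: strict_C1_iff)
    have ASw: "mapp n n A (mapp n l S w) \<in> Kn l" by (rule chart_S_Kn[OF ac xU A w])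
    have "mapp m l B (mapp n n A (mapp n l S w))
        = mapp m l (mmul l C (mmul n (cpm s) A')) (mapp n n A (mapp n l S w))"
      using sd_unique[OF openin_Int_Kn[OF ch(6) ln] _ B _ ASw] sd_chart_factor[OF ac xU ln A' C] gx
      by (auto simp: comp_def)
    also have "\<dots> = mapp m l C (pp (mapp n l A' (mapp n n A (mapp n l S w))))"
      by (simp add: mapp_mmul mapp_cpm[OF nice_s[OF nice]])
    also have "mapp n l A' (mapp n n A (mapp n l S w)) = mapp n l S w"
      using adapted_chart_deriv_inverse(2)[OF ac xU A A' mapp_Kn] mapp_Kn_le[OF ASw ln] by metis
    finally show ?thesis using cp_S[OF w] by simp
  qed
  show ?thesis unfolding differential_def
  proof (rule the_equality)
    obtain U V g A A' where ac: "adapted_chart n l X U V g" and xU: "x \<in> U" and gx: "g x \<in> V" "g x \<in> Kn l"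
        and A: "sd n n U g A x" and A': "sd n n V (inv_into U g) A' (g x)"
      using chart_at_x by metis
    let ?B = "mmul l C (mmul n (cpm s) A')"
    have B: "sd l m (V \<inter> Kn l) (f \<circ> inv_into U g) ?B (g x)"
      using sd_chart_factor[OF ac xU ln A' C] by (simp add: comp_def)
    note ch = adapted_chartD[OF ac]
    have "has_strict_deriv n n U g A x" using A has_strict_deriv_sd[OF ch(5) xU] by blast
    moreover have "has_strict_deriv l m (V \<inter> Kn l) (f \<circ> inv_into U g) ?B (g x)"
      using B has_strict_deriv_sd[OF openin_Int_Kn[OF ch(6) ln]] gx by blast
    moreover have "mapp m l C w = mapp m l ?B (mapp n n A (mapp n l S w))"
      using key[OF ac xU A B] by simp
    ultimately show "\<exists>U V g A B. x \<in> U \<and> adapted_chart n l X U V g \<and> has_strict_deriv n n U g A x \<and>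
        has_strict_deriv l m (V \<inter> Kn l) (f \<circ> inv_into U g) B (g x) \<and>
        mapp m l C w = mapp m l B (mapp n n A (mapp n l S w))"
      using ac xU by blast
  next
    fix w' assume "\<exists>U V g A B. x \<in> U \<and> adapted_chart n l X U V g \<and> has_strict_deriv n n U g A x \<and>
        has_strict_deriv l m (V \<inter> Kn l) (f \<circ> inv_into U g) B (g x) \<and>
        w' = mapp m l B (mapp n n A (mapp n l S w))"
    then obtain U V g A B where *: "x \<in> U" "adapted_chart n l X U V g" "has_strict_deriv n n U g A x"
        "has_strict_deriv l m (V \<inter> Kn l) (f \<circ> inv_into U g) B (g x)"
        "w' = mapp m l B (mapp n n A (mapp n l S w))" by blast
    note ch = adapted_chartD[OF *(2)]
    have "g x \<in> V \<inter> Kn l" using ch(11) *(1) nice_x[OF nice] by blast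
    then have "sd l m (V \<inter> Kn l) (f \<circ> inv_into U g) B (g x)"
      using * has_strict_deriv_sd[OF openin_Int_Kn[OF ch(6) ln]] by blast
    moreover have "sd n n U g A x" using * has_strict_deriv_sd[OF ch(5)] by blast
    ultimately show "w' = mapp m l C w" using key * by blast
  qed
qed

lemma codifferential_nice:
  assumes "sd l m BB (\<lambda>w. f (sg w)) C (pp x)" and "w \<in> Kn l"
  shows "codifferential n l X m f x \<eta> (mapp n l S w) = \<eta> (mapp m l C w)"
  using differential_nice[OF assms] assms(2) by (simp add: codifferential_def tangent_nice)

lemma codifferential_eqI:
  assumes "\<And>w. w \<in> Kn l \<Longrightarrow> \<xi> (mapp n l S w) = \<xi>' (mapp n l S w)"
    and "\<And>v. v \<notin> tangent n l X x \<Longrightarrow> \<xi> v = 0" "\<And>v. v \<notin> tangent n l X x \<Longrightarrow> \<xi>' v = 0"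
  shows "\<xi> = (\<xi>' :: 'k kvec \<Rightarrow> 'k)"
proof (rule ext)
  fix v show "\<xi> v = \<xi>' v"
    using assms tangent_nice by (cases "v \<in> tangent n l X x") auto
qed

end

end

subsection \<open>Open subsets\<close>

lemma openin_Kn_subset: "openin (top_of_set (Kn n)) U \<Longrightarrow> X \<subseteq> Kn n \<Longrightarrow> openin (top_of_set X) (X \<inter> U)"
proof -
  assume U: "openin (top_of_set (Kn n)) U" and X: "X \<subseteq> Kn n"
  then obtain T where "open T" "U = Kn n \<inter> T" by (auto simp: openin_open)
  then show ?thesis using X by (auto simp: openin_open)
qed

text \<open>The same map serves for an open part, but its target has to be cut down; the new target
  is open because the inverse chart is continuous.\<close>

lemma adapted_chart_Int:
  assumes ac: "adapted_chart n l X U V g" and O: "openin (top_of_set (Kn n)) Q"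
  shows "adapted_chart n l (X \<inter> Q) (U \<inter> Q) (g ` (U \<inter> Q)) g"
proof -
  note ch = adapted_chartD[OF ac]
  have inj: "inj_on g U" using ch(1) by (simp add: bij_betw_def)
  have gV: "g ` U = V" using ch(1) by (simp add: bij_betw_def)
  have eqV: "g ` (U \<inter> Q) = V \<inter> inv_into U g -` Q"
    using ch(7,8,9) gV by (force simp: image_iff)
  have UQ: "openin (top_of_set (Kn n)) (U \<inter> Q)" using ch(5) O by blast
  obtain T where T: "open T" "Q = Kn n \<inter> T" using O by (auto simp: openin_open)
  have "V \<inter> inv_into U g -` Q = V \<inter> inv_into U g -` T"
    using T ch(9) openin_imp_subset[OF ch(5)] by auto
  moreover have "openin (top_of_set V) (V \<inter> inv_into U g -` T)"
    using strict_C1_continuous[OF ch(3)] T(1) continuous_openin_preimage_eq by blast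
  ultimately have "openin (top_of_set V) (g ` (U \<inter> Q))" using eqV by simp
  then have oV: "openin (top_of_set (Kn n)) (g ` (U \<inter> Q))" using ch(6) openin_trans by blast
  have inv: "inv_into (U \<inter> Q) g w = inv_into U g w" if "w \<in> g ` (U \<inter> Q)" for w
    using that inj by (auto simp: inv_into_f_f inj_on_Int)
  have "strict_C1 n n (g ` (U \<inter> Q)) (inv_into (U \<inter> Q) g)"
    using strict_C1_cong[of "g ` (U \<inter> Q)" "inv_into (U \<inter> Q) g" "inv_into U g" n n, OF inv]
      strict_C1_subset[OF ch(3) oV] eqV by blast
  moreover have "strict_C1 n n (U \<inter> Q) g" by (rule strict_C1_subset[OF ch(2) UQ]) auto
  moreover have "bij_betw g (U \<inter> Q) (g ` (U \<inter> Q))" using inj by (auto simp: bij_betw_def inj_on_Int)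
  moreover have "g ` (X \<inter> Q \<inter> (U \<inter> Q)) = g ` (U \<inter> Q) \<inter> Kn l"
  proof (intro equalityI subsetI)
    fix w assume "w \<in> g ` (U \<inter> Q) \<inter> Kn l"
    then obtain y where y: "y \<in> U \<inter> Q" "w = g y" "w \<in> Kn l" by blast
    have "g y \<in> V" using bij_betw_apply[OF ch(1)] y by blast
    then have "w \<in> g ` (X \<inter> U)" unfolding ch(4) using y by simp
    then obtain y' where y': "y' \<in> X \<inter> U" "w = g y'" by blast
    have "g y = g y'" using y y' by metis
    then have "y = y'" by (rule inj_onD[OF inj]) (use y y' in auto)
    then have "y \<in> X" using y' by simp
    then show "w \<in> g ` (X \<inter> Q \<inter> (U \<inter> Q))" using y by blast
  qed (use ch(11) in auto)
  ultimately show ?thesis by (simp add: adapted_chart_def)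
qed

lemma submanifold_open:
  assumes sub: "submanifold n l X" and O: "openin (top_of_set X) X'" "X' \<noteq> {}"
  shows "submanifold n l X'"
proof -
  have XK: "X \<subseteq> Kn n" using sub by (simp add: submanifold_def)
  obtain T where T: "open T" "X' = X \<inter> T" using O by (auto simp: openin_open)
  have Q: "openin (top_of_set (Kn n)) (Kn n \<inter> T)" using T by (simp add: openin_open_Int)
  have "\<exists>U V g. x \<in> U \<and> adapted_chart n l X' U V g" if x: "x \<in> X'" for x
  proof -
    obtain U V g where "x \<in> U" "adapted_chart n l X U V g"
      using sub x T unfolding submanifold_def by blast
    from adapted_chart_Int[OF this(2) Q] this(1) x T XK show ?thesis
      by (metis (no_types, lifting) IntI Int_assoc inf.absorb1 Int_iff subsetD)
  qed
  then show ?thesis using sub T O(2) XK by (auto simp: submanifold_def)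
qed

lemma adapted_chart_id:
  assumes "openin (top_of_set (Kn l)) W"
  shows "adapted_chart l l W W W (\<lambda>x. x)"
proof -
  have "strict_C1 l l W (inv_into W (\<lambda>x. x)) \<longleftrightarrow> strict_C1 l l W (\<lambda>x. x)"
    by (rule strict_C1_cong) (simp add: inv_into_f_f[of "\<lambda>x. x", simplified])
  then show ?thesis
    using strict_C1_id[OF assms] openin_imp_subset[OF assms] by (auto simp: adapted_chart_def bij_betw_def)
qed

lemma inv_into_ident: "w \<in> W \<Longrightarrow> inv_into W (\<lambda>x. x) w = w"
  using inv_into_f_f[of "\<lambda>x. x" W w] by simp

lemma submanifold_Kn_open: "openin (top_of_set (Kn l)) W \<Longrightarrow> W \<noteq> {} \<Longrightarrow> submanifold l l W"
  using adapted_chart_id[of l W] openin_imp_subset by (auto simp: submanifold_def)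

subsection \<open>Morphisms\<close>

text \<open>The definition of a morphism only speaks of h f g^-1 for one pair of adapted charts.
  Composing with g after the section on one side and with h^-1 on the other gives f after the
  section, near x.\<close>

lemma morphism_sd:
  assumes mor: "strict_C1_morphism n l X m k Y f" and nice: "nice n l X s x j"
    and lk: "l \<le> n" "k \<le> m"
  shows "\<exists>C. sd l m (bl l (Kn l) (coord_proj l s x) j) (\<lambda>w. f (sec n l X s x j w)) C (coord_proj l s x)"
proof -
  let ?\<sigma> = "sec n l X s x j" let ?p = "coord_proj l s" let ?B = "bl l (Kn l) (?p x) j"
  have xX: "x \<in> X" by (rule nice_x[OF nice])
  have pxB: "?p x \<in> ?B" by (simp add: bl_self coord_proj_Kn)
  obtain S where S: "sd l n ?B ?\<sigma> S (?p x)" using nice_sec_C1[OF nice] pxB by (auto simp: strict_C1_iff)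
  have fX: "f ` X \<subseteq> Y" using mor by (simp add: strict_C1_morphism_def)
  obtain U V g U' V' h where xU: "x \<in> U" and ac: "adapted_chart n l X U V g"
    and ac': "adapted_chart m k Y U' V' h" and fU: "f ` (X \<inter> U) \<subseteq> U'"
    and C1: "strict_C1 l k (V \<inter> Kn l) (h \<circ> f \<circ> inv_into U g)"
    using mor xX unfolding strict_C1_morphism_def by blast
  note ch = adapted_chartD[OF ac] and ch' = adapted_chartD[OF ac']
  have oXU: "openin (top_of_set X) (X \<inter> U)" by (rule openin_Kn_subset[OF ch(5) nice_XK[OF nice]])
  obtain i where "bl n X x i \<subseteq> X \<inter> U"
    using oXU xU xX openin_iff_near[OF nice_XK[OF nice], of "X \<inter> U"] by blast
  then have sub: "bl n X x (max i j) \<subseteq> X \<inter> U"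
    using bl_mono[of i "max i j" x n X x] bl_self[OF xX] by auto
  let ?B' = "bl l (Kn l) (?p x) (max i j)"
  have pxB': "?p x \<in> ?B'" by (simp add: bl_self coord_proj_Kn)
  have \<sigma>B': "?\<sigma> w \<in> X \<inter> U" if "w \<in> ?B'" for w
    using sec_ball(1)[OF nice S, of "max i j"] sub that by auto
  obtain A where A: "sd n n U g A x" using ch(2) xU by (auto simp: strict_C1_iff)
  have g\<sigma>: "sd l l ?B' (\<lambda>w. g (?\<sigma> w)) (mmul n A S) (?p x)"
    by (rule sd_target_le[OF sd_mono[OF sd_sec_comp[OF nice S A oXU xU] sec_ball(2)[OF nice S]] lk(1)]) simp
  have \<sigma>x: "?\<sigma> (?p x) = x" by (rule sg_px[OF nice S])
  have gx: "g x \<in> V \<inter> Kn l" using ch(11) xU xX by blast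
  obtain D where D: "sd l k (V \<inter> Kn l) (\<lambda>w. h (f (inv_into U g w))) D (g x)"
    using C1 gx by (auto simp: strict_C1_iff comp_def)
  have hf: "h (f (inv_into U g w)) \<in> V' \<inter> Kn k" if "w \<in> V \<inter> Kn l" for w
    using ch(10)[OF that] fU fX ch'(11) by blast
  have 1: "sd l k ?B' (\<lambda>w. h (f (inv_into U g (g (?\<sigma> w))))) (mmul l D (mmul n A S)) (?p x)"
    by (rule sd_comp[OF g\<sigma> _ _ pxB']) (use D \<sigma>x \<sigma>B' ch(11) in \<open>auto\<close>)
  have tg: "inv_into U g (g (?\<sigma> w)) = ?\<sigma> w" if "w \<in> ?B'" for w using ch(7) \<sigma>B'[OF that] by blast
  have hfx: "h (f x) \<in> V' \<inter> Kn k" using hf[OF gx] ch(7)[OF xU] by simp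
  obtain E where E: "sd m m V' (inv_into U' h) E (h (f x))" using ch'(3) hfx by (auto simp: strict_C1_iff)
  have E': "sd k m (V' \<inter> Kn k) (inv_into U' h) E (h (f x))"
    by (rule sd_source_le[OF E lk(2)]) (use hfx in auto)
  have "sd l m ?B' (\<lambda>w. inv_into U' h (h (f (inv_into U g (g (?\<sigma> w)))))) (mmul k E (mmul l D (mmul n A S))) (?p x)"
  proof (rule sd_comp[OF 1 _ _ pxB'])
    show "sd k m (V' \<inter> Kn k) (inv_into U' h) E (h (f (inv_into U g (g (?\<sigma> (?p x))))))"
      using E' \<sigma>x ch(7)[OF xU] by simp
    show "(\<lambda>w. h (f (inv_into U g (g (?\<sigma> w))))) ` ?B' \<subseteq> V' \<inter> Kn k"
      using hf ch(11) \<sigma>B' by blast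
  qed
  also have "?this \<longleftrightarrow> sd l m ?B' (\<lambda>w. f (?\<sigma> w)) (mmul k E (mmul l D (mmul n A S))) (?p x)"
  proof (rule sd_cong)
    fix w assume w: "w \<in> ?B'"
    then have "f (?\<sigma> w) \<in> U'" using \<sigma>B' fU by blast
    then show "inv_into U' h (h (f (inv_into U g (g (?\<sigma> w))))) = f (?\<sigma> w)"
      using tg[OF w] ch'(7) by simp
  qed
  finally have "sd l m ?B (\<lambda>w. f (?\<sigma> w)) (mmul k E (mmul l D (mmul n A S))) (?p x)"
    by (rule sd_open_subset[OF _ openin_bl pxB' sec_ball(2)[OF nice S] bl_subset]) simp
  then show ?thesis by blast
qed

lemma morphism_cont:
  assumes mor: "strict_C1_morphism n l X m k Y f" and "submanifold n l X" "k \<le> m" "x \<in> X"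
  shows "\<exists>J. \<forall>y\<in>bl n X x J. near m i (f y - f x)"
proof -
  obtain s j where nice: "nice n l X s x j" using nice_exists assms by blast
  let ?p = "coord_proj l s" let ?B = "bl l (Kn l) (?p x) j"
  have ln: "l \<le> n" using assms by (simp add: submanifold_def)
  have pxB: "?p x \<in> ?B" by (simp add: bl_self coord_proj_Kn)
  obtain C where C: "sd l m ?B (\<lambda>w. f (sec n l X s x j w)) C (?p x)"
    using morphism_sd[OF mor nice ln assms(3)] by blast
  have px: "sec n l X s x j (?p x) = x" by (rule sec_cp[OF nice bl_self[OF assms(4)]])
  obtain J where J: "\<And>w. w \<in> bl l ?B (?p x) J \<Longrightarrow> near m i (f (sec n l X s x j w) - f x)"
    using sd_cont[OF C pxB, of i] unfolding px by blast
  have "near m i (f y - f x)" if y: "y \<in> bl n X x (max j J)" for y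
  proof -
    have yb: "y \<in> bl n X x j" using bl_mono[of j "max j J" x n X x] bl_self assms(4) y by auto
    have "near l (max j J) (?p y - ?p x)"
      using y nice_iso[OF nice yb bl_self[OF assms(4)]] by (simp add: mem_bl)
    then have "near l J (?p y - ?p x)" by (rule near_mono) simp
    then have "?p y \<in> bl l ?B (?p x) J" using cp_mem[OF nice yb] by (simp add: mem_bl)
    from J[OF this] show ?thesis using sec_cp[OF nice yb] by simp
  qed
  then show ?thesis by blast
qed

subsection \<open>Isometric charts as strict charts\<close>

text \<open>Smoothness is tested in strict charts, so the isometric ones have to be recognized among
  them. The projection is linear in the ambient space; in the other direction the section is
  followed by an adapted chart of the ball, whose values lie in \<open>Kn l\<close>, so l of the n
  components suffice.\<close>

lemma C1_chart_nice:
  assumes nice: "nice n l X s x j" and sub: "submanifold n l X"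
  shows "C1_chart n l X (bl n X x j) (bl l (Kn l) (coord_proj l s x) j) (coord_proj l s)"
proof -
  let ?p = "coord_proj l s" let ?b = "bl n X x j" let ?B = "bl l (Kn l) (?p x) j" let ?\<sigma> = "sec n l X s x j"
  have ln: "l \<le> n" using sub by (simp add: submanifold_def)
  have xX: "x \<in> X" by (rule nice_x[OF nice])
  have subb: "submanifold n l ?b"
    by (rule submanifold_open[OF sub openin_bl]) (use bl_self[OF xX] in blast)
  have bij: "bij_betw ?p ?b ?B"
    using nice_inj[OF nice] nice_img[OF nice] by (simp add: bij_betw_def)
  have fwd: "strict_C1_morphism n l ?b l l ?B ?p"
    unfolding strict_C1_morphism_def
  proof (intro conjI ballI)
    show "?p ` ?b \<subseteq> ?B" using nice_img[OF nice] by simp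
    fix y assume y: "y \<in> ?b"
    have "\<exists>U V g. y \<in> U \<and> adapted_chart n l ?b U V g"
      using subb y unfolding submanifold_def by blast
    then obtain U V g where yU: "y \<in> U" and ac: "adapted_chart n l ?b U V g" by blast
    note ch = adapted_chartD[OF ac]
    have t: "strict_C1 l n (V \<inter> Kn l) (inv_into U g)" by (rule strict_C1_Int_Kn[OF ch(3) ln])
    have p: "strict_C1 n l (Kn n) ?p"
      unfolding strict_C1_iff
      by (intro conjI ballI exI[of _ "cpm s"] sd_coord_proj nice_s[OF nice] image_subsetI coord_proj_Kn) simp
    have "strict_C1 l l (V \<inter> Kn l) (\<lambda>w. ?p (inv_into U g w))"
      by (rule strict_C1_comp[OF t p]) (use t in \<open>simp add: strict_C1_iff\<close>)
    then have "strict_C1 l l (V \<inter> Kn l) ((\<lambda>x. x) \<circ> ?p \<circ> inv_into U g)" by (simp add: comp_def)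
    note st = this
    have pb: "?p ` (?b \<inter> U) \<subseteq> ?B" using nice_img[OF nice] by blast
    show "\<exists>U V g U' V' h. y \<in> U \<and> adapted_chart n l ?b U V g \<and> adapted_chart l l ?B U' V' h \<and>
        ?p ` (?b \<inter> U) \<subseteq> U' \<and> strict_C1 l l (V \<inter> Kn l) (h \<circ> ?p \<circ> inv_into U g)"
      by (intro exI conjI, rule yU, rule ac, rule adapted_chart_id[OF openin_bl], rule pb, rule st)
  qed
  have bwd: "strict_C1_morphism l l ?B n l ?b ?\<sigma>"
    unfolding strict_C1_morphism_def
  proof (intro conjI ballI)
    show "?\<sigma> ` ?B \<subseteq> ?b" using sec_mem[OF nice] by blast
    fix w assume w: "w \<in> ?B"
    let ?y = "?\<sigma> w"
    have y: "?y \<in> ?b" using sec_mem[OF nice w] .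
    have py: "?p ?y = w" by (rule cp_sec[OF nice w])
    have "\<exists>U V g. ?y \<in> U \<and> adapted_chart n l ?b U V g"
      using subb y unfolding submanifold_def by blast
    then obtain U V g where yU: "?y \<in> U" and ac: "adapted_chart n l ?b U V g" by blast
    note ch = adapted_chartD[OF ac]
    have "openin (top_of_set ?b) (?b \<inter> U)"
      by (rule openin_Kn_subset[OF ch(5)]) (use nice_XK[OF nice] bl_subset in blast)
    then have "openin (top_of_set X) (?b \<inter> U)" using openin_bl openin_trans by blast
    then obtain i where i: "bl n X ?y i \<subseteq> ?b \<inter> U"
      using y yU openin_iff_near[OF nice_XK[OF nice]] by blast
    let ?i = "max i j"
    have sub_i: "bl n X ?y ?i \<subseteq> ?b \<inter> U"
      using i bl_mono[of i ?i ?y n X ?y] bl_self[of ?y X n i] y by (auto simp: mem_bl)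
    let ?W = "bl l (Kn l) w ?i"
    have WB: "?W \<subseteq> ?B" by (rule bl_mono[OF _ w]) simp
    have \<sigma>W: "?\<sigma> z \<in> ?b \<inter> U" if z: "z \<in> ?W" for z
    proof -
      obtain y' where "y' \<in> bl n X ?y ?i" "z = ?p y'"
        using nice_img_sub[OF nice y, of ?i] z by (auto simp: py)
      moreover have "y' \<in> ?b \<inter> U" using sub_i calculation(1) by blast
      moreover have "?\<sigma> (?p y') = y'" by (rule sec_cp[OF nice]) (use calculation(3) in blast)
      ultimately show ?thesis by metis
    qed
    have s1: "strict_C1 l n ?W ?\<sigma>" by (rule strict_C1_subset[OF nice_sec_C1[OF nice] openin_bl WB])
    have "strict_C1 l n ?W (\<lambda>z. g (?\<sigma> z))"
      by (rule strict_C1_comp[OF s1 ch(2)]) (use \<sigma>W in blast)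
    then have "strict_C1 l l ?W (\<lambda>z. g (?\<sigma> z))"
      using sd_target_le[OF _ ln] ch(11) \<sigma>W unfolding strict_C1_iff by blast
    moreover have "strict_C1 l l ?W (g \<circ> ?\<sigma> \<circ> inv_into ?W (\<lambda>x. x)) \<longleftrightarrow> strict_C1 l l ?W (\<lambda>z. g (?\<sigma> z))"
      by (rule strict_C1_cong) (simp add: inv_into_ident)
    moreover have "?W \<inter> Kn l = ?W" using bl_subset by blast
    moreover have "adapted_chart l l ?B ?W ?W (\<lambda>x. x)"
      using adapted_chart_id[of l ?W, OF openin_bl] WB
      by (simp add: adapted_chart_def Int_absorb1 Int_absorb2 bl_subset)
    moreover have "?\<sigma> ` (?B \<inter> ?W) \<subseteq> U" using \<sigma>W by blast
    moreover have "w \<in> ?W" using w by (simp add: mem_bl)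
    ultimately show "\<exists>U V g U' V' h. w \<in> U \<and> adapted_chart l l ?B U V g \<and> adapted_chart n l ?b U' V' h \<and>
        ?\<sigma> ` (?B \<inter> U) \<subseteq> U' \<and> strict_C1 l l (V \<inter> Kn l) (h \<circ> ?\<sigma> \<circ> inv_into U g)"
      using ac by (metis (no_types, lifting))
  qed
  show ?thesis
    unfolding C1_chart_def strict_C1_iso_def using openin_bl bij fwd bwd by (auto simp: sec_def)
qed

section \<open>Coordinates of covectors in an isometric chart\<close>

context
  fixes n l :: nat and X :: "'k::nonarch_local_field kvec set" and s x j S
  assumes nice: "nice n l X s x j"
    and S: "sd l n (bl l (Kn l) (coord_proj l s x) j) (sec n l X s x j) S (coord_proj l s x)"
    and sub: "submanifold n l X"
begin

text \<open>The covector with coordinates \<zeta> in the isometric chart, in the form in which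
  \<open>smooth_at\<close> specifies covectors in a strict chart.\<close>

definition cov :: "'k kvec \<Rightarrow> 'k kvec \<Rightarrow> 'k" where
  "cov \<zeta> = codifferential n l (bl n X x j) l (coord_proj l s) x (covec l \<zeta>)"

lemma nice_b: "nice n l (bl n X x j) s x j" "sec n l (bl n X x j) s x j = sec n l X s x j"
  using nice_open[OF bl_subset order_refl nice] by blast+

lemma sub_b: "submanifold n l (bl n X x j)"
  by (rule submanifold_open[OF sub openin_bl]) (use x_b[OF nice S] in blast)

lemma S_b: "sd l n (bl l (Kn l) (coord_proj l s x) j) (sec n l (bl n X x j) s x j) S (coord_proj l s x)"
  using S nice_b by simp

lemma tangent_b: "tangent n l (bl n X x j) x = mapp n l S ` Kn l"
  by (rule tangent_nice[OF nice_b(1) S_b sub_b])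

lemma tangent_X: "tangent n l X x = mapp n l S ` Kn l"
  by (rule tangent_nice[OF nice S sub])

lemma cov_S: "w \<in> Kn l \<Longrightarrow> cov \<zeta> (mapp n l S w) = dotp l w \<zeta>"
proof -
  assume w: "w \<in> Kn l"
  let ?p = "coord_proj l s" let ?B = "bl l (Kn l) (?p x) j"
  have "sd l l ?B (\<lambda>w. ?p (sec n l (bl n X x j) s x j w)) idm (?p x) \<longleftrightarrow> sd l l ?B (\<lambda>w. w) idm (?p x)"
    by (rule sd_cong) (simp add: nice_b(2) cp_sec[OF nice])
  then have "sd l l ?B (\<lambda>w. ?p (sec n l (bl n X x j) s x j w)) idm (?p x)"
    using sd_id[OF bl_subset] by blast
  from codifferential_nice[OF nice_b(1) S_b sub_b this w] show ?thesis
    using w by (simp add: cov_def mapp_idm[OF w] covec_def)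
qed

lemma cov_outside: "v \<notin> tangent n l X x \<Longrightarrow> cov \<zeta> v = 0"
  by (simp add: cov_def codifferential_def tangent_b tangent_X)

lemma cov_covectors: "cov \<zeta> \<in> covectors n l X x"
  unfolding covectors_def
proof (intro CollectI conjI ballI allI impI)
  fix v w assume "v \<in> tangent n l X x" "w \<in> tangent n l X x"
  then obtain a b where ab: "a \<in> Kn l" "v = mapp n l S a" "b \<in> Kn l" "w = mapp n l S b"
    by (auto simp: tangent_X)
  have "(\<lambda>i. v i + w i) = mapp n l S (a + b)" by (auto simp: ab mapp_add)
  then show "cov \<zeta> (\<lambda>i. v i + w i) = cov \<zeta> v + cov \<zeta> w"
    using ab cov_S[OF Kn_add[OF ab(1,3)]] by (simp add: cov_S dotp_add_left)
next
  fix c v assume "v \<in> tangent n l X x"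
  then obtain a where a: "a \<in> Kn l" "v = mapp n l S a" by (auto simp: tangent_X)
  have "(\<lambda>i. c * v i) = mapp n l S (\<lambda>i. c * a i)" by (simp add: a mapp_scale)
  then show "cov \<zeta> (\<lambda>i. c * v i) = c * cov \<zeta> v"
    using a cov_S[OF Kn_scale[OF a(1), of c]] by (simp add: cov_S dotp_scale_left)
qed (rule cov_outside)

lemma cov_inj:
  assumes "\<zeta> \<in> Kn l" "\<zeta>' \<in> Kn l" "cov \<zeta> = cov \<zeta>'"
  shows "\<zeta> = \<zeta>'"
proof (rule Kn_eqI[OF assms(1,2)])
  fix i assume i: "i < l"
  then have "cov \<zeta> (mapp n l S (unitv i)) = \<zeta> i" "cov \<zeta>' (mapp n l S (unitv i)) = \<zeta>' i"
    by (simp_all add: cov_S unitv_Kn dotp_unitv)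
  then show "\<zeta> i = \<zeta>' i" using assms(3) by simp
qed

lemma cov_0: "cov 0 = (\<lambda>_. 0)"
proof (rule ext)
  fix v show "cov 0 v = 0"
    using cov_outside[of v 0] by (cases "v \<in> tangent n l X x") (auto simp: tangent_X cov_S)
qed

lemma cov_cotangent: "\<zeta> \<in> Kn l \<Longrightarrow> \<zeta> \<noteq> 0 \<Longrightarrow> (x, cov \<zeta>) \<in> cotangent_nz n l X"
  using cov_covectors cov_inj[of \<zeta> 0] nice_x[OF nice] by (auto simp: cotangent_nz_def cov_0)

text \<open>The coordinates are the values on the images of the unit vectors. Linearity of \<xi> is
  available on the tangent space only, so w is built up by initial segments, whose images under S
  stay there.\<close>

lemma cov_surj:
  assumes "\<xi> \<in> covectors n l X x"
  obtains \<zeta> where "\<zeta> \<in> Kn l" "cov \<zeta> = \<xi>"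
proof -
  have add: "\<xi> (v + w) = \<xi> v + \<xi> w" if "v \<in> tangent n l X x" "w \<in> tangent n l X x" for v w
    using assms that by (simp add: covectors_def plus_fun_def)
  have scale: "\<xi> (\<lambda>i. c * v i) = c * \<xi> v" if "v \<in> tangent n l X x" for c v
    using assms that by (simp add: covectors_def)
  have out: "v \<notin> tangent n l X x \<Longrightarrow> \<xi> v = 0" for v using assms by (simp add: covectors_def)
  have tan: "mapp n l S w \<in> tangent n l X x" if "w \<in> Kn l" for w using that by (auto simp: tangent_X)
  define \<zeta> where "\<zeta> = (\<lambda>i. if i < l then \<xi> (mapp n l S (unitv i)) else 0)"
  have \<zeta>K: "\<zeta> \<in> Kn l" by (simp add: \<zeta>_def Kn_def)
  have "\<xi> (mapp n l S w) = dotp l w \<zeta>" if w: "w \<in> Kn l" for w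
  proof -
    let ?w = "\<lambda>r i. if i < r then w i else 0"
    have "\<xi> (mapp n l S (?w r)) = (\<Sum>i<r. w i * \<zeta> i)" if "r \<le> l" for r
      using that
    proof (induct r)
      case 0
      have "?w 0 = 0" by auto
      moreover have "\<xi> 0 = 0"
      proof -
        have "\<xi> 0 + \<xi> 0 = \<xi> 0 + 0" using add[of 0 0] tan[OF Kn_0] by (simp only: mapp_0) simp
        then show ?thesis by (rule add_left_imp_eq)
      qed
      ultimately show ?case by simp
    next
      case (Suc r)
      have e: "?w (Suc r) = ?w r + (\<lambda>i. w r * unitv r i)" by (auto simp: unitv_def less_Suc_eq)
      have K: "?w r \<in> Kn l" using Suc by (auto simp: Kn_def)
      have "\<xi> (mapp n l S (?w (Suc r))) = \<xi> (mapp n l S (?w r)) + \<xi> (mapp n l S (\<lambda>i. w r * unitv r i))"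
        unfolding e mapp_add using Suc by (intro add tan K Kn_scale unitv_Kn) simp
      also have "\<xi> (mapp n l S (\<lambda>i. w r * unitv r i)) = w r * \<zeta> r"
        unfolding mapp_scale using Suc by (subst scale) (auto simp: \<zeta>_def intro!: tan unitv_Kn)
      finally show ?case using Suc by simp
    qed
    from this[of l] have "\<xi> (mapp n l S (?w l)) = dotp l w \<zeta>" by (simp add: dotp_def)
    moreover have "?w l = w" using w by (auto simp: Kn_def)
    ultimately show ?thesis by simp
  qed
  then have "cov \<zeta> = \<xi>"
    by (intro codifferential_eqI[OF nice S sub]) (auto simp: cov_S cov_outside out)
  then show ?thesis using that \<zeta>K by blast
qed

text \<open>The derivatives of the two transition maps between g and the isometric chart are inverse
  to each other by the chain rule. Equality of the covectors relates \<eta>0 and \<eta> through one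
  of them; inverting it gives the transpose of the other.\<close>

lemma chart_relation:
  assumes ch: "C1_chart n l X U W g" and xU: "x \<in> U" and \<eta>: "\<eta>0 \<in> Kn l" "\<eta> \<in> Kn l"
    and eq: "codifferential n l U l g x (covec l \<eta>0) = cov \<eta>"
  shows "\<exists>E r. bl l (Kn l) (g x) r \<subseteq> W \<and>
    sd l l (bl l (Kn l) (g x) r) (\<lambda>w. coord_proj l s (inv_into U g w)) E (g x) \<and> tmapp l l E \<eta> = \<eta>0"
proof -
  let ?p = "coord_proj l s"
  have U: "openin (top_of_set X) U" and W: "openin (top_of_set (Kn l)) W"
    and bij: "bij_betw g U W" and mor: "strict_C1_morphism n l U l l W g"
    and mor': "strict_C1_morphism l l W n l U (inv_into U g)"
    using ch by (auto simp: C1_chart_def strict_C1_iso_def)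
  have ln: "l \<le> n" using sub by (simp add: submanifold_def)
  have subU: "submanifold n l U" by (rule submanifold_open[OF sub U]) (use xU in blast)
  have xX: "x \<in> X" by (rule nice_x[OF nice])
  have UX: "U \<subseteq> X" using openin_imp_subset[OF U] .
  have WK: "W \<subseteq> Kn l" using openin_imp_subset[OF W] .
  have gx: "g x \<in> W" using bij_betw_apply[OF bij xU] .
  have ginv: "inv_into U g (g y) = y" if "y \<in> U" for y using bij that by (simp add: bij_betw_def)
  have ginv': "g (inv_into U g w) = w" if "w \<in> W" for w using bij_betw_inv_into_right[OF bij that] .
  have ginvU: "inv_into U g w \<in> U" if "w \<in> W" for w using bij_betw_apply[OF bij_betw_inv_into[OF bij] that] .
  obtain r where r: "bl l (Kn l) (g x) r \<subseteq> W" using W gx openin_iff_near[of "Kn l" l W] by blast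
  have gxK: "g x \<in> Kn l" using gx WK by blast
  note nW = nice_open_Kn[OF WK gxK r]
  let ?D = "bl l (Kn l) (g x) r"
  have gxD: "g x \<in> ?D" by (rule bl_self[OF gxK])
  obtain E where "sd l n (bl l (Kn l) (coord_proj l id (g x)) r) (\<lambda>w. inv_into U g (sec l l W id (g x) r w)) E (coord_proj l id (g x))"
    using morphism_sd[OF mor' nW(1) order_refl ln] by blast
  then have E0: "sd l n ?D (\<lambda>w. inv_into U g (sec l l W id (g x) r w)) E (g x)"
    by (simp add: coord_proj_id[OF gxK])
  have "sd l n ?D (\<lambda>w. inv_into U g (sec l l W id (g x) r w)) E (g x) \<longleftrightarrow> sd l n ?D (inv_into U g) E (g x)"
    by (rule sd_cong) (simp add: nW(2))
  then have E: "sd l n ?D (inv_into U g) E (g x)" using E0 by blast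
  define P where "P = mmul n (cpm s) E"
  have P: "sd l l ?D (\<lambda>w. ?p (inv_into U g w)) P (g x)"
    unfolding P_def by (rule sd_comp[OF E sd_coord_proj[OF nice_s[OF nice], of UNIV]]) (auto simp: gxD)
  obtain i where i: "bl n X x i \<subseteq> U" using U xU openin_iff_near[OF nice_XK[OF nice]] by blast
  let ?i = "max i j"
  have iU: "bl n X x ?i \<subseteq> U" using i bl_mono[of i ?i x n X x] bl_self[OF xX] by auto
  have nX: "nice n l X s x ?i" by (rule nice_sub[OF nice x_b[OF nice S]]) simp
  note nU = nice_open[OF UX iU nX]
  let ?B = "bl l (Kn l) (?p x) ?i"
  have secU: "sec n l U s x ?i w = sec n l X s x j w" if "w \<in> ?B" for w
    using sec_sub_eq[OF nice x_b[OF nice S] _ that] nU(2) by simp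
  have "sd l n ?B (sec n l U s x ?i) S (?p x) \<longleftrightarrow> sd l n ?B (sec n l X s x j) S (?p x)"
    by (rule sd_cong) (rule secU)
  then have SU: "sd l n ?B (sec n l U s x ?i) S (?p x)"
    using sd_mono[OF S sec_ball(2)[OF nice S, of ?i]] by simp
  obtain G where G: "sd l l ?B (\<lambda>w. g (sec n l U s x ?i w)) G (?p x)"
    using morphism_sd[OF mor nU(1) ln order_refl] by blast
  have rel: "dotp l (mapp l l G w) \<eta>0 = dotp l w \<eta>" if w: "w \<in> Kn l" for w
  proof -
    have "codifferential n l U l g x (covec l \<eta>0) (mapp n l S w) = covec l \<eta>0 (mapp l l G w)"
      by (rule codifferential_nice[OF nU(1) SU subU G w])
    then show ?thesis using cov_S[OF w] eq by (simp add: covec_def mapp_Kn)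
  qed
  have "mapp l l G (mapp l l P z) = z" if z: "z \<in> Kn l" for z
  proof -
    obtain r' where r': "\<And>w. w \<in> bl l ?D (g x) r' \<Longrightarrow> near n ?i (inv_into U g w - inv_into U g (g x))"
      using sd_cont[OF E gxD, of ?i] by blast
    let ?D' = "bl l ?D (g x) r'"
    have bD: "inv_into U g w \<in> bl n U x ?i" if "w \<in> ?D'" for w
      using r'[OF that] ginvU[of w] that r ginv[OF xU] by (auto simp: mem_bl)
    have gxD': "g x \<in> ?D'" by (rule bl_self[OF gxD])
    have pB: "(\<lambda>w. ?p (inv_into U g w)) ` ?D' \<subseteq> ?B" using bD cp_mem[OF nU(1)] by blast
    have "sd l l ?D' (\<lambda>w. g (sec n l U s x ?i (?p (inv_into U g w)))) (mmul l G P) (g x)"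
      by (rule sd_comp[where g = "\<lambda>w. g (sec n l U s x ?i w)", OF sd_mono[OF P bl_subset] _ pB gxD'])
        (use G ginv[OF xU] in simp)
    also have "?this \<longleftrightarrow> sd l l ?D' (\<lambda>w. w) (mmul l G P) (g x)"
    proof (rule sd_cong)
      fix w assume w: "w \<in> ?D'"
      then have "w \<in> W" using r bl_subset by blast
      then show "g (sec n l U s x ?i (?p (inv_into U g w))) = w"
        using sec_cp[OF nU(1) bD[OF w]] ginv' by simp
    qed
    finally have 1: "sd l l ?D (\<lambda>w. w) (mmul l G P) (g x)" by (rule sd_local)
    have "mapp l l (mmul l G P) z = mapp l l idm z"
      by (rule sd_unique[OF openin_bl gxD 1 sd_id[OF bl_subset] z])
    then show ?thesis by (simp add: mapp_mmul mapp_idm[OF z])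
  qed
  then have "dotp l z \<eta>0 = dotp l z (tmapp l l P \<eta>)" if "z \<in> Kn l" for z
    using rel[of "mapp l l P z"] that mapp_Kn dotp_mapp by metis
  then have "tmapp l l P \<eta> i = \<eta>0 i" if "i < l" for i
    using that unitv_Kn dotp_unitv by metis
  then have "tmapp l l P \<eta> = \<eta>0"
    by (intro Kn_eqI[of _ l]) (simp_all add: tmapp_def mapp_Kn \<eta>)
  then show ?thesis using P r by blast
qed

end

text \<open>Reduces the geometry to one matrix A: disjointness from the conormal set will say that
  \<open>tmapp k l A\<close> kills no direction of \<Gamma> over f x, and the pull-back cone over x
  consists of the nonzero images of such directions.\<close>

lemma morphism_local:
  fixes X Y :: "'k::nonarch_local_field kvec set" and f :: "'k kvec \<Rightarrow> 'k kvec"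
  assumes mor: "strict_C1_morphism n l X m k Y f" and sub: "submanifold n l X" "submanifold m k Y"
    and nX: "nice n l X s x j" and nY: "nice m k Y t (f x) i"
    and S: "sd l n (bl l (Kn l) (coord_proj l s x) j) (sec n l X s x j) S (coord_proj l s x)"
    and T: "sd k m (bl k (Kn k) (coord_proj k t (f x)) i) (sec m k Y t (f x) i) T (coord_proj k t (f x))"
  obtains A where
    "sd l k (bl l (Kn l) (coord_proj l s x) j) (\<lambda>w. coord_proj k t (f (sec n l X s x j w))) A (coord_proj l s x)"
    "\<And>\<theta>. codifferential n l X m f x (cov m k Y t (f x) i \<theta>) = cov n l X s x j (tmapp k l A \<theta>)"
proof -
  let ?p = "coord_proj l s" let ?B = "bl l (Kn l) (?p x) j" let ?\<sigma> = "sec n l X s x j"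
  let ?q = "coord_proj k t"
  have lk: "l \<le> n" "k \<le> m" using sub by (simp_all add: submanifold_def)
  have xX: "x \<in> X" by (rule nice_x[OF nX])
  have pxB: "?p x \<in> ?B" by (rule px_BB[OF nX S])
  have \<sigma>x: "?\<sigma> (?p x) = x" by (rule sg_px[OF nX S])
  have fXY: "f ` X \<subseteq> Y" using mor by (simp add: strict_C1_morphism_def)
  obtain C where C: "sd l m ?B (\<lambda>w. f (?\<sigma> w)) C (?p x)" using morphism_sd[OF mor nX lk] by blast
  define A where "A = mmul m (cpm t) C"
  have A: "sd l k ?B (\<lambda>w. ?q (f (?\<sigma> w))) A (?p x)"
    unfolding A_def by (rule sd_comp[OF C sd_coord_proj[OF nice_s[OF nY], of UNIV]]) (auto simp: pxB)
  have CT: "mapp m l C w = mapp m k T (mapp k l A w)" if w: "w \<in> Kn l" for w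
  proof -
    obtain J where J: "\<And>w. w \<in> bl l ?B (?p x) J \<Longrightarrow> near m i (f (?\<sigma> w) - f (?\<sigma> (?p x)))"
      using sd_cont[OF C pxB, of i] by blast
    let ?B' = "bl l ?B (?p x) J"
    have fb: "f (?\<sigma> w) \<in> bl m Y (f x) i" if "w \<in> ?B'" for w
      using J[OF that] \<sigma>x fXY sec_mem[OF nX, of w] that bl_subset by (auto simp: mem_bl)
    have pxB': "?p x \<in> ?B'" by (rule bl_self[OF pxB])
    have "sd l m ?B' (\<lambda>w. sec m k Y t (f x) i (?q (f (?\<sigma> w)))) (mmul k T A) (?p x)"
    proof (rule sd_comp[OF sd_mono[OF A bl_subset] _ _ pxB'])
      show "sd k m (bl k (Kn k) (?q (f x)) i) (sec m k Y t (f x) i) T (?q (f (?\<sigma> (?p x))))"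
        using T \<sigma>x by simp
      show "(\<lambda>w. ?q (f (?\<sigma> w))) ` ?B' \<subseteq> bl k (Kn k) (?q (f x)) i" using fb cp_mem[OF nY] by blast
    qed
    also have "?this \<longleftrightarrow> sd l m ?B' (\<lambda>w. f (?\<sigma> w)) (mmul k T A) (?p x)"
      by (rule sd_cong) (use fb sec_cp[OF nY] in simp)
    finally have 1: "sd l m ?B (\<lambda>w. f (?\<sigma> w)) (mmul k T A) (?p x)" by (rule sd_local)
    have "mapp m l C w = mapp m l (mmul k T A) w" by (rule sd_unique[OF openin_bl pxB C 1 w])
    then show ?thesis by (simp add: mapp_mmul)
  qed
  have "codifferential n l X m f x (cov m k Y t (f x) i \<theta>) = cov n l X s x j (tmapp k l A \<theta>)" for \<theta>
  proof (rule codifferential_eqI[OF nX S sub(1)])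
    fix w :: "'k kvec" assume w: "w \<in> Kn l"
    have "codifferential n l X m f x (cov m k Y t (f x) i \<theta>) (mapp n l S w) = cov m k Y t (f x) i \<theta> (mapp m l C w)"
      by (rule codifferential_nice[OF nX S sub(1) C w])
    also have "\<dots> = dotp k (mapp k l A w) \<theta>"
      unfolding CT[OF w] by (rule cov_S[OF nY T sub(2) mapp_Kn])
    also have "\<dots> = cov n l X s x j (tmapp k l A \<theta>) (mapp n l S w)"
      by (simp add: cov_S[OF nX S sub(1) w] dotp_mapp)
    finally show "codifferential n l X m f x (cov m k Y t (f x) i \<theta>) (mapp n l S w) =
        cov n l X s x j (tmapp k l A \<theta>) (mapp n l S w)" .
  qed (simp_all add: codifferential_def cov_outside[OF nX S sub(1)])
  then show ?thesis using that A by blast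
qed

section \<open>Test functions and distributions\<close>

lemma closed_near: "closed {y::'k::nonarch_local_field kvec. near n j (y - x)}"
proof -
  have "{y. near n j (y - x)} = (\<Inter>i<n. (\<lambda>y. y i) -` {t. vge j (t - x i)})"
    by (auto simp: near_def)
  moreover have "closed ((\<lambda>y::'k kvec. y i) -` {t. vge j (t - x i)})" for i
    by (intro closed_vimage closed_vge continuous_on_product_coordinates)
  ultimately show ?thesis by auto
qed

lemma compact_bl_sub:
  assumes "compact (bl n X x j)" "y \<in> bl n X x j" "j \<le> i"
  shows "compact (bl n X y i)"
proof -
  have "bl n X y i = bl n X x j \<inter> {z. near n i (z - y)}"
    using bl_mono[OF assms(3,2)] by (auto simp: mem_bl)
  then show ?thesis using assms(1) compact_Int_closed closed_near by metis
qed

lemma lc_iff: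
  assumes "X \<subseteq> Kn n"
  shows "locally_constant_on X \<phi> \<longleftrightarrow> (\<forall>x\<in>X. \<exists>j. \<forall>y\<in>bl n X x j. \<phi> y = \<phi> x)"
proof
  assume L: "locally_constant_on X \<phi>"
  show "\<forall>x\<in>X. \<exists>j. \<forall>y\<in>bl n X x j. \<phi> y = \<phi> x"
  proof
    fix x assume "x \<in> X"
    then obtain U where U: "openin (top_of_set X) U" "x \<in> U" "\<phi> constant_on U"
      using L unfolding locally_constant_on_def by blast
    obtain j where "bl n X x j \<subseteq> U" using U openin_iff_near[OF assms] by blast
    then show "\<exists>j. \<forall>y\<in>bl n X x j. \<phi> y = \<phi> x" using U(2,3) unfolding constant_on_def by (metis subsetD)
  qed
next
  assume R: "\<forall>x\<in>X. \<exists>j. \<forall>y\<in>bl n X x j. \<phi> y = \<phi> x"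
  show "locally_constant_on X \<phi>" unfolding locally_constant_on_def
  proof
    fix x assume x: "x \<in> X"
    then obtain j where "\<forall>y\<in>bl n X x j. \<phi> y = \<phi> x" using R by blast
    then have "\<phi> constant_on bl n X x j" unfolding constant_on_def by (intro exI[of _ "\<phi> x"])
    then show "\<exists>U. openin (top_of_set X) U \<and> x \<in> U \<and> \<phi> constant_on U"
      by (intro exI[of _ "bl n X x j"] conjI openin_bl bl_self x)
  qed
qed

lemma lc_binop:
  assumes "X \<subseteq> Kn n" "locally_constant_on X \<phi>" "locally_constant_on X \<phi>'"
  shows "locally_constant_on X (\<lambda>x. H (\<phi> x) (\<phi>' x))"
  unfolding lc_iff[OF assms(1)]
proof
  fix x assume "x \<in> X"
  then obtain i j where i: "\<And>y. y \<in> bl n X x i \<Longrightarrow> \<phi> y = \<phi> x" and j: "\<And>y. y \<in> bl n X x j \<Longrightarrow> \<phi>' y = \<phi>' x"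
    using assms(2,3) unfolding lc_iff[OF assms(1)] by meson
  have "y \<in> bl n X x i" "y \<in> bl n X x j" if "y \<in> bl n X x (max i j)" for y
    using that near_mono[of n "max i j" "y - x"] by (auto simp: mem_bl)
  then show "\<exists>j. \<forall>y\<in>bl n X x j. H (\<phi> y) (\<phi>' y) = H (\<phi> x) (\<phi>' x)"
    using i j by (intro exI[of _ "max i j"]) simp
qed

lemma lc_const: "locally_constant_on X (\<lambda>_. c)"
  unfolding locally_constant_on_def constant_on_def by (metis openin_subtopology_self)

lemma lc_mono: "X' \<subseteq> X \<Longrightarrow> X \<subseteq> Kn n \<Longrightarrow> locally_constant_on X \<phi> \<Longrightarrow> locally_constant_on X' \<phi>"
proof -
  assume s: "X' \<subseteq> X" "X \<subseteq> Kn n" and l: "locally_constant_on X \<phi>"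
  then have "X' \<subseteq> Kn n" by blast
  moreover have "bl n X' x j \<subseteq> bl n X x j" for x j using s by (auto simp: mem_bl)
  ultimately show ?thesis using l s unfolding lc_iff[OF s(2)] lc_iff[OF \<open>X' \<subseteq> Kn n\<close>] by (meson subsetD)
qed

lemma lc_compose:
  assumes "X \<subseteq> Kn n" "Y \<subseteq> Kn m" "f ` X \<subseteq> Y" "locally_constant_on Y h"
    and c: "\<And>x i. x \<in> X \<Longrightarrow> \<exists>J. \<forall>y\<in>bl n X x J. near m i (f y - f x)"
  shows "locally_constant_on X (\<lambda>x. h (f x))"
  unfolding lc_iff[OF assms(1)]
proof
  fix x assume x: "x \<in> X"
  then obtain i where i: "\<And>y. y \<in> bl m Y (f x) i \<Longrightarrow> h y = h (f x)"
    using assms(3,4) unfolding lc_iff[OF assms(2)] by blast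
  obtain J where "\<forall>y\<in>bl n X x J. near m i (f y - f x)" using c[OF x] by blast
  then show "\<exists>j. \<forall>y\<in>bl n X x j. h (f y) = h (f x)"
    using assms(3) by (intro exI[of _ J]) (auto simp: mem_bl image_subset_iff intro!: i)
qed

section \<open>Supports and decompositions of test functions\<close>

lemma tf_intro:
  assumes X: "X \<subseteq> Kn n" and lc: "locally_constant_on X \<phi>" and 0: "\<And>x. x \<notin> X \<Longrightarrow> \<phi> x = 0"
    and K: "compact K" "K \<subseteq> X" "\<And>x. \<phi> x \<noteq> 0 \<Longrightarrow> x \<in> K"
  shows "\<phi> \<in> test_functions X"
proof -
  have "openin (top_of_set X) {x \<in> X. \<phi> x = 0}"
    unfolding openin_iff_near[OF X]
  proof (intro conjI ballI)
    fix x assume x: "x \<in> {x \<in> X. \<phi> x = 0}"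
    then obtain j where "\<forall>y\<in>bl n X x j. \<phi> y = \<phi> x" using lc unfolding lc_iff[OF X] by blast
    then have "bl n X x j \<subseteq> {x \<in> X. \<phi> x = 0}" using x bl_subset by fastforce
    then show "\<exists>j. bl n X x j \<subseteq> {x \<in> X. \<phi> x = 0}" by blast
  qed auto
  then obtain T where T: "open T" "{x \<in> X. \<phi> x = 0} = X \<inter> T" by (auto simp: openin_open)
  have "{x. \<phi> x \<noteq> 0} = K \<inter> (- T)"
  proof (intro equalityI subsetI)
    fix x assume "x \<in> {x. \<phi> x \<noteq> 0}"
    then have "x \<in> K" "\<phi> x \<noteq> 0" using K by auto
    moreover have "x \<notin> T" using T(2) calculation K(2) by blast
    ultimately show "x \<in> K \<inter> (- T)" by blast
  next
    fix x assume "x \<in> K \<inter> (- T)"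
    then show "x \<in> {x. \<phi> x \<noteq> 0}" using K(2) T(2) by blast
  qed
  moreover have "compact (K \<inter> (- T))" using K(1) T(1) by (simp add: compact_Int_closed closed_Compl)
  ultimately show ?thesis using lc 0 by (simp add: test_functions_def)
qed

lemma tfD:
  assumes "\<phi> \<in> test_functions X"
  shows "locally_constant_on X \<phi>" "\<And>x. x \<notin> X \<Longrightarrow> \<phi> x = 0" "compact {x. \<phi> x \<noteq> 0}" "{x. \<phi> x \<noteq> 0} \<subseteq> X"
  using assms by (auto simp: test_functions_def)

lemma tf_add:
  assumes "X \<subseteq> Kn n" "\<phi> \<in> test_functions X" "\<phi>' \<in> test_functions X"
  shows "(\<lambda>x. \<phi> x + \<phi>' x) \<in> test_functions X"
proof (rule tf_intro[OF assms(1)])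
  show "locally_constant_on X (\<lambda>x. \<phi> x + \<phi>' x)" using lc_binop[OF assms(1)] tfD(1) assms by blast
  show "compact ({x. \<phi> x \<noteq> 0} \<union> {x. \<phi>' x \<noteq> 0})" using tfD(3) assms by blast
qed (use tfD(2,4)[OF assms(2)] tfD(2,4)[OF assms(3)] in auto)

lemma tf_mult_lc:
  assumes "X \<subseteq> Kn n" "\<phi> \<in> test_functions X" "locally_constant_on X h"
  shows "(\<lambda>x. h x * \<phi> x) \<in> test_functions X"
proof (rule tf_intro[OF assms(1)])
  show "locally_constant_on X (\<lambda>x. h x * \<phi> x)" using lc_binop[OF assms(1)] tfD(1) assms by blast
  show "compact {x. \<phi> x \<noteq> 0}" using tfD(3) assms by blast
qed (use tfD(2,4)[OF assms(2)] in auto)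

lemma tf_scale: "X \<subseteq> Kn n \<Longrightarrow> \<phi> \<in> test_functions X \<Longrightarrow> (\<lambda>x. c * \<phi> x) \<in> test_functions X"
  by (rule tf_mult_lc[OF _ _ lc_const])

lemma tf_0: "X \<subseteq> Kn n \<Longrightarrow> (\<lambda>_. 0) \<in> test_functions X"
  by (rule tf_intro[OF _ lc_const, of _ n _ "{}"]) auto

lemma tf_sum:
  assumes "X \<subseteq> Kn n" "\<And>i. i \<in> I \<Longrightarrow> \<phi> i \<in> test_functions X"
  shows "(\<lambda>x. \<Sum>i\<in>I. c i * \<phi> i x) \<in> test_functions X"
  using assms(2)
proof (induct I rule: infinite_finite_induct)
  case (insert i I)
  then show ?case using tf_add[OF assms(1) tf_scale[OF assms(1)]] by simp
qed (simp_all add: tf_0[OF assms(1)])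

definition ind :: "nat \<Rightarrow> 'k::nonarch_local_field kvec set \<Rightarrow> 'k kvec \<Rightarrow> int \<Rightarrow> 'k kvec \<Rightarrow> complex" where
  "ind n X x j y = (if y \<in> bl n X x j then 1 else 0)"

lemma lc_ind: "X \<subseteq> Kn n \<Longrightarrow> locally_constant_on X (ind n X x j)"
proof -
  assume X: "X \<subseteq> Kn n"
  have "ind n X x j z = ind n X x j y" if y: "y \<in> X" and "z \<in> bl n X y j" for y z
  proof -
    have "near n j (z - x) \<longleftrightarrow> near n j (y - x)"
      using that near_trans[of n j z y x] near_trans[of n j y z x] near_commute[of n j z y]
      by (auto simp: mem_bl)
    moreover have "z \<in> X" using that(2) by (simp add: mem_bl)
    ultimately show ?thesis using y by (simp add: ind_def mem_bl)
  qed
  then show ?thesis unfolding lc_iff[OF X] by blast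
qed

lemma ind_test: "X \<subseteq> Kn n \<Longrightarrow> compact (bl n X x j) \<Longrightarrow> ind n X x j \<in> test_functions X"
  by (rule tf_intro[of X n _ "bl n X x j"]) (auto simp: lc_ind ind_def bl_def split: if_splits)

lemma near_cover:
  assumes "compact K"
  obtains F where "F \<subseteq> K" "finite F" "K \<subseteq> (\<Union>x\<in>F. {y::'k::nonarch_local_field kvec. near n (J x) (y - x)})"
  by (rule compactE_image[OF assms, of K "\<lambda>x. {y. near n (J x) (y - x)}"]) (auto intro: open_near)

text \<open>A finite cover of the compact support makes pointwise radii uniform. Q is any property
  of balls that passes to smaller balls with other centres, for instance being isometric.\<close>

lemma tf_uniform:
  assumes X: "X \<subseteq> Kn n" and \<phi>: "\<phi> \<in> test_functions X"
    and Q: "\<And>x. x \<in> X \<Longrightarrow> \<exists>j. Q x j"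
      "\<And>x j y j'. Q x j \<Longrightarrow> y \<in> bl n X x j \<Longrightarrow> j \<le> j' \<Longrightarrow> Q y j'"
  shows "\<exists>j0. (\<forall>x\<in>X. \<forall>j\<ge>j0. \<phi> x \<noteq> 0 \<longrightarrow> Q x j) \<and> (\<forall>x\<in>X. \<forall>j\<ge>j0. \<forall>y\<in>bl n X x j. \<phi> y = \<phi> x)"
proof -
  let ?K = "{x. \<phi> x \<noteq> 0}"
  have KX: "?K \<subseteq> X" and cK: "compact ?K" using tfD[OF \<phi>] by auto
  have "\<exists>j. Q x j \<and> (\<forall>y\<in>bl n X x j. \<phi> y = \<phi> x)" if x: "x \<in> X" for x
  proof -
    obtain i where i: "Q x i" using Q(1)[OF x] by blast
    obtain j where j: "\<forall>y\<in>bl n X x j. \<phi> y = \<phi> x" using tfD(1)[OF \<phi>] x unfolding lc_iff[OF X] by blast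
    have "Q x (max i j)" by (rule Q(2)[OF i bl_self[OF x]]) simp
    moreover have "bl n X x (max i j) \<subseteq> bl n X x j" by (rule bl_mono[OF _ bl_self[OF x]]) simp
    ultimately show ?thesis using j by blast
  qed
  then obtain J where J: "\<And>x. x \<in> X \<Longrightarrow> Q x (J x)" "\<And>x y. x \<in> X \<Longrightarrow> y \<in> bl n X x (J x) \<Longrightarrow> \<phi> y = \<phi> x"
    by metis
  obtain F where F: "F \<subseteq> ?K" "finite F" "?K \<subseteq> (\<Union>x\<in>F. {y. near n (J x) (y - x)})"
    using near_cover[OF cK, of n J] by blast
  define j0 where "j0 = Max (insert 0 (J ` F))"
  have K: "Q x j \<and> (\<forall>y\<in>bl n X x j. \<phi> y = \<phi> x)" if x: "x \<in> ?K" and j: "j0 \<le> j" for x j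
  proof -
    obtain a where a: "a \<in> F" "near n (J a) (x - a)" using F(3) x by blast
    have "J a \<le> j0" unfolding j0_def using a F(2) by (intro Max_ge) auto
    then have Jj: "J a \<le> j" using j by simp
    have aX: "a \<in> X" using a F(1) KX by blast
    have xa: "x \<in> bl n X a (J a)" using a x KX by (auto simp: mem_bl)
    have "\<phi> y = \<phi> x" if "y \<in> bl n X x j" for y
      using J(2)[OF aX, of y] J(2)[OF aX xa] bl_mono[OF Jj xa] that by auto
    then show ?thesis using Q(2)[OF J(1)[OF aX] xa Jj] by blast
  qed
  show ?thesis
  proof (intro exI[of _ j0] conjI ballI allI impI)
    show "Q x j" if "x \<in> X" "j0 \<le> j" "\<phi> x \<noteq> 0" for x j using K[of x j] that by simp
    have "\<phi> y = \<phi> x" if y: "y \<in> bl n X x j" "x \<in> X" "j0 \<le> j" for x y j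
    proof (cases "\<phi> x = 0")
      case True
      \<comment> \<open>Outside the support the roles are exchanged: if \<phi> y were nonzero, the
        ball around y would contain x and force \<phi> x to be nonzero.\<close>
      have "x \<in> bl n X y j" using y near_commute by (auto simp: mem_bl)
      then show ?thesis using K[of y j] y True by force
    next
      case False
      then have "x \<in> ?K" by simp
      from K[OF this y(3)] y(1) show ?thesis by blast
    qed
    then show "\<phi> y = \<phi> x" if "x \<in> X" "j0 \<le> j" "y \<in> bl n X x j" for x j y using that by blast
  qed
qed

lemma tf_decomp:
  assumes X: "X \<subseteq> Kn n" and \<phi>: "\<phi> \<in> test_functions X"
    and c: "\<And>x y. y \<in> bl n X x j \<Longrightarrow> x \<in> X \<Longrightarrow> \<phi> y = \<phi> x"
  shows "\<exists>I. finite I \<and> I \<subseteq> {x. \<phi> x \<noteq> 0} \<and> \<phi> = (\<lambda>y. \<Sum>x\<in>I. \<phi> x * ind n X x j y) \<and>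
    (\<forall>x\<in>I. \<forall>y\<in>I. x \<noteq> y \<longrightarrow> bl n X x j \<inter> bl n X y j = {})"
proof -
  let ?K = "{x. \<phi> x \<noteq> 0}"
  have KX: "?K \<subseteq> X" and cK: "compact ?K" using tfD[OF \<phi>] by auto
  obtain F where F: "F \<subseteq> ?K" "finite F" "?K \<subseteq> (\<Union>x\<in>F. {y. near n j (y - x)})"
    using near_cover[OF cK, of n "\<lambda>_. j"] by blast
  \<comment> \<open>A finite cover may contain centres of the same ball several times; a
    representative depending on the ball alone counts each ball once.\<close>
  define r where "r C = (SOME z. z \<in> ?K \<and> bl n X z j = C)" for C
  have r: "r (bl n X x j) \<in> ?K \<and> bl n X (r (bl n X x j)) j = bl n X x j" if "x \<in> ?K" for x
    unfolding r_def by (rule someI[of _ x]) (use that in simp)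
  define I where "I = (\<lambda>x. r (bl n X x j)) ` F"
  have I: "finite I" "I \<subseteq> ?K" using F r unfolding I_def by auto
  have Ir: "x = r (bl n X x j)" if "x \<in> I" for x
  proof -
    obtain a where a: "a \<in> F" "x = r (bl n X a j)" using \<open>x \<in> I\<close> by (auto simp: I_def)
    then have "bl n X x j = bl n X a j" using r[of a] F(1) by auto
    then show ?thesis using a by simp
  qed
  have disj: "bl n X x j \<inter> bl n X y j = {}" if "x \<in> I" "y \<in> I" "x \<noteq> y" for x y
  proof (rule ccontr)
    assume "bl n X x j \<inter> bl n X y j \<noteq> {}"
    then obtain z where "z \<in> bl n X x j" "z \<in> bl n X y j" by blast
    then have "bl n X x j = bl n X y j" using bl_eq_mem by metis
    then show False using Ir that by metis
  qed
  have "\<phi> y = (\<Sum>x\<in>I. \<phi> x * ind n X x j y)" for y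
  proof (cases "y \<in> ?K")
    case True
    then obtain x where x: "x \<in> F" "near n j (y - x)" using F(3) by blast
    let ?z = "r (bl n X x j)"
    have zI: "?z \<in> I" using x by (simp add: I_def)
    have "y \<in> bl n X x j" using x True KX by (auto simp: mem_bl)
    then have yz: "y \<in> bl n X ?z j" using r x F(1) by blast
    have "(\<Sum>x\<in>I. \<phi> x * ind n X x j y) = (\<Sum>x\<in>{?z}. \<phi> x * ind n X x j y)"
    proof (rule sum.mono_neutral_right[OF I(1)])
      show "\<forall>i\<in>I - {?z}. \<phi> i * ind n X i j y = 0"
        using disj[OF _ zI] yz by (auto simp: ind_def)
    qed (use zI in simp)
    also have "\<dots> = \<phi> y" using yz c[OF yz] I(2) zI KX by (auto simp: ind_def)
    finally show ?thesis by simp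
  next
    case False
    have "ind n X x j y = 0" if "x \<in> I" for x
      using c[of y x] that I(2) KX False by (auto simp: ind_def)
    then show ?thesis using False by simp
  qed
  then have "\<phi> = (\<lambda>y. \<Sum>x\<in>I. \<phi> x * ind n X x j y)" by (rule ext)
  then show ?thesis using I disj by (intro exI[of _ I] conjI) auto
qed

text \<open>Reduces a property stable under linear combinations to indicators of balls, where Q lets
  each application decide which balls are small enough.\<close>

lemma tf_induct:
  assumes X: "X \<subseteq> Kn n" and \<phi>: "\<phi> \<in> test_functions X"
    and Q: "\<And>x. x \<in> X \<Longrightarrow> \<exists>j. Q x j"
      "\<And>x j y j'. Q x j \<Longrightarrow> y \<in> bl n X x j \<Longrightarrow> j \<le> j' \<Longrightarrow> Q y j'"
      "\<And>x j. Q x j \<Longrightarrow> x \<in> X \<Longrightarrow> compact (bl n X x j)"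
    and P0: "P (\<lambda>_. 0)" and Pi: "\<And>x j. x \<in> X \<Longrightarrow> Q x j \<Longrightarrow> P (ind n X x j)"
    and Padd: "\<And>\<phi> \<phi>'. \<phi> \<in> test_functions X \<Longrightarrow> \<phi>' \<in> test_functions X \<Longrightarrow> P \<phi> \<Longrightarrow> P \<phi>' \<Longrightarrow> P (\<lambda>x. \<phi> x + \<phi>' x)"
    and Pscale: "\<And>c \<phi>. \<phi> \<in> test_functions X \<Longrightarrow> P \<phi> \<Longrightarrow> P (\<lambda>x. c * \<phi> x)"
  shows "P \<phi>"
proof -
  obtain j0 where j0: "\<And>x j. x \<in> X \<Longrightarrow> \<phi> x \<noteq> 0 \<Longrightarrow> j0 \<le> j \<Longrightarrow> Q x j"
    "\<And>x y j. y \<in> bl n X x j \<Longrightarrow> x \<in> X \<Longrightarrow> j0 \<le> j \<Longrightarrow> \<phi> y = \<phi> x"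
  proof -
    have "\<exists>j0. (\<forall>x\<in>X. \<forall>j\<ge>j0. \<phi> x \<noteq> 0 \<longrightarrow> Q x j) \<and> (\<forall>x\<in>X. \<forall>j\<ge>j0. \<forall>y\<in>bl n X x j. \<phi> y = \<phi> x)"
      by (rule tf_uniform[OF X \<phi>]) (fact Q)+
    then show ?thesis using that by blast
  qed
  obtain I where I: "finite I" "I \<subseteq> {x. \<phi> x \<noteq> 0}" "\<phi> = (\<lambda>y. \<Sum>x\<in>I. \<phi> x * ind n X x j0 y)"
  proof -
    have "\<exists>I. finite I \<and> I \<subseteq> {x. \<phi> x \<noteq> 0} \<and> \<phi> = (\<lambda>y. \<Sum>x\<in>I. \<phi> x * ind n X x j0 y) \<and>
        (\<forall>x\<in>I. \<forall>y\<in>I. x \<noteq> y \<longrightarrow> bl n X x j0 \<inter> bl n X y j0 = {})"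
      by (rule tf_decomp[OF X \<phi>]) (rule j0(2), assumption+, simp)
    then show ?thesis using that by (elim exE conjE)
  qed
  have Qx: "Q x j0" "x \<in> X" if "x \<in> I" for x using j0(1)[of x j0] that I(2) tfD(4)[OF \<phi>] by auto
  have "P (\<lambda>y. \<Sum>x\<in>I. c x * ind n X x j0 y)" for c
    using I(1) Qx
  proof (induct I rule: finite_induct)
    case (insert x I)
    have 1: "ind n X x j0 \<in> test_functions X" using insert Q(3) ind_test[OF X] by blast
    have 2: "(\<lambda>y. \<Sum>x\<in>I. c x * ind n X x j0 y) \<in> test_functions X"
      using insert Q(3) by (intro tf_sum[OF X] ind_test[OF X]) blast
    have "P (\<lambda>y. c x * ind n X x j0 y + (\<Sum>x\<in>I. c x * ind n X x j0 y))"
      using insert by (intro Padd 2 tf_scale[OF X 1] Pscale[OF 1] Pi) blast+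
    then show ?case using insert by simp
  qed (simp add: P0)
  then show ?thesis by (subst I(3))
qed

text \<open>At points outside U local constancy comes from the compact support, whose complement is
  open.\<close>

lemma tf_extend:
  assumes "U \<subseteq> X" "X \<subseteq> Kn n" "openin (top_of_set X) U" "\<phi> \<in> test_functions U"
  shows "\<phi> \<in> test_functions X"
proof (rule tf_intro[OF assms(2)])
  let ?K = "{x. \<phi> x \<noteq> 0}"
  have UK: "U \<subseteq> Kn n" using assms by blast
  show "compact ?K" "?K \<subseteq> X" using tfD(3,4)[OF assms(4)] assms(1) by auto
  show "locally_constant_on X \<phi>" unfolding lc_iff[OF assms(2)]
  proof
    fix x assume x: "x \<in> X"
    show "\<exists>j. \<forall>y\<in>bl n X x j. \<phi> y = \<phi> x"
    proof (cases "x \<in> U")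
      case True
      obtain i where i: "bl n X x i \<subseteq> U" using assms(3) True openin_iff_near[OF assms(2)] by blast
      obtain j where j: "\<forall>y\<in>bl n U x j. \<phi> y = \<phi> x" using tfD(1)[OF assms(4)] True unfolding lc_iff[OF UK] by blast
      have "y \<in> bl n U x j" if "y \<in> bl n X x (max i j)" for y
      proof -
        have "y \<in> bl n X x i" using that near_mono[of n "max i j" "y - x" i] by (auto simp: mem_bl)
        then show ?thesis using i that near_mono[of n "max i j" "y - x" j] by (auto simp: mem_bl)
      qed
      then show ?thesis using j by blast
    next
      case False
      then have "x \<in> - ?K" using tfD(2)[OF assms(4)] by simp
      moreover have "open (- ?K)" using tfD(3)[OF assms(4)] by (simp add: compact_imp_closed open_Compl)
      ultimately obtain j where j: "\<And>y. y \<in> Kn n \<Longrightarrow> near n j (y - x) \<Longrightarrow> y \<in> - ?K"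
        using open_contains_near[of "- ?K" x n] x assms(2) by blast
      have "\<phi> y = 0" if "y \<in> bl n X x j" for y using j[of y] that assms(2) by (auto simp: mem_bl)
      then show ?thesis using \<open>x \<in> - ?K\<close> by (intro exI[of _ j]) simp
    qed
  qed
qed (use tfD(2)[OF assms(4)] assms(1) in auto)

lemma tf_restrict:
  assumes "U \<subseteq> X" "X \<subseteq> Kn n" "\<phi> \<in> test_functions X" "\<And>x. x \<notin> U \<Longrightarrow> \<phi> x = 0"
  shows "\<phi> \<in> test_functions U"
  using lc_mono[OF assms(1,2) tfD(1)[OF assms(3)]] tfD(3)[OF assms(3)] assms(4)
  by (simp add: test_functions_def)

lemma tf_transport:
  fixes X Y :: "'k::nonarch_local_field kvec set" and f g :: "'k kvec \<Rightarrow> 'k kvec"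
  assumes X: "X \<subseteq> Kn n" and Y: "Y \<subseteq> Kn m" and fX: "f ` X \<subseteq> Y" and gY: "g ` Y \<subseteq> X"
    and gf: "\<And>x. x \<in> X \<Longrightarrow> g (f x) = x"
    and f: "\<And>x i. x \<in> X \<Longrightarrow> \<exists>J. \<forall>y\<in>bl n X x J. near m i (f y - f x)"
    and g: "\<And>x i. x \<in> Y \<Longrightarrow> \<exists>J. \<forall>y\<in>bl m Y x J. near n i (g y - g x)"
    and \<phi>: "\<phi> \<in> test_functions Y"
  shows "(\<lambda>x. if x \<in> X then \<phi> (f x) else 0) \<in> test_functions X"
proof (rule tf_intro[OF X])
  let ?K = "{y. \<phi> y \<noteq> 0}"
  have KY: "?K \<subseteq> Y" using tfD(4)[OF \<phi>] .
  have "continuous_on Y g"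
  proof (rule continuous_on_near[OF Y, of g n])
    show "g ` Y \<subseteq> Kn n" using gY X by blast
  qed (rule g)
  then have "continuous_on ?K g" using KY continuous_on_subset by blast
  then show "compact (g ` ?K)" using tfD(3)[OF \<phi>] compact_continuous_image by blast
  show "g ` ?K \<subseteq> X" using KY gY by blast
  show "x \<in> g ` ?K" if "(if x \<in> X then \<phi> (f x) else 0) \<noteq> 0" for x
    using that gf[of x] by (auto simp: image_iff split: if_splits intro!: exI[of _ "f x"])
  have "locally_constant_on X (\<lambda>x. \<phi> (f x))" by (rule lc_compose[OF X Y fX tfD(1)[OF \<phi>] f])
  then show "locally_constant_on X (\<lambda>x. if x \<in> X then \<phi> (f x) else 0)"
    unfolding lc_iff[OF X] using bl_subset by (metis (no_types, lifting) subsetD)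
qed simp

section \<open>Transport of functions and distributions through strict charts\<close>

lemma C1_chartD:
  assumes "C1_chart n l X U W g" "submanifold n l X"
  shows "openin (top_of_set X) U" "openin (top_of_set (Kn l)) W" "bij_betw g U W" "U \<subseteq> X" "W \<subseteq> Kn l"
    "g ` U \<subseteq> W" "inv_into U g ` W \<subseteq> U" "\<And>x. x \<in> U \<Longrightarrow> inv_into U g (g x) = x"
    "\<And>w. w \<in> W \<Longrightarrow> g (inv_into U g w) = w"
    "\<And>x i. x \<in> U \<Longrightarrow> \<exists>J. \<forall>y\<in>bl n U x J. near l i (g y - g x)"
    "\<And>w i. w \<in> W \<Longrightarrow> \<exists>J. \<forall>y\<in>bl l W w J. near n i (inv_into U g y - inv_into U g w)"
proof -
  show U: "openin (top_of_set X) U" and W: "openin (top_of_set (Kn l)) W" and bij: "bij_betw g U W"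
    using assms(1) by (auto simp: C1_chart_def strict_C1_iso_def)
  show "U \<subseteq> X" "W \<subseteq> Kn l" using openin_imp_subset U W by blast+
  show "g ` U \<subseteq> W" "inv_into U g ` W \<subseteq> U"
    using bij_betw_imp_surj_on[OF bij] bij_betw_imp_surj_on[OF bij_betw_inv_into[OF bij]] by simp_all
  show "\<And>x. x \<in> U \<Longrightarrow> inv_into U g (g x) = x" using bij by (simp add: bij_betw_def)
  show "\<And>w. w \<in> W \<Longrightarrow> g (inv_into U g w) = w" using bij_betw_inv_into_right[OF bij] .
  have mor: "strict_C1_morphism n l U l l W g" "strict_C1_morphism l l W n l U (inv_into U g)"
    using assms(1) by (auto simp: C1_chart_def strict_C1_iso_def)
  show "\<exists>J. \<forall>y\<in>bl n U x J. near l i (g y - g x)" if "x \<in> U" for x i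
    using morphism_cont[OF mor(1) submanifold_open[OF assms(2) U] order_refl that] that by blast
  have ln: "l \<le> n" using assms(2) by (simp add: submanifold_def)
  show "\<exists>J. \<forall>y\<in>bl l W w J. near n i (inv_into U g y - inv_into U g w)" if "w \<in> W" for w i
    using morphism_cont[OF mor(2) submanifold_Kn_open[OF W] ln that] that by blast
qed

lemma chart_pull:
  assumes "C1_chart n l X U W g" "submanifold n l X" "\<phi> \<in> test_functions W"
  shows "(\<lambda>x. if x \<in> U then \<phi> (g x) else 0) \<in> test_functions U"
    "(\<lambda>x. if x \<in> U then \<phi> (g x) else 0) \<in> test_functions X"
proof -
  note c = C1_chartD[OF assms(1,2)]
  have XK: "X \<subseteq> Kn n" using assms(2) by (simp add: submanifold_def)
  show "(\<lambda>x. if x \<in> U then \<phi> (g x) else 0) \<in> test_functions U"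
    by (rule tf_transport[OF _ c(5,6,7,8,10,11) assms(3)]) (use XK c(4) in auto)
  then show "(\<lambda>x. if x \<in> U then \<phi> (g x) else 0) \<in> test_functions X"
    by (rule tf_extend[OF c(4) XK c(1)])
qed

lemma chart_push:
  assumes "C1_chart n l X U W g" "submanifold n l X" "\<phi> \<in> test_functions U"
  shows "(\<lambda>w. if w \<in> W then \<phi> (inv_into U g w) else 0) \<in> test_functions W"
proof -
  note c = C1_chartD[OF assms(1,2)]
  have XK: "U \<subseteq> Kn n" using assms(2) c(4) by (auto simp: submanifold_def)
  show ?thesis by (rule tf_transport[OF c(5) XK c(7,6,9,11,10) assms(3)])
qed

lemma distr_add: "u \<in> distributions X \<Longrightarrow> \<phi> \<in> test_functions X \<Longrightarrow> \<phi>' \<in> test_functions X \<Longrightarrow>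
    u (\<lambda>x. \<phi> x + \<phi>' x) = u \<phi> + u \<phi>'"
  by (simp add: distributions_def)

lemma distr_scale: "u \<in> distributions X \<Longrightarrow> \<phi> \<in> test_functions X \<Longrightarrow> u (\<lambda>x. c * \<phi> x) = c * u \<phi>"
  by (simp add: distributions_def)

lemma distr_0: "u \<in> distributions X \<Longrightarrow> X \<subseteq> Kn n \<Longrightarrow> u (\<lambda>_. 0) = 0"
  using distr_scale[of u X "\<lambda>_. 0" 0] tf_0[of X n] by simp

lemma distr_sum:
  assumes "u \<in> distributions X" "X \<subseteq> Kn n" "\<And>i. i \<in> I \<Longrightarrow> \<phi> i \<in> test_functions X"
  shows "u (\<lambda>x. \<Sum>i\<in>I. c i * \<phi> i x) = (\<Sum>i\<in>I. c i * u (\<phi> i))"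
  using assms(3)
proof (induct I rule: infinite_finite_induct)
  case (insert i I)
  then show ?case
    using distr_add[OF assms(1) tf_scale[OF assms(2)] tf_sum[OF assms(2)], of "\<phi> i" I \<phi> "c i" c]
      distr_scale[OF assms(1)] by simp
qed (simp_all add: distr_0[OF assms(1,2)])

lemma pushforward_distr:
  assumes "C1_chart n l X U W g" "submanifold n l X" "u \<in> distributions X"
  shows "pushforward U W g u \<in> distributions W"
proof -
  note c = C1_chartD[OF assms(1,2)]
  let ?T = "\<lambda>\<phi> x. if x \<in> U then \<phi> (g x) else (0::complex)"
  have a: "u (?T (\<lambda>x. \<phi> x + \<phi>' x)) = u (?T \<phi>) + u (?T \<phi>')"
    if "\<phi> \<in> test_functions W" "\<phi>' \<in> test_functions W" for \<phi> \<phi>'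
  proof -
    have eq: "?T (\<lambda>x. \<phi> x + \<phi>' x) = (\<lambda>x. ?T \<phi> x + ?T \<phi>' x)" by auto
    show ?thesis unfolding eq
      by (rule distr_add[OF assms(3) chart_pull(2)[OF assms(1,2) that(1)] chart_pull(2)[OF assms(1,2) that(2)]])
  qed
  have s: "u (?T (\<lambda>x. c * \<phi> x)) = c * u (?T \<phi>)" if "\<phi> \<in> test_functions W" for \<phi> c
  proof -
    have eq: "?T (\<lambda>x. c * \<phi> x) = (\<lambda>x. c * ?T \<phi> x)" by auto
    show ?thesis unfolding eq by (rule distr_scale[OF assms(3) chart_pull(2)[OF assms(1,2) that]])
  qed
  show ?thesis
    using a s tf_add[OF c(5)] tf_scale[OF c(5)] by (simp add: distributions_def pushforward_def)
qed

section \<open>Haar measure and the canonical measure\<close>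

definition cells :: "nat \<Rightarrow> 'k::nonarch_local_field kvec set \<Rightarrow> 'k kvec set \<Rightarrow> int \<Rightarrow> 'k kvec set set" where
  "cells n X C J = (\<lambda>y. bl n X y J) ` C"

text \<open>A cell of level J + 1 in a ball of level J is determined by its next digit: the residue
  class of (y - x) / \<open>upow J\<close> in each of the l coordinates.\<close>

lemma cells_split_Kn:
  fixes x :: "'k::nonarch_local_field kvec"
  assumes x: "x \<in> Kn l"
  shows "finite (cells l (Kn l) (bl l (Kn l) x J) (J + 1)) \<and>
    card (cells l (Kn l) (bl l (Kn l) x J) (J + 1)) = rq TYPE('k) ^ l"
proof -
  obtain T :: "'k set" where T: "finite T" "card T = rq TYPE('k)" "\<And>t. t \<in> T \<Longrightarrow> vge 0 t"
      "\<And>z. vge 0 z \<Longrightarrow> \<exists>!t. t \<in> T \<and> vge 1 (z - t)"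
    using residue_reps[where 'k='k] by blast
  define e where "e t = x + (\<lambda>i. if i < l then upow J * t i else 0)" for t
  let ?P = "PiE {..<l} (\<lambda>_. T)"
  define \<Phi> where "\<Phi> t = bl l (Kn l) (e t) (J + 1)" for t
  have eK: "e t \<in> Kn l" for t using x unfolding e_def by (intro Kn_add) (auto simp: Kn_def)
  have eb: "e t \<in> bl l (Kn l) x J" if "t \<in> ?P" for t
    using eK[of t] that T(3) by (auto simp: mem_bl e_def near_def vge_upow_mult PiE_iff)
  have "\<Phi> ` ?P = cells l (Kn l) (bl l (Kn l) x J) (J + 1)"
  proof (intro equalityI subsetI)
    fix C assume "C \<in> \<Phi> ` ?P"
    then show "C \<in> cells l (Kn l) (bl l (Kn l) x J) (J + 1)" using eb by (auto simp: \<Phi>_def cells_def)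
  next
    fix C assume "C \<in> cells l (Kn l) (bl l (Kn l) x J) (J + 1)"
    then obtain y where y: "y \<in> Kn l" "near l J (y - x)" "C = bl l (Kn l) y (J + 1)"
      by (auto simp: cells_def mem_bl)
    define z where "z i = inverse (upow J) * (y i - x i)" for i
    have yz: "y i - x i = upow J * z i" for i by (simp add: z_def)
    have z0: "vge 0 (z i)" if "i < l" for i
      using y(2) that vge_upow_mult[of J J "z i"] by (simp add: near_def flip: yz)
    define t where "t = (\<lambda>i\<in>{..<l}. THE t. t \<in> T \<and> vge 1 (z i - t))"
    have t: "t i \<in> T \<and> vge 1 (z i - t i)" if "i < l" for i
      using theI'[OF T(4)[OF z0[OF that]]] that by (simp add: t_def)
    have tP: "t \<in> ?P" using t by (auto simp: t_def PiE_iff extensional_def)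
    have "near l (J + 1) (y - e t)"
      unfolding near_def
    proof (intro allI impI)
      fix i assume i: "i < l"
      have "(y - e t) i = upow J * (z i - t i)" using i yz[of i] by (simp add: e_def algebra_simps)
      then show "vge (J + 1) ((y - e t) i)" using t[OF i] by (simp add: vge_upow_mult)
    qed
    then have "C = \<Phi> t" unfolding y(3) \<Phi>_def by (rule bl_eq)
    then show "C \<in> \<Phi> ` ?P" using tP by blast
  qed
  moreover have "inj_on \<Phi> ?P"
  proof (rule inj_onI)
    fix t t' assume tt: "t \<in> ?P" "t' \<in> ?P" "\<Phi> t = \<Phi> t'"
    then have "e t \<in> bl l (Kn l) (e t') (J + 1)" using bl_self[OF eK[of t], of l "J + 1"] by (simp add: \<Phi>_def)
    then have n: "near l (J + 1) (e t - e t')" by (simp add: mem_bl)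
    show "t = t'"
    proof (rule PiE_ext[OF tt(1,2)])
      fix i assume "i \<in> {..<l}"
      then have i: "i < l" by simp
      have "(e t - e t') i = upow J * (t i - t' i)" using i by (simp add: e_def algebra_simps)
      then have v: "vge 1 (t i - t' i)" using n i by (auto simp: near_def vge_upow_mult)
      have tT: "t i \<in> T" "t' i \<in> T" using tt i by (auto simp: PiE_iff)
      show "t i = t' i" using T(4)[OF T(3)[OF tT(1)]] tT v by (metis diff_self vge_0)
    qed
  qed
  moreover have "finite ?P" "card ?P = rq TYPE('k) ^ l" using T by (auto simp: card_PiE intro: finite_PiE)
  ultimately show ?thesis by (metis card_image finite_imageI)
qed

lemma card_cells_Kn:
  fixes x :: "'k::nonarch_local_field kvec"
  assumes x: "x \<in> Kn l"
  shows "finite (cells l (Kn l) (bl l (Kn l) x j) (j + int N)) \<and>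
    card (cells l (Kn l) (bl l (Kn l) x j) (j + int N)) = rq TYPE('k) ^ (l * N)"
proof (induct N)
  case 0
  have "cells l (Kn l) (bl l (Kn l) x j) j = {bl l (Kn l) x j}"
    using bl_self[OF x, of l j] bl_eq_mem unfolding cells_def by blast
  then show ?case by simp
next
  case (Suc N)
  let ?J = "j + int N" let ?b = "bl l (Kn l)"
  let ?A = "cells l (Kn l) (?b x j) ?J"
  have sub: "C \<subseteq> ?b x j" if "C \<in> ?A" for C
    using that bl_mono[of j ?J _ l "Kn l" x] by (auto simp: cells_def)
  have self: "cells l (Kn l) C (?J + 1) = cells l (Kn l) (?b y ?J) (?J + 1)" if "C = ?b y ?J" for C y using that by simp
  have U: "cells l (Kn l) (?b x j) (?J + 1) = (\<Union>C\<in>?A. cells l (Kn l) C (?J + 1))"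
  proof (intro equalityI subsetI)
    fix D assume "D \<in> cells l (Kn l) (?b x j) (?J + 1)"
    then obtain y where y: "y \<in> ?b x j" "D = ?b y (?J + 1)" by (auto simp: cells_def)
    then have "y \<in> ?b y ?J" by (simp add: mem_bl)
    then show "D \<in> (\<Union>C\<in>?A. cells l (Kn l) C (?J + 1))" using y by (auto simp: cells_def)
  next
    fix D assume "D \<in> (\<Union>C\<in>?A. cells l (Kn l) C (?J + 1))"
    then show "D \<in> cells l (Kn l) (?b x j) (?J + 1)" using sub by (fastforce simp: cells_def)
  qed
  have fc: "finite (cells l (Kn l) C (?J + 1)) \<and> card (cells l (Kn l) C (?J + 1)) = rq TYPE('k) ^ l"
    if CA: "C \<in> ?A" for C
  proof -
    obtain y where y: "y \<in> ?b x j" "C = ?b y ?J" using CA unfolding cells_def by blast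
    then show ?thesis using cells_split_Kn[of y l ?J] by (simp add: mem_bl)
  qed
  have disj: "cells l (Kn l) C (?J + 1) \<inter> cells l (Kn l) C' (?J + 1) = {}"
    if CC: "C \<in> ?A" "C' \<in> ?A" "C \<noteq> C'" for C C'
  proof (rule ccontr)
    assume "cells l (Kn l) C (?J + 1) \<inter> cells l (Kn l) C' (?J + 1) \<noteq> {}"
    then obtain y y' where y: "y \<in> C" "y' \<in> C'" "?b y (?J + 1) = ?b y' (?J + 1)" by (auto simp: cells_def)
    obtain a a' where a: "C = ?b a ?J" "C' = ?b a' ?J" using CC by (auto simp: cells_def)
    have "y \<in> ?b y' (?J + 1)" using y bl_self[of y "Kn l" l "?J + 1"] a bl_subset by blast
    then have "y \<in> ?b y' ?J" using near_mono[of l "?J + 1" "y - y'" ?J] by (simp add: mem_bl)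
    then have "?b y ?J = ?b y' ?J" by (rule bl_eq_mem)
    then show False using CC(3) a y(1,2) bl_eq_mem by metis
  qed
  have "card (cells l (Kn l) (?b x j) (?J + 1)) = (\<Sum>C\<in>?A. card (cells l (Kn l) C (?J + 1)))"
    unfolding U by (rule card_UN_disjoint) (use Suc fc disj in auto)
  also have "\<dots> = rq TYPE('k) ^ (l * N) * rq TYPE('k) ^ l" using Suc fc by simp
  also have "\<dots> = rq TYPE('k) ^ (l * Suc N)" by (simp add: power_add)
  finally have "card (cells l (Kn l) (?b x j) (?J + 1)) = rq TYPE('k) ^ (l * Suc N)" .
  moreover have "finite (cells l (Kn l) (?b x j) (?J + 1))" unfolding U using Suc fc by auto
  moreover have "?J + 1 = j + int (Suc N)" by simp
  ultimately show ?case by metis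
qed

lemma card_cells_nice:
  fixes x :: "'k::nonarch_local_field kvec"
  assumes nice: "nice n l X s x j"
  shows "finite (cells n X (bl n X x j) (j + int N)) \<and>
    card (cells n X (bl n X x j) (j + int N)) = rq TYPE('k) ^ (l * N)"
proof -
  let ?p = "coord_proj l s" let ?J = "j + int N"
  let ?A = "cells n X (bl n X x j) ?J" let ?B = "cells l (Kn l) (bl l (Kn l) (?p x) j) ?J"
  have img: "?p ` bl n X y ?J = bl l (Kn l) (?p y) ?J" if "y \<in> bl n X x j" for y
    by (rule nice_img_sub[OF nice that]) simp
  have "(`) ?p ` ?A = (\<lambda>y. bl l (Kn l) (?p y) ?J) ` bl n X x j"
    unfolding cells_def image_image by (rule image_cong[OF refl img])
  also have "\<dots> = ?B" unfolding cells_def nice_img[OF nice, symmetric] by (simp add: image_image)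
  finally have eq: "(`) ?p ` ?A = ?B" .
  have "\<Union>?A \<subseteq> bl n X x j" using bl_mono[of j ?J _ n X x] by (auto simp: cells_def)
  then have inj: "inj_on ((`) ?p) ?A" by (intro inj_on_image inj_on_subset[OF nice_inj[OF nice]])
  have B: "finite ?B \<and> card ?B = rq TYPE('k) ^ (l * N)" by (rule card_cells_Kn[OF coord_proj_Kn])
  have "card ?B = card ?A" unfolding eq[symmetric] by (rule card_image[OF inj])
  moreover have "finite ?A" by (rule finite_imageD[OF _ inj]) (simp only: eq B)
  ultimately show ?thesis using B by simp
qed

text \<open>Every ball of X is the trace of a cell of some ball of \<open>Kn n\<close> around 0, and
  for each pair of levels there are finitely many cells.\<close>

lemma countable_balls:
  fixes X :: "'k::nonarch_local_field kvec set"
  assumes X: "X \<subseteq> Kn n"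
  shows "countable {bl n X x j | x j. x \<in> X}"
proof -
  let ?b = "bl n (Kn n :: 'k kvec set)"
  have "countable (cells n (Kn n) (?b 0 (- int N)) (- int N + int M))" for N M
    using card_cells_Kn[OF Kn_0] countable_finite by blast
  then have c: "countable (\<Union>N. \<Union>M. cells n (Kn n) (?b 0 (- int N)) (- int N + int M))" by blast
  have "{bl n X x j | x j. x \<in> X} \<subseteq> (\<lambda>C. X \<inter> C) ` (\<Union>N. \<Union>M. cells n (Kn n) (?b 0 (- int N)) (- int N + int M))"
  proof
    fix C assume "C \<in> {bl n X x j | x j. x \<in> X}"
    then obtain x j where x: "x \<in> X" "C = bl n X x j" by blast
    obtain i where i: "near n i x" using near_ex by blast
    let ?N = "nat (- i) + nat (- j)" let ?M = "nat (j + int ?N)"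
    have "near n (- int ?N) x" using i by (rule near_mono) auto
    then have "x \<in> ?b 0 (- int ?N)" using x X by (auto simp: mem_bl)
    moreover have "- int ?N + int ?M = j" by auto
    ultimately have "?b x j \<in> cells n (Kn n) (?b 0 (- int ?N)) (- int ?N + int ?M)" by (auto simp: cells_def)
    moreover have "C = X \<inter> ?b x j" using x X by (auto simp: mem_bl)
    ultimately show "C \<in> (\<lambda>C. X \<inter> C) ` (\<Union>N. \<Union>M. cells n (Kn n) (?b 0 (- int N)) (- int N + int M))" by blast
  qed
  then show ?thesis by (rule countable_subset) (rule countable_image[OF c])
qed

text \<open>What a measure determined by cell counts needs: the admissible balls Q are compact, pass
  to smaller balls, and split into q^(l N) cells. It is instantiated with \<open>Kn l\<close>, with
  the isometric balls of a submanifold, and with those inside an open part of one.\<close>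

locale ball_base =
  fixes n l :: nat and X :: "'k::nonarch_local_field kvec set" and Q :: "'k kvec \<Rightarrow> int \<Rightarrow> bool"
  assumes XK: "X \<subseteq> Kn n"
    and Qex: "\<And>x. x \<in> X \<Longrightarrow> \<exists>j. Q x j"
    and Qsub: "\<And>x j y j'. Q x j \<Longrightarrow> y \<in> bl n X x j \<Longrightarrow> j \<le> j' \<Longrightarrow> Q y j'"
    and Qcompact: "\<And>x j. x \<in> X \<Longrightarrow> Q x j \<Longrightarrow> compact (bl n X x j)"
    and Qcard: "\<And>x j N. x \<in> X \<Longrightarrow> Q x j \<Longrightarrow> finite (cells n X (bl n X x j) (j + int N)) \<and>
      card (cells n X (bl n X x j) (j + int N)) = rq TYPE('k) ^ (l * N)"
begin

definition MM :: "'k kvec set set" where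
  "MM = insert {} {bl n X x j | x j. x \<in> X \<and> Q x j}"

lemma MM_ball: "x \<in> X \<Longrightarrow> Q x j \<Longrightarrow> bl n X x j \<in> MM"
  by (auto simp: MM_def)

lemma MM_E:
  assumes "C \<in> MM" "C \<noteq> {}"
  obtains x j where "x \<in> X" "Q x j" "C = bl n X x j"
  using assms by (auto simp: MM_def)

lemma MM_sub: "C \<in> MM \<Longrightarrow> C \<subseteq> X"
  by (auto simp: MM_def mem_bl)

lemma countable_MM: "countable MM"
proof -
  have "{bl n X x j | x j. x \<in> X \<and> Q x j} \<subseteq> {bl n X x j | x j. x \<in> X}" by blast
  then have "countable {bl n X x j | x j. x \<in> X \<and> Q x j}" using countable_balls[OF XK] countable_subset by blast
  then show ?thesis by (simp add: MM_def)
qed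

lemma MM_nested: "C \<in> MM \<Longrightarrow> D \<in> MM \<Longrightarrow> C \<inter> D = {} \<or> C \<subseteq> D \<or> D \<subseteq> C"
proof -
  assume CD: "C \<in> MM" "D \<in> MM"
  show ?thesis
  proof (cases "C = {} \<or> D = {}")
    case False
    obtain x j where C: "C = bl n X x j" using MM_E[OF CD(1)] False by metis
    obtain y i where D: "D = bl n X y i" using MM_E[OF CD(2)] False by metis
    have "i \<le> j \<or> j \<le> i" by linarith
    then show ?thesis using bl_disjoint[of j i n X x y] bl_disjoint[of i j n X y x] unfolding C D by blast
  qed auto
qed

lemma MM_Int: "C \<in> MM \<Longrightarrow> D \<in> MM \<Longrightarrow> C \<inter> D \<in> MM"
  using MM_nested[of C D] MM_def by (auto simp: Int_absorb1 Int_absorb2)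

lemma MM_semiring: "semiring_of_sets X MM"
proof
  show "MM \<subseteq> Pow X" using MM_sub by blast
  show "{} \<in> MM" by (simp add: MM_def)
  show "\<And>a b. a \<in> MM \<Longrightarrow> b \<in> MM \<Longrightarrow> a \<inter> b \<in> MM" by (rule MM_Int)
  fix a b assume ab: "a \<in> MM" "b \<in> MM"
  show "\<exists>C\<subseteq>MM. finite C \<and> disjoint C \<and> a - b = \<Union>C"
  proof (cases "a \<inter> b = {} \<or> a \<subseteq> b")
    case True
    then show ?thesis
    proof
      assume "a \<inter> b = {}"
      then show ?thesis using ab by (intro exI[of _ "{a}"]) (auto simp: disjoint_def)
    next
      assume "a \<subseteq> b"
      then show ?thesis by (intro exI[of _ "{}"]) (auto simp: disjoint_def)
    qed
  next
    case False
    then have ne: "a \<noteq> {}" "b \<noteq> {}" by auto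
    obtain x j where x: "x \<in> X" "Q x j" "a = bl n X x j" using MM_E[OF ab(1) ne(1)] by metis
    obtain y i where y: "y \<in> X" "Q y i" "b = bl n X y i" using MM_E[OF ab(2) ne(2)] by metis
    have ji: "j \<le> i" using bl_disjoint[of i j n X y x] False x y by force
    \<comment> \<open>The larger ball is cut into cells of the level of the smaller one. Then b is
      one of the cells, and the others form the difference.\<close>
    let ?A = "cells n X a i"
    have "finite (cells n X a (j + int (nat (i - j))))" using Qcard[OF x(1,2)] x(3) by blast
    then have fin: "finite ?A" using ji by simp
    have sub: "?A \<subseteq> MM"
      using Qsub[OF x(2) _ ji] x(3) by (auto simp: cells_def mem_bl intro!: MM_ball)
    have sa: "C \<subseteq> a" if "C \<in> ?A" for C using that bl_mono[OF ji, of _ n X x] x(3) by (auto simp: cells_def)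
    have disj: "C \<inter> D = {}" if CD: "C \<in> ?A" "D \<in> insert b ?A" "C \<noteq> D" for C D
    proof (rule ccontr)
      assume "C \<inter> D \<noteq> {}"
      then obtain z where z: "z \<in> C" "z \<in> D" by blast
      obtain c where "C = bl n X c i" using CD by (auto simp: cells_def)
      moreover obtain d where "D = bl n X d i" using CD y by (auto simp: cells_def)
      ultimately show False using CD(3) z bl_eq_mem by metis
    qed
    have "a - b = \<Union>(?A - {b})"
    proof (intro equalityI subsetI)
      fix z assume z: "z \<in> a - b"
      then have "z \<in> bl n X z i" using x(3) by (simp add: mem_bl)
      then show "z \<in> \<Union>(?A - {b})" using z by (auto simp: cells_def)
    next
      fix z assume "z \<in> \<Union>(?A - {b})"
      then show "z \<in> a - b" using disj sa by blast
    qed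
    moreover have "disjoint (?A - {b})" using disj unfolding disjoint_def by blast
    ultimately show ?thesis using fin sub by (intro exI[of _ "?A - {b}"]) auto
  qed
qed

text \<open>Countability of the family of balls makes every relatively open set a countable union of
  them.\<close>

lemma sigma_MM: "sigma_sets X MM = sets (restrict_space borel X)"
proof (intro equalityI subsetI)
  fix A assume "A \<in> sigma_sets X MM"
  moreover have "MM \<subseteq> sets (restrict_space borel X)"
  proof
    fix C assume "C \<in> MM"
    have "C = X \<inter> C" using MM_sub[OF \<open>C \<in> MM\<close>] by blast
    have "\<exists>T. open T \<and> C = X \<inter> T"
    proof (cases "C = {}")
      case False
      then obtain x j where "C = bl n X x j" using MM_E[OF \<open>C \<in> MM\<close>] by metis
      then show ?thesis using openin_bl[of X n x j] unfolding openin_open by auto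
    qed auto
    then obtain T where "open T" "C = X \<inter> T" by blast
    then show "C \<in> sets (restrict_space borel X)"
      unfolding sets_restrict_space by (intro image_eqI[of _ _ T]) simp_all
  qed
  moreover have "space (restrict_space borel X) = X" by (simp add: space_restrict_space)
  ultimately show "A \<in> sets (restrict_space borel X)"
    using sets.sigma_sets_subset[of MM "restrict_space borel X"] by auto
next
  fix A assume "A \<in> sets (restrict_space borel X)"
  then obtain B where B: "B \<in> sets borel" "A = X \<inter> B" by (auto simp: sets_restrict_space)
  have "B \<in> sigma_sets UNIV {S. open S}" using B(1) by (simp add: sets_borel)
  then have "X \<inter> B \<in> sigma_sets X MM"
  proof induct
    case (Basic T)
    then have T: "open T" by simp
    have "X \<inter> T = \<Union>{C \<in> MM. C \<subseteq> T}"
    proof (intro equalityI subsetI)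
      fix x assume x: "x \<in> X \<inter> T"
      obtain j where j: "Q x j" using Qex x by blast
      obtain i where i: "\<And>y. y \<in> Kn n \<Longrightarrow> near n i (y - x) \<Longrightarrow> y \<in> T"
        using open_contains_near[OF T, of x n] x XK by blast
      have "Q x (max i j)" by (rule Qsub[OF j bl_self]) (use x in auto)
      then have "bl n X x (max i j) \<in> MM" using x MM_ball by blast
      moreover have "bl n X x (max i j) \<subseteq> T"
      proof
        fix y assume "y \<in> bl n X x (max i j)"
        then show "y \<in> T" using XK near_mono[of n "max i j" "y - x" i] by (intro i) (auto simp: mem_bl)
      qed
      ultimately show "x \<in> \<Union>{C \<in> MM. C \<subseteq> T}" using bl_self[of x X n "max i j"] x by blast
    qed (use MM_sub in blast)
    moreover have "countable {C \<in> MM. C \<subseteq> T}" using countable_MM by auto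
    ultimately show ?case by (auto intro!: sigma_sets_UNION)
  next
    case Empty
    then show ?case by (simp add: sigma_sets.Empty)
  next
    case (Compl a)
    have "X \<inter> (UNIV - a) = X - (X \<inter> a)" by blast
    then show ?case using Compl sigma_sets.Compl by metis
  next
    case (Union a)
    have "X \<inter> (\<Union>i. a i) = (\<Union>i. X \<inter> a i)" by blast
    then show ?case using Union sigma_sets.Union[of "\<lambda>i. X \<inter> a i"] by metis
  qed
  then show "A \<in> sigma_sets X MM" using B by simp
qed

lemma measure_unique:
  assumes s: "sets \<mu> = sets (restrict_space borel X)" "sets \<nu> = sets (restrict_space borel X)"
    and eq: "\<And>x j. x \<in> X \<Longrightarrow> Q x j \<Longrightarrow> emeasure \<mu> (bl n X x j) = emeasure \<nu> (bl n X x j)"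
    and fin: "\<And>x j. x \<in> X \<Longrightarrow> Q x j \<Longrightarrow> emeasure \<mu> (bl n X x j) \<noteq> \<infinity>"
  shows "\<mu> = \<nu>"
proof (rule measure_eqI_generator_eq_countable[where \<Omega> = X and E = MM and A = MM])
  show "Int_stable MM" unfolding Int_stable_def using MM_Int by blast
  show "MM \<subseteq> Pow X" using MM_sub by blast
  show "emeasure \<mu> C = emeasure \<nu> C" if "C \<in> MM" for C
    using that eq by (auto simp: MM_def)
  show "sets \<mu> = sigma_sets X MM" "sets \<nu> = sigma_sets X MM" using s sigma_MM by simp_all
  show "countable MM" by (rule countable_MM)
  show "emeasure \<mu> a \<noteq> \<infinity>" if "a \<in> MM" for a using that fin by (auto simp: MM_def)
  show "\<Union>MM = X"
  proof (intro equalityI subsetI)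
    fix x assume x: "x \<in> X"
    then obtain j where "Q x j" using Qex by blast
    then show "x \<in> \<Union>MM" using MM_ball x bl_self by blast
  qed (use MM_sub in blast)
qed simp

text \<open>The normalized number of cells, which is constant from the level of a ball on. Defining
  it through the set, and not through a centre and a radius, makes it well defined at once.\<close>

definition val :: "'k kvec set \<Rightarrow> real" where
  "val C = lim (\<lambda>J. real (card (cells n X C (int J))) * rqr TYPE('k) powi (- (int l * int J)))"

lemma val_eventually:
  assumes "x \<in> X" "Q x j" "j \<le> J"
  shows "finite (cells n X (bl n X x j) J)"
    "real (card (cells n X (bl n X x j) J)) * rqr TYPE('k) powi (- (int l * J)) = rqr TYPE('k) powi (- (int l * j))"
proof -
  obtain N where J: "J = j + int N" using assms(3) zle_iff_zadd by blast
  show "finite (cells n X (bl n X x j) J)" using Qcard[OF assms(1,2), of N] by (simp add: J)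
  have "real (card (cells n X (bl n X x j) J)) = rqr TYPE('k) ^ (l * N)"
    using Qcard[OF assms(1,2), of N] by (simp add: J)
  also have "\<dots> = rqr TYPE('k) powi (int (l * N))" by (simp only: power_int_of_nat)
  also have "int (l * N) = int l * (J - j)" by (simp add: J)
  finally show "real (card (cells n X (bl n X x j) J)) * rqr TYPE('k) powi (- (int l * J)) = rqr TYPE('k) powi (- (int l * j))"
    by (simp flip: power_int_add add: algebra_simps)
qed

lemma val_ball:
  assumes "x \<in> X" "Q x j"
  shows "val (bl n X x j) = rqr TYPE('k) powi (- (int l * j))"
  unfolding val_def
proof (rule limI, rule tendsto_eventually)
  show "\<forall>\<^sub>F J in sequentially. real (card (cells n X (bl n X x j) (int J))) * rqr TYPE('k) powi (- (int l * int J))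
      = rqr TYPE('k) powi (- (int l * j))"
    using eventually_ge_at_top[of "nat j"] by eventually_elim (use val_eventually[OF assms] in simp)
qed

lemma val_empty: "val {} = 0"
  unfolding val_def cells_def by (simp add: limI)

lemma val_MM:
  assumes "C \<in> MM"
  shows "\<exists>j0. \<forall>J\<ge>j0. finite (cells n X C J) \<and> val C = real (card (cells n X C J)) * rqr TYPE('k) powi (- (int l * J))
     \<and> (\<forall>D\<in>cells n X C J. D \<subseteq> C)"
proof (cases "C = {}")
  case True
  then show ?thesis by (simp add: val_empty cells_def)
next
  case False
  then obtain x j where x: "x \<in> X" "Q x j" "C = bl n X x j" using MM_E[OF assms] by metis
  have "D \<subseteq> C" if "j \<le> J" "D \<in> cells n X C J" for D J
    using that bl_mono[of j J _ n X x] x(3) by (auto simp: cells_def)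
  then show ?thesis using val_eventually[OF x(1,2)] val_ball[OF x(1,2)] x(3) by (intro exI[of _ j]) auto
qed

lemma val_nonneg: "C \<in> MM \<Longrightarrow> 0 \<le> val C"
  using val_MM[of C] by (metis order_refl of_nat_0_le_iff mult_nonneg_nonneg zero_le_power_int)

text \<open>At a level J beyond all thresholds the cells of each member lie inside it, so disjoint
  members have different cells and the counts add up.\<close>

lemma val_additive:
  assumes I: "finite I" and A: "\<And>i. i \<in> I \<Longrightarrow> A i \<in> MM" and d: "disjoint_family_on A I" and U: "(\<Union>i\<in>I. A i) \<in> MM"
  shows "val (\<Union>i\<in>I. A i) = (\<Sum>i\<in>I. val (A i))"
proof -
  let ?q = "rqr TYPE('k)"
  have "\<forall>i\<in>I. \<exists>j0. \<forall>J\<ge>j0. finite (cells n X (A i) J) \<and> val (A i) = real (card (cells n X (A i) J)) * ?q powi (- (int l * J))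
     \<and> (\<forall>D\<in>cells n X (A i) J. D \<subseteq> A i)" using val_MM A by blast
  then obtain j where j: "\<And>i J. i \<in> I \<Longrightarrow> j i \<le> J \<Longrightarrow> finite (cells n X (A i) J) \<and>
     val (A i) = real (card (cells n X (A i) J)) * ?q powi (- (int l * J)) \<and> (\<forall>D\<in>cells n X (A i) J. D \<subseteq> A i)"
    by metis
  obtain j0 where j0: "\<And>J. j0 \<le> J \<Longrightarrow> val (\<Union>i\<in>I. A i) = real (card (cells n X (\<Union>i\<in>I. A i) J)) * ?q powi (- (int l * J))"
    using val_MM[OF U] by metis
  define J where "J = Max (insert j0 (j ` I))"
  have J: "j0 \<le> J" "\<And>i. i \<in> I \<Longrightarrow> j i \<le> J" using I by (auto simp: J_def)
  have "cells n X (\<Union>i\<in>I. A i) J = (\<Union>i\<in>I. cells n X (A i) J)" by (auto simp: cells_def)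
  moreover have "card (\<Union>i\<in>I. cells n X (A i) J) = (\<Sum>i\<in>I. card (cells n X (A i) J))"
  proof (rule card_UN_disjoint[OF I])
    show "\<forall>i\<in>I. finite (cells n X (A i) J)" using j J by blast
    show "\<forall>i\<in>I. \<forall>k\<in>I. i \<noteq> k \<longrightarrow> cells n X (A i) J \<inter> cells n X (A k) J = {}"
    proof (intro ballI impI, rule ccontr)
      fix i k assume ik: "i \<in> I" "k \<in> I" "i \<noteq> k" "cells n X (A i) J \<inter> cells n X (A k) J \<noteq> {}"
      then obtain D where D: "D \<in> cells n X (A i) J" "D \<in> cells n X (A k) J" by blast
      then have "D \<subseteq> A i \<inter> A k" using j[OF ik(1) J(2)[OF ik(1)]] j[OF ik(2) J(2)[OF ik(2)]] by blast
      moreover have "A i \<inter> A k = {}" using d ik by (auto simp: disjoint_family_on_def)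
      moreover obtain y where "y \<in> A i" "D = bl n X y J" using D by (auto simp: cells_def)
      then have "y \<in> D" using MM_sub[OF A[OF ik(1)]] bl_self by blast
      ultimately show False by blast
    qed
  qed
  ultimately have "val (\<Union>i\<in>I. A i) = (\<Sum>i\<in>I. real (card (cells n X (A i) J)) * ?q powi (- (int l * J)))"
    using j0[OF J(1)] by (simp add: sum_distrib_right)
  also have "\<dots> = (\<Sum>i\<in>I. val (A i))"
    by (rule sum.cong[OF refl]) (metis j J(2))
  finally show ?thesis .
qed

text \<open>Caratheodory. Balls are compact and relatively open, so a ball that is a countable
  disjoint union of balls is already the union of finitely many of them; countable additivity is
  finite additivity.\<close>

theorem ball_measure_exists:
  "\<exists>\<mu>. sets \<mu> = sets (restrict_space borel X) \<and>
    (\<forall>x\<in>X. \<forall>j. Q x j \<longrightarrow> emeasure \<mu> (bl n X x j) = ennreal (rqr TYPE('k) powi (- (int l * j))))"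
proof -
  interpret semiring_of_sets X MM by (rule MM_semiring)
  have pos: "positive MM (\<lambda>C. ennreal (val C))" by (simp add: positive_def val_empty)
  have "countably_additive MM (\<lambda>C. ennreal (val C))"
  proof (rule countably_additiveI)
    fix A :: "nat \<Rightarrow> 'k kvec set"
    assume A: "range A \<subseteq> MM" "disjoint_family A" "(\<Union>i. A i) \<in> MM"
    let ?C = "\<Union>i. A i"
    have cC: "compact ?C"
    proof (cases "?C = {}")
      case False
      then obtain x j where "x \<in> X" "Q x j" "?C = bl n X x j" using MM_E[OF A(3)] by metis
      then show ?thesis using Qcompact by simp
    next
      case True then show ?thesis by (metis compact_empty)
    qed
    have "\<exists>T. open T \<and> A i = X \<inter> T" for i
    proof (cases "A i = {}")
      case False
      moreover have "A i \<in> MM" using A(1) by blast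
      ultimately obtain x j where "A i = bl n X x j" using MM_E by metis
      then show ?thesis using openin_bl[of X n x j] unfolding openin_open by auto
    qed auto
    then obtain T where T: "\<And>i. open (T i)" "\<And>i. A i = X \<inter> T i" by metis
    have cov: "?C \<subseteq> (\<Union>i\<in>UNIV. T i)" using T by blast
    obtain I where I: "I \<subseteq> UNIV" "finite I" "?C \<subseteq> (\<Union>i\<in>I. T i)"
      by (rule compactE_image[OF cC T(1) cov])
    have CX: "?C \<subseteq> X" using MM_sub[OF A(3)] .
    have UI: "?C = (\<Union>i\<in>I. A i)"
    proof (intro equalityI subsetI)
      fix z assume z: "z \<in> ?C"
      then obtain i where "i \<in> I" "z \<in> T i" using I(3) by blast
      moreover have "z \<in> X" using z CX by blast
      ultimately show "z \<in> (\<Union>i\<in>I. A i)" using T(2) by auto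
    qed blast
    have empty: "A i = {}" if "i \<notin> I" for i
    proof -
      have "A i \<inter> A k = {}" if "k \<in> I" for k
        using A(2) \<open>i \<notin> I\<close> \<open>k \<in> I\<close> unfolding disjoint_family_on_def by (metis UNIV_I)
      then show ?thesis using UI by blast
    qed
    have "(\<Sum>i. ennreal (val (A i))) = (\<Sum>i\<in>I. ennreal (val (A i)))"
      by (rule suminf_finite[OF I(2)]) (simp add: empty val_empty)
    also have "\<dots> = ennreal (\<Sum>i\<in>I. val (A i))"
      using A(1) val_nonneg by (intro sum_ennreal) blast
    also have "(\<Sum>i\<in>I. val (A i)) = val (\<Union>i\<in>I. A i)"
      using A UI by (intro val_additive[symmetric] I(2)) (auto simp: disjoint_family_on_def)
    finally show "(\<Sum>i. ennreal (val (A i))) = ennreal (val ?C)" using UI by simp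
  qed
  from caratheodory[OF pos this] obtain \<mu>' where \<mu>': "\<And>C. C \<in> MM \<Longrightarrow> \<mu>' C = ennreal (val C)"
      "measure_space X (sigma_sets X MM) \<mu>'" by blast
  define \<mu> where "\<mu> = measure_of X (sigma_sets X MM) \<mu>'"
  have sub: "sigma_sets X MM \<subseteq> Pow X" using sigma_sets_into_sp[of MM X] MM_sub by blast
  then have s: "sets \<mu> = sigma_sets X MM"
    using \<mu>'(2) by (simp add: \<mu>_def measure_space_def sigma_algebra.sigma_sets_eq)
  have "emeasure \<mu> C = \<mu>' C" if "C \<in> MM" for C
    unfolding \<mu>_def using \<mu>'(2) that by (intro emeasure_measure_of_sigma) (auto simp: measure_space_def intro: sigma_sets.Basic)
  then show ?thesis using s sigma_MM \<mu>'(1) MM_ball val_ball by (intro exI[of _ \<mu>]) auto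
qed

end

section \<open>Instances, Haar measure and canonical measure\<close>

lemma ball_base_nice:
  fixes X :: "'k::nonarch_local_field kvec set"
  assumes "submanifold n l X"
  shows "ball_base n l X (\<lambda>x j. \<exists>s. nice n l X s x j)"
proof
  show "X \<subseteq> Kn n" using assms by (simp add: submanifold_def)
  show "\<exists>j s. nice n l X s x j" if "x \<in> X" for x using nice_exists[OF assms that] by blast
  show "\<exists>s. nice n l X s y j'" if "\<exists>s. nice n l X s x j" "y \<in> bl n X x j" "j \<le> j'" for x j y j'
    using nice_sub that by blast
  show "compact (bl n X x j)" if "\<exists>s. nice n l X s x j" for x j using nice_compact that by blast
  show "finite (cells n X (bl n X x j) (j + int N)) \<and>
      card (cells n X (bl n X x j) (j + int N)) = rq TYPE('k) ^ (l * N)"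
    if "\<exists>s. nice n l X s x j" for x j N using card_cells_nice that by blast
qed

lemma ball_base_Kn: "ball_base l l (Kn l :: 'k::nonarch_local_field kvec set) (\<lambda>_ _. True)"
proof
  show "compact (bl l (Kn l) x j)" for x :: "'k kvec" and j by (rule compact_bl_Kn)
  show "finite (cells l (Kn l) (bl l (Kn l) x j) (j + int N)) \<and>
      card (cells l (Kn l) (bl l (Kn l) x j) (j + int N)) = rq TYPE('k) ^ (l * N)"
    if "x \<in> Kn l" for x :: "'k kvec" and j N using card_cells_Kn[OF that] .
qed auto

lemma bl_translate:
  assumes "a \<in> Kn l"
  shows "(\<lambda>x i. a i + x i) ` bl l (Kn l) x j = bl l (Kn l) (a + x) j"
proof -
  have e: "(\<lambda>x i. a i + x i) = (\<lambda>x. a + x)" by (auto simp: fun_eq_iff)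
  show ?thesis unfolding e
  proof (intro equalityI subsetI)
    fix y assume "y \<in> (+) a ` bl l (Kn l) x j"
    then show "y \<in> bl l (Kn l) (a + x) j" using assms by (auto simp: mem_bl intro!: Kn_add)
  next
    fix y assume y: "y \<in> bl l (Kn l) (a + x) j"
    then have "y - a \<in> bl l (Kn l) x j" using assms by (auto simp: mem_bl diff_diff_eq intro!: Kn_diff)
    then show "y \<in> (+) a ` bl l (Kn l) x j" by (auto intro!: image_eqI[of _ _ "y - a"])
  qed
qed

lemma measurable_restrict_near:
  fixes X Y :: "'k::nonarch_local_field kvec set"
  assumes "X \<subseteq> Kn n" "f ` X \<subseteq> Y" "Y \<subseteq> Kn m"
    and c: "\<And>a i. a \<in> X \<Longrightarrow> \<exists>J. \<forall>x\<in>bl n X a J. near m i (f x - f a)"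
  shows "f \<in> measurable (restrict_space borel X) (restrict_space borel (Y :: 'k::nonarch_local_field kvec set))"
proof (rule measurable_restrict_space2)
  show "f \<in> space (restrict_space borel X) \<rightarrow> Y" using assms(2) by (auto simp: space_restrict_space)
  show "f \<in> borel_measurable (restrict_space borel X)"
  proof (rule borel_measurable_continuous_on_restrict, rule continuous_on_near[OF assms(1), of f m])
    show "f ` X \<subseteq> Kn m" using assms(2,3) by blast
  qed (rule c)
qed

text \<open>Invariance follows from uniqueness: the translated measure agrees with the original one
  on balls, whose volume depends on the level alone.\<close>

lemma haar_measure_exists: "\<exists>\<mu> :: 'k::nonarch_local_field kvec measure. is_haar_measure l \<mu>"
proof -
  interpret ball_base l l "Kn l :: 'k kvec set" "\<lambda>_ _. True" by (rule ball_base_Kn)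
  let ?K = "Kn l :: 'k kvec set"
  obtain \<mu> where \<mu>: "sets \<mu> = sets (restrict_space borel ?K)"
    "\<And>x j. x \<in> ?K \<Longrightarrow> emeasure \<mu> (bl l ?K x j) = ennreal (rqr TYPE('k) powi (- (int l * j)))"
    using ball_measure_exists by blast
  have sp: "space \<mu> = ?K" using sets_eq_imp_space_eq[OF \<mu>(1)] by (simp add: space_restrict_space)
  have "emeasure \<mu> ((\<lambda>x i. a i + x i) ` B) = emeasure \<mu> B" if a: "a \<in> ?K" and B: "B \<in> sets \<mu>" for a B
  proof -
    have m: "(\<lambda>x. x - a) \<in> measurable \<mu> \<mu>"
    proof -
      have "(\<lambda>x. x - a) \<in> measurable (restrict_space borel ?K) (restrict_space borel ?K)"
      proof (rule measurable_restrict_near[OF order_refl _ order_refl])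
        show "\<exists>J. \<forall>y\<in>bl l ?K x J. near l i (y - a - (x - a))" for x i
          by (intro exI[of _ i]) (simp add: mem_bl)
      qed (use a Kn_diff in auto)
      then show ?thesis by (simp add: measurable_cong_sets[OF \<mu>(1) \<mu>(1)])
    qed
    have vim: "(\<lambda>x. x - a) -` C \<inter> ?K = (\<lambda>x i. a i + x i) ` C" if C: "C \<subseteq> ?K" for C
    proof (intro equalityI subsetI)
      fix x assume x: "x \<in> (\<lambda>x. x - a) -` C \<inter> ?K"
      have "x = (\<lambda>i. a i + (x - a) i)" by auto
      then show "x \<in> (\<lambda>x i. a i + x i) ` C" using x by blast
    next
      fix x assume "x \<in> (\<lambda>x i. a i + x i) ` C"
      then obtain y where y: "y \<in> C" "x = a + y" by (auto simp: plus_fun_def)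
      then show "x \<in> (\<lambda>x. x - a) -` C \<inter> ?K" using C a Kn_add[of a l y] by auto
    qed
    let ?\<nu> = "distr \<mu> \<mu> (\<lambda>x. x - a)"
    have e: "emeasure ?\<nu> C = emeasure \<mu> ((\<lambda>x i. a i + x i) ` C)" if "C \<in> sets \<mu>" for C
      using emeasure_distr[OF m that] vim[of C] sets.sets_into_space[OF that] by (simp add: sp)
    have "\<mu> = ?\<nu>"
    proof (rule measure_unique)
      fix x :: "'k kvec" and j assume x: "x \<in> ?K"
      have "bl l ?K x j \<in> sets \<mu>" using sigma_MM MM_ball[OF x, of j] \<mu>(1) by blast
      then show "emeasure \<mu> (bl l ?K x j) = emeasure ?\<nu> (bl l ?K x j)"
        using e \<mu>(2) x a Kn_add[OF a x] by (simp add: bl_translate[OF a])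
      show "emeasure \<mu> (bl l ?K x j) \<noteq> \<infinity>" using \<mu>(2)[OF x] by simp
    qed (use \<mu>(1) in simp_all)
    then show ?thesis using e[OF B] by metis
  qed
  moreover have "{x \<in> ?K. \<forall>i<l. x i \<in> valuation_ring} = bl l ?K 0 0"
    by (auto simp: mem_bl near_def valuation_ring_vge)
  ultimately have "is_haar_measure l \<mu>"
    unfolding is_haar_measure_def using \<mu> by simp
  then show ?thesis by blast
qed

lemma haar_measure: "is_haar_measure l (haar_measure l :: 'k::nonarch_local_field kvec measure)"
  unfolding haar_measure_def by (rule someI_ex[OF haar_measure_exists])

text \<open>Of the chosen measure only invariance and normalization are known. Both force the value:
  a ball is a disjoint union of q^(l N) translates of a ball N levels smaller, and the ball of level
  0 has measure 1.\<close>

lemma haar_ball: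
  fixes x :: "'k::nonarch_local_field kvec"
  assumes x: "x \<in> Kn l"
  shows "emeasure (haar_measure l) (bl l (Kn l) x j) = ennreal (rqr TYPE('k) powi (- (int l * j)))"
proof -
  let ?K = "Kn l :: 'k kvec set" let ?\<mu> = "haar_measure l :: 'k kvec measure" let ?q = "rqr TYPE('k)"
  interpret ball_base l l ?K "\<lambda>_ _. True" by (rule ball_base_Kn)
  have s: "sets ?\<mu> = sets (restrict_space borel ?K)"
    and tr: "\<And>a B. a \<in> ?K \<Longrightarrow> B \<in> sets ?\<mu> \<Longrightarrow> emeasure ?\<mu> ((\<lambda>x i. a i + x i) ` B) = emeasure ?\<mu> B"
    and one: "emeasure ?\<mu> {x \<in> ?K. \<forall>i<l. x i \<in> valuation_ring} = 1"
    using haar_measure[of l] unfolding is_haar_measure_def by blast+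
  have bs: "bl l ?K y i \<in> sets ?\<mu>" if "y \<in> ?K" for y i using sigma_MM MM_ball[OF that, of i] s by blast
  have t: "emeasure ?\<mu> (bl l ?K y i) = emeasure ?\<mu> (bl l ?K 0 i)" if "y \<in> ?K" for y i
    using tr[OF that bs[OF Kn_0, of i]] bl_translate[OF that, of 0 i] by simp
  have "{x \<in> ?K. \<forall>i<l. x i \<in> valuation_ring} = bl l ?K 0 0"
    by (auto simp: mem_bl near_def valuation_ring_vge)
  then have one': "emeasure ?\<mu> (bl l ?K 0 0) = 1" using one by simp
  have split: "emeasure ?\<mu> (bl l ?K 0 i) = ennreal (?q ^ (l * N)) * emeasure ?\<mu> (bl l ?K 0 (i + int N))" for i N
  proof -
    let ?A = "cells l ?K (bl l ?K 0 i) (i + int N)"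
    have A: "finite ?A" "card ?A = rq TYPE('k) ^ (l * N)" using card_cells_Kn[OF Kn_0] by blast+
    have U: "bl l ?K 0 i = \<Union>?A"
    proof (intro equalityI subsetI)
      fix y assume "y \<in> bl l ?K 0 i"
      then show "y \<in> \<Union>?A" using bl_self[of y ?K l "i + int N"] bl_subset by (fastforce simp: cells_def)
    next
      fix y assume "y \<in> \<Union>?A"
      then show "y \<in> bl l ?K 0 i" using bl_mono[of i "i + int N" _ l ?K 0] by (fastforce simp: cells_def)
    qed
    have cell: "\<exists>y\<in>?K. C = bl l ?K y (i + int N)" if "C \<in> ?A" for C
      using that bl_subset by (fastforce simp: cells_def)
    have disj: "disjoint_family_on (\<lambda>C. C) ?A"
      unfolding disjoint_family_on_def
    proof (intro ballI impI, rule ccontr)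
      fix C D assume CD: "C \<in> ?A" "D \<in> ?A" "C \<noteq> D" "C \<inter> D \<noteq> {}"
      then obtain z where "z \<in> C" "z \<in> D" by blast
      then show False using cell[OF CD(1)] cell[OF CD(2)] CD(3) bl_eq_mem by metis
    qed
    have sA: "(\<lambda>C. C) ` ?A \<subseteq> sets ?\<mu>" using cell bs by fastforce
    have "emeasure ?\<mu> (bl l ?K 0 i) = emeasure ?\<mu> (\<Union>C\<in>?A. C)"
      by (subst U) simp
    also have "\<dots> = (\<Sum>C\<in>?A. emeasure ?\<mu> C)"
      by (rule sum_emeasure[symmetric, OF sA disj A(1)])
    also have "\<dots> = (\<Sum>C\<in>?A. emeasure ?\<mu> (bl l ?K 0 (i + int N)))"
    proof (rule sum.cong[OF refl])
      fix C assume "C \<in> ?A"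
      then obtain y where "y \<in> ?K" "C = bl l ?K y (i + int N)" using cell by blast
      then show "emeasure ?\<mu> C = emeasure ?\<mu> (bl l ?K 0 (i + int N))" using t[of y "i + int N"] by simp
    qed
    also have "\<dots> = of_nat (card ?A) * emeasure ?\<mu> (bl l ?K 0 (i + int N))" by simp
    also have "of_nat (card ?A) = ennreal (?q ^ (l * N))" unfolding A(2) by (simp only: ennreal_of_nat_eq_real_of_nat of_nat_power)
    finally show ?thesis .
  qed
  have pw: "?q ^ (l * N) = ?q powi (int l * int N)" for N
    by (simp flip: power_int_of_nat)
  have "emeasure ?\<mu> (bl l ?K 0 j) = ennreal (?q powi (- (int l * j)))"
  proof (cases "j \<le> 0")
    case True
    then have "j = - int (nat (- j))" by simp
    then obtain N where N: "j = - int N" by blast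
    then show ?thesis using split[of j N] one' by (simp add: pw)
  next
    case False
    then obtain N where N: "j = int N" by (metis nonneg_int_cases linear)
    have 1: "1 = ennreal (?q ^ (l * N)) * emeasure ?\<mu> (bl l ?K 0 j)" using split[of 0 N] one' N by simp
    \<comment> \<open>Finiteness has to come before the division: a positive multiple of infinity is
      not 1.\<close>
    then have "emeasure ?\<mu> (bl l ?K 0 j) \<noteq> \<infinity>" by (auto simp: ennreal_mult_top split: if_splits)
    then obtain r where r: "emeasure ?\<mu> (bl l ?K 0 j) = ennreal r" "0 \<le> r"
      by (cases "emeasure ?\<mu> (bl l ?K 0 j)") auto
    have "ennreal 1 = ennreal (?q ^ (l * N) * r)" using 1 r by (simp add: ennreal_mult)
    then have "?q ^ (l * N) * r = 1" using r by (simp del: ennreal_1)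
    then have "r = inverse (?q ^ (l * N))" by (simp add: field_simps)
    then show ?thesis using r N by (simp add: power_int_minus pw)
  qed
  then show ?thesis using t[OF x] by simp
qed

text \<open>Surjectivity comes from counting the cells of both balls.\<close>

lemma isometry_image_ball:
  fixes X :: "'k::nonarch_local_field kvec set"
  assumes nice: "nice n l X s' y i" and s: "s ` {..<l} \<subseteq> {..<n}"
    and iso: "\<And>a b i'. a \<in> bl n X y i \<Longrightarrow> b \<in> bl n X y i \<Longrightarrow>
      near l i' (coord_proj l s a - coord_proj l s b) \<longleftrightarrow> near n i' (a - b)"
  shows "coord_proj l s ` bl n X y i = bl l (Kn l) (coord_proj l s y) i"
proof -
  let ?p = "coord_proj l s" let ?b = "bl n X y i" let ?B = "bl l (Kn l) (?p y) i"
  have y: "y \<in> ?b" by (rule bl_self[OF nice_x[OF nice]])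
  have sub: "?p ` ?b \<subseteq> ?B" using iso[OF _ y] by (auto simp: mem_bl coord_proj_Kn)
  have dense: "\<exists>a\<in>?b. near l (i + int N) (?p a - w)" if w: "w \<in> ?B" for w N
  proof -
    let ?J = "i + int N"
    \<comment> \<open>The centre picked by \<open>SOME\<close> does not matter, because the isometry
      sends all points of a cell into a single cell; it also keeps distinct cells apart.\<close>
    define h where "h C = bl l (Kn l) (?p (SOME a. a \<in> ?b \<and> C = bl n X a ?J)) ?J" for C
    have h: "h (bl n X a ?J) = bl l (Kn l) (?p a) ?J" if a: "a \<in> ?b" for a
    proof -
      let ?a = "SOME a'. a' \<in> ?b \<and> bl n X a ?J = bl n X a' ?J"
      have a': "?a \<in> ?b \<and> bl n X a ?J = bl n X ?a ?J" by (rule someI[of _ a]) (use a in simp)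
      then have "?a \<in> bl n X a ?J" using bl_self bl_subset by blast
      then have "near l ?J (?p ?a - ?p a)" using iso[of ?a a ?J] a a' by (simp add: mem_bl)
      then show ?thesis unfolding h_def by (rule bl_eq)
    qed
    let ?A = "cells n X ?b ?J" let ?C = "cells l (Kn l) ?B ?J"
    have hA: "h ` ?A \<subseteq> ?C" using h sub by (auto simp: cells_def)
    have "inj_on h ?A"
    proof (rule inj_onI)
      fix C D assume CD: "C \<in> ?A" "D \<in> ?A" "h C = h D"
      obtain a b where ab: "a \<in> ?b" "C = bl n X a ?J" "b \<in> ?b" "D = bl n X b ?J"
        using CD(1,2) unfolding cells_def by blast
      then have "?p a \<in> bl l (Kn l) (?p b) ?J" using CD(3) h bl_self[OF coord_proj_Kn, of l s a l ?J] by simp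
      then have "near n ?J (a - b)" using iso[OF ab(1,3)] by (simp add: mem_bl)
      then show "C = D" unfolding ab by (rule bl_eq)
    qed
    moreover have "finite ?C" "card ?A = card ?C"
      using card_cells_Kn[OF coord_proj_Kn, of l s y i N] card_cells_nice[OF nice, of N] by simp_all
    ultimately have "h ` ?A = ?C" using hA by (metis card_image card_subset_eq)
    then have "bl l (Kn l) w ?J \<in> h ` ?A" using w unfolding cells_def by blast
    then obtain a where a: "a \<in> ?b" "bl l (Kn l) w ?J = bl l (Kn l) (?p a) ?J" using h by (auto simp: cells_def)
    have "?p a \<in> bl l (Kn l) w ?J" unfolding a(2) by (rule bl_self[OF coord_proj_Kn])
    then show ?thesis using a(1) by (auto simp: mem_bl)
  qed
  have "?B \<subseteq> ?p ` ?b"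
  proof (rule ccontr)
    assume "\<not> ?thesis"
    then obtain w where w: "w \<in> ?B" "w \<notin> ?p ` ?b" by blast
    have bK: "?b \<subseteq> Kn n" using bl_subset nice_XK[OF nice] by blast
    have "continuous_on ?b ?p"
    proof (rule continuous_on_near[OF bK])
      show "?p ` ?b \<subseteq> Kn l" using coord_proj_Kn by blast
      fix a i' assume "a \<in> ?b"
      then show "\<exists>J. \<forall>x\<in>bl n ?b a J. near l i' (?p x - ?p a)"
        using iso by (intro exI[of _ i']) (simp add: mem_bl[of _ n ?b])
    qed
    then have "compact (?p ` ?b)" using nice_compact[OF nice] by (rule compact_continuous_image)
    then have "open (- (?p ` ?b))" by (simp add: compact_imp_closed open_Compl)
    moreover have "w \<in> - (?p ` ?b)" "w \<in> Kn l" using w by (auto simp: mem_bl)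
    ultimately obtain r where r: "\<And>v. v \<in> Kn l \<Longrightarrow> near l r (v - w) \<Longrightarrow> v \<in> - (?p ` ?b)"
      using open_contains_near by meson
    obtain a where a: "a \<in> ?b" "near l (i + int (nat (r - i))) (?p a - w)" using dense[OF w(1)] by blast
    have "near l r (?p a - w)" by (rule near_mono[OF a(2)]) linarith
    then show False using r[OF coord_proj_Kn] a(1) by blast
  qed
  then show ?thesis using sub by blast
qed

text \<open>The measure built on isometric balls must agree with Haar measure through every
  isometric projection of an open U, whatever coordinates were used for the balls. On U both sides
  are measures with the same values on small balls, since the image of such a ball is a ball by
  \<open>isometry_image_ball\<close>.\<close>

lemma canonical_measure_exists:
  fixes X :: "'k::nonarch_local_field kvec set"
  assumes sub: "submanifold n l X"
  shows "\<exists>\<mu>. is_canonical_measure n l X \<mu>"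
proof -
  let ?q = "rqr TYPE('k)" let ?H = "haar_measure l :: 'k kvec measure"
  interpret B: ball_base n l X "\<lambda>x j. \<exists>s. nice n l X s x j" by (rule ball_base_nice[OF sub])
  interpret K: ball_base l l "Kn l :: 'k kvec set" "\<lambda>_ _. True" by (rule ball_base_Kn)
  obtain \<mu> where \<mu>: "sets \<mu> = sets (restrict_space borel X)"
    "\<And>x j s. x \<in> X \<Longrightarrow> nice n l X s x j \<Longrightarrow> emeasure \<mu> (bl n X x j) = ennreal (?q powi (- (int l * j)))"
    using B.ball_measure_exists by blast
  have "is_haar_measure l ?H" by (rule haar_measure)
  then have Hs: "sets ?H = sets (restrict_space borel (Kn l))" unfolding is_haar_measure_def by blast
  have spX: "space \<mu> = X" using sets_eq_imp_space_eq[OF \<mu>(1)] by (simp add: space_restrict_space)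
  have spH: "space ?H = Kn l" using sets_eq_imp_space_eq[OF Hs] by (simp add: space_restrict_space)
  have "emeasure \<mu> A = emeasure ?H (coord_proj l s ` A)"
    if U: "openin (top_of_set X) U" and s: "s ` {..<l} \<subseteq> {..<n}"
      and iso: "\<forall>x\<in>U. \<forall>y\<in>U. vnorm l (coord_proj l s x - coord_proj l s y) = vnorm n (x - y)"
      and A: "A \<in> sets \<mu>" "A \<subseteq> U" for U s A
  proof -
    let ?p = "coord_proj l s"
    have UX: "U \<subseteq> X" using openin_imp_subset[OF U] .
    then have UK: "U \<subseteq> Kn n" using B.XK by blast
    have iso': "near l i (?p x - ?p y) \<longleftrightarrow> near n i (x - y)" if "x \<in> U" "y \<in> U" for x y i
      using iso that by (simp flip: vnorm_le_iff)
    have inj: "inj_on ?p U" by (rule inj_on_isometry[OF UK order_refl]) (use iso' in blast)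
    define V where "V = ?p ` U"
    have VK: "V \<subseteq> Kn l" using coord_proj_Kn by (auto simp: V_def)
    \<comment> \<open>Balls that are isometric for some projection and lie in U: the first part
      gives their volume, the second makes the given projection an isometry on them.\<close>
    define Q where "Q x j \<longleftrightarrow> (\<exists>s. nice n l X s x j) \<and> bl n X x j \<subseteq> U" for x j
    have blU: "bl n U x j = bl n X x j" if "Q x j" for x j using that UX by (auto simp: mem_bl Q_def)
    have img: "?p ` bl n X x j = bl l (Kn l) (?p x) j" if Qxj: "Q x j" for x j
    proof -
      obtain s' where s': "nice n l X s' x j" using Qxj unfolding Q_def by blast
      have sU: "bl n X x j \<subseteq> U" using Qxj unfolding Q_def by blast
      show ?thesis by (rule isometry_image_ball[OF s' s]) (use iso' sU in blast)
    qed
    have BU: "ball_base n l U Q"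
    proof
      show "U \<subseteq> Kn n" by (rule UK)
      show "\<exists>j. Q x j" if x: "x \<in> U" for x
      proof -
        obtain i where i: "bl n X x i \<subseteq> U" using U x openin_iff_near[OF B.XK] by blast
        obtain s' j where j: "nice n l X s' x j" using nice_exists[OF sub] x UX by blast
        have "nice n l X s' x (max i j)" by (rule nice_sub[OF j bl_self]) (use x UX in auto)
        moreover have "bl n X x (max i j) \<subseteq> U" using i bl_mono[of i "max i j" x n X x] bl_self[of x X n i] x UX by auto
        ultimately show ?thesis by (auto simp: Q_def)
      qed
      show "Q y j'" if "Q x j" "y \<in> bl n U x j" "j \<le> j'" for x j y j'
      proof -
        have y: "y \<in> bl n X x j" using that(2) blU[OF that(1)] by simp
        then have "bl n X y j' \<subseteq> bl n X x j" using bl_mono[OF that(3)] by blast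
        then show ?thesis using that(1) B.Qsub[OF _ y that(3)] by (auto simp: Q_def)
      qed
      show "compact (bl n U x j)" if "x \<in> U" "Q x j" for x j
        using B.Qcompact[of x j] that UX by (auto simp: blU[OF that(2)] Q_def)
      show "finite (cells n U (bl n U x j) (j + int N)) \<and>
          card (cells n U (bl n U x j) (j + int N)) = rq TYPE('k) ^ (l * N)" if "x \<in> U" "Q x j" for x j N
      proof -
        have "bl n U y (j + int N) = bl n X y (j + int N)" if "y \<in> bl n X x j" for y
          using bl_mono[of j "j + int N" y n X x] that \<open>Q x j\<close> UX by (auto simp: mem_bl Q_def)
        then have "cells n U (bl n U x j) (j + int N) = cells n X (bl n X x j) (j + int N)"
          unfolding cells_def blU[OF that(2)] by (intro image_cong) auto
        then show ?thesis using B.Qcard[of x j N] that UX by (auto simp: Q_def)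
      qed
    qed
    interpret U: ball_base n l U Q by (rule BU)
    have V: "openin (top_of_set (Kn l)) V"
      unfolding openin_iff_near[OF order_refl]
    proof (intro conjI ballI VK)
      fix w assume "w \<in> V"
      then obtain x where x: "x \<in> U" "w = ?p x" by (auto simp: V_def)
      obtain j where j: "Q x j" using U.Qex x by blast
      have "bl l (Kn l) w j \<subseteq> V" using img[OF j] j x by (auto simp: V_def Q_def)
      then show "\<exists>j. bl l (Kn l) w j \<subseteq> V" by blast
    qed
    let ?g = "inv_into U ?p"
    have gU: "?g w \<in> U" "?p (?g w) = w" if "w \<in> V" for w
      using that inv_into_into[of w ?p U] f_inv_into_f[of w ?p U] by (auto simp: V_def)
    have gm: "?g \<in> measurable (restrict_space borel V) (restrict_space borel U)"
    proof (rule measurable_restrict_near[OF VK _ UK])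
      show "?g ` V \<subseteq> U" using gU by blast
      fix w i assume w: "w \<in> V"
      have "near n i (?g v - ?g w)" if "v \<in> bl l V w i" for v
        using iso'[OF gU(1) gU(1), of v w i] gU(2) w that by (simp add: mem_bl)
      then show "\<exists>J. \<forall>v\<in>bl l V w J. near n i (?g v - ?g w)" by blast
    qed
    have Vs: "V \<in> sets ?H"
    proof -
      obtain T where "open T" "V = Kn l \<inter> T" using V by (auto simp: openin_open)
      then show ?thesis unfolding Hs sets_restrict_space by (intro image_eqI[of _ _ T]) simp_all
    qed
    have Us: "U \<in> sets \<mu>"
    proof -
      obtain T where "open T" "U = X \<inter> T" using U by (auto simp: openin_open)
      then show ?thesis unfolding \<mu>(1) sets_restrict_space by (intro image_eqI[of _ _ T]) simp_all
    qed
    let ?\<nu>1 = "restrict_space \<mu> U"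
    let ?HV = "restrict_space ?H V"
    let ?\<nu>2 = "distr ?HV (restrict_space borel U) ?g"
    have rr: "sets (restrict_space M D) = sets (restrict_space borel D)"
      if "sets M = sets (restrict_space borel E)" "D \<subseteq> E" for M :: "'k kvec measure" and D E
    proof -
      have "(\<inter>) D ` (\<inter>) E ` sets borel = (\<inter>) D ` sets borel"
        using that(2) by (simp add: image_image Int_assoc[symmetric] inf.absorb1)
      then show ?thesis by (simp add: sets_restrict_space that(1))
    qed
    have s1: "sets ?\<nu>1 = sets (restrict_space borel U)" by (rule rr[OF \<mu>(1) UX])
    have sHV: "sets ?HV = sets (restrict_space borel V)" by (rule rr[OF Hs VK])
    have gm': "?g \<in> measurable ?HV (restrict_space borel U)"
      using gm by (simp add: measurable_cong_sets[OF sHV refl])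
    have spHV: "space ?HV = V" using sets_eq_imp_space_eq[OF sHV] by (simp add: space_restrict_space)
    have e2: "emeasure ?\<nu>2 C = emeasure ?H (?p ` C)" if C: "C \<in> sets (restrict_space borel U)" for C
    proof -
      have CU: "C \<subseteq> U" using C by (auto simp: sets_restrict_space)
      have "?g -` C \<inter> V = ?p ` C"
      proof (intro equalityI subsetI)
        fix w assume "w \<in> ?g -` C \<inter> V"
        then show "w \<in> ?p ` C" using gU(2)[of w] by (metis Int_iff image_eqI vimage_eq)
      next
        fix w assume "w \<in> ?p ` C"
        then show "w \<in> ?g -` C \<inter> V" using CU inj by (auto simp: V_def inv_into_f_f subset_iff)
      qed
      moreover have "emeasure ?HV (?p ` C) = emeasure ?H (?p ` C)"
        using CU Vs spH VK by (intro emeasure_restrict_space) (auto simp: V_def Int_absorb2)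
      ultimately show ?thesis using emeasure_distr[OF gm' C] spHV by simp
    qed
    have e1: "emeasure ?\<nu>1 C = emeasure \<mu> C" if "C \<subseteq> U" for C
      using Us spX UX that by (intro emeasure_restrict_space) (auto simp: Int_absorb2)
    have eq: "?\<nu>1 = ?\<nu>2"
    proof (rule U.measure_unique[OF s1])
      fix x j assume x: "x \<in> U" "Q x j"
      obtain s' where s': "nice n l X s' x j" using x by (auto simp: Q_def)
      have m: "emeasure ?\<nu>1 (bl n U x j) = ennreal (?q powi (- (int l * j)))"
        using e1[OF bl_subset] \<mu>(2)[OF _ s'] x UX by (auto simp: blU[OF x(2)] Q_def e1)
      have "bl n U x j \<in> sets (restrict_space borel U)" using U.sigma_MM U.MM_ball[OF x] by blast
      then show "emeasure ?\<nu>1 (bl n U x j) = emeasure ?\<nu>2 (bl n U x j)"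
        using e2 img[OF x(2)] by (simp add: m[unfolded blU[OF x(2)]] blU[OF x(2)] haar_ball[OF coord_proj_Kn])
      show "emeasure ?\<nu>1 (bl n U x j) \<noteq> \<infinity>" by (simp add: m)
    qed simp
    have "A = U \<inter> A" using A by blast
    then have "A \<in> sets (restrict_space borel U)"
      using A(1) s1 by (metis image_eqI sets_restrict_space)
    then show ?thesis using e1[OF A(2)] e2 eq by simp
  qed
  then have "is_canonical_measure n l X \<mu>" unfolding is_canonical_measure_def using \<mu>(1) by blast
  then show ?thesis by blast
qed

lemma canonical_measure:
  assumes "submanifold n l X"
  shows "is_canonical_measure n l X (canonical_measure n l X)"
  unfolding canonical_measure_def by (rule someI_ex[OF canonical_measure_exists[OF assms]])

lemma canonical_ball:
  fixes X :: "'k::nonarch_local_field kvec set"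
  assumes sub: "submanifold n l X" and nice: "nice n l X s x j"
  shows "bl n X x j \<in> sets (canonical_measure n l X)"
    "emeasure (canonical_measure n l X) (bl n X x j) = ennreal (rqr TYPE('k) powi (- (int l * j)))"
proof -
  let ?\<mu> = "canonical_measure n l X" let ?b = "bl n X x j"
  interpret B: ball_base n l X "\<lambda>x j. \<exists>s. nice n l X s x j" by (rule ball_base_nice[OF sub])
  note c = canonical_measure[OF sub, unfolded is_canonical_measure_def]
  have "?b \<in> sets (restrict_space borel X)" using B.sigma_MM B.MM_ball[OF nice_x[OF nice], of j] nice by blast
  then show s: "?b \<in> sets ?\<mu>" using c by blast
  have "vnorm l (coord_proj l s y - coord_proj l s z) = vnorm n (y - z)" if "y \<in> ?b" "z \<in> ?b" for y z
  proof (cases "y = z")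
    case False
    have yz: "y - z \<in> Kn n" using that nice_XK[OF nice] bl_subset by (blast intro: Kn_diff)
    have pyz: "coord_proj l s y - coord_proj l s z \<in> Kn l" by (intro Kn_diff coord_proj_Kn)
    have "coord_proj l s y \<noteq> coord_proj l s z" using False inj_onD[OF nice_inj[OF nice]] that by blast
    then obtain a where a: "vnorm l (coord_proj l s y - coord_proj l s z) = rqr TYPE('k) powi (- a)"
      using vnorm_cases[OF pyz] by auto
    obtain b where b: "vnorm n (y - z) = rqr TYPE('k) powi (- b)" using False vnorm_cases[OF yz] by auto
    \<comment> \<open>Both norms are powers of q; testing the equivalence of levels at each of the
      two exponents gives the two inequalities.\<close>
    show ?thesis
      using nice_iso[OF nice that, of a] nice_iso[OF nice that, of b]
        vnorm_le_iff[of l "coord_proj l s y - coord_proj l s z" a]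
        vnorm_le_iff[of l "coord_proj l s y - coord_proj l s z" b]
        vnorm_le_iff[of n "y - z" a] vnorm_le_iff[of n "y - z" b] a b by auto
  qed (simp add: vnorm_def knorm_def image_constant_conv)
  then have "emeasure ?\<mu> ?b = emeasure (haar_measure l) (coord_proj l s ` ?b)"
    using c[THEN conjunct2, THEN spec[of _ ?b], THEN spec[of _ s]]
      nice_mono_s[OF nice] nice_s[OF nice] s openin_bl[of X n x j] by simp
  then show "emeasure ?\<mu> ?b = ennreal (rqr TYPE('k) powi (- (int l * j)))"
    by (simp add: nice_img[OF nice] haar_ball[OF coord_proj_Kn])
qed

section \<open>Integration of test functions\<close>

definition cint :: "nat \<Rightarrow> nat \<Rightarrow> 'k::nonarch_local_field kvec set \<Rightarrow> ('k kvec \<Rightarrow> complex) \<Rightarrow> complex" where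
  "cint n l X \<phi> = (\<integral>x. \<phi> x \<partial>canonical_measure n l X)"

definition qpow :: "'k::nonarch_local_field itself \<Rightarrow> int \<Rightarrow> complex" where
  "qpow k i = complex_of_real (rqr k powi i)"

lemma qpow_add: "qpow TYPE('k::nonarch_local_field) (i + j) = qpow TYPE('k) i * qpow TYPE('k) j"
  by (simp add: qpow_def power_int_add)

lemma qpow_0 [simp]: "qpow TYPE('k::nonarch_local_field) 0 = 1"
  by (simp add: qpow_def)

lemma qpow_nat: "of_nat (rq TYPE('k::nonarch_local_field) ^ N) = qpow TYPE('k) (int N)"
  by (simp add: qpow_def)

lemma submanifold_sub_Kn: "submanifold n l X \<Longrightarrow> X \<subseteq> Kn n"
  by (simp add: submanifold_def)

lemma integral_ind:
  fixes X :: "'k::nonarch_local_field kvec set"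
  assumes sub: "submanifold n l X" and nice: "nice n l X s x j"
  shows "integrable (canonical_measure n l X) (ind n X x j)"
    "cint n l X (ind n X x j) = qpow TYPE('k) (- (int l * j))"
proof -
  let ?\<mu> = "canonical_measure n l X" let ?b = "bl n X x j"
  note c = canonical_ball[OF sub nice]
  have e: "ind n X x j = (\<lambda>y. complex_of_real (indicator ?b y))"
    by (auto simp: ind_def indicator_def)
  have "integrable ?\<mu> (indicator ?b :: _ \<Rightarrow> real)"
    using c by (intro integrable_real_indicator) auto
  then show "integrable ?\<mu> (ind n X x j)" unfolding e by (rule integrable_of_real)
  have "(\<integral>y. indicator ?b y \<partial>?\<mu>) = measure ?\<mu> ?b"
    using c(1) by (simp add: sets.Int_space_eq2)
  also have "\<dots> = rqr TYPE('k) powi (- (int l * j))"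
    using c(2) by (simp add: measure_def)
  finally show "cint n l X (ind n X x j) = qpow TYPE('k) (- (int l * j))"
    unfolding cint_def e qpow_def by (subst integral_complex_of_real) simp
qed

lemma nice_induct:
  assumes sub: "submanifold n l X" and \<phi>: "\<phi> \<in> test_functions X"
    and "P (\<lambda>_. 0)" and "\<And>s x j. nice n l X s x j \<Longrightarrow> P (ind n X x j)"
    and "\<And>\<phi> \<phi>'. \<phi> \<in> test_functions X \<Longrightarrow> \<phi>' \<in> test_functions X \<Longrightarrow> P \<phi> \<Longrightarrow> P \<phi>' \<Longrightarrow> P (\<lambda>x. \<phi> x + \<phi>' x)"
    and "\<And>c \<phi>. \<phi> \<in> test_functions X \<Longrightarrow> P \<phi> \<Longrightarrow> P (\<lambda>x. c * \<phi> x)"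
  shows "P \<phi>"
proof -
  interpret B: ball_base n l X "\<lambda>x j. \<exists>s. nice n l X s x j" by (rule ball_base_nice[OF sub])
  show ?thesis
  proof (rule tf_induct[OF B.XK \<phi>, of "\<lambda>x j. \<exists>s. nice n l X s x j"])
    show "P (ind n X x j)" if "\<exists>s. nice n l X s x j" for x j using assms(4) that by blast
    show "compact (bl n X x j)" if "x \<in> X" "\<exists>s. nice n l X s x j" for x j using B.Qcompact that by blast
    show "P (\<lambda>_. 0)" by (rule assms(3))
    show "P (\<lambda>x. f x + g x)" if "f \<in> test_functions X" "g \<in> test_functions X" "P f" "P g" for f g
      by (rule assms(5)[OF that])
    show "P (\<lambda>x. c * f x)" if "f \<in> test_functions X" "P f" for c f by (rule assms(6)[OF that])
  qed (fact B.Qex B.Qsub)+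
qed

lemma tf_integrable:
  assumes sub: "submanifold n l X" and \<phi>: "\<phi> \<in> test_functions X"
  shows "integrable (canonical_measure n l X) \<phi>"
  by (rule nice_induct[OF sub \<phi>]) (use integral_ind[OF sub] in auto)

lemma cint_add: "submanifold n l X \<Longrightarrow> \<phi> \<in> test_functions X \<Longrightarrow> \<phi>' \<in> test_functions X \<Longrightarrow>
    cint n l X (\<lambda>x. \<phi> x + \<phi>' x) = cint n l X \<phi> + cint n l X \<phi>'"
  by (simp add: cint_def tf_integrable)

lemma cint_scale: "cint n l X (\<lambda>x. c * \<phi> x) = c * cint n l X \<phi>"
  by (simp add: cint_def)

lemma cint_0: "cint n l X (\<lambda>x. 0) = 0"
  by (simp add: cint_def)

lemma cint_sum:
  assumes "submanifold n l X" "\<And>i. i \<in> I \<Longrightarrow> \<phi> i \<in> test_functions X"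
  shows "cint n l X (\<lambda>x. \<Sum>i\<in>I. c i * \<phi> i x) = (\<Sum>i\<in>I. c i * cint n l X (\<phi> i))"
  using assms(2)
proof (induct I rule: infinite_finite_induct)
  case (insert i I)
  note XK = submanifold_sub_Kn[OF assms(1)]
  have "cint n l X (\<lambda>x. c i * \<phi> i x + (\<Sum>i\<in>I. c i * \<phi> i x)) = cint n l X (\<lambda>x. c i * \<phi> i x) + cint n l X (\<lambda>x. \<Sum>i\<in>I. c i * \<phi> i x)"
    using insert by (intro cint_add[OF assms(1)] tf_scale[OF XK] tf_sum[OF XK]) auto
  then show ?case using insert by (simp add: cint_scale)
qed (simp_all add: cint_0)

lemma submanifold_Kn: "submanifold l l (Kn l :: 'k::nonarch_local_field kvec set)"
  by (rule submanifold_Kn_open) (simp, use Kn_0 in blast)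

lemma nice_Kn: "x \<in> Kn l \<Longrightarrow> nice l l (Kn l) id x j"
  by (rule nice_open_Kn(1)) (auto simp: bl_subset)

abbreviation "iK l \<equiv> cint l l (Kn l)"

lemma iK_ind: "x \<in> Kn l \<Longrightarrow> iK l (ind l (Kn l) (x :: 'k::nonarch_local_field kvec) j) = qpow TYPE('k) (- (int l * j))"
  by (rule integral_ind(2)[OF submanifold_Kn nice_Kn])

lemma ind_Kn_test: "ind l (Kn l) x j \<in> test_functions (Kn l)"
  by (rule ind_test[OF order_refl compact_bl_Kn])

text \<open>Both sides are linear in \<phi>. On the indicator of a smaller ball of level i they are
  equal, because its push-forward is the indicator of a ball of level i in
  \<open>Kn l\<close>.\<close>

lemma cint_transport:
  fixes X :: "'k::nonarch_local_field kvec set"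
  assumes sub: "submanifold n l X" and nice: "nice n l X s x j"
    and \<phi>: "\<phi> \<in> test_functions X" and supp: "\<And>y. y \<notin> bl n X x j \<Longrightarrow> \<phi> y = 0"
  defines "push \<equiv> \<lambda>\<phi> w. if w \<in> bl l (Kn l) (coord_proj l s x) j then \<phi> (sec n l X s x j w) else (0::complex)"
  shows "push \<phi> \<in> test_functions (Kn l)" "cint n l X \<phi> = iK l (push \<phi>)"
proof -
  let ?b = "bl n X x j" let ?B = "bl l (Kn l) (coord_proj l s x) j" let ?p = "coord_proj l s"
  have XK: "X \<subseteq> Kn n" by (rule nice_XK[OF nice])
  have bK: "?b \<subseteq> Kn n" using XK bl_subset by blast
  note ch = C1_chart_nice[OF nice sub]
  have test_X: "\<phi> \<in> test_functions X" if "\<phi> \<in> test_functions ?b" for \<phi>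
    by (rule tf_extend[OF bl_subset XK openin_bl that])
  have pt: "push \<phi> \<in> test_functions (Kn l)" if "\<phi> \<in> test_functions ?b" for \<phi>
    using tf_extend[OF bl_subset order_refl openin_bl chart_push[OF ch sub that]]
    unfolding push_def sec_def .
  have \<phi>b: "\<phi> \<in> test_functions ?b" by (rule tf_restrict[OF bl_subset XK \<phi> supp])
  then show "push \<phi> \<in> test_functions (Kn l)" by (rule pt)
  show "cint n l X \<phi> = iK l (push \<phi>)"
  proof (rule tf_induct[OF bK \<phi>b, of "\<lambda>y i. j \<le> i"])
    show "\<exists>i. j \<le> i" by auto
    show "compact (bl n ?b y i)" if "j \<le> i" "y \<in> ?b" for y i
    proof -
      have "bl n ?b y i = bl n X y i" using bl_mono[OF that] by (auto simp: mem_bl)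
      then show ?thesis using compact_bl_sub[OF nice_compact[OF nice] that(2,1)] by simp
    qed
    show "cint n l X (\<lambda>_. 0) = iK l (push (\<lambda>_. 0))" by (simp add: push_def cint_0)
    show "cint n l X (ind n ?b y i) = iK l (push (ind n ?b y i))" if y: "y \<in> ?b" and i: "j \<le> i" for y i
    proof -
      have "bl n ?b y i = bl n X y i" using bl_mono[OF i y] by (auto simp: mem_bl)
      then have 1: "ind n ?b y i = ind n X y i" by (auto simp: ind_def)
      have "push (ind n X y i) = ind l (Kn l) (?p y) i"
      proof (rule ext)
        fix w
        show "push (ind n X y i) w = ind l (Kn l) (?p y) i w"
        proof (cases "w \<in> ?B")
          case True
          have m: "sec n l X s x j w \<in> ?b" "?p (sec n l X s x j w) = w"
            by (rule sec_mem[OF nice True], rule cp_sec[OF nice True])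
          then have "near n i (sec n l X s x j w - y) \<longleftrightarrow> near l i (w - ?p y)"
            using nice_iso[OF nice m(1) y, of i] by simp
          then show ?thesis using True m(1) by (auto simp: push_def ind_def mem_bl)
        next
          case False
          then have "w \<notin> bl l (Kn l) (?p y) i" using bl_mono[OF i cp_mem[OF nice y]] by blast
          then show ?thesis using False by (simp add: push_def ind_def)
        qed
      qed
      then show ?thesis
        unfolding 1 using integral_ind(2)[OF sub nice_sub[OF nice y i]] iK_ind[OF coord_proj_Kn, of l s y i] by simp
    qed
    show "cint n l X (\<lambda>x. f x + g x) = iK l (push (\<lambda>x. f x + g x))"
      if "f \<in> test_functions ?b" "g \<in> test_functions ?b" "cint n l X f = iK l (push f)" "cint n l X g = iK l (push g)" for f g
    proof -
      have "push (\<lambda>x. f x + g x) = (\<lambda>w. push f w + push g w)" by (auto simp: push_def)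
      then show ?thesis
        using that cint_add[OF sub test_X test_X] cint_add[OF submanifold_Kn pt pt] by simp
    qed
    show "cint n l X (\<lambda>x. c * f x) = iK l (push (\<lambda>x. c * f x))" if "cint n l X f = iK l (push f)" for c f
    proof -
      have "push (\<lambda>x. c * f x) = (\<lambda>w. c * push f w)" by (auto simp: push_def)
      then show ?thesis using that by (simp add: cint_scale)
    qed
  qed auto
qed

lemma iK_translate:
  fixes g :: "'k::nonarch_local_field kvec \<Rightarrow> complex"
  assumes g: "g \<in> test_functions (Kn l)" and a: "a \<in> Kn l"
  shows "iK l (\<lambda>w. g (w + a)) = iK l g"
proof -
  have "(\<lambda>w. g (w + a)) \<in> test_functions (Kn l) \<and> iK l (\<lambda>w. g (w + a)) = iK l g"
  proof (rule nice_induct[OF submanifold_Kn g])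
    fix s j and x :: "'k kvec" assume "nice l l (Kn l) s x j"
    then have x: "x \<in> Kn l" by (rule nice_x)
    have "w + a \<in> Kn l \<longleftrightarrow> w \<in> Kn l" for w using Kn_add[of w l a] Kn_diff[of "w + a" l a] a by auto
    then have "(\<lambda>w. ind l (Kn l) x j (w + a)) = ind l (Kn l) (x - a) j"
      by (auto simp: ind_def mem_bl fun_eq_iff[of "\<lambda>w. ind l (Kn l) x j (w + a)"] diff_diff_eq2)
    then show "(\<lambda>w. ind l (Kn l) x j (w + a)) \<in> test_functions (Kn l) \<and> iK l (\<lambda>w. ind l (Kn l) x j (w + a)) = iK l (ind l (Kn l) x j)"
      using ind_Kn_test iK_ind[OF Kn_diff[OF x a]] iK_ind[OF x] by simp
  next
    fix f h assume "f \<in> test_functions (Kn l)" "h \<in> test_functions (Kn l)"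
      "(\<lambda>w. f (w + a)) \<in> test_functions (Kn l) \<and> iK l (\<lambda>w. f (w + a)) = iK l f"
      "(\<lambda>w. h (w + a)) \<in> test_functions (Kn l) \<and> iK l (\<lambda>w. h (w + a)) = iK l h"
    then show "(\<lambda>w. f (w + a) + h (w + a)) \<in> test_functions (Kn l) \<and>
        iK l (\<lambda>w. f (w + a) + h (w + a)) = iK l (\<lambda>x. f x + h x)"
      by (simp add: cint_add[OF submanifold_Kn] tf_add[OF order_refl])
  next
    fix c f assume "(\<lambda>w. f (w + a)) \<in> test_functions (Kn l) \<and> iK l (\<lambda>w. f (w + a)) = iK l f"
    then show "(\<lambda>w. c * f (w + a)) \<in> test_functions (Kn l) \<and> iK l (\<lambda>w. c * f (w + a)) = iK l (\<lambda>x. c * f x)"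
      by (simp add: cint_scale tf_scale[OF order_refl])
  qed (simp add: tf_0[OF order_refl])
  then show ?thesis by blast
qed

section \<open>Oscillatory integrals and Fourier expansion\<close>

context
  fixes \<psi> :: "'k::nonarch_local_field \<Rightarrow> complex"
  assumes psi: "additive_character \<psi>"
begin

lemma psi_add: "\<psi> (x + y) = \<psi> x * \<psi> y"
  and psi_nonzero: "\<psi> x \<noteq> 0"
  and psi_vge1: "vge 1 x \<Longrightarrow> \<psi> x = 1"
  and psi_nontrivial: "\<exists>x. vge 0 x \<and> \<psi> x \<noteq> 1"
  using psi unfolding additive_character_def maximal_ideal_vge[symmetric] valuation_ring_vge[symmetric] by blast+

lemma psi_0 [simp]: "\<psi> 0 = 1"
  by (rule psi_vge1) simp

lemma psi_eq: "vge 1 (x - y) \<Longrightarrow> \<psi> x = \<psi> y"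
  using psi_add[of "x - y" y] psi_vge1 by simp

lemma lc_psi:
  assumes "X \<subseteq> Kn l"
  shows "locally_constant_on X (\<lambda>w. \<psi> (dotp l w \<xi>))"
  unfolding lc_iff[OF assms]
proof
  fix x assume "x \<in> X"
  obtain i where i: "near l i \<xi>" using near_ex by blast
  have "\<psi> (dotp l y \<xi>) = \<psi> (dotp l x \<xi>)" if "y \<in> bl l X x (1 - i)" for y
  proof (rule psi_eq)
    have "vge (1 - i + i) (dotp l (y - x) \<xi>)" using that i by (intro vge_dotp) (simp add: mem_bl)
    then show "vge 1 (dotp l y \<xi> - dotp l x \<xi>)" by (simp add: dotp_diff_left)
  qed
  then show "\<exists>j. \<forall>y\<in>bl l X x j. \<psi> (dotp l y \<xi>) = \<psi> (dotp l x \<xi>)" by blast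
qed

text \<open>The failing coordinate of \<xi> has valuation at most - j, so a multiple of a unit
  vector, still of level j, pairs with \<xi> to an element of the valuation ring where \<psi> is not
  1. As \<psi> is trivial from level 1 on, 1 - j is the exact dual level of j.\<close>

lemma char_nontrivial:
  assumes "\<not> near l (1 - j) \<xi>"
  shows "\<exists>a\<in>Kn l. near l j a \<and> \<psi> (dotp l a \<xi>) \<noteq> 1"
proof -
  obtain i where i: "i < l" "\<not> vge (1 - j) (\<xi> i)" using assms by (auto simp: near_def)
  then have ne: "\<xi> i \<noteq> 0" "ord (\<xi> i) < 1 - j" by (auto simp: vge_def)
  obtain t where t: "vge 0 t" "\<psi> t \<noteq> 1" using psi_nontrivial by blast
  define c where "c = t / \<xi> i"
  have ct: "\<xi> i * c = t" using ne by (simp add: c_def)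
  have "vge (- ord (\<xi> i)) c" using vge_mult_iff[OF ne(1), of 0 c] t(1) by (simp add: ct)
  then have "vge j c" by (rule vge_mono) (use ne in simp)
  then have "near l j (\<lambda>k. c * unitv i k)" by (auto simp: near_def unitv_def)
  moreover have "dotp l (\<lambda>k. c * unitv i k) \<xi> = t"
    unfolding dotp_scale_left dotp_unitv[OF i(1)] using ct by (simp only: mult.commute)
  ultimately show ?thesis using t Kn_scale[OF unitv_Kn[OF i(1)]] by blast
qed

text \<open>Translation by a vector a of level j leaves g unchanged and multiplies the integrand by
  \<psi> (a|\<xi>), which can be chosen different from 1.\<close>

lemma oscillation_linear:
  assumes g: "g \<in> test_functions (Kn l)"
    and c: "\<And>x y. y \<in> bl l (Kn l) x j \<Longrightarrow> x \<in> Kn l \<Longrightarrow> g y = g x"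
    and \<xi>: "\<not> near l (1 - j) \<xi>"
  shows "iK l (\<lambda>w. g w * \<psi> (dotp l w \<xi>)) = 0"
proof -
  obtain a where a: "a \<in> Kn l" "near l j a" "\<psi> (dotp l a \<xi>) \<noteq> 1" using char_nontrivial[OF \<xi>] by blast
  let ?h = "\<lambda>w. g w * \<psi> (dotp l w \<xi>)"
  have h: "?h \<in> test_functions (Kn l)"
    using tf_mult_lc[OF order_refl g lc_psi[OF order_refl, where \<xi> = \<xi>]] by (simp add: mult.commute)
  have "g (w + a) = g w" for w
  proof (cases "w \<in> Kn l")
    case True
    then show ?thesis using a by (intro c) (auto simp: mem_bl intro!: Kn_add)
  next
    case False
    then have "w + a \<notin> Kn l" using Kn_diff[of "w + a" l a] a(1) by auto
    then show ?thesis using False tfD(2)[OF g] by simp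
  qed
  then have "(\<lambda>w. ?h (w + a)) = (\<lambda>w. \<psi> (dotp l a \<xi>) * ?h w)"
    by (auto simp: dotp_add_left psi_add)
  then have "iK l ?h = \<psi> (dotp l a \<xi>) * iK l ?h"
    using iK_translate[OF h a(1)] by (simp add: cint_scale)
  then show ?thesis using a(3) by (simp add: mult_cancel_right1)
qed

text \<open>Cut g into balls of level j. On each of them the phase agrees with an affine one up to
  level 1, which \<psi> does not see, and the linear part \<zeta> is too large for the character to
  be constant there.\<close>

lemma stationary_phase:
  assumes g: "g \<in> test_functions (Kn l)"
    and c: "\<And>x y. y \<in> bl l (Kn l) x j \<Longrightarrow> x \<in> Kn l \<Longrightarrow> g y = g x"
    and \<zeta>: "\<not> near l (1 - j) \<zeta>"
    and \<Phi>: "\<And>x w. g x \<noteq> 0 \<Longrightarrow> w \<in> bl l (Kn l) x j \<Longrightarrow> vge 1 (\<Phi> w - \<Phi> x - dotp l (w - x) \<zeta>)"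
  shows "iK l (\<lambda>w. g w * \<psi> (\<Phi> w)) = 0"
proof -
  have "\<exists>I. finite I \<and> I \<subseteq> {x. g x \<noteq> 0} \<and> g = (\<lambda>y. \<Sum>x\<in>I. g x * ind l (Kn l) x j y) \<and>
    (\<forall>x\<in>I. \<forall>y\<in>I. x \<noteq> y \<longrightarrow> bl l (Kn l) x j \<inter> bl l (Kn l) y j = {})"
    by (rule tf_decomp[OF order_refl g c])
  then obtain I where I: "finite I" "I \<subseteq> {x. g x \<noteq> 0}" "g = (\<lambda>y. \<Sum>x\<in>I. g x * ind l (Kn l) x j y)" by blast
  let ?e = "\<lambda>x w. ind l (Kn l) x j w * \<psi> (dotp l w \<zeta>)"
  have "g w * \<psi> (\<Phi> w) = (\<Sum>x\<in>I. (g x * \<psi> (\<Phi> x - dotp l x \<zeta>)) * ?e x w)" for w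
  proof -
    have "g w * \<psi> (\<Phi> w) = (\<Sum>x\<in>I. g x * ind l (Kn l) x j w * \<psi> (\<Phi> w))"
      by (subst I(3)) (simp add: sum_distrib_right)
    also have "\<dots> = (\<Sum>x\<in>I. (g x * \<psi> (\<Phi> x - dotp l x \<zeta>)) * ?e x w)"
    proof (rule sum.cong[OF refl])
      fix x assume x: "x \<in> I"
      show "g x * ind l (Kn l) x j w * \<psi> (\<Phi> w) = (g x * \<psi> (\<Phi> x - dotp l x \<zeta>)) * ?e x w"
      proof (cases "w \<in> bl l (Kn l) x j")
        case True
        have "\<psi> (\<Phi> w) = \<psi> ((\<Phi> x - dotp l x \<zeta>) + dotp l w \<zeta>)"
          using \<Phi>[OF _ True] x I(2) by (intro psi_eq) (auto simp: dotp_diff_left algebra_simps)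
        then show ?thesis by (simp add: psi_add)
      qed (simp add: ind_def)
    qed
    finally show ?thesis .
  qed
  moreover have "?e x \<in> test_functions (Kn l)" for x
    using tf_mult_lc[OF order_refl ind_Kn_test lc_psi[OF order_refl]] by (simp add: mult.commute)
  moreover have "iK l (?e x) = 0" for x
  proof (rule oscillation_linear[OF ind_Kn_test _ \<zeta>])
    fix a y :: "'k kvec" assume "y \<in> bl l (Kn l) a j" "a \<in> Kn l"
    then have "bl l (Kn l) y j = bl l (Kn l) a j" "y \<in> Kn l" using bl_eq_mem by (blast, simp add: mem_bl)
    then show "ind l (Kn l) x j y = ind l (Kn l) x j a"
      using \<open>a \<in> Kn l\<close> near_trans[of l j y a x] near_trans[of l j a y x] near_commute[of l j y a] \<open>y \<in> bl l (Kn l) a j\<close>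
      by (auto simp: ind_def mem_bl)
  qed
  ultimately show ?thesis by (simp add: cint_sum[OF submanifold_Kn])
qed

text \<open>Representatives of the ball of level \<open>i\<close> modulo the ball of level \<open>c\<close>.\<close>

definition reps :: "nat \<Rightarrow> int \<Rightarrow> int \<Rightarrow> 'k kvec set" where
  "reps k c i = (\<lambda>C. SOME \<eta>. \<eta> \<in> C) ` cells k (Kn k) (bl k (Kn k) 0 i) c"

lemma rep_cell: "\<eta> \<in> Kn k \<Longrightarrow> (SOME \<eta>'. \<eta>' \<in> bl k (Kn k) \<eta> c) \<in> bl k (Kn k) \<eta> c"
  by (rule someI[of _ \<eta>]) (rule bl_self)

lemma reps_E:
  assumes "\<eta> \<in> reps k c i" "i \<le> c"
  shows "\<eta> \<in> Kn k" "near k i \<eta>" "\<eta> = (SOME \<eta>'. \<eta>' \<in> bl k (Kn k) \<eta> c)"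
proof -
  obtain \<eta>0 where 0: "\<eta>0 \<in> bl k (Kn k) 0 i" "\<eta> = (SOME \<eta>'. \<eta>' \<in> bl k (Kn k) \<eta>0 c)"
    using assms(1) by (auto simp: reps_def cells_def)
  have m: "\<eta> \<in> bl k (Kn k) \<eta>0 c" unfolding 0(2) by (rule rep_cell) (use 0(1) in \<open>simp add: mem_bl\<close>)
  then have "\<eta> \<in> bl k (Kn k) 0 i" using bl_mono[OF assms(2) 0(1)] by blast
  then show "\<eta> \<in> Kn k" "near k i \<eta>" by (simp_all add: mem_bl)
  show "\<eta> = (SOME \<eta>'. \<eta>' \<in> bl k (Kn k) \<eta> c)" unfolding bl_eq_mem[OF m] by (rule 0(2))
qed

lemma reps_card:
  assumes "i \<le> c"
  shows "finite (reps k c i)" "of_nat (card (reps k c i)) = qpow TYPE('k) (int k * (c - i))"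
proof -
  obtain N where N: "c = i + int N" using assms zle_iff_zadd by blast
  let ?A = "cells k (Kn k) (bl k (Kn k) 0 i :: 'k kvec set) c"
  have A: "finite ?A" "card ?A = rq TYPE('k) ^ (k * N)" using card_cells_Kn[OF Kn_0] by (auto simp: N)
  show "finite (reps k c i)" using A by (simp add: reps_def)
  have "inj_on (\<lambda>C. SOME \<eta>. \<eta> \<in> C) ?A"
  proof (rule inj_onI)
    fix C D assume CD: "C \<in> ?A" "D \<in> ?A" "(SOME \<eta>. \<eta> \<in> C) = (SOME \<eta>. \<eta> \<in> D)"
    obtain x y where xy: "x \<in> Kn k" "C = bl k (Kn k) x c" "y \<in> Kn k" "D = bl k (Kn k) y c"
      using CD bl_subset unfolding cells_def by blast
    have "(SOME \<eta>. \<eta> \<in> C) \<in> C" "(SOME \<eta>. \<eta> \<in> D) \<in> D" using rep_cell xy by simp_all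
    then show "C = D" using CD(3) xy bl_eq_mem by metis
  qed
  then have "card (reps k c i) = rq TYPE('k) ^ (k * N)" using A by (simp add: reps_def card_image)
  then show "of_nat (card (reps k c i)) = qpow TYPE('k) (int k * (c - i))"
    using qpow_nat[of "k * N"] by (simp add: N)
qed

lemma reps_mono: "i \<le> i' \<Longrightarrow> reps k c i' \<subseteq> reps k c i"
  unfolding reps_def cells_def using near_mono[of k i' _ i] by (auto simp: bl_def)

lemma reps_restrict:
  assumes "\<eta> \<in> reps k c i" "i \<le> c" "near k i' \<eta>"
  shows "\<eta> \<in> reps k c i'"
proof -
  have "\<eta> \<in> bl k (Kn k) 0 i'" using reps_E[OF assms(1,2)] assms(3) by (simp add: mem_bl)
  then show ?thesis using reps_E(3)[OF assms(1,2)] unfolding reps_def cells_def by blast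
qed

text \<open>The level j1 of z makes \<psi> (z|\<eta>) depend only on the class of \<eta> modulo
  level 1 - j1. If z is not of level j, translation by some a of level 1 - j permutes the classes
  and multiplies the sum by a number other than 1.\<close>

lemma orthogonality:
  assumes z: "z \<in> Kn k" "near k j1 z" and j: "j1 \<le> j"
  shows "(\<Sum>\<eta>\<in>reps k (1 - j1) (1 - j). \<psi> (dotp k z \<eta>)) =
    (if near k j z then qpow TYPE('k) (int k * (j - j1)) else 0)"
proof -
  let ?R = "reps k (1 - j1) (1 - j)"
  have le: "1 - j \<le> 1 - j1" using j by simp
  show ?thesis
  proof (cases "near k j z")
    case True
    have "\<psi> (dotp k z \<eta>) = 1" if "\<eta> \<in> ?R" for \<eta>
      using vge_dotp[OF True reps_E(2)[OF that le]] by (intro psi_vge1) simp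
    then have "(\<Sum>\<eta>\<in>?R. \<psi> (dotp k z \<eta>)) = of_nat (card ?R)" by simp
    then show ?thesis using True reps_card(2)[OF le, of k] by simp
  next
    case False
    then have "\<not> near k (1 - (1 - j)) z" by simp
    from char_nontrivial[OF this] obtain a where a: "a \<in> Kn k" "near k (1 - j) a" "\<psi> (dotp k z a) \<noteq> 1"
      by (auto simp: dotp_commute)
    \<comment> \<open>Adding a leads out of the set of representatives, so it is followed by passing
      to the representative of the class.\<close>
    define \<tau> where "\<tau> \<eta> = (SOME \<eta>'. \<eta>' \<in> bl k (Kn k) (\<eta> + a) (1 - j1))" for \<eta>
    have ea: "\<eta> + a \<in> bl k (Kn k) 0 (1 - j)" if "\<eta> \<in> ?R" for \<eta>
      using reps_E(1,2)[OF that le] a by (auto simp: mem_bl intro!: Kn_add near_add)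
    have \<tau>: "\<tau> \<eta> \<in> bl k (Kn k) (\<eta> + a) (1 - j1)" if "\<eta> \<in> ?R" for \<eta>
      unfolding \<tau>_def by (rule rep_cell) (use ea[OF that] in \<open>simp add: mem_bl\<close>)
    have "\<tau> ` ?R \<subseteq> ?R" using ea by (auto simp: reps_def cells_def \<tau>_def)
    moreover have "inj_on \<tau> ?R"
    proof (rule inj_onI)
      fix \<eta> \<eta>' assume e: "\<eta> \<in> ?R" "\<eta>' \<in> ?R" "\<tau> \<eta> = \<tau> \<eta>'"
      have "near k (1 - j1) (\<tau> \<eta> - (\<eta> + a))" "near k (1 - j1) (\<tau> \<eta> - (\<eta>' + a))"
        using \<tau>[OF e(1)] \<tau>[OF e(2)] e(3) by (simp_all add: mem_bl)
      from near_diff[OF this(2,1)] have "near k (1 - j1) (\<eta> - \<eta>')" by simp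
      then have "bl k (Kn k) \<eta> (1 - j1) = bl k (Kn k) \<eta>' (1 - j1)" by (rule bl_eq)
      then show "\<eta> = \<eta>'" using reps_E(3)[OF e(1) le] reps_E(3)[OF e(2) le] by simp
    qed
    ultimately have bij: "bij_betw \<tau> ?R ?R"
      using endo_inj_surj[OF reps_card(1)[OF le]] by (auto simp: bij_betw_def)
    have "\<psi> (dotp k z (\<tau> \<eta>)) = \<psi> (dotp k z a) * \<psi> (dotp k z \<eta>)" if "\<eta> \<in> ?R" for \<eta>
    proof -
      have "near k (1 - j1) (\<tau> \<eta> - (\<eta> + a))" using \<tau>[OF that] by (simp add: mem_bl)
      from vge_dotp[OF z(2) this] have "vge 1 (dotp k z (\<tau> \<eta>) - dotp k z (\<eta> + a))"
        by (simp add: dotp_diff_right)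
      then have "\<psi> (dotp k z (\<tau> \<eta>)) = \<psi> (dotp k z (\<eta> + a))" by (rule psi_eq)
      then show ?thesis by (simp add: dotp_add_right psi_add)
    qed
    then have "(\<Sum>\<eta>\<in>?R. \<psi> (dotp k z (\<tau> \<eta>))) = \<psi> (dotp k z a) * (\<Sum>\<eta>\<in>?R. \<psi> (dotp k z \<eta>))"
      by (simp add: sum_distrib_left)
    then have "(\<Sum>\<eta>\<in>?R. \<psi> (dotp k z \<eta>)) = \<psi> (dotp k z a) * (\<Sum>\<eta>\<in>?R. \<psi> (dotp k z \<eta>))"
      using sum.reindex_bij_betw[OF bij, of "\<lambda>\<eta>. \<psi> (dotp k z \<eta>)"] by simp
    then show ?thesis using a(3) False by (simp add: mult_cancel_right1)
  qed
qed

text \<open>Fourier inversion on the finite quotient of the ball of level j1 by the ball of level j.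
  The factor with exponent k * j1 is the inverse volume of the large ball: orthogonality contributes
  k * (j - j1), the integral over a small ball - k * j.\<close>

lemma fourier_expansion:
  fixes \<theta> :: "'k kvec \<Rightarrow> complex"
  assumes \<theta>: "\<theta> \<in> test_functions (Kn k)" and w0: "w0 \<in> Kn k"
    and supp: "\<And>w. w \<notin> bl k (Kn k) w0 j1 \<Longrightarrow> \<theta> w = 0"
    and c: "\<And>x y. y \<in> bl k (Kn k) x j \<Longrightarrow> x \<in> Kn k \<Longrightarrow> \<theta> y = \<theta> x" and j: "j1 \<le> j"
  shows "\<theta> w = (\<Sum>\<xi>\<in>reps k (1 - j1) (1 - j).
     (qpow TYPE('k) (int k * j1) * iK k (\<lambda>w'. \<theta> w' * \<psi> (dotp k w' (- \<xi>)))) *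
     (ind k (Kn k) w0 j1 w * \<psi> (dotp k w \<xi>)))"
proof (cases "w \<in> bl k (Kn k) w0 j1")
  case False
  then show ?thesis using supp by (simp add: ind_def)
next
  case True
  let ?R = "reps k (1 - j1) (1 - j)" let ?q = "qpow TYPE('k)"
  have tst: "(\<lambda>w'. \<theta> w' * \<psi> (dotp k w' (- \<xi>))) \<in> test_functions (Kn k)" for \<xi>
    using tf_mult_lc[OF order_refl \<theta> lc_psi[OF order_refl, where \<xi> = "- \<xi>"]] by (simp add: mult.commute)
  have wK: "w \<in> Kn k" using True by (simp add: mem_bl)
  have "(\<Sum>\<xi>\<in>?R. \<psi> (dotp k w \<xi>) * (\<theta> w' * \<psi> (dotp k w' (- \<xi>)))) = ?q (int k * (j - j1)) * \<theta> w * ind k (Kn k) w j w'" for w'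
  proof (cases "w' \<in> bl k (Kn k) w0 j1")
    case w': True
    have n: "near k j1 (w - w')" using True w' near_trans near_commute by (metis mem_bl)
    have d: "w - w' \<in> Kn k" using True w' by (auto simp: mem_bl intro!: Kn_diff)
    have "(\<Sum>\<xi>\<in>?R. \<psi> (dotp k w \<xi>) * (\<theta> w' * \<psi> (dotp k w' (- \<xi>)))) = \<theta> w' * (\<Sum>\<xi>\<in>?R. \<psi> (dotp k (w - w') \<xi>))"
      unfolding sum_distrib_left
    proof (rule sum.cong[OF refl])
      fix \<xi>
      have "dotp k (w - w') \<xi> = dotp k w \<xi> + dotp k w' (- \<xi>)" by (simp add: dotp_diff_left dotp_uminus_right)
      then show "\<psi> (dotp k w \<xi>) * (\<theta> w' * \<psi> (dotp k w' (- \<xi>))) = \<theta> w' * \<psi> (dotp k (w - w') \<xi>)"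
        by (simp add: psi_add)
    qed
    also have "\<dots> = \<theta> w' * (if near k j (w - w') then ?q (int k * (j - j1)) else 0)"
      by (simp add: orthogonality[OF d n j])
    also have "\<dots> = ?q (int k * (j - j1)) * \<theta> w * ind k (Kn k) w j w'"
    proof (cases "near k j (w - w')")
      case nn: True
      then have m: "w' \<in> bl k (Kn k) w j" using w' near_commute by (metis mem_bl)
      then show ?thesis using c[OF m wK] nn by (simp add: ind_def)
    next
      case nn: False
      then have "w' \<notin> bl k (Kn k) w j" using near_commute by (metis mem_bl)
      then show ?thesis using nn by (simp add: ind_def)
    qed
    finally show ?thesis .
  next
    case w': False
    have "w' \<notin> bl k (Kn k) w j" using w' bl_mono[OF j True] by blast
    then show ?thesis using supp[OF w'] by (simp add: ind_def)
  qed
  then have eq: "(\<lambda>w'. \<Sum>\<xi>\<in>?R. \<psi> (dotp k w \<xi>) * (\<theta> w' * \<psi> (dotp k w' (- \<xi>)))) = (\<lambda>w'. (?q (int k * (j - j1)) * \<theta> w) * ind k (Kn k) w j w')"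
    by auto
  have "(\<Sum>\<xi>\<in>?R. \<psi> (dotp k w \<xi>) * iK k (\<lambda>w'. \<theta> w' * \<psi> (dotp k w' (- \<xi>)))) = ?q (int k * (j - j1)) * \<theta> w * ?q (- (int k * j))"
  proof -
    have S: "iK k (\<lambda>w'. \<Sum>\<xi>\<in>?R. \<psi> (dotp k w \<xi>) * (\<theta> w' * \<psi> (dotp k w' (- \<xi>)))) =
        (\<Sum>\<xi>\<in>?R. \<psi> (dotp k w \<xi>) * iK k (\<lambda>w'. \<theta> w' * \<psi> (dotp k w' (- \<xi>))))"
      by (rule cint_sum[OF submanifold_Kn tst])
    show ?thesis unfolding S[symmetric] eq cint_scale iK_ind[OF wK] ..
  qed
  also have "\<dots> = ?q (- (int k * j1)) * \<theta> w"
    by (simp add: algebra_simps flip: qpow_add)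
  finally have "?q (int k * j1) * (\<Sum>\<xi>\<in>?R. \<psi> (dotp k w \<xi>) * iK k (\<lambda>w'. \<theta> w' * \<psi> (dotp k w' (- \<xi>)))) = \<theta> w"
    by (simp flip: mult.assoc qpow_add)
  then show ?thesis using True by (simp add: ind_def sum_distrib_left algebra_simps)
qed

end

section \<open>Local estimates\<close>

lemma not_near_scaled:
  assumes "c \<noteq> 0" "v = (\<lambda>i. c * w i)" "\<not> near n j w"
  shows "\<not> near n (j + ord c) v"
  unfolding assms(2) near_scale_iff[OF assms(1)] using assms(3) by simp

context
  fixes \<psi> :: "'k::nonarch_local_field \<Rightarrow> complex" and \<Lambda> :: "'k set"
  assumes psi: "additive_character \<psi>" and Lam: "open_finite_index_subgroup \<Lambda>"
begin

lemma Lam_props: "c \<in> \<Lambda> \<Longrightarrow> c \<noteq> 0" "1 \<in> \<Lambda>" "a \<in> \<Lambda> \<Longrightarrow> b \<in> \<Lambda> \<Longrightarrow> a * b \<in> \<Lambda>" "a \<in> \<Lambda> \<Longrightarrow> inverse a \<in> \<Lambda>"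
  using Lam unfolding open_finite_index_subgroup_def by blast+

text \<open>Finite index puts two powers of a uniformizer into one coset, so their quotient lies in
  \<Lambda>; its powers realize all multiples of e. Hence scaling by \<Lambda> moves every nonzero
  vector into a compact shell of e consecutive levels.\<close>

lemma Lam_negative: "\<exists>e>0. \<forall>s::int. \<exists>c\<in>\<Lambda>. ord c = - (e * s)"
proof -
  let ?f = "\<lambda>i::nat. (\<lambda>b. upow (int i) * b) ` \<Lambda>"
  have "range ?f \<subseteq> (\<lambda>a. (\<lambda>b. a * b) ` \<Lambda>) ` (UNIV - {0})" by auto
  then have "finite (range ?f)" using Lam finite_subset unfolding open_finite_index_subgroup_def by blast
  then have "\<not> inj ?f" using finite_imageD by blast
  then obtain i i' where ii: "i < i'" "?f i = ?f i'"
    by (metis (no_types, lifting) injI linorder_neqE_nat)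
  have "upow (int i') * 1 \<in> ?f i'" using Lam_props(2) by (rule imageI)
  then obtain b where b: "b \<in> \<Lambda>" "upow (int i') * 1 = upow (int i) * b" unfolding ii(2)[symmetric] by blast
  have "ord (upow (int i') * 1 :: 'k) = int i + ord b"
    unfolding b(2) using Lam_props(1)[OF b(1)] by (simp add: ord_mult)
  then have ob: "ord b = int i' - int i" by simp
  have "b ^ m \<in> \<Lambda>" for m by (induct m) (simp_all add: Lam_props(2,3) b(1))
  then have pw: "b ^ m \<in> \<Lambda> \<and> ord (b ^ m) = int m * ord b" for m
    using ord_power[OF Lam_props(1)[OF b(1)]] by blast
  have "\<exists>c\<in>\<Lambda>. ord c = - (ord b * s)" for s
  proof (cases "s \<le> 0")
    case True
    then show ?thesis using pw[of "nat (- s)"] by (intro bexI[of _ "b ^ nat (- s)"]) (auto simp: algebra_simps)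
  next
    case False
    have "ord (inverse (b ^ nat s)) = - ord (b ^ nat s)"
      using Lam_props(1)[of "b ^ nat s"] pw by (intro ord_inverse) blast
    then show ?thesis using pw[of "nat s"] Lam_props(4) False
      by (intro bexI[of _ "inverse (b ^ nat s)"]) (auto simp: algebra_simps)
  qed
  then show ?thesis using ob ii(1) by (intro exI[of _ "ord b"]) auto
qed

lemma bl_open_subset:
  assumes "openin (top_of_set (Kn k)) U" "y \<in> U"
  obtains J where "\<And>j. J \<le> j \<Longrightarrow> bl k (Kn k) y j \<subseteq> U"
proof -
  obtain J where J: "bl k (Kn k) y J \<subseteq> U" using assms openin_iff_near[of "Kn k" k U] by blast
  have "y \<in> Kn k" using assms openin_imp_subset by blast
  then have "bl k (Kn k) y j \<subseteq> U" if "J \<le> j" for j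
    using J bl_mono[OF that bl_self] by blast
  then show ?thesis by (rule that)
qed

text \<open>Let e be the exact level of the total gradient and work on balls of level - e. The three
  bounds on T say that at this scale g is constant, the balls stay where the error estimate holds,
  and the Taylor error paired with \<eta> has level at least 1 and is invisible to \<psi>.\<close>

lemma oscillation:
  assumes g: "g \<in> test_functions (Kn l)" and supp: "\<And>x. x \<notin> bl l (Kn l) x0 j2 \<Longrightarrow> g x = 0"
    and c: "\<And>x y j. J \<le> j \<Longrightarrow> y \<in> bl l (Kn l) x j \<Longrightarrow> x \<in> Kn l \<Longrightarrow> g y = g x"
    and err: "\<And>x w t. x \<in> bl l (Kn l) x0 j2 \<Longrightarrow> w \<in> bl l (Kn l) x0 j2 \<Longrightarrow> near l t (x - w) \<Longrightarrow>
      near k (t + cc) (F x - F w - mapp k l A (x - w))"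
    and \<eta>: "near k m \<eta>" and \<zeta>: "\<not> near l T (\<zeta> + tmapp k l A \<eta>)"
    and T: "T \<le> 1 - J" "T \<le> 1 - j2" "T \<le> cc + m"
  shows "iK l (\<lambda>x. g x * \<psi> (dotp l x \<zeta> + dotp k (F x) \<eta>)) = 0"
proof -
  obtain e where e: "e < T" "near l e (\<zeta> + tmapp k l A \<eta>)" "\<not> near l (e + 1) (\<zeta> + tmapp k l A \<eta>)"
    using near_exact[OF \<zeta>] by metis
  show ?thesis
  proof (rule stationary_phase[OF psi g, of "- e" "\<zeta> + tmapp k l A \<eta>"])
    show "g y = g x" if "y \<in> bl l (Kn l) x (- e)" "x \<in> Kn l" for x y
      by (rule c[OF _ that]) (use e(1) T(1) in simp)
    show "\<not> near l (1 - - e) (\<zeta> + tmapp k l A \<eta>)" using e(3) by (simp add: add.commute)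
    fix x w assume x: "g x \<noteq> 0" and w: "w \<in> bl l (Kn l) x (- e)"
    have xb: "x \<in> bl l (Kn l) x0 j2" using supp x by blast
    have "bl l (Kn l) x (- e) \<subseteq> bl l (Kn l) x0 j2" by (rule bl_mono[OF _ xb]) (use e(1) T(2) in simp)
    then have wb: "w \<in> bl l (Kn l) x0 j2" using w by blast
    have n: "near l (- e) (w - x)" using w by (simp add: mem_bl)
    have "vge (- e + cc + m) (dotp k (F w - F x - mapp k l A (w - x)) \<eta>)"
      by (rule vge_dotp[OF err[OF wb xb n] \<eta>])
    then have "vge 1 (dotp k (F w - F x - mapp k l A (w - x)) \<eta>)" by (rule vge_mono) (use e(1) T(3) in simp)
    moreover have "dotp k (F w - F x - mapp k l A (w - x)) \<eta> =
        dotp l w \<zeta> + dotp k (F w) \<eta> - (dotp l x \<zeta> + dotp k (F x) \<eta>) - dotp l (w - x) (\<zeta> + tmapp k l A \<eta>)"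
      by (simp add: dotp_diff_left dotp_add_left dotp_add_right dotp_mapp mapp_diff algebra_simps)
    ultimately show "vge 1 (dotp l w \<zeta> + dotp k (F w) \<eta> - (dotp l x \<zeta> + dotp k (F x) \<eta>) - dotp l (w - x) (\<zeta> + tmapp k l A \<eta>))"
      by simp
  qed
qed

lemma tmapp_scale: "tmapp k l A (\<lambda>i. c * v i) = (\<lambda>i. c * tmapp k l A v i)"
  by (simp add: tmapp_def mapp_scale)

lemma tmapp_diff: "tmapp k l A (v - w) = tmapp k l A v - tmapp k l A w"
  by (simp add: tmapp_def mapp_diff)

lemma tmapp_uminus: "tmapp k l A (- v) = - tmapp k l A v"
  using tmapp_diff[of k l A 0 v] by (simp add: tmapp_def)

lemma tf_level:
  assumes "X \<subseteq> Kn n" "g \<in> test_functions X"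
  obtains J where "\<And>x y j. J \<le> j \<Longrightarrow> y \<in> bl n X x j \<Longrightarrow> x \<in> X \<Longrightarrow> g y = g x"
proof -
  have "\<exists>j0. (\<forall>x\<in>X. \<forall>j\<ge>j0. g x \<noteq> 0 \<longrightarrow> True) \<and> (\<forall>x\<in>X. \<forall>j\<ge>j0. \<forall>y\<in>bl n X x j. g y = g x)"
    by (rule tf_uniform[OF assms]) auto
  then show ?thesis using that by blast
qed

lemma tf_phase:
  assumes g: "g \<in> test_functions (bl l (Kn l) x0 j2)"
    and err: "\<And>x w t. x \<in> bl l (Kn l) x0 j2 \<Longrightarrow> w \<in> bl l (Kn l) x0 j2 \<Longrightarrow> near l t (x - w) \<Longrightarrow>
      near k (t + cc) (F x - F w - mapp k l A (x - w))"
  shows "(\<lambda>x. g x * \<psi> (dotp l x \<zeta> + dotp k (F x) \<eta>)) \<in> test_functions (bl l (Kn l) x0 j2)"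
proof -
  let ?b = "bl l (Kn l) x0 j2"
  have bK: "?b \<subseteq> Kn l" by (rule bl_subset)
  obtain a where a: "\<And>v j. near l j v \<Longrightarrow> near k (j + a) (mapp k l A v)" using mapp_bound by metis
  obtain i where i: "near k i \<eta>" using near_ex by blast
  have "locally_constant_on ?b (\<lambda>x. \<psi> (dotp k (F x) \<eta>))"
    unfolding lc_iff[OF bK]
  proof
    fix x assume x: "x \<in> ?b"
    let ?t = "1 - i - min cc a"
    have "\<psi> (dotp k (F w) \<eta>) = \<psi> (dotp k (F x) \<eta>)" if w: "w \<in> bl l ?b x ?t" for w
    proof -
      have wb: "w \<in> ?b" and n: "near l ?t (w - x)" using w by (simp_all add: mem_bl)
      have "near k (?t + min cc a) (F w - F x - mapp k l A (w - x) + mapp k l A (w - x))"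
        by (intro near_add near_mono[OF err[OF wb x n]] near_mono[OF a[OF n]]) auto
      then have "near k (1 - i) (F w - F x)" by simp
      from vge_dotp[OF this i] have "vge 1 (dotp k (F w) \<eta> - dotp k (F x) \<eta>)" by (simp add: dotp_diff_left)
      then show ?thesis by (rule psi_eq[OF psi])
    qed
    then show "\<exists>j. \<forall>w\<in>bl l ?b x j. \<psi> (dotp k (F w) \<eta>) = \<psi> (dotp k (F x) \<eta>)" by blast
  qed
  then have "locally_constant_on ?b (\<lambda>x. \<psi> (dotp l x \<zeta>) * \<psi> (dotp k (F x) \<eta>))"
    by (rule lc_binop[OF bK lc_psi[OF psi bK]])
  from tf_mult_lc[OF bK g this] show ?thesis by (simp add: psi_add[OF psi] mult.commute)
qed

lemma ind_psi_test:
  "(\<lambda>w. ind k (Kn k) y j w * \<psi> (dotp k w \<eta>)) \<in> test_functions (bl k (Kn k) y j)"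
proof (rule tf_restrict[OF bl_subset order_refl])
  show "(\<lambda>w. ind k (Kn k) y j w * \<psi> (dotp k w \<eta>)) \<in> test_functions (Kn k)"
    using tf_mult_lc[OF order_refl ind_Kn_test lc_psi[OF psi order_refl]] by (simp add: mult.commute)
qed (simp add: ind_def)

lemma ind_test_bl: "ind k (Kn k) y j \<in> test_functions (bl k (Kn k) y j)"
  by (rule tf_restrict[OF bl_subset order_refl ind_Kn_test]) (simp add: ind_def)

lemma tf_bl_extend:
  assumes "bl k (Kn k) y j \<subseteq> W" "W \<subseteq> Kn k" "g \<in> test_functions (bl k (Kn k) y j)"
  shows "g \<in> test_functions W"
proof (rule tf_extend[OF assms(1,2) _ assms(3)])
  have "bl k (Kn k) y j = W \<inter> bl k (Kn k) y j" using assms(1) by blast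
  then show "openin (top_of_set W) (bl k (Kn k) y j)"
    using openin_Kn_subset[OF openin_bl assms(2)] by metis
qed

lemma distr_fourier:
  assumes u: "u \<in> distributions W" and W: "W \<subseteq> Kn k" "bl k (Kn k) w0 j1 \<subseteq> W" and w0: "w0 \<in> Kn k"
    and \<theta>: "\<theta> \<in> test_functions (bl k (Kn k) w0 j1)"
    and c: "\<And>x y. y \<in> bl k (Kn k) x j \<Longrightarrow> x \<in> Kn k \<Longrightarrow> \<theta> y = \<theta> x" and j: "j1 \<le> j"
  shows "u \<theta> = (\<Sum>\<xi>\<in>reps k (1 - j1) (1 - j).
     (qpow TYPE('k) (int k * j1) * iK k (\<lambda>w'. \<theta> w' * \<psi> (dotp k w' (- \<xi>)))) *
     u (\<lambda>w. ind k (Kn k) w0 j1 w * \<psi> (dotp k w \<xi>)))"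
proof -
  have \<theta>K: "\<theta> \<in> test_functions (Kn k)" by (rule tf_bl_extend[OF bl_subset order_refl \<theta>])
  have "\<theta> = (\<lambda>w. \<Sum>\<xi>\<in>reps k (1 - j1) (1 - j).
     (qpow TYPE('k) (int k * j1) * iK k (\<lambda>w'. \<theta> w' * \<psi> (dotp k w' (- \<xi>)))) *
     (ind k (Kn k) w0 j1 w * \<psi> (dotp k w \<xi>)))"
    by (rule ext, rule fourier_expansion[OF psi \<theta>K w0 tfD(2)[OF \<theta>] c j])
  then have "u \<theta> = u (\<lambda>w. \<Sum>\<xi>\<in>reps k (1 - j1) (1 - j).
     (qpow TYPE('k) (int k * j1) * iK k (\<lambda>w'. \<theta> w' * \<psi> (dotp k w' (- \<xi>)))) *
     (ind k (Kn k) w0 j1 w * \<psi> (dotp k w \<xi>)))" by (rule arg_cong)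
  also have "\<dots> = (\<Sum>\<xi>\<in>reps k (1 - j1) (1 - j).
     (qpow TYPE('k) (int k * j1) * iK k (\<lambda>w'. \<theta> w' * \<psi> (dotp k w' (- \<xi>)))) *
     u (\<lambda>w. ind k (Kn k) w0 j1 w * \<psi> (dotp k w \<xi>)))"
    by (rule distr_sum[OF u W(1) tf_bl_extend[OF W(2,1) ind_psi_test]])
  finally show ?thesis .
qed

text \<open>Smoothness survives a nonlinear phase, which is the independence of the chart. The
  function g \<psi> (F|c \<xi>) is expanded in linear characters: a frequency \<zeta> with \<zeta> /
  c near \<eta>0 is killed by u, and for any other one the gradient of the phase is large and the
  Fourier coefficient vanishes.\<close>

lemma smooth_change:
  assumes W: "openin (top_of_set (Kn l)) W" and D: "D \<subseteq> distributions W"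
    and sm: "smooth_at_open \<psi> \<Lambda> l W D w0 \<eta>0"
    and F: "sd l k (bl l (Kn l) w0 r) F A w0" and \<eta>: "\<eta> \<in> Kn k" "tmapp k l A \<eta> = \<eta>0"
  shows "\<exists>J i. \<forall>j1\<ge>J. \<forall>g\<in>test_functions (bl l (Kn l) w0 j1). \<exists>N. \<forall>u\<in>D. \<forall>c\<in>\<Lambda>. ord c < N \<longrightarrow>
    (\<forall>\<xi>\<in>bl k (Kn k) \<eta> i. u (\<lambda>w. g w * \<psi> (dotp k (F w) (\<lambda>i. c * \<xi> i))) = 0)"
proof -
  have WK: "W \<subseteq> Kn l" using openin_imp_subset[OF W] .
  obtain U0 V0 where U0: "openin (top_of_set (Kn l)) U0" "U0 \<subseteq> W" "w0 \<in> U0"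
    and V0: "openin (top_of_set (Kn l)) V0" "\<eta>0 \<in> V0"
    and sm': "\<And>\<phi>. \<phi> \<in> test_functions U0 \<Longrightarrow> \<exists>N. \<forall>u\<in>D. \<forall>c\<in>\<Lambda>. ord c < N \<longrightarrow>
           (\<forall>\<xi>\<in>V0. fourier \<psi> l \<phi> u (\<lambda>i. c * \<xi> i) = 0)"
    using sm unfolding smooth_at_open_def by blast
  have w0: "w0 \<in> Kn l" using U0 WK by blast
  obtain i0 where i0: "bl l (Kn l) \<eta>0 i0 \<subseteq> V0" using V0 openin_iff_near[of "Kn l" l V0] by blast
  obtain a where a: "\<And>v j. near k j v \<Longrightarrow> near l (j + a) (tmapp k l A v)"
    unfolding tmapp_def using mapp_bound by metis
  \<comment> \<open>The transposed matrix shifts levels by a, so closeness i1 of \<xi> to \<eta>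
    gives closeness i0 of its image to \<eta>0.\<close>
  define i1 where "i1 = i0 - a"
  obtain m0 where m0: "near k m0 \<eta>" using near_ex by blast
  define m where "m = min m0 i1"
  have \<xi>p: "near k m \<xi>" "near l i0 (tmapp k l A \<xi> - \<eta>0)" if "\<xi> \<in> bl k (Kn k) \<eta> i1" for \<xi>
  proof -
    have n: "near k i1 (\<xi> - \<eta>)" using that by (simp add: mem_bl)
    have "near k m (\<xi> - \<eta> + \<eta>)" by (intro near_add near_mono[OF n] near_mono[OF m0]) (auto simp: m_def)
    then show "near k m \<xi>" by simp
    show "near l i0 (tmapp k l A \<xi> - \<eta>0)" using a[OF n] \<eta>(2) by (simp add: tmapp_diff i1_def)
  qed
  \<comment> \<open>The gradient will be bounded at level i0 + \<open>ord c\<close>, while c \<xi>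
    has level m + \<open>ord c\<close>; the difference i0 - m is the gain that
    \<open>oscillation\<close> requires, and it does not depend on c.\<close>
  define cc where "cc = i0 - m"
  obtain J1 where J1: "\<And>x w t. x \<in> bl l (bl l (Kn l) w0 r) w0 J1 \<Longrightarrow> w \<in> bl l (bl l (Kn l) w0 r) w0 J1 \<Longrightarrow>
      near l t (x - w) \<Longrightarrow> near k (t + cc) (F x - F w - mapp k l A (x - w))"
    using sdD[OF F, of cc] by metis
  obtain J2 where J2: "\<And>j. J2 \<le> j \<Longrightarrow> bl l (Kn l) w0 j \<subseteq> U0" using bl_open_subset[OF U0(1,3)] by metis
  define J where "J = max J2 (max r J1)"
  have "\<exists>N. \<forall>u\<in>D. \<forall>c\<in>\<Lambda>. ord c < N \<longrightarrow>
      (\<forall>\<xi>\<in>bl k (Kn k) \<eta> i1. u (\<lambda>w. g w * \<psi> (dotp k (F w) (\<lambda>i. c * \<xi> i))) = 0)"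
    if j1: "J \<le> j1" and g: "g \<in> test_functions (bl l (Kn l) w0 j1)" for j1 g
  proof -
    let ?b = "bl l (Kn l) w0 j1"
    have bU: "?b \<subseteq> U0" by (rule J2) (use j1 in \<open>simp add: J_def\<close>)
    then have bW: "?b \<subseteq> W" using U0(2) by blast
    have err: "near k (t + cc) (F x - F w - mapp k l A (x - w))"
      if xw: "x \<in> ?b" "w \<in> ?b" "near l t (x - w)" for x w t
    proof -
      have "?b \<subseteq> bl l (bl l (Kn l) w0 r) w0 J1"
        using near_mono[of l j1 _ r] near_mono[of l j1 _ J1] j1 unfolding bl_def J_def by auto
      then show ?thesis using J1 xw by blast
    qed
    have gK: "g \<in> test_functions (Kn l)" by (rule tf_bl_extend[OF bl_subset order_refl g])
    obtain J' where J': "\<And>x y j. J' \<le> j \<Longrightarrow> y \<in> bl l (Kn l) x j \<Longrightarrow> x \<in> Kn l \<Longrightarrow> g y = g x"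
      using tf_level[OF order_refl gK] by metis
    have "ind l (Kn l) w0 j1 \<in> test_functions U0"
      by (rule tf_bl_extend[OF bU _ ind_test_bl]) (use U0 WK in blast)
    then obtain N1 where N1: "\<And>u c \<xi>. u \<in> D \<Longrightarrow> c \<in> \<Lambda> \<Longrightarrow> ord c < N1 \<Longrightarrow> \<xi> \<in> V0 \<Longrightarrow>
        fourier \<psi> l (ind l (Kn l) w0 j1) u (\<lambda>i. c * \<xi> i) = 0" using sm' by blast
    define N where "N = min N1 (min (1 - J' - i0) (1 - j1 - i0))"
    have "u (\<lambda>w. g w * \<psi> (dotp k (F w) (\<lambda>i. c * \<xi> i))) = 0"
      if u: "u \<in> D" and c: "c \<in> \<Lambda>" "ord c < N" and \<xi>: "\<xi> \<in> bl k (Kn k) \<eta> i1" for u c \<xi>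
    proof -
      have c0: "c \<noteq> 0" using Lam_props(1)[OF c(1)] .
      have cinv: "c * (inverse c * t) = t" for t using c0 by (simp flip: mult.assoc)
      let ?\<eta> = "\<lambda>i. c * \<xi> i"
      let ?\<theta> = "\<lambda>w. g w * \<psi> (dotp k (F w) ?\<eta>)"
      have \<theta>: "?\<theta> \<in> test_functions ?b" using tf_phase[OF g err, of 0 ?\<eta>] by simp
      obtain J3 where J3: "\<And>x y j. J3 \<le> j \<Longrightarrow> y \<in> bl l (Kn l) x j \<Longrightarrow> x \<in> Kn l \<Longrightarrow> ?\<theta> y = ?\<theta> x"
        using tf_level[OF order_refl tf_bl_extend[OF bl_subset order_refl \<theta>]] by metis
      let ?j = "max J3 j1"
      have uW: "u \<in> distributions W" using u D by blast
      have "u ?\<theta> = (\<Sum>\<zeta>\<in>reps l (1 - j1) (1 - ?j).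
         (qpow TYPE('k) (int l * j1) * iK l (\<lambda>w'. ?\<theta> w' * \<psi> (dotp l w' (- \<zeta>)))) *
         u (\<lambda>w. ind l (Kn l) w0 j1 w * \<psi> (dotp l w \<zeta>)))"
        by (rule distr_fourier[OF uW WK bW w0 \<theta> J3]) auto
      also have "\<dots> = 0"
      proof (rule sum.neutral, rule ballI)
        fix \<zeta> :: "'k kvec" assume "\<zeta> \<in> reps l (1 - j1) (1 - ?j)"
        then have \<zeta>K: "\<zeta> \<in> Kn l" by (rule reps_E(1)[OF psi]) simp
        let ?\<zeta> = "\<lambda>i. inverse c * \<zeta> i"
        show "(qpow TYPE('k) (int l * j1) * iK l (\<lambda>w'. ?\<theta> w' * \<psi> (dotp l w' (- \<zeta>)))) *
         u (\<lambda>w. ind l (Kn l) w0 j1 w * \<psi> (dotp l w \<zeta>)) = 0"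
        proof (cases "near l i0 (?\<zeta> - \<eta>0)")
          case True
          then have "?\<zeta> \<in> V0" using i0 Kn_scale[OF \<zeta>K] by (auto simp: mem_bl)
          from N1[OF u c(1) _ this] have "fourier \<psi> l (ind l (Kn l) w0 j1) u \<zeta> = 0"
            using c(2) by (simp add: N_def cinv)
          then show ?thesis by (simp add: fourier_def)
        next
          case False
          have "\<not> near l i0 (tmapp k l A \<xi> - ?\<zeta>)"
          proof
            assume "near l i0 (tmapp k l A \<xi> - ?\<zeta>)"
            from near_diff[OF \<xi>p(2)[OF \<xi>] this] show False using False by simp
          qed
          moreover have "(- \<zeta>) + tmapp k l A ?\<eta> = (\<lambda>i. c * (tmapp k l A \<xi> - ?\<zeta>) i)"
            by (auto simp: tmapp_scale right_diff_distrib cinv)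
          ultimately have nn: "\<not> near l (i0 + ord c) ((- \<zeta>) + tmapp k l A ?\<eta>)"
            by (rule not_near_scaled[OF c0, rotated])
          have n\<eta>: "near k (m + ord c) ?\<eta>" using near_scale_iff[OF c0, of k "m + ord c" \<xi>] \<xi>p(1)[OF \<xi>] by simp
          have "iK l (\<lambda>x. g x * \<psi> (dotp l x (- \<zeta>) + dotp k (F x) ?\<eta>)) = 0"
          proof (rule oscillation[OF gK, where J = J' and cc = cc and m = "m + ord c" and T = "i0 + ord c" and ?j2.0 = j1 and ?x0.0 = w0])
            show "g x = 0" if "x \<notin> bl l (Kn l) w0 j1" for x using that by (rule tfD(2)[OF g])
            show "g y = g x" if "J' \<le> j" "y \<in> bl l (Kn l) x j" "x \<in> Kn l" for x y j using that by (rule J')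
            show "near k (t + cc) (F x - F w - mapp k l A (x - w))"
              if "x \<in> bl l (Kn l) w0 j1" "w \<in> bl l (Kn l) w0 j1" "near l t (x - w)" for x w t using that by (rule err)
            show "i0 + ord c \<le> 1 - J'" "i0 + ord c \<le> 1 - j1" "i0 + ord c \<le> cc + (m + ord c)" using c(2) by (auto simp: N_def cc_def)
            show "near k (m + ord c) ?\<eta>" by (rule n\<eta>)
            show "\<not> near l (i0 + ord c) (- \<zeta> + tmapp k l A ?\<eta>)" by (rule nn)
          qed
          then show ?thesis by (simp add: psi_add[OF psi] algebra_simps)
        qed
      qed
      finally show ?thesis .
    qed
    then show ?thesis by blast
  qed
  then show ?thesis by blast
qed

text \<open>Both alternatives persist near a given direction: being mapped away from \<xi>0 by
  continuity, smoothness by its definition. A finite cover of C makes T, J and then, for each radius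
  j1, the bound N uniform. The target \<xi>0 is 0 for the existence of the pull-back and nonzero for
  its wave front set.\<close>

lemma dichotomy:
  assumes W: "openin (top_of_set (Kn k)) W" and y0: "y0 \<in> W"
    and C: "compact C" "C \<subseteq> Kn k"
    and dich: "\<And>\<theta>. \<theta> \<in> C \<Longrightarrow> tmapp k l A \<theta> \<noteq> \<xi>0 \<or> smooth_at_open \<psi> \<Lambda> k W D y0 \<theta>" and \<xi>0: "\<xi>0 \<in> Kn l"
  shows "\<exists>T J. \<forall>j1\<ge>J. \<exists>N. \<forall>\<theta>\<in>C. \<not> near l T (\<xi>0 - tmapp k l A \<theta>) \<or>
    (\<forall>u\<in>D. \<forall>c\<in>\<Lambda>. ord c < N \<longrightarrow> u (\<lambda>w. ind k (Kn k) y0 j1 w * \<psi> (dotp k w (\<lambda>i. c * \<theta> i))) = 0)"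
proof -
  let ?Z = "\<lambda>j1 N \<theta>. \<forall>u\<in>D. \<forall>c\<in>\<Lambda>. ord c < N \<longrightarrow> u (\<lambda>w. ind k (Kn k) y0 j1 w * \<psi> (dotp k w (\<lambda>i. c * \<theta> i))) = 0"
  have WK: "W \<subseteq> Kn k" using openin_imp_subset[OF W] .
  obtain a where a: "\<And>v j. near k j v \<Longrightarrow> near l (j + a) (tmapp k l A v)"
    unfolding tmapp_def using mapp_bound by metis
  have "\<exists>i T J. (\<forall>\<theta>'\<in>bl k (Kn k) \<theta> i. \<not> near l T (\<xi>0 - tmapp k l A \<theta>')) \<or> (\<forall>j1\<ge>J. \<exists>N. \<forall>\<theta>'\<in>bl k (Kn k) \<theta> i. ?Z j1 N \<theta>')"
    if \<theta>: "\<theta> \<in> C" for \<theta>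
  proof (cases "tmapp k l A \<theta> = \<xi>0")
    case False
    have "\<exists>t. \<not> near l t (\<xi>0 - tmapp k l A \<theta>)"
    proof (rule ccontr)
      assume "\<not> ?thesis"
      moreover have "\<xi>0 - tmapp k l A \<theta> \<in> Kn l" using \<xi>0 by (auto intro!: Kn_diff mapp_Kn simp: tmapp_def)
      ultimately have "\<xi>0 - tmapp k l A \<theta> = 0" using near_all_0 by blast
      then show False using False by simp
    qed
    then obtain t where t: "\<not> near l t (\<xi>0 - tmapp k l A \<theta>)" by blast
    have "\<not> near l t (\<xi>0 - tmapp k l A \<theta>')" if "\<theta>' \<in> bl k (Kn k) \<theta> (t - a)" for \<theta>'
    proof
      assume n: "near l t (\<xi>0 - tmapp k l A \<theta>')"
      have "near l (t - a + a) (tmapp k l A (\<theta>' - \<theta>))" using that by (intro a) (simp add: mem_bl)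
      then have "near l t (tmapp k l A \<theta>' - tmapp k l A \<theta>)" by (simp add: tmapp_diff)
      from near_add[OF n this] show False using t by simp
    qed
    then show ?thesis by blast
  next
    case True
    then have "smooth_at_open \<psi> \<Lambda> k W D y0 \<theta>" using dich[OF \<theta>] by blast
    then obtain U0 V0 where U0: "openin (top_of_set (Kn k)) U0" "U0 \<subseteq> W" "y0 \<in> U0"
      and V0: "openin (top_of_set (Kn k)) V0" "\<theta> \<in> V0"
      and sm: "\<And>\<phi>. \<phi> \<in> test_functions U0 \<Longrightarrow> \<exists>N. \<forall>u\<in>D. \<forall>c\<in>\<Lambda>. ord c < N \<longrightarrow>
             (\<forall>\<xi>\<in>V0. fourier \<psi> k \<phi> u (\<lambda>i. c * \<xi> i) = 0)"
      unfolding smooth_at_open_def by blast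
    obtain i where i: "bl k (Kn k) \<theta> i \<subseteq> V0" using V0 openin_iff_near[of "Kn k" k V0] by blast
    obtain J where J: "\<And>j. J \<le> j \<Longrightarrow> bl k (Kn k) y0 j \<subseteq> U0" using bl_open_subset[OF U0(1,3)] by metis
    have "\<exists>N. \<forall>\<theta>'\<in>bl k (Kn k) \<theta> i. ?Z j1 N \<theta>'" if "J \<le> j1" for j1
    proof -
      have "ind k (Kn k) y0 j1 \<in> test_functions U0"
        by (rule tf_bl_extend[OF J[OF that] _ ind_test_bl]) (use U0 WK in blast)
      from sm[OF this] obtain N where N: "\<forall>u\<in>D. \<forall>c\<in>\<Lambda>. ord c < N \<longrightarrow>
             (\<forall>\<xi>\<in>V0. fourier \<psi> k (ind k (Kn k) y0 j1) u (\<lambda>i. c * \<xi> i) = 0)" by blast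
      then show ?thesis using i unfolding fourier_def by blast
    qed
    then show ?thesis by blast
  qed
  then have "\<forall>\<theta>\<in>C. \<exists>i T J. (\<forall>\<theta>'\<in>bl k (Kn k) \<theta> i. \<not> near l T (\<xi>0 - tmapp k l A \<theta>')) \<or>
      (\<forall>j1\<ge>J. \<exists>N. \<forall>\<theta>'\<in>bl k (Kn k) \<theta> i. ?Z j1 N \<theta>')" by (intro ballI)
  from bchoice[OF this] obtain i where "\<forall>\<theta>\<in>C. \<exists>T J. (\<forall>\<theta>'\<in>bl k (Kn k) \<theta> (i \<theta>). \<not> near l T (\<xi>0 - tmapp k l A \<theta>')) \<or>
      (\<forall>j1\<ge>J. \<exists>N. \<forall>\<theta>'\<in>bl k (Kn k) \<theta> (i \<theta>). ?Z j1 N \<theta>')" ..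
  from bchoice[OF this] obtain T where "\<forall>\<theta>\<in>C. \<exists>J. (\<forall>\<theta>'\<in>bl k (Kn k) \<theta> (i \<theta>). \<not> near l (T \<theta>) (\<xi>0 - tmapp k l A \<theta>')) \<or>
      (\<forall>j1\<ge>J. \<exists>N. \<forall>\<theta>'\<in>bl k (Kn k) \<theta> (i \<theta>). ?Z j1 N \<theta>')" ..
  from bchoice[OF this] obtain J where iTJ: "\<forall>\<theta>\<in>C. (\<forall>\<theta>'\<in>bl k (Kn k) \<theta> (i \<theta>). \<not> near l (T \<theta>) (\<xi>0 - tmapp k l A \<theta>')) \<or>
      (\<forall>j1\<ge>J \<theta>. \<exists>N. \<forall>\<theta>'\<in>bl k (Kn k) \<theta> (i \<theta>). ?Z j1 N \<theta>')" ..
  obtain P where P: "P \<subseteq> C" "finite P" "C \<subseteq> (\<Union>x\<in>P. {y. near k (i x) (y - x)})"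
    using near_cover[OF C(1), of k i] by blast
  define T0 where "T0 = Max (insert 0 (T ` P))"
  define J0 where "J0 = Max (insert 0 (J ` P))"
  have "\<exists>N. \<forall>\<theta>\<in>C. \<not> near l T0 (\<xi>0 - tmapp k l A \<theta>) \<or> ?Z j1 N \<theta>" if j1: "J0 \<le> j1" for j1
  proof -
    have "\<forall>\<theta>\<in>P. \<exists>N. \<forall>\<theta>'\<in>bl k (Kn k) \<theta> (i \<theta>). \<not> near l (T \<theta>) (\<xi>0 - tmapp k l A \<theta>') \<or> ?Z j1 N \<theta>'"
    proof
      fix \<theta> assume \<theta>: "\<theta> \<in> P"
      have Jj: "J \<theta> \<le> j1" using \<theta> P(2) j1 by (auto simp: J0_def)
      have "\<theta> \<in> C" using \<theta> P(1) by blast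
      from bspec[OF iTJ this] show "\<exists>N. \<forall>\<theta>'\<in>bl k (Kn k) \<theta> (i \<theta>). \<not> near l (T \<theta>) (\<xi>0 - tmapp k l A \<theta>') \<or> ?Z j1 N \<theta>'"
      proof
        assume "\<forall>\<theta>'\<in>bl k (Kn k) \<theta> (i \<theta>). \<not> near l (T \<theta>) (\<xi>0 - tmapp k l A \<theta>')"
        then show ?thesis by blast
      next
        assume "\<forall>j1\<ge>J \<theta>. \<exists>N. \<forall>\<theta>'\<in>bl k (Kn k) \<theta> (i \<theta>). ?Z j1 N \<theta>'"
        then obtain N where "\<forall>\<theta>'\<in>bl k (Kn k) \<theta> (i \<theta>). ?Z j1 N \<theta>'" using Jj by blast
        then show ?thesis by blast
      qed
    qed
    from bchoice[OF this] obtain N where N': "\<forall>\<theta>\<in>P. \<forall>\<theta>'\<in>bl k (Kn k) \<theta> (i \<theta>).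
        \<not> near l (T \<theta>) (\<xi>0 - tmapp k l A \<theta>') \<or> ?Z j1 (N \<theta>) \<theta>'" ..
    have N: "\<not> near l (T \<theta>) (\<xi>0 - tmapp k l A \<theta>') \<or> ?Z j1 (N \<theta>) \<theta>'"
      if "\<theta> \<in> P" "\<theta>' \<in> bl k (Kn k) \<theta> (i \<theta>)" for \<theta> \<theta>' using N' that by blast
    define N0 where "N0 = Min (insert 0 (N ` P))"
    have "\<not> near l T0 (\<xi>0 - tmapp k l A \<theta>) \<or> ?Z j1 N0 \<theta>" if \<theta>: "\<theta> \<in> C" for \<theta>
    proof -
      obtain x where x: "x \<in> P" "near k (i x) (\<theta> - x)" using P(3) \<theta> by blast
      then have "\<theta> \<in> bl k (Kn k) x (i x)" using \<theta> C(2) by (auto simp: mem_bl)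
      from N[OF x(1) this] show ?thesis
      proof
        assume n: "\<not> near l (T x) (\<xi>0 - tmapp k l A \<theta>)"
        have "T x \<le> T0" unfolding T0_def using x P(2) by (intro Max_ge) auto
        then show ?thesis using n near_mono by blast
      next
        assume z: "?Z j1 (N x) \<theta>"
        have "N0 \<le> N x" unfolding N0_def using x P(2) by (intro Min_le) auto
        then show ?thesis using z by (meson less_le_trans)
      qed
    qed
    then show ?thesis by blast
  qed
  then show ?thesis by blast
qed

end

section \<open>Pull-back in coordinates\<close>

text \<open>The situation read in isometric charts: F is the map with derivative A at x0, and G is
  the set of coordinate directions of \<Gamma> over y0. Off G the set D is uniformly smooth; on G
  the transposed derivative has no kernel, which is the condition on the conormal set.\<close>

context
  fixes \<psi> :: "'k::nonarch_local_field \<Rightarrow> complex" and \<Lambda> :: "'k set"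
    and k l :: nat and W :: "'k kvec set" and D :: "'k distr set" and y0 x0 :: "'k kvec"
    and F :: "'k kvec \<Rightarrow> 'k kvec" and A :: "nat \<Rightarrow> nat \<Rightarrow> 'k" and r :: int and G :: "'k kvec set"
  assumes psi: "additive_character \<psi>" and Lam: "open_finite_index_subgroup \<Lambda>"
    and W: "openin (top_of_set (Kn k)) W" and D: "D \<subseteq> distributions W" and y0: "y0 \<in> W"
    and x0: "x0 \<in> Kn l" and Fx0: "F x0 = y0" and FK: "F ` bl l (Kn l) x0 r \<subseteq> Kn k"
    and F: "sd l k (bl l (Kn l) x0 r) F A x0"
    and G: "\<And>\<theta>. \<theta> \<in> Kn k \<Longrightarrow> \<theta> \<noteq> 0 \<Longrightarrow> \<theta> \<notin> G \<Longrightarrow> smooth_at_open \<psi> \<Lambda> k W D y0 \<theta>"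
    and G0: "\<And>\<theta>. \<theta> \<in> Kn k \<Longrightarrow> \<theta> \<noteq> 0 \<Longrightarrow> \<theta> \<in> G \<Longrightarrow> tmapp k l A \<theta> \<noteq> 0"
begin

definition uhat :: "'k distr \<Rightarrow> int \<Rightarrow> 'k kvec \<Rightarrow> complex" where
  "uhat u j1 \<eta> = u (\<lambda>w. ind k (Kn k) y0 j1 w * \<psi> (dotp k w \<eta>))"

lemma WK: "W \<subseteq> Kn k"
  using openin_imp_subset[OF W] .

lemma y0K: "y0 \<in> Kn k"
  using WK y0 by blast

lemma err_level:
  obtains J where "\<And>j2 x w t. J \<le> j2 \<Longrightarrow> x \<in> bl l (Kn l) x0 j2 \<Longrightarrow> w \<in> bl l (Kn l) x0 j2 \<Longrightarrow> near l t (x - w) \<Longrightarrow>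
      near k (t + cc) (F x - F w - mapp k l A (x - w))" "r \<le> J"
proof -
  obtain J1 where J1: "\<And>x w t. x \<in> bl l (bl l (Kn l) x0 r) x0 J1 \<Longrightarrow> w \<in> bl l (bl l (Kn l) x0 r) x0 J1 \<Longrightarrow>
      near l t (x - w) \<Longrightarrow> near k (t + cc) (F x - F w - mapp k l A (x - w))"
    using sdD[OF F, of cc] by metis
  have "bl l (Kn l) x0 j2 \<subseteq> bl l (bl l (Kn l) x0 r) x0 J1" if "max r J1 \<le> j2" for j2
    using that near_mono[of l j2 _ r] near_mono[of l j2 _ J1] unfolding bl_def by auto
  then have s: "x \<in> bl l (bl l (Kn l) x0 r) x0 J1" if "max r J1 \<le> j2" "x \<in> bl l (Kn l) x0 j2" for x j2
    using that by blast
  show ?thesis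
  proof (rule that[of "max r J1"])
    show "near k (t + cc) (F x - F w - mapp k l A (x - w))"
      if "max r J1 \<le> j2" "x \<in> bl l (Kn l) x0 j2" "w \<in> bl l (Kn l) x0 j2" "near l t (x - w)" for j2 x w t
      by (rule J1[OF s[OF that(1,2)] s[OF that(1,3)] that(4)])
  qed simp
qed

text \<open>The scaled value of u on the ball around F x is an average of u. Frequencies of level 1
  - j are constant on that ball, so the coefficients of its indicator are its volume times a
  character at F x; only the Fourier transform of u cut off at radius j1 and oscillatory integrals
  remain.\<close>

lemma average_expansion:
  assumes u: "u \<in> D" and b1: "bl k (Kn k) y0 j1 \<subseteq> W" and j: "j1 \<le> j"
    and g: "g \<in> test_functions (bl l (Kn l) x0 j2)" and Fb: "F ` bl l (Kn l) x0 j2 \<subseteq> bl k (Kn k) y0 j1"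
    and err: "\<And>x w t. x \<in> bl l (Kn l) x0 j2 \<Longrightarrow> w \<in> bl l (Kn l) x0 j2 \<Longrightarrow> near l t (x - w) \<Longrightarrow>
      near k (t + cc) (F x - F w - mapp k l A (x - w))"
  shows "iK l (\<lambda>x. g x * \<psi> (dotp l x \<zeta>) * (qpow TYPE('k) (int k * j) * u (ind k (Kn k) (F x) j))) =
    (\<Sum>\<eta>\<in>reps k (1 - j1) (1 - j). (qpow TYPE('k) (int k * j1) * uhat u j1 \<eta>) *
      iK l (\<lambda>x. g x * \<psi> (dotp l x \<zeta> + dotp k (F x) (- \<eta>))))"
proof -
  let ?R = "reps k (1 - j1) (1 - j) :: 'k kvec set" let ?q = "qpow TYPE('k)"
  have uW: "u \<in> distributions W" using u D by blast
  have av: "?q (int k * j) * u (ind k (Kn k) (F x) j) =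
      (\<Sum>\<eta>\<in>?R. (?q (int k * j1) * uhat u j1 \<eta>) * \<psi> (dotp k (F x) (- \<eta>)))" if x: "x \<in> bl l (Kn l) x0 j2" for x
  proof -
    have Fx: "F x \<in> bl k (Kn k) y0 j1" using Fb x by blast
    then have FxK: "F x \<in> Kn k" by (simp add: mem_bl)
    have sub: "bl k (Kn k) (F x) j \<subseteq> bl k (Kn k) y0 j1" by (rule bl_mono[OF j Fx])
    have t: "ind k (Kn k) (F x) j \<in> test_functions (bl k (Kn k) y0 j1)"
      by (rule tf_bl_extend[OF psi Lam sub bl_subset ind_test_bl[OF psi Lam]])
    have c: "ind k (Kn k) (F x) j y = ind k (Kn k) (F x) j a" if "y \<in> bl k (Kn k) a j" "a \<in> Kn k" for a y :: "'k kvec"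
    proof -
      have "bl k (Kn k) y j = bl k (Kn k) a j" by (rule bl_eq_mem[OF that(1)])
      moreover have "y \<in> Kn k" using that(1) by (simp add: mem_bl)
      ultimately show ?thesis
        using that(2) bl_self[of y "Kn k" k j] bl_self[of a "Kn k" k j] bl_eq_mem[of y k "Kn k" "F x" j] bl_eq_mem[of a k "Kn k" "F x" j]
        unfolding ind_def by metis
    qed
    have co: "iK k (\<lambda>w'. ind k (Kn k) (F x) j w' * \<psi> (dotp k w' (- \<eta>))) = ?q (- (int k * j)) * \<psi> (dotp k (F x) (- \<eta>))"
      if "\<eta> \<in> ?R" for \<eta>
    proof -
      have n: "near k (1 - j) \<eta>" using reps_E(2)[OF psi that] j by simp
      have "(\<lambda>w'. ind k (Kn k) (F x) j w' * \<psi> (dotp k w' (- \<eta>))) = (\<lambda>w'. \<psi> (dotp k (F x) (- \<eta>)) * ind k (Kn k) (F x) j w')"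
      proof
        fix w'
        show "ind k (Kn k) (F x) j w' * \<psi> (dotp k w' (- \<eta>)) = \<psi> (dotp k (F x) (- \<eta>)) * ind k (Kn k) (F x) j w'"
        proof (cases "w' \<in> bl k (Kn k) (F x) j")
          case True
          have "vge (j + (1 - j)) (dotp k (w' - F x) (- \<eta>))" using True n by (intro vge_dotp) (simp_all add: mem_bl)
          then have "\<psi> (dotp k w' (- \<eta>)) = \<psi> (dotp k (F x) (- \<eta>))" by (intro psi_eq[OF psi]) (simp add: dotp_diff_left)
          then show ?thesis by simp
        qed (simp add: ind_def)
      qed
      then show ?thesis using iK_ind[OF FxK, of j] by (simp add: cint_scale)
    qed
    have "u (ind k (Kn k) (F x) j) = (\<Sum>\<eta>\<in>?R. (?q (int k * j1) * iK k (\<lambda>w'. ind k (Kn k) (F x) j w' * \<psi> (dotp k w' (- \<eta>)))) *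
       u (\<lambda>w. ind k (Kn k) y0 j1 w * \<psi> (dotp k w \<eta>)))"
      by (rule distr_fourier[OF psi Lam uW WK b1 y0K t _ j]) (rule c)
    also have "\<dots> = (\<Sum>\<eta>\<in>?R. ?q (- (int k * j)) * ((?q (int k * j1) * uhat u j1 \<eta>) * \<psi> (dotp k (F x) (- \<eta>))))"
      by (rule sum.cong[OF refl], subst co, assumption) (simp add: uhat_def algebra_simps)
    finally have "u (ind k (Kn k) (F x) j) = ?q (- (int k * j)) * (\<Sum>\<eta>\<in>?R. (?q (int k * j1) * uhat u j1 \<eta>) * \<psi> (dotp k (F x) (- \<eta>)))"
      by (simp only: sum_distrib_left)
    then show ?thesis by (simp flip: mult.assoc qpow_add)
  qed
  have e: "g x * \<psi> (dotp l x \<zeta>) * (?q (int k * j) * u (ind k (Kn k) (F x) j)) =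
      (\<Sum>\<eta>\<in>?R. (?q (int k * j1) * uhat u j1 \<eta>) * (g x * \<psi> (dotp l x \<zeta> + dotp k (F x) (- \<eta>))))" for x
  proof (cases "x \<in> bl l (Kn l) x0 j2")
    case True
    show ?thesis unfolding av[OF True] by (simp add: sum_distrib_left psi_add[OF psi] algebra_simps)
  next
    case False
    then show ?thesis using tfD(2)[OF g] by simp
  qed
  show ?thesis
    unfolding e
  proof (rule cint_sum[OF submanifold_Kn])
    fix \<eta>
    show "(\<lambda>x. g x * \<psi> (dotp l x \<zeta> + dotp k (F x) (- \<eta>))) \<in> test_functions (Kn l)"
      by (rule tf_bl_extend[OF psi Lam bl_subset order_refl], rule tf_phase[OF psi Lam g]) (rule err)
  qed
qed

text \<open>Scaling by \<Lambda> moves \<eta> into a compact shell, where \<open>dichotomy\<close>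
  with target 0 applies: either the coefficient of u vanishes, or the transpose of A at \<eta> is
  not small relative to \<eta>. The phase \<zeta> is allowed as long as it is R levels smaller than
  \<eta>, so that it cannot cancel this gradient.\<close>

lemma large_frequencies:
  "\<exists>J1 J2 R. r \<le> J2 \<and> (\<forall>j1\<ge>J1. \<forall>j2\<ge>J2. \<forall>g\<in>test_functions (bl l (Kn l) x0 j2). \<exists>M. \<forall>\<eta>\<in>Kn k. \<forall>\<zeta>.
     \<not> near k M \<eta> \<longrightarrow> (\<forall>t. near k t \<eta> \<longrightarrow> near l (t + R) \<zeta>) \<longrightarrow>
     (\<forall>u\<in>D. uhat u j1 \<eta> = 0) \<or> iK l (\<lambda>x. g x * \<psi> (dotp l x \<zeta> + dotp k (F x) (- \<eta>))) = 0)"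
proof -
  obtain e where e: "0 < e" "\<And>s. \<exists>c\<in>\<Lambda>. ord c = - (e * s)" using Lam_negative[OF psi Lam] by blast
  \<comment> \<open>Vectors whose exact level lies between 1 - e and 0, one value for each residue
    modulo e; every nonzero vector is a multiple of one of them by an element of \<Lambda>.\<close>
  define C where "C = bl k (Kn k) 0 (1 - e) \<inter> - {y::'k kvec. near k 1 (y - 0)}"
  have C: "compact C"
    unfolding C_def using open_near[of k 1 "0::'k kvec"] by (intro compact_Int_closed compact_bl_Kn) (simp add: closed_Compl)
  have CK: "C \<subseteq> Kn k" by (auto simp: C_def mem_bl)
  have dich: "tmapp k l A \<theta> \<noteq> 0 \<or> smooth_at_open \<psi> \<Lambda> k W D y0 \<theta>" if "\<theta> \<in> C" for \<theta>
  proof -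
    have "\<theta> \<in> Kn k" "\<theta> \<noteq> 0" using that by (auto simp: C_def mem_bl)
    then show ?thesis using G G0 by blast
  qed
  from dichotomy[OF psi Lam W y0 C CK dich Kn_0] obtain T J1 where TJ: "\<And>j1. J1 \<le> j1 \<Longrightarrow> \<exists>N. \<forall>\<theta>\<in>C. \<not> near l T (0 - tmapp k l A \<theta>) \<or>
    (\<forall>u\<in>D. \<forall>c\<in>\<Lambda>. ord c < N \<longrightarrow> u (\<lambda>w. ind k (Kn k) y0 j1 w * \<psi> (dotp k w (\<lambda>i. c * \<theta> i))) = 0)"
    by blast
  \<comment> \<open>The scaling factor used below has valuation at most t + e - 1 when \<eta> has
    exact level t, so this gain suffices for a gradient bounded at level T plus that valuation. The
    same number serves as R.\<close>
  define cc where "cc = T + e - 1"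
  obtain J2 where J2: "\<And>j2 x w t. J2 \<le> j2 \<Longrightarrow> x \<in> bl l (Kn l) x0 j2 \<Longrightarrow> w \<in> bl l (Kn l) x0 j2 \<Longrightarrow> near l t (x - w) \<Longrightarrow>
      near k (t + cc) (F x - F w - mapp k l A (x - w))" and rJ2: "r \<le> J2"
    using err_level[of cc] by blast
  have "\<exists>M. \<forall>\<eta>\<in>Kn k. \<forall>\<zeta>. \<not> near k M \<eta> \<longrightarrow> (\<forall>t. near k t \<eta> \<longrightarrow> near l (t + (T + e - 1)) \<zeta>) \<longrightarrow>
     (\<forall>u\<in>D. uhat u j1 \<eta> = 0) \<or> iK l (\<lambda>x. g x * \<psi> (dotp l x \<zeta> + dotp k (F x) (- \<eta>))) = 0"
    if j1: "J1 \<le> j1" and j2: "J2 \<le> j2" and g: "g \<in> test_functions (bl l (Kn l) x0 j2)" for j1 j2 g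
  proof -
    obtain N where N: "\<And>\<theta>. \<theta> \<in> C \<Longrightarrow> \<not> near l T (0 - tmapp k l A \<theta>) \<or>
      (\<forall>u\<in>D. \<forall>c\<in>\<Lambda>. ord c < N \<longrightarrow> u (\<lambda>w. ind k (Kn k) y0 j1 w * \<psi> (dotp k w (\<lambda>i. c * \<theta> i))) = 0)"
      using TJ[OF j1] by blast
    have gK: "g \<in> test_functions (Kn l)" by (rule tf_bl_extend[OF psi Lam bl_subset order_refl g])
    obtain J' where J': "\<And>x y j. J' \<le> j \<Longrightarrow> y \<in> bl l (Kn l) x j \<Longrightarrow> x \<in> Kn l \<Longrightarrow> g y = g x"
      using tf_level[OF psi Lam order_refl gK] by metis
    \<comment> \<open>As t < M, the scaling factor has valuation below M + e - 1, the minimum taken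
      here; its entries are the vanishing bound N and the conditions of \<open>oscillation\<close>
      on J' and j2.\<close>
    define M where "M = min N (min (2 - T - J') (2 - T - j2)) + 1 - e"
    have "(\<forall>u\<in>D. uhat u j1 \<eta> = 0) \<or> iK l (\<lambda>x. g x * \<psi> (dotp l x \<zeta> + dotp k (F x) (- \<eta>))) = 0"
      if \<eta>: "\<eta> \<in> Kn k" "\<not> near k M \<eta>" and \<zeta>: "\<And>t. near k t \<eta> \<Longrightarrow> near l (t + (T + e - 1)) \<zeta>" for \<eta> \<zeta>
    proof -
      obtain t where t: "t < M" "near k t \<eta>" "\<not> near k (t + 1) \<eta>" using near_exact[OF \<eta>(2)] by metis
      define s where "s = - (t div e)"
      obtain c where c: "c \<in> \<Lambda>" "ord c = - (e * s)" using e(2) by blast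
      have c0: "c \<noteq> 0" using Lam_props(1)[OF psi Lam c(1)] .
      have oc: "ord c = t - t mod e" using minus_mod_eq_mult_div[of t e] c(2) by (simp add: s_def)
      have tm: "0 \<le> t mod e" "t mod e < e" using e(1) by simp_all
      define \<theta> where "\<theta> = (\<lambda>i. inverse c * \<eta> i)"
      have \<eta>\<theta>: "\<eta> = (\<lambda>i. c * \<theta> i)" using c0 by (auto simp: \<theta>_def simp flip: mult.assoc)
      have \<theta>K: "\<theta> \<in> Kn k" unfolding \<theta>_def by (rule Kn_scale[OF \<eta>(1)])
      have n\<theta>: "near k j \<theta> \<longleftrightarrow> near k (j + ord c) \<eta>" for j
        unfolding \<eta>\<theta> using near_scale_iff[OF c0, of k "j + ord c" \<theta>] by simp
      have "near k (t mod e) \<theta>" using t(2) by (simp add: n\<theta> oc)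
      moreover have "\<not> near k (t mod e + 1) \<theta>" using t(3) by (simp add: n\<theta> oc add.commute)
      ultimately have th: "near k (t mod e) \<theta>" "\<not> near k (t mod e + 1) \<theta>" by blast+
      define c' where "c' = t mod e"
      \<comment> \<open>If e does not divide t, scaling by c leaves a positive level, outside the
        shell; d shifts by one more period e and brings it down to t mod e - e.\<close>
      obtain d where d: "d \<in> \<Lambda>" "ord d = - (e * (s - 1))" using e(2) by blast
      show ?thesis
      proof (cases "c' = 0")
        case True
        have "\<theta> \<in> C" using th True e(1) \<theta>K near_mono[of k 0 \<theta> "1 - e"] by (auto simp: C_def mem_bl c'_def)
        from N[OF this] show ?thesis
        proof
          assume "\<forall>u\<in>D. \<forall>c\<in>\<Lambda>. ord c < N \<longrightarrow> u (\<lambda>w. ind k (Kn k) y0 j1 w * \<psi> (dotp k w (\<lambda>i. c * \<theta> i))) = 0"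
          moreover have "ord c < N" using oc t(1) True e(1) by (simp add: M_def c'_def)
          ultimately show ?thesis using c(1) by (simp add: uhat_def \<eta>\<theta>)
        next
          assume n: "\<not> near l T (0 - tmapp k l A \<theta>)"
          have "tmapp k l A (- \<eta>) = (\<lambda>i. c * (0 - tmapp k l A \<theta>) i)"
            by (simp add: \<eta>\<theta> tmapp_uminus[OF psi Lam] tmapp_scale[OF psi Lam] fun_eq_iff)
          then have nn: "\<not> near l (T + ord c) (tmapp k l A (- \<eta>))"
            by (rule not_near_scaled[OF c0 _ n])
          have "near l (T + ord c) \<zeta>" using near_mono[OF \<zeta>[OF t(2)]] oc True e(1) by (simp add: c'_def)
          have ns: "\<not> near l (T + ord c) (\<zeta> + tmapp k l A (- \<eta>))"
          proof
            assume "near l (T + ord c) (\<zeta> + tmapp k l A (- \<eta>))"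
            from near_diff[OF this \<open>near l (T + ord c) \<zeta>\<close>] show False using nn by simp
          qed
          have "iK l (\<lambda>x. g x * \<psi> (dotp l x \<zeta> + dotp k (F x) (- \<eta>))) = 0"
            proof (rule oscillation[OF psi Lam gK, where J = J' and cc = cc and m = "t" and T = "T + ord c" and ?j2.0 = j2 and ?x0.0 = x0])
              show "g x = 0" if "x \<notin> bl l (Kn l) x0 j2" for x using that by (rule tfD(2)[OF g])
              show "g y = g x" if "J' \<le> j" "y \<in> bl l (Kn l) x j" "x \<in> Kn l" for x y j using that by (rule J')
              show "near k (t + cc) (F x - F w - mapp k l A (x - w))"
                if "x \<in> bl l (Kn l) x0 j2" "w \<in> bl l (Kn l) x0 j2" "near l t (x - w)" for x w t using that by (rule J2[OF j2])
              show "T + ord c \<le> 1 - J'" "T + ord c \<le> 1 - j2" "T + ord c \<le> cc + (t)" using t(1,2) oc True e(1) by (auto simp: M_def cc_def c'_def)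
              show "near k (t) (- \<eta>)" using t(2) by simp
              show "\<not> near l (T + ord c) (\<zeta> + tmapp k l A (- \<eta>))" by (rule ns)
            qed
          then show ?thesis by blast
        qed
      next
        case False
        define \<theta>' where "\<theta>' = (\<lambda>i. inverse d * \<eta> i)"
        have d0: "d \<noteq> 0" using Lam_props(1)[OF psi Lam d(1)] .
        have \<eta>\<theta>': "\<eta> = (\<lambda>i. d * \<theta>' i)" using d0 by (auto simp: \<theta>'_def simp flip: mult.assoc)
        have \<theta>'K: "\<theta>' \<in> Kn k" unfolding \<theta>'_def by (rule Kn_scale[OF \<eta>(1)])
        have od: "ord d = t - c' + e" using oc c(2) d(2) by (simp add: c'_def algebra_simps)
        have n\<theta>': "near k j \<theta>' \<longleftrightarrow> near k (j + ord d) \<eta>" for j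
          unfolding \<eta>\<theta>' using near_scale_iff[OF d0, of k "j + ord d" \<theta>'] by simp
        have cb: "0 < c'" "c' < e" using False tm by (auto simp: c'_def)
        have "near k (c' - e) \<theta>'" "\<not> near k (c' - e + 1) \<theta>'" using t(2,3) by (simp_all add: n\<theta>' od add.commute)
        then have "near k (1 - e) \<theta>'" "\<not> near k 1 \<theta>'"
          using near_mono[of k "c' - e" \<theta>' "1 - e"] near_mono[of k 1 \<theta>' "c' - e + 1"] cb by auto
        then have "\<theta>' \<in> C" using \<theta>'K by (simp add: C_def mem_bl)
        from N[OF this] show ?thesis
        proof
          assume "\<forall>u\<in>D. \<forall>c\<in>\<Lambda>. ord c < N \<longrightarrow> u (\<lambda>w. ind k (Kn k) y0 j1 w * \<psi> (dotp k w (\<lambda>i. c * \<theta>' i))) = 0"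
          moreover have "ord d < N" using od t(1) cb by (simp add: M_def)
          ultimately show ?thesis using d(1) by (simp add: uhat_def \<eta>\<theta>')
        next
          assume n: "\<not> near l T (0 - tmapp k l A \<theta>')"
          have "tmapp k l A (- \<eta>) = (\<lambda>i. d * (0 - tmapp k l A \<theta>') i)"
            by (simp add: \<eta>\<theta>' tmapp_uminus[OF psi Lam] tmapp_scale[OF psi Lam] fun_eq_iff)
          then have nn: "\<not> near l (T + ord d) (tmapp k l A (- \<eta>))"
            by (rule not_near_scaled[OF d0 _ n])
          have "near l (T + ord d) \<zeta>" using near_mono[OF \<zeta>[OF t(2)]] od cb by simp
          have ns: "\<not> near l (T + ord d) (\<zeta> + tmapp k l A (- \<eta>))"
          proof
            assume "near l (T + ord d) (\<zeta> + tmapp k l A (- \<eta>))"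
            from near_diff[OF this \<open>near l (T + ord d) \<zeta>\<close>] show False using nn by simp
          qed
          have "iK l (\<lambda>x. g x * \<psi> (dotp l x \<zeta> + dotp k (F x) (- \<eta>))) = 0"
            proof (rule oscillation[OF psi Lam gK, where J = J' and cc = cc and m = "t" and T = "T + ord d" and ?j2.0 = j2 and ?x0.0 = x0])
              show "g x = 0" if "x \<notin> bl l (Kn l) x0 j2" for x using that by (rule tfD(2)[OF g])
              show "g y = g x" if "J' \<le> j" "y \<in> bl l (Kn l) x j" "x \<in> Kn l" for x y j using that by (rule J')
              show "near k (t + cc) (F x - F w - mapp k l A (x - w))"
                if "x \<in> bl l (Kn l) x0 j2" "w \<in> bl l (Kn l) x0 j2" "near l t (x - w)" for x w t using that by (rule J2[OF j2])
              show "T + ord d \<le> 1 - J'" "T + ord d \<le> 1 - j2" "T + ord d \<le> cc + (t)" using t(1,2) od cb by (auto simp: M_def cc_def)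
              show "near k (t) (- \<eta>)" using t(2) by simp
              show "\<not> near l (T + ord d) (\<zeta> + tmapp k l A (- \<eta>))" by (rule ns)
            qed
          then show ?thesis by blast
        qed
      qed
    qed
    then show ?thesis by blast
  qed
  then show ?thesis using rJ2 by blast
qed

text \<open>The cut-off radius j1 on the target is fixed first, inside W. Then continuity of F and
  the error estimate determine j2 on the source.\<close>

lemma good_radii:
  obtains j1 j2 where "J1 \<le> j1" "J2 \<le> j2" "r \<le> j2" "bl k (Kn k) y0 j1 \<subseteq> W" "F ` bl l (Kn l) x0 j2 \<subseteq> bl k (Kn k) y0 j1"
    "\<And>x w t. x \<in> bl l (Kn l) x0 j2 \<Longrightarrow> w \<in> bl l (Kn l) x0 j2 \<Longrightarrow> near l t (x - w) \<Longrightarrow>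
      near k (t + cc) (F x - F w - mapp k l A (x - w))"
proof -
  obtain J where J: "\<And>j. J \<le> j \<Longrightarrow> bl k (Kn k) y0 j \<subseteq> W" using bl_open_subset[OF psi Lam W y0] by metis
  define j1 where "j1 = max J J1"
  have xb: "x0 \<in> bl l (Kn l) x0 r" by (rule bl_self[OF x0])
  obtain J3 where J3: "\<And>x. x \<in> bl l (bl l (Kn l) x0 r) x0 J3 \<Longrightarrow> near k j1 (F x - y0)"
    using sd_cont[OF F xb, of j1] Fx0 by metis
  obtain J4 where J4: "\<And>j2 x w t. J4 \<le> j2 \<Longrightarrow> x \<in> bl l (Kn l) x0 j2 \<Longrightarrow> w \<in> bl l (Kn l) x0 j2 \<Longrightarrow> near l t (x - w) \<Longrightarrow>
      near k (t + cc) (F x - F w - mapp k l A (x - w))" and "r \<le> J4"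
    using err_level[of cc] by blast
  define j2 where "j2 = max (max J2 J3) (max J4 r)"
  have sub: "bl l (Kn l) x0 j2 \<subseteq> bl l (bl l (Kn l) x0 r) x0 J3"
  proof
    fix x assume "x \<in> bl l (Kn l) x0 j2"
    then have x: "x \<in> Kn l" "near l j2 (x - x0)" by (simp_all add: mem_bl)
    have "near l r (x - x0)" "near l J3 (x - x0)" by (rule near_mono[OF x(2)], simp add: j2_def)+
    then show "x \<in> bl l (bl l (Kn l) x0 r) x0 J3" using x(1) by (simp add: mem_bl)
  qed
  have "F ` bl l (Kn l) x0 j2 \<subseteq> bl k (Kn k) y0 j1"
  proof
    fix y assume "y \<in> F ` bl l (Kn l) x0 j2"
    then obtain x where x: "x \<in> bl l (Kn l) x0 j2" "y = F x" by blast
    then have xJ: "x \<in> bl l (bl l (Kn l) x0 r) x0 J3" using sub by blast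
    then have "x \<in> bl l (Kn l) x0 r" using bl_subset by blast
    then have "F x \<in> Kn k" using FK by blast
    then show "y \<in> bl k (Kn k) y0 j1" using J3[OF xJ] x by (simp add: mem_bl)
  qed
  then have Fb: "F ` bl l (Kn l) x0 j2 \<subseteq> bl k (Kn k) y0 j1" .
  show ?thesis
  proof (rule that[of j1 j2])
    show "near k (t + cc) (F x - F w - mapp k l A (x - w))"
      if "x \<in> bl l (Kn l) x0 j2" "w \<in> bl l (Kn l) x0 j2" "near l t (x - w)" for x w t
      using that by (rule J4[rotated]) (simp add: j2_def)
    show "bl k (Kn k) y0 j1 \<subseteq> W" by (rule J) (simp add: j1_def)
  qed (use Fb in \<open>simp_all add: j1_def j2_def\<close>)
qed

text \<open>By the expansion, raising the level only adds terms with large \<eta>. With \<zeta> = 0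
  each of them vanishes, through u or through the integral, at a threshold common to all u in
  D.\<close>

theorem pullback_stable:
  "\<exists>j2\<ge>r. \<forall>g\<in>test_functions (bl l (Kn l) x0 j2). \<exists>j0. \<forall>j\<ge>j0. \<forall>u\<in>D.
    iK l (\<lambda>x. g x * (qpow TYPE('k) (int k * j) * u (ind k (Kn k) (F x) j))) =
    iK l (\<lambda>x. g x * (qpow TYPE('k) (int k * j0) * u (ind k (Kn k) (F x) j0)))"
proof -
  obtain J1 J2 R where L: "r \<le> J2" "\<And>j1 j2 g. J1 \<le> j1 \<Longrightarrow> J2 \<le> j2 \<Longrightarrow> g \<in> test_functions (bl l (Kn l) x0 j2) \<Longrightarrow> \<exists>M. \<forall>\<eta>\<in>Kn k. \<forall>\<zeta>.
     \<not> near k M \<eta> \<longrightarrow> (\<forall>t. near k t \<eta> \<longrightarrow> near l (t + R) \<zeta>) \<longrightarrow>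
     (\<forall>u\<in>D. uhat u j1 \<eta> = 0) \<or> iK l (\<lambda>x. g x * \<psi> (dotp l x \<zeta> + dotp k (F x) (- \<eta>))) = 0"
    using large_frequencies by blast
  obtain j1 j2 where j: "J1 \<le> j1" "J2 \<le> j2" "r \<le> j2" "bl k (Kn k) y0 j1 \<subseteq> W" "F ` bl l (Kn l) x0 j2 \<subseteq> bl k (Kn k) y0 j1"
    and err: "\<And>x w t. x \<in> bl l (Kn l) x0 j2 \<Longrightarrow> w \<in> bl l (Kn l) x0 j2 \<Longrightarrow> near l t (x - w) \<Longrightarrow>
      near k (t + 0) (F x - F w - mapp k l A (x - w))"
    using good_radii[of J1 J2 0] by blast
  have "\<exists>j0. \<forall>j\<ge>j0. \<forall>u\<in>D.
    iK l (\<lambda>x. g x * (qpow TYPE('k) (int k * j) * u (ind k (Kn k) (F x) j))) =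
    iK l (\<lambda>x. g x * (qpow TYPE('k) (int k * j0) * u (ind k (Kn k) (F x) j0)))"
    if g: "g \<in> test_functions (bl l (Kn l) x0 j2)" for g
  proof -
    obtain M where M: "\<And>\<eta> \<zeta>. \<eta> \<in> Kn k \<Longrightarrow> \<not> near k M \<eta> \<Longrightarrow> (\<forall>t. near k t \<eta> \<longrightarrow> near l (t + R) \<zeta>) \<Longrightarrow>
     (\<forall>u\<in>D. uhat u j1 \<eta> = 0) \<or> iK l (\<lambda>x. g x * \<psi> (dotp l x \<zeta> + dotp k (F x) (- \<eta>))) = 0"
      using L(2)[OF j(1,2) g] by blast
    \<comment> \<open>A frequency present at level i but not at level j0 fails level 1 - j0, hence
      level M, where \<open>large_frequencies\<close> begins.\<close>
    define j0 where "j0 = max j1 (1 - M)"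
    have "iK l (\<lambda>x. g x * (qpow TYPE('k) (int k * i) * u (ind k (Kn k) (F x) i))) =
      iK l (\<lambda>x. g x * (qpow TYPE('k) (int k * j0) * u (ind k (Kn k) (F x) j0)))"
      if i: "j0 \<le> i" and u: "u \<in> D" for i u
    proof -
      let ?t = "\<lambda>\<eta>. (qpow TYPE('k) (int k * j1) * uhat u j1 \<eta>) * iK l (\<lambda>x. g x * \<psi> (dotp l x 0 + dotp k (F x) (- \<eta>)))"
      have ex: "iK l (\<lambda>x. g x * (qpow TYPE('k) (int k * i) * u (ind k (Kn k) (F x) i))) = sum ?t (reps k (1 - j1) (1 - i))"
        if "j1 \<le> i" for i
      proof -
        have "iK l (\<lambda>x. g x * \<psi> (dotp l x 0) * (qpow TYPE('k) (int k * i) * u (ind k (Kn k) (F x) i))) = sum ?t (reps k (1 - j1) (1 - i))"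
          by (rule average_expansion[OF u j(4) that g j(5)]) (rule err)
        then show ?thesis using psi_0[OF psi] by simp
      qed
      have j01: "j1 \<le> j0" "j1 \<le> i" using i by (auto simp: j0_def)
      have "sum ?t (reps k (1 - j1) (1 - i)) = sum ?t (reps k (1 - j1) (1 - j0))"
      proof (rule sum.mono_neutral_right)
        show "finite (reps k (1 - j1) (1 - i) :: 'k kvec set)" using reps_card(1)[OF psi] j01 by simp
        show "reps k (1 - j1) (1 - j0) \<subseteq> (reps k (1 - j1) (1 - i) :: 'k kvec set)"
          by (rule reps_mono[OF psi]) (use i in simp)
        show "\<forall>\<eta>\<in>reps k (1 - j1) (1 - i) - reps k (1 - j1) (1 - j0). ?t \<eta> = 0"
        proof
          fix \<eta> assume \<eta>: "\<eta> \<in> reps k (1 - j1) (1 - i) - (reps k (1 - j1) (1 - j0) :: 'k kvec set)"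
          have \<eta>K: "\<eta> \<in> Kn k" using reps_E(1)[OF psi, of \<eta> k "1 - j1" "1 - i"] \<eta> j01 by simp
          have "\<not> near k (1 - j0) \<eta>" using reps_restrict[OF psi, of \<eta> k "1 - j1" "1 - i" "1 - j0"] \<eta> j01 by auto
          moreover have "1 - j0 \<le> M" by (simp add: j0_def)
          ultimately have "\<not> near k M \<eta>" using near_mono by blast
          then have "(\<forall>u\<in>D. uhat u j1 \<eta> = 0) \<or> iK l (\<lambda>x. g x * \<psi> (dotp l x 0 + dotp k (F x) (- \<eta>))) = 0"
            by (rule M[OF \<eta>K]) simp
          then show "?t \<eta> = 0" using u by auto
        qed
      qed
      then show ?thesis using ex[OF j01(1)] ex[OF j01(2)] by simp
    qed
    then show ?thesis by blast
  qed
  then show ?thesis using j(3) by blast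
qed

text \<open>Compare \<eta> with c. If \<eta> is much larger than c \<xi>,
  \<open>large_frequencies\<close> applies with \<zeta> = c \<xi>. Otherwise \<eta> / c stays in a
  fixed compact ball, where \<open>dichotomy\<close> with target \<xi>0 makes u vanish at \<eta> or
  keeps the gradient \<xi> - A^T (\<eta> / c) away from 0.\<close>

theorem pullback_smooth:
  assumes \<xi>0: "\<xi>0 \<in> Kn l" "\<xi>0 \<noteq> 0" and G1: "\<And>\<theta>. \<theta> \<in> Kn k \<Longrightarrow> \<theta> \<noteq> 0 \<Longrightarrow> \<theta> \<in> G \<Longrightarrow> tmapp k l A \<theta> \<noteq> \<xi>0"
  shows "\<exists>j1 j2 i. r \<le> j2 \<and> (\<forall>g\<in>test_functions (bl l (Kn l) x0 j2). \<exists>N. \<forall>u\<in>D. \<forall>c\<in>\<Lambda>. ord c < N \<longrightarrow>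
    (\<forall>\<xi>\<in>bl l (Kn l) \<xi>0 i. \<forall>j\<ge>j1.
      iK l (\<lambda>x. g x * \<psi> (dotp l x (\<lambda>i. c * \<xi> i)) * (qpow TYPE('k) (int k * j) * u (ind k (Kn k) (F x) j))) = 0))"
proof -
  obtain J1 J2 R where L: "r \<le> J2" "\<And>j1 j2 g. J1 \<le> j1 \<Longrightarrow> J2 \<le> j2 \<Longrightarrow> g \<in> test_functions (bl l (Kn l) x0 j2) \<Longrightarrow> \<exists>M. \<forall>\<eta>\<in>Kn k. \<forall>\<zeta>.
     \<not> near k M \<eta> \<longrightarrow> (\<forall>t. near k t \<eta> \<longrightarrow> near l (t + R) \<zeta>) \<longrightarrow>
     (\<forall>u\<in>D. uhat u j1 \<eta> = 0) \<or> iK l (\<lambda>x. g x * \<psi> (dotp l x \<zeta> + dotp k (F x) (- \<eta>))) = 0"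
    using large_frequencies by blast
  obtain m0 where m0: "near l m0 \<xi>0" using near_ex by blast
  \<comment> \<open>The border between the two regimes: if \<eta> fails level R0 +
    \<open>ord c\<close>, its level t satisfies t + R < m0 + \<open>ord c\<close>, so c \<xi> is
    small enough to be a perturbation.\<close>
  define R0 where "R0 = m0 - R"
  let ?C = "bl k (Kn k) (0::'k kvec) R0"
  \<comment> \<open>The ball C contains the direction 0, on which nothing is known about u; it is
    harmless because \<xi>0 is nonzero.\<close>
  have dich: "tmapp k l A \<theta> \<noteq> \<xi>0 \<or> smooth_at_open \<psi> \<Lambda> k W D y0 \<theta>" if "\<theta> \<in> ?C" for \<theta>
  proof (cases "\<theta> = 0")
    case True
    then show ?thesis using \<xi>0(2) by (simp add: tmapp_def)
  next
    case False
    then show ?thesis using G[of \<theta>] G1[of \<theta>] that by (auto simp: mem_bl)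
  qed
  from dichotomy[OF psi Lam W y0 compact_bl_Kn bl_subset dich \<xi>0(1)] obtain T J3 where TJ: "\<And>j1. J3 \<le> j1 \<Longrightarrow> \<exists>N. \<forall>\<theta>\<in>?C. \<not> near l T (\<xi>0 - tmapp k l A \<theta>) \<or>
    (\<forall>u\<in>D. \<forall>c\<in>\<Lambda>. ord c < N \<longrightarrow> u (\<lambda>w. ind k (Kn k) y0 j1 w * \<psi> (dotp k w (\<lambda>i. c * \<theta> i))) = 0)"
    by blast
  \<comment> \<open>The gradient is bounded at level T + \<open>ord c\<close>, the frequency has
    level R0 + \<open>ord c\<close>; their difference is the required gain.\<close>
  define cc where "cc = T - R0"
  \<comment> \<open>Level T keeps the distance from the image of A^T when \<xi>0 is replaced by
    \<xi>, and level m0 keeps \<xi> as small as \<xi>0.\<close>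
  define i where "i = max T m0"
  obtain j1 j2 where j: "max J1 J3 \<le> j1" "J2 \<le> j2" "r \<le> j2" "bl k (Kn k) y0 j1 \<subseteq> W" "F ` bl l (Kn l) x0 j2 \<subseteq> bl k (Kn k) y0 j1"
    and err: "\<And>x w t. x \<in> bl l (Kn l) x0 j2 \<Longrightarrow> w \<in> bl l (Kn l) x0 j2 \<Longrightarrow> near l t (x - w) \<Longrightarrow>
      near k (t + cc) (F x - F w - mapp k l A (x - w))"
    using good_radii[of "max J1 J3" J2 cc] by blast
  have "\<exists>N. \<forall>u\<in>D. \<forall>c\<in>\<Lambda>. ord c < N \<longrightarrow>
    (\<forall>\<xi>\<in>bl l (Kn l) \<xi>0 i. \<forall>j\<ge>j1.
      iK l (\<lambda>x. g x * \<psi> (dotp l x (\<lambda>i. c * \<xi> i)) * (qpow TYPE('k) (int k * j) * u (ind k (Kn k) (F x) j))) = 0)"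
    if g: "g \<in> test_functions (bl l (Kn l) x0 j2)" for g
  proof -
    have "J1 \<le> j1" "J3 \<le> j1" using j(1) by simp_all
    obtain M where M: "\<And>\<eta> \<zeta>. \<eta> \<in> Kn k \<Longrightarrow> \<not> near k M \<eta> \<Longrightarrow> (\<forall>t. near k t \<eta> \<longrightarrow> near l (t + R) \<zeta>) \<Longrightarrow>
     (\<forall>u\<in>D. uhat u j1 \<eta> = 0) \<or> iK l (\<lambda>x. g x * \<psi> (dotp l x \<zeta> + dotp k (F x) (- \<eta>))) = 0"
      using L(2)[OF \<open>J1 \<le> j1\<close> j(2) g] by blast
    obtain N1 where N1: "\<And>\<theta>. \<theta> \<in> ?C \<Longrightarrow> \<not> near l T (\<xi>0 - tmapp k l A \<theta>) \<or>
      (\<forall>u\<in>D. \<forall>c\<in>\<Lambda>. ord c < N1 \<longrightarrow> u (\<lambda>w. ind k (Kn k) y0 j1 w * \<psi> (dotp k w (\<lambda>i. c * \<theta> i))) = 0)"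
      using TJ[OF \<open>J3 \<le> j1\<close>] by blast
    have gK: "g \<in> test_functions (Kn l)" by (rule tf_bl_extend[OF psi Lam bl_subset order_refl g])
    obtain J' where J': "\<And>x y j. J' \<le> j \<Longrightarrow> y \<in> bl l (Kn l) x j \<Longrightarrow> x \<in> Kn l \<Longrightarrow> g y = g x"
      using tf_level[OF psi Lam order_refl gK] by metis
    define N where "N = min (min N1 (M - R0)) (min (1 - T - J') (1 - T - j2))"
    have "iK l (\<lambda>x. g x * \<psi> (dotp l x (\<lambda>i. c * \<xi> i)) * (qpow TYPE('k) (int k * j') * u (ind k (Kn k) (F x) j'))) = 0"
      if u: "u \<in> D" and c: "c \<in> \<Lambda>" "ord c < N" and \<xi>: "\<xi> \<in> bl l (Kn l) \<xi>0 i" and j': "j1 \<le> j'" for u c \<xi> j'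
    proof -
      have c0: "c \<noteq> 0" using Lam_props(1)[OF psi Lam c(1)] .
      let ?\<zeta> = "\<lambda>i. c * \<xi> i"
      have n\<xi>: "near l i (\<xi> - \<xi>0)" using \<xi> by (simp add: mem_bl)
      have "near l m0 (\<xi> - \<xi>0 + \<xi>0)" by (intro near_add near_mono[OF n\<xi>] m0) (simp add: i_def)
      then have m\<xi>: "near l m0 \<xi>" by simp
      have "iK l (\<lambda>x. g x * \<psi> (dotp l x ?\<zeta>) * (qpow TYPE('k) (int k * j') * u (ind k (Kn k) (F x) j'))) =
        (\<Sum>\<eta>\<in>reps k (1 - j1) (1 - j'). (qpow TYPE('k) (int k * j1) * uhat u j1 \<eta>) *
          iK l (\<lambda>x. g x * \<psi> (dotp l x ?\<zeta> + dotp k (F x) (- \<eta>))))"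
        by (rule average_expansion[OF u j(4) j' g j(5)]) (rule err)
      also have "\<dots> = 0"
      proof (rule sum.neutral, rule ballI)
        fix \<eta> :: "'k kvec" assume \<eta>: "\<eta> \<in> reps k (1 - j1) (1 - j')"
        have \<eta>K: "\<eta> \<in> Kn k" using reps_E(1)[OF psi \<eta>] j' by simp
        have "uhat u j1 \<eta> = 0 \<or> iK l (\<lambda>x. g x * \<psi> (dotp l x ?\<zeta> + dotp k (F x) (- \<eta>))) = 0"
        proof (cases "near k (R0 + ord c) \<eta>")
          case False
          have "\<not> near k M \<eta>" using False near_mono[of k M \<eta> "R0 + ord c"] c(2) by (auto simp: N_def)
          moreover have "near l (t + R) ?\<zeta>" if "near k t \<eta>" for t
          proof -
            have "t < R0 + ord c" using that False near_mono[of k t \<eta> "R0 + ord c"] by force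
            then have "t + R - ord c \<le> m0" by (simp add: R0_def)
            then have "near l (t + R - ord c) \<xi>" using m\<xi> near_mono by blast
            then show ?thesis using near_scale_iff[OF c0, of l "t + R" \<xi>] by simp
          qed
          ultimately show ?thesis using M[OF \<eta>K, of ?\<zeta>] u by blast
        next
          case True
          define \<theta> where "\<theta> = (\<lambda>i. inverse c * \<eta> i)"
          have \<eta>\<theta>: "\<eta> = (\<lambda>i. c * \<theta> i)" using c0 by (auto simp: \<theta>_def simp flip: mult.assoc)
          have \<theta>K: "\<theta> \<in> Kn k" unfolding \<theta>_def by (rule Kn_scale[OF \<eta>K])
          have "near k R0 \<theta>" using True near_scale_iff[OF c0, of k "R0 + ord c" \<theta>] by (simp add: \<eta>\<theta>)
          then have "\<theta> \<in> ?C" using \<theta>K by (simp add: mem_bl)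
          from N1[OF this] show ?thesis
          proof
            assume "\<forall>u\<in>D. \<forall>c\<in>\<Lambda>. ord c < N1 \<longrightarrow> u (\<lambda>w. ind k (Kn k) y0 j1 w * \<psi> (dotp k w (\<lambda>i. c * \<theta> i))) = 0"
            then show ?thesis using u c by (simp add: uhat_def \<eta>\<theta> N_def)
          next
            assume n: "\<not> near l T (\<xi>0 - tmapp k l A \<theta>)"
            have "\<not> near l T (\<xi> - tmapp k l A \<theta>)"
            proof
              assume "near l T (\<xi> - tmapp k l A \<theta>)"
              from near_diff[OF this near_mono[OF n\<xi>, of T]] show False using n by (simp add: i_def)
            qed
            moreover have "?\<zeta> + tmapp k l A (- \<eta>) = (\<lambda>i. c * (\<xi> - tmapp k l A \<theta>) i)"
              by (simp add: \<eta>\<theta> tmapp_uminus[OF psi Lam] tmapp_scale[OF psi Lam] fun_eq_iff right_diff_distrib)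
            ultimately have ns: "\<not> near l (T + ord c) (?\<zeta> + tmapp k l A (- \<eta>))"
              by (rule not_near_scaled[OF c0, rotated])
            have "iK l (\<lambda>x. g x * \<psi> (dotp l x ?\<zeta> + dotp k (F x) (- \<eta>))) = 0"
              proof (rule oscillation[OF psi Lam gK, where J = J' and cc = cc and m = "R0 + ord c" and T = "T + ord c" and ?j2.0 = j2 and ?x0.0 = x0])
                show "g x = 0" if "x \<notin> bl l (Kn l) x0 j2" for x using that by (rule tfD(2)[OF g])
                show "g y = g x" if "J' \<le> j" "y \<in> bl l (Kn l) x j" "x \<in> Kn l" for x y j using that by (rule J')
                show "near k (t + cc) (F x - F w - mapp k l A (x - w))"
                  if "x \<in> bl l (Kn l) x0 j2" "w \<in> bl l (Kn l) x0 j2" "near l t (x - w)" for x w t using that by (rule err)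
                show "T + ord c \<le> 1 - J'" "T + ord c \<le> 1 - j2" "T + ord c \<le> cc + (R0 + ord c)" using True c(2) by (auto simp: N_def cc_def)
                show "near k (R0 + ord c) (- \<eta>)" using True by simp
                show "\<not> near l (T + ord c) (?\<zeta> + tmapp k l A (- \<eta>))" by (rule ns)
              qed
            then show ?thesis by blast
          qed
        qed
        then show "(qpow TYPE('k) (int k * j1) * uhat u j1 \<eta>) * iK l (\<lambda>x. g x * \<psi> (dotp l x ?\<zeta> + dotp k (F x) (- \<eta>))) = 0" by auto
      qed
      finally show ?thesis .
    qed
    then show ?thesis by blast
  qed
  then show ?thesis using j(3) by blast
qed

end

section \<open>From charts to manifolds\<close>

context
  fixes \<psi> :: "'k::nonarch_local_field \<Rightarrow> complex" and \<Lambda> :: "'k set"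
  assumes psi: "additive_character \<psi>" and Lam: "open_finite_index_subgroup \<Lambda>"
begin

text \<open>Two levels are kept apart throughout: the chart lives on the ball of level j, while test
  functions are confined to the smaller ball of level r on which the local estimates hold.\<close>

lemma nice_pull:
  assumes nice: "nice n l X s x j" and sub: "submanifold n l X" and le: "j \<le> r"
    and \<phi>: "\<phi> \<in> test_functions (bl l (Kn l) (coord_proj l s x) r)"
  shows "\<phi> \<in> test_functions (bl l (Kn l) (coord_proj l s x) j)"
    "(\<lambda>z. if z \<in> bl n X x j then \<phi> (coord_proj l s z) else 0) \<in> test_functions X"
    "\<And>z. z \<notin> bl n X x r \<Longrightarrow> (if z \<in> bl n X x j then \<phi> (coord_proj l s z) else 0) = 0"
proof -
  have s: "bl l (Kn l) (coord_proj l s x) r \<subseteq> bl l (Kn l) (coord_proj l s x) j"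
    by (rule bl_mono[OF le bl_self[OF coord_proj_Kn]])
  show 1: "\<phi> \<in> test_functions (bl l (Kn l) (coord_proj l s x) j)"
    by (rule tf_bl_extend[OF psi Lam s bl_subset \<phi>])
  show "(\<lambda>z. if z \<in> bl n X x j then \<phi> (coord_proj l s z) else 0) \<in> test_functions X"
    by (rule chart_pull(2)[OF C1_chart_nice[OF nice sub] sub 1])
  fix z assume z: "z \<notin> bl n X x r"
  show "(if z \<in> bl n X x j then \<phi> (coord_proj l s z) else 0) = 0"
  proof (cases "z \<in> bl n X x j")
    case True
    have "\<not> near n r (z - x)" using z True by (simp add: mem_bl)
    then have "\<not> near l r (coord_proj l s z - coord_proj l s x)"
      using nice_iso[OF nice True bl_self[OF nice_x[OF nice]], of r] by simp
    then have "coord_proj l s z \<notin> bl l (Kn l) (coord_proj l s x) r" by (simp add: mem_bl)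
    then show ?thesis using tfD(2)[OF \<phi>] by simp
  qed simp
qed

lemma nice_push:
  assumes nice: "nice n l X s x j" and sub: "submanifold n l X" and le: "j \<le> r"
    and \<phi>: "\<phi> \<in> test_functions X" and supp: "\<And>z. z \<notin> bl n X x r \<Longrightarrow> \<phi> z = 0"
  shows "\<exists>g\<in>test_functions (bl l (Kn l) (coord_proj l s x) r). \<phi> = (\<lambda>z. if z \<in> bl n X x j then g (coord_proj l s z) else 0)"
proof -
  let ?B = "bl l (Kn l) (coord_proj l s x) j"
  let ?g = "\<lambda>w. if w \<in> ?B then \<phi> (sec n l X s x j w) else 0"
  have sb: "bl n X x r \<subseteq> bl n X x j" by (rule bl_mono[OF le bl_self[OF nice_x[OF nice]]])
  then have supp': "\<phi> z = 0" if "z \<notin> bl n X x j" for z using supp that by blast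
  have "?g \<in> test_functions (bl l (Kn l) (coord_proj l s x) r)"
  proof (rule tf_restrict[OF bl_subset order_refl])
    show "?g \<in> test_functions (Kn l)" by (rule cint_transport(1)[OF sub nice \<phi>]) (rule supp')
    fix w assume w: "w \<notin> bl l (Kn l) (coord_proj l s x) r"
    show "?g w = 0"
    proof (cases "w \<in> ?B")
      case True
      have m: "sec n l X s x j w \<in> bl n X x j" by (rule sec_mem[OF nice True])
      have "\<not> near l r (w - coord_proj l s x)" using w True by (simp add: mem_bl)
      then have "\<not> near n r (sec n l X s x j w - x)"
        using nice_iso[OF nice m bl_self[OF nice_x[OF nice]], of r] cp_sec[OF nice True] by simp
      then show ?thesis using supp by (simp add: mem_bl)
    qed simp
  qed
  moreover have "\<phi> = (\<lambda>z. if z \<in> bl n X x j then ?g (coord_proj l s z) else 0)"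
  proof
    fix z show "\<phi> z = (if z \<in> bl n X x j then ?g (coord_proj l s z) else 0)"
    proof (cases "z \<in> bl n X x j")
      case True
      show ?thesis unfolding sec_cp[OF nice True] using True cp_mem[OF nice True] by simp
    next
      case False
      show ?thesis using supp'[OF False] False by simp
    qed
  qed
  ultimately show ?thesis by (intro bexI[of _ ?g])
qed

lemma nice_cint:
  assumes nice: "nice n l X s x j" and sub: "submanifold n l X" and le: "j \<le> r"
    and \<phi>: "\<phi> \<in> test_functions (bl l (Kn l) (coord_proj l s x) r)" and h: "locally_constant_on X h"
    and h': "\<And>w. w \<in> bl l (Kn l) (coord_proj l s x) r \<Longrightarrow> h (sec n l X s x j w) = h' w"
  shows "cint n l X (\<lambda>z. h z * (if z \<in> bl n X x j then \<phi> (coord_proj l s z) else 0)) = iK l (\<lambda>w. \<phi> w * h' w)"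
proof -
  let ?\<Phi> = "\<lambda>z. if z \<in> bl n X x j then \<phi> (coord_proj l s z) else 0"
  let ?B = "bl l (Kn l) (coord_proj l s x) j"
  have XK: "X \<subseteq> Kn n" by (rule nice_XK[OF nice])
  have "cint n l X (\<lambda>z. h z * ?\<Phi> z) = iK l (\<lambda>w. if w \<in> ?B then h (sec n l X s x j w) * ?\<Phi> (sec n l X s x j w) else 0)"
    by (rule cint_transport(2)[OF sub nice tf_mult_lc[OF XK nice_pull(2)[OF nice sub le \<phi>] h]]) simp
  moreover have "(if w \<in> ?B then h (sec n l X s x j w) * ?\<Phi> (sec n l X s x j w) else 0) = \<phi> w * h' w" for w
  proof (cases "w \<in> bl l (Kn l) (coord_proj l s x) r")
    case True
    then have "w \<in> ?B" using bl_mono[OF le bl_self[OF coord_proj_Kn]] by blast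
    then show ?thesis using h'[OF True] sec_mem[OF nice] cp_sec[OF nice] by simp
  next
    case False
    then show ?thesis using tfD(2)[OF \<phi> False] cp_sec[OF nice] by simp
  qed
  ultimately show ?thesis by simp
qed

text \<open>From some strict chart to the isometric one: \<open>chart_relation\<close> gives the
  coordinates of the covector, and \<open>smooth_change\<close> is applied to the transition, which
  turns the linear phase of the isometric chart into a nonlinear one in the chart g.\<close>

lemma smooth_at_nice:
  assumes nice: "nice n l X s x j" and sub: "submanifold n l X"
    and S: "sd l n (bl l (Kn l) (coord_proj l s x) j) (sec n l X s x j) S (coord_proj l s x)"
    and D: "D \<subseteq> distributions X" and \<eta>: "\<eta> \<in> Kn l"
    and sm: "smooth_at \<psi> \<Lambda> n l X D x (cov n l X s x j \<eta>)"
  shows "smooth_at_open \<psi> \<Lambda> l (bl l (Kn l) (coord_proj l s x) j)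
    (pushforward (bl n X x j) (bl l (Kn l) (coord_proj l s x) j) (coord_proj l s) ` D) (coord_proj l s x) \<eta>"
proof -
  let ?p = "coord_proj l s" let ?b = "bl n X x j" let ?B = "bl l (Kn l) (?p x) j"
  obtain U W g \<eta>0 where ch: "C1_chart n l X U W g" and xU: "x \<in> U" and \<eta>0: "\<eta>0 \<in> Kn l"
    and cod: "codifferential n l U l g x (covec l \<eta>0) = cov n l X s x j \<eta>"
    and smo: "smooth_at_open \<psi> \<Lambda> l W (pushforward U W g ` D) (g x) \<eta>0"
    using sm unfolding smooth_at_def by blast
  note c = C1_chartD[OF ch sub]
  have XK: "X \<subseteq> Kn n" by (rule nice_XK[OF nice])
  have UK: "U \<subseteq> Kn n" using c(4) XK by blast
  obtain E r where Er: "bl l (Kn l) (g x) r \<subseteq> W" "sd l l (bl l (Kn l) (g x) r) (\<lambda>w. ?p (inv_into U g w)) E (g x)"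
    "tmapp l l E \<eta> = \<eta>0"
    using chart_relation[OF nice S sub ch xU \<eta>0 \<eta> cod] by blast
  have D': "pushforward U W g ` D \<subseteq> distributions W" using pushforward_distr[OF ch sub] D by blast
  from smooth_change[OF psi Lam c(2) D' smo Er(2) \<eta> Er(3)] obtain J i where J: "\<And>j1 g'. J \<le> j1 \<Longrightarrow> g' \<in> test_functions (bl l (Kn l) (g x) j1) \<Longrightarrow>
     \<exists>N. \<forall>u\<in>pushforward U W g ` D. \<forall>c\<in>\<Lambda>. ord c < N \<longrightarrow>
      (\<forall>\<xi>\<in>bl l (Kn l) \<eta> i. u (\<lambda>w. g' w * \<psi> (dotp l (?p (inv_into U g w)) (\<lambda>i. c * \<xi> i))) = 0)" by blast
  obtain r1 where r1: "bl n X x r1 \<subseteq> U" using c(1) xU openin_iff_near[OF XK] by blast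
  obtain r2 where r2: "\<And>y. y \<in> bl n U x r2 \<Longrightarrow> near l J (g y - g x)" using c(10)[OF xU, of J] by blast
  define r' where "r' = max j (max r1 r2)"
  have le: "j \<le> r'" by (simp add: r'_def)
  have xX: "x \<in> X" by (rule nice_x[OF nice])
  have bU: "bl n X x r' \<subseteq> U"
    using bl_mono[of r1 r' x n X x, OF _ bl_self[OF xX]] r1 unfolding r'_def by (meson max.cobounded1 max.cobounded2 order_trans)
  have near: "near l J (g y - g x)" if "y \<in> bl n X x r'" for y
  proof (rule r2)
    have "near n r2 (y - x)" using that by (intro near_mono[of n r' "y - x" r2]) (simp_all add: mem_bl r'_def)
    then show "y \<in> bl n U x r2" using that bU by (auto simp: mem_bl)
  qed
  have "\<exists>N. \<forall>u\<in>pushforward ?b ?B ?p ` D. \<forall>c\<in>\<Lambda>. ord c < N \<longrightarrow>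
      (\<forall>\<xi>\<in>bl l (Kn l) \<eta> i. fourier \<psi> l \<phi> u (\<lambda>i. c * \<xi> i) = 0)"
    if \<phi>: "\<phi> \<in> test_functions (bl l (Kn l) (?p x) r')" for \<phi>
  proof -
    define P where "P \<theta> = (\<lambda>z. if z \<in> ?b then \<theta> (?p z) else (0::complex))" for \<theta>
    \<comment> \<open>P lifts a function from the isometric chart to X, and Q carries it on to the
      chart g. The factor \<psi> becomes a character of the projection after the inverse of g, as
      \<open>smooth_change\<close> expects.\<close>
    define Q where "Q \<theta> = (\<lambda>w. if w \<in> W then P \<theta> (inv_into U g w) else 0)" for \<theta>
    have P: "P \<theta> \<in> test_functions U" "\<And>z. z \<notin> bl n X x r' \<Longrightarrow> P \<theta> z = 0"
      if "\<theta> \<in> test_functions (bl l (Kn l) (?p x) r')" for \<theta>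
    proof -
      note np = nice_pull[OF nice sub le that]
      show z: "P \<theta> z = 0" if "z \<notin> bl n X x r'" for z using np(3)[OF that] by (simp add: P_def)
      show "P \<theta> \<in> test_functions U"
        by (rule tf_restrict[OF c(4) XK np(2)[folded P_def]]) (use z bU in blast)
    qed
    have Q: "Q \<theta> \<in> test_functions W" if "\<theta> \<in> test_functions (bl l (Kn l) (?p x) r')" for \<theta>
      unfolding Q_def by (rule chart_push[OF ch sub P(1)[OF that]])
    have "Q \<phi> \<in> test_functions (bl l (Kn l) (g x) J)"
    proof (rule tf_restrict[OF bl_subset order_refl])
      show "Q \<phi> \<in> test_functions (Kn l)"
      proof (rule tf_extend[OF c(5) order_refl c(2) Q[OF \<phi>]])
      qed
      fix w assume w: "w \<notin> bl l (Kn l) (g x) J"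
      show "Q \<phi> w = 0"
      proof (cases "w \<in> W")
        case True
        have "inv_into U g w \<notin> bl n X x r'"
        proof
          assume "inv_into U g w \<in> bl n X x r'"
          from near[OF this] show False using w True c(5,9) by (auto simp: mem_bl)
        qed
        then show ?thesis using P(2)[OF \<phi>] by (simp add: Q_def)
      qed (simp add: Q_def)
    qed
    from J[OF order_refl this] obtain N where N: "\<And>u c \<xi>. u \<in> D \<Longrightarrow> c \<in> \<Lambda> \<Longrightarrow> ord c < N \<Longrightarrow> \<xi> \<in> bl l (Kn l) \<eta> i \<Longrightarrow>
      pushforward U W g u (\<lambda>w. Q \<phi> w * \<psi> (dotp l (?p (inv_into U g w)) (\<lambda>i. c * \<xi> i))) = 0" by blast
    have "fourier \<psi> l \<phi> (pushforward ?b ?B ?p u) (\<lambda>i. c * \<xi> i) = 0"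
      if u: "u \<in> D" and cN: "c \<in> \<Lambda>" "ord c < N" and \<xi>: "\<xi> \<in> bl l (Kn l) \<eta> i" for u c \<xi>
    proof -
      let ?\<theta> = "\<lambda>w. \<phi> w * \<psi> (dotp l w (\<lambda>i. c * \<xi> i))"
      have \<theta>: "?\<theta> \<in> test_functions (bl l (Kn l) (?p x) r')"
        using tf_mult_lc[OF bl_subset \<phi> lc_psi[OF psi bl_subset]] by (simp add: mult.commute)
      have e1: "fourier \<psi> l \<phi> (pushforward ?b ?B ?p u) (\<lambda>i. c * \<xi> i) = u (P ?\<theta>)"
        using nice_pull(1)[OF nice sub le \<theta>] by (simp add: fourier_def pushforward_def P_def)
      have e2: "(\<lambda>w. Q \<phi> w * \<psi> (dotp l (?p (inv_into U g w)) (\<lambda>i. c * \<xi> i))) = Q ?\<theta>"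
        by (auto simp: Q_def P_def)
      have e3: "(\<lambda>z. if z \<in> U then Q ?\<theta> (g z) else 0) = P ?\<theta>"
      proof
        fix z show "(if z \<in> U then Q ?\<theta> (g z) else 0) = P ?\<theta> z"
        proof (cases "z \<in> U")
          case True
          then have "g z \<in> W" "inv_into U g (g z) = z" using c(6,8) by blast+
          then show ?thesis using True by (simp add: Q_def)
        next
          case False
          then show ?thesis using P(2)[OF \<theta>, of z] bU by auto
        qed
      qed
      have "pushforward U W g u (Q ?\<theta>) = u (P ?\<theta>)"
        unfolding pushforward_def e3[symmetric] using Q[OF \<theta>] by simp
      then show ?thesis using N[OF u cN \<xi>] unfolding e1 e2 by simp
    qed
    then show ?thesis by blast
  qed
  moreover have "bl l (Kn l) (?p x) r' \<subseteq> ?B" by (rule bl_mono[OF le bl_self[OF coord_proj_Kn]])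
  ultimately show ?thesis
    unfolding smooth_at_open_def
    by (intro exI[of _ "bl l (Kn l) (?p x) r'"] exI[of _ "bl l (Kn l) \<eta> i"] conjI openin_bl bl_self coord_proj_Kn \<eta> ballI)
qed

end

section \<open>Averages of a distribution over small balls\<close>

text \<open>The mean of u over the ball of level j around y, where the power of q is the inverse
  volume. Where that ball is not isometric, its compactness is unknown and the value is 0; on the
  support of a given test function this no longer occurs for large j.\<close>

definition smoothing :: "nat \<Rightarrow> nat \<Rightarrow> 'k::nonarch_local_field kvec set \<Rightarrow> int \<Rightarrow> 'k distr \<Rightarrow> 'k kvec \<Rightarrow> complex" where
  "smoothing m k Y j u y = (if \<exists>t. nice m k Y t y j then qpow TYPE('k) (int k * j) * u (ind m Y y j) else 0)"

lemma smoothing_const: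
  assumes "z \<in> bl m Y y j" and y: "y \<in> Y"
  shows "smoothing m k Y j u z = smoothing m k Y j u y"
proof -
  have e: "bl m Y z j = bl m Y y j" by (rule bl_eq_mem[OF assms(1)])
  have zY: "z \<in> Y" using assms by (simp add: mem_bl)
  have "(\<exists>t. nice m k Y t z j) \<longleftrightarrow> (\<exists>t. nice m k Y t y j)"
  proof
    assume "\<exists>t. nice m k Y t y j"
    then show "\<exists>t. nice m k Y t z j" using nice_sub[OF _ assms(1) order_refl] by blast
  next
    assume "\<exists>t. nice m k Y t z j"
    then obtain t where t: "nice m k Y t z j" by blast
    have "y \<in> bl m Y z j" unfolding e by (rule bl_self[OF y])
    then show "\<exists>t. nice m k Y t y j" using nice_sub[OF t _ order_refl] by blast
  qed
  moreover have "ind m Y z j = ind m Y y j" by (simp add: ind_def e fun_eq_iff)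
  ultimately show ?thesis by (simp add: smoothing_def)
qed

lemma smoothing_lc: "Y \<subseteq> Kn m \<Longrightarrow> locally_constant_on Y (smoothing m k Y j u)"
  by (subst lc_iff) (blast intro: smoothing_const)+

text \<open>An equality and not only a limit: once \<phi> is constant on balls of level j it is a
  combination of their indicators, and on each of them volume and inverse volume cancel.\<close>

lemma smoothing_cint:
  assumes sub: "submanifold m k Y" and u: "u \<in> distributions Y" and \<phi>: "\<phi> \<in> test_functions Y"
    and nice: "\<And>y. \<phi> y \<noteq> 0 \<Longrightarrow> \<exists>t. nice m k Y t y j"
    and c: "\<And>x y. y \<in> bl m Y x j \<Longrightarrow> x \<in> Y \<Longrightarrow> \<phi> y = \<phi> x"
  shows "cint m k Y (\<lambda>y. smoothing m k Y j u y * \<phi> y) = u \<phi>"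
proof -
  note YK = submanifold_sub_Kn[OF sub]
  have "\<exists>I. finite I \<and> I \<subseteq> {x. \<phi> x \<noteq> 0} \<and> \<phi> = (\<lambda>y. \<Sum>x\<in>I. \<phi> x * ind m Y x j y) \<and>
    (\<forall>x\<in>I. \<forall>y\<in>I. x \<noteq> y \<longrightarrow> bl m Y x j \<inter> bl m Y y j = {})"
    by (rule tf_decomp[OF YK \<phi>]) (rule c)
  then obtain I where I: "finite I" "I \<subseteq> {x. \<phi> x \<noteq> 0}" "\<phi> = (\<lambda>y. \<Sum>x\<in>I. \<phi> x * ind m Y x j y)" by blast
  have t: "ind m Y x j \<in> test_functions Y" if "x \<in> I" for x
    using nice[of x] that I(2) ind_test[OF YK] nice_compact by blast
  have e: "smoothing m k Y j u y * \<phi> y = (\<Sum>x\<in>I. (\<phi> x * smoothing m k Y j u x) * ind m Y x j y)" for y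
  proof -
    have "smoothing m k Y j u y * \<phi> y = (\<Sum>x\<in>I. smoothing m k Y j u y * (\<phi> x * ind m Y x j y))"
      by (subst I(3)) (simp add: sum_distrib_left)
    also have "\<dots> = (\<Sum>x\<in>I. (\<phi> x * smoothing m k Y j u x) * ind m Y x j y)"
    proof (rule sum.cong[OF refl])
      fix x assume "x \<in> I"
      then have "x \<in> Y" using I(2) tfD(4)[OF \<phi>] by blast
      then show "smoothing m k Y j u y * (\<phi> x * ind m Y x j y) = (\<phi> x * smoothing m k Y j u x) * ind m Y x j y"
        using smoothing_const[of y m Y x j k u] by (simp add: ind_def)
    qed
    finally show ?thesis .
  qed
  have "cint m k Y (\<lambda>y. smoothing m k Y j u y * \<phi> y) = (\<Sum>x\<in>I. (\<phi> x * smoothing m k Y j u x) * cint m k Y (ind m Y x j))"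
    unfolding e by (rule cint_sum[OF sub t])
  also have "\<dots> = (\<Sum>x\<in>I. \<phi> x * u (ind m Y x j))"
  proof (rule sum.cong[OF refl])
    fix x assume x: "x \<in> I"
    then obtain t where n: "nice m k Y t x j" using nice[of x] I(2) by blast
    have "qpow TYPE('a) (int k * j) * qpow TYPE('a) (- (int k * j)) = 1"
      by (simp flip: qpow_add)
    then show "(\<phi> x * smoothing m k Y j u x) * cint m k Y (ind m Y x j) = \<phi> x * u (ind m Y x j)"
      using n integral_ind(2)[OF sub n] by (auto simp: smoothing_def)
  qed
  also have "\<dots> = u (\<lambda>y. \<Sum>x\<in>I. \<phi> x * ind m Y x j y)" by (rule distr_sum[OF u YK t, symmetric])
  finally show ?thesis using I(3) by simp
qed

lemma smoothing_converges:
  assumes sub: "submanifold m k Y" and \<phi>: "\<phi> \<in> test_functions Y"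
  shows "\<exists>j0. \<forall>j\<ge>j0. \<forall>u\<in>distributions Y. cint m k Y (\<lambda>y. smoothing m k Y j u y * \<phi> y) = u \<phi>"
proof -
  note YK = submanifold_sub_Kn[OF sub]
  have "\<exists>j0. (\<forall>x\<in>Y. \<forall>j\<ge>j0. \<phi> x \<noteq> 0 \<longrightarrow> (\<exists>t. nice m k Y t x j)) \<and> (\<forall>x\<in>Y. \<forall>j\<ge>j0. \<forall>y\<in>bl m Y x j. \<phi> y = \<phi> x)"
  proof (rule tf_uniform[OF YK \<phi>])
    show "\<exists>j t. nice m k Y t x j" if "x \<in> Y" for x using nice_exists[OF sub that] by blast
    show "\<exists>t. nice m k Y t y j'" if "\<exists>t. nice m k Y t x j" "y \<in> bl m Y x j" "j \<le> j'" for x j y j'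
      using that nice_sub by blast
  qed
  then obtain j0 where j0: "\<And>x j. x \<in> Y \<Longrightarrow> j0 \<le> j \<Longrightarrow> \<phi> x \<noteq> 0 \<Longrightarrow> \<exists>t. nice m k Y t x j"
    "\<And>x y j. x \<in> Y \<Longrightarrow> j0 \<le> j \<Longrightarrow> y \<in> bl m Y x j \<Longrightarrow> \<phi> y = \<phi> x" by blast
  have "cint m k Y (\<lambda>y. smoothing m k Y j u y * \<phi> y) = u \<phi>" if "j0 \<le> j" "u \<in> distributions Y" for j u
  proof (rule smoothing_cint[OF sub that(2) \<phi>])
    show "\<exists>t. nice m k Y t y j" if "\<phi> y \<noteq> 0" for y
      by (rule j0(1)[OF _ \<open>j0 \<le> j\<close> that]) (use tfD(2)[OF \<phi>] that in blast)
    show "\<phi> y = \<phi> x" if "y \<in> bl m Y x j" "x \<in> Y" for x y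
      by (rule j0(2)[OF that(2) \<open>j0 \<le> j\<close> that(1)])
  qed
  then show ?thesis by blast
qed

lemma smooth_distr_cint: "\<phi> \<in> test_functions X \<Longrightarrow> smooth_distr n l X h \<phi> = cint n l X (\<lambda>x. h x * \<phi> x)"
  by (simp add: smooth_distr_def cint_def)

lemma smooth_distr_distr:
  assumes sub: "submanifold n l X" and h: "locally_constant_on X h"
  shows "smooth_distr n l X h \<in> distributions X"
proof -
  note XK = submanifold_sub_Kn[OF sub]
  have "smooth_distr n l X h (\<lambda>x. \<phi> x + \<phi>' x) = smooth_distr n l X h \<phi> + smooth_distr n l X h \<phi>'"
    if "\<phi> \<in> test_functions X" "\<phi>' \<in> test_functions X" for \<phi> \<phi>'
    using cint_add[OF sub tf_mult_lc[OF XK that(1) h] tf_mult_lc[OF XK that(2) h]] that tf_add[OF XK that]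
    by (simp add: smooth_distr_cint distrib_left)
  moreover have "smooth_distr n l X h (\<lambda>x. c * \<phi> x) = c * smooth_distr n l X h \<phi>"
    if "\<phi> \<in> test_functions X" for \<phi> c
    using cint_scale[of n l X c "\<lambda>x. h x * \<phi> x"] that tf_scale[OF XK that]
    by (simp add: smooth_distr_cint mult.left_commute)
  ultimately show ?thesis by (simp add: distributions_def smooth_distr_def)
qed

text \<open>Uniformity in j comes from comparing the frequency with the averaging level. A character
  that is constant on balls of level j is paired exactly as with u, for which decay is known; any
  other one is cancelled by the averaging, by \<open>oscillation_linear\<close>.\<close>

lemma smoothing_smooth:
  assumes psi: "additive_character \<psi>" and Lam: "open_finite_index_subgroup \<Lambda>"
    and nice: "nice m k Y t y i" and sub: "submanifold m k Y"
    and T: "sd k m (bl k (Kn k) (coord_proj k t y) i) (sec m k Y t y i) T (coord_proj k t y)"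
    and u: "u \<in> distributions Y" and \<eta>: "\<eta> \<in> Kn k" "\<eta> \<noteq> 0"
    and sm: "smooth_at \<psi> \<Lambda> m k Y {u} y (cov m k Y t y i \<eta>)"
  shows "smooth_at \<psi> \<Lambda> m k Y (range (\<lambda>j. smooth_distr m k Y (smoothing m k Y j u))) y (cov m k Y t y i \<eta>)"
proof -
  let ?p = "coord_proj k t" let ?b = "bl m Y y i" let ?B = "bl k (Kn k) (?p y) i"
  let ?v = "\<lambda>j. smooth_distr m k Y (smoothing m k Y j u)"
  note YK = submanifold_sub_Kn[OF sub]
  have D: "{u} \<subseteq> distributions Y" using u by simp
  from smooth_at_nice[OF psi Lam nice sub T D \<eta>(1) sm] obtain U0 V0 where U0: "openin (top_of_set (Kn k)) U0" "?p y \<in> U0"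
    and V0: "openin (top_of_set (Kn k)) V0" "\<eta> \<in> V0"
    and sm': "\<And>\<phi>. \<phi> \<in> test_functions U0 \<Longrightarrow> \<exists>N. \<forall>c\<in>\<Lambda>. ord c < N \<longrightarrow>
           (\<forall>\<xi>\<in>V0. fourier \<psi> k \<phi> (pushforward ?b ?B ?p u) (\<lambda>i. c * \<xi> i) = 0)"
    unfolding smooth_at_open_def by auto
  obtain J1 where J1: "\<And>j. J1 \<le> j \<Longrightarrow> bl k (Kn k) (?p y) j \<subseteq> U0" using bl_open_subset[OF psi Lam U0] by metis
  obtain J2 where J2: "\<And>j. J2 \<le> j \<Longrightarrow> bl k (Kn k) \<eta> j \<subseteq> V0" using bl_open_subset[OF psi Lam V0] by metis
  \<comment> \<open>A nonzero \<eta> fails some level e, and so do the nearby \<xi>; hence c \<xi>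
    becomes large as the valuation of c decreases.\<close>
  obtain e where e: "\<not> near k e \<eta>" using near_all_0[OF \<eta>(1)] \<eta>(2) by blast
  define r where "r = max i J1"
  define r' where "r' = max e J2"
  have le: "i \<le> r" by (simp add: r_def)
  have rU: "bl k (Kn k) (?p y) r \<subseteq> U0" by (rule J1) (simp add: r_def)
  have away: "\<not> near k e \<xi>" "\<xi> \<in> V0" if "\<xi> \<in> bl k (Kn k) \<eta> r'" for \<xi>
  proof -
    have n: "near k e (\<xi> - \<eta>)" using that by (intro near_mono[of k r' "\<xi> - \<eta>" e]) (simp_all add: mem_bl r'_def)
    show "\<not> near k e \<xi>" using near_diff[of k e \<xi> "\<xi> - \<eta>"] n e by auto
    show "\<xi> \<in> V0" using J2[of r'] that by (auto simp: r'_def)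
  qed
  have "\<exists>N. \<forall>v\<in>pushforward ?b ?B ?p ` range ?v. \<forall>c\<in>\<Lambda>. ord c < N \<longrightarrow>
      (\<forall>\<xi>\<in>bl k (Kn k) \<eta> r'. fourier \<psi> k \<phi> v (\<lambda>i. c * \<xi> i) = 0)"
    if \<phi>: "\<phi> \<in> test_functions (bl k (Kn k) (?p y) r)" for \<phi>
  proof -
    have \<phi>U: "\<phi> \<in> test_functions U0"
      by (rule tf_bl_extend[OF psi Lam rU openin_imp_subset[OF U0(1)] \<phi>])
    obtain N1 where N1: "\<And>c \<xi>. c \<in> \<Lambda> \<Longrightarrow> ord c < N1 \<Longrightarrow> \<xi> \<in> V0 \<Longrightarrow>
        fourier \<psi> k \<phi> (pushforward ?b ?B ?p u) (\<lambda>i. c * \<xi> i) = 0" using sm'[OF \<phi>U] by blast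
    have \<phi>K: "\<phi> \<in> test_functions (Kn k)" by (rule tf_bl_extend[OF psi Lam bl_subset order_refl \<phi>])
    obtain J3 where J3: "\<And>x y j. J3 \<le> j \<Longrightarrow> y \<in> bl k (Kn k) x j \<Longrightarrow> x \<in> Kn k \<Longrightarrow> \<phi> y = \<phi> x"
      using tf_level[OF psi Lam order_refl \<phi>K] by metis
    define J where "J = max J3 r"
    \<comment> \<open>The second entry makes c \<xi> fail level 1 - J, so its character is not
      constant at the level J where \<phi> is.\<close>
    define N where "N = min N1 (1 - J - e)"
    have "fourier \<psi> k \<phi> (pushforward ?b ?B ?p (?v j)) (\<lambda>i. c * \<xi> i) = 0"
      if c: "c \<in> \<Lambda>" "ord c < N" and \<xi>: "\<xi> \<in> bl k (Kn k) \<eta> r'" for j c \<xi>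
    proof -
      let ?\<zeta> = "\<lambda>i. c * \<xi> i" let ?h = "smoothing m k Y j u"
      let ?\<theta> = "\<lambda>w. \<phi> w * \<psi> (dotp k w ?\<zeta>)"
      let ?\<Theta> = "\<lambda>z. if z \<in> ?b then ?\<theta> (?p z) else 0"
      have c0: "c \<noteq> 0" using Lam_props(1)[OF psi Lam c(1)] .
      have "\<not> near k (e + ord c) ?\<zeta>" by (rule not_near_scaled[OF c0 refl away(1)[OF \<xi>]])
      then have nJ: "\<not> near k (1 - J) ?\<zeta>"
        using near_mono[of k "1 - J" ?\<zeta> "e + ord c"] c(2) by (auto simp: N_def)
      have \<theta>: "?\<theta> \<in> test_functions (bl k (Kn k) (?p y) r)"
        using tf_mult_lc[OF bl_subset \<phi> lc_psi[OF psi bl_subset]] by (simp add: mult.commute)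
      note np = nice_pull[OF psi Lam nice sub le \<theta>]
      have f: "fourier \<psi> k \<phi> (pushforward ?b ?B ?p v) ?\<zeta> = v ?\<Theta>" for v
        using np(1) by (simp add: fourier_def pushforward_def)
      have "cint m k Y (\<lambda>z. ?h z * ?\<Theta> z) = 0"
      proof (cases "near k (1 - j) ?\<zeta>")
        case True
        have jJ: "J < j" using nJ near_mono[OF True, of "1 - J"] by force
        have "cint m k Y (\<lambda>z. ?h z * ?\<Theta> z) = u ?\<Theta>"
        proof (rule smoothing_cint[OF sub u np(2)])
          fix z
          show "\<exists>t. nice m k Y t z j" if "?\<Theta> z \<noteq> 0"
          proof -
            have "z \<in> ?b" using that by (auto split: if_splits)
            from nice_sub[OF nice this, of j] jJ le show ?thesis by (auto simp: J_def)
          qed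
        next
          fix x z assume z: "z \<in> bl m Y x j" and x: "x \<in> Y"
          have xz: "z \<in> ?b \<longleftrightarrow> x \<in> ?b"
          proof -
            have "near m i (z - x)" using z jJ le by (intro near_mono[of m j "z - x" i]) (simp_all add: mem_bl J_def)
            then show ?thesis using z x near_trans[of m i z x y] near_trans[of m i x z y] near_commute[of m i z x]
              by (auto simp: mem_bl)
          qed
          show "?\<Theta> z = ?\<Theta> x"
          proof (cases "x \<in> ?b")
            case True
            have n: "near k j (?p z - ?p x)" using z nice_iso[OF nice _ True, of z j] xz True by (simp add: mem_bl)
            have "\<phi> (?p z) = \<phi> (?p x)"
              by (rule J3[of j]) (use jJ n in \<open>simp_all add: J_def mem_bl coord_proj_Kn\<close>)
            moreover have "\<psi> (dotp k (?p z) ?\<zeta>) = \<psi> (dotp k (?p x) ?\<zeta>)"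
              using vge_dotp[OF n \<open>near k (1 - j) ?\<zeta>\<close>] by (intro psi_eq[OF psi]) (simp add: dotp_diff_left)
            ultimately show ?thesis using True xz by simp
          qed (use xz in simp)
        qed
        also have "\<dots> = 0" using N1[OF c(1) _ away(2)[OF \<xi>]] c(2) f[of u] by (simp add: N_def)
        finally show ?thesis .
      next
        case False
        have "cint m k Y (\<lambda>z. ?h z * ?\<Theta> z) = iK k (\<lambda>w. ?\<theta> w * ?h (sec m k Y t y i w))"
          by (rule nice_cint[OF psi Lam nice sub le \<theta> smoothing_lc[OF YK] refl])
        also have "\<dots> = iK k (\<lambda>w. (if w \<in> ?B then ?h (sec m k Y t y i w) * \<phi> w else 0) * \<psi> (dotp k w ?\<zeta>))"
        proof (rule arg_cong[of _ _ "iK k"], rule ext)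
          fix w show "?\<theta> w * ?h (sec m k Y t y i w) = (if w \<in> ?B then ?h (sec m k Y t y i w) * \<phi> w else 0) * \<psi> (dotp k w ?\<zeta>)"
            using tfD(2)[OF nice_pull(1)[OF psi Lam nice sub le \<phi>], of w] by auto
        qed
        also have "\<dots> = 0"
        proof (rule oscillation_linear[OF psi])
          have "(\<lambda>w. if w \<in> ?B then ?h (sec m k Y t y i w) * (if sec m k Y t y i w \<in> ?b then \<phi> (?p (sec m k Y t y i w)) else 0) else 0) \<in> test_functions (Kn k)"
            by (rule cint_transport(1)[OF sub nice tf_mult_lc[OF YK nice_pull(2)[OF psi Lam nice sub le \<phi>] smoothing_lc[OF YK]]]) simp
          moreover have "(\<lambda>w. if w \<in> ?B then ?h (sec m k Y t y i w) * (if sec m k Y t y i w \<in> ?b then \<phi> (?p (sec m k Y t y i w)) else 0) else 0) =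
              (\<lambda>w. if w \<in> ?B then ?h (sec m k Y t y i w) * \<phi> w else 0)"
            using sec_mem[OF nice] cp_sec[OF nice] by (intro ext) simp
          ultimately show "(\<lambda>w. if w \<in> ?B then ?h (sec m k Y t y i w) * \<phi> w else 0) \<in> test_functions (Kn k)" by simp
          show "\<not> near k (1 - max j J) ?\<zeta>" using nJ False by (cases "j \<le> J") simp_all
          fix x w :: "'a kvec" assume w: "w \<in> bl k (Kn k) x (max j J)" and x: "x \<in> Kn k"
          have n: "near k (max j J) (w - x)" and wK: "w \<in> Kn k" using w by (simp_all add: mem_bl)
          have wx: "w \<in> ?B \<longleftrightarrow> x \<in> ?B"
          proof -
            have "near k i (w - x)" using le by (intro near_mono[OF n]) (simp add: J_def le_max_iff_disj)
            then show ?thesis using wK x near_trans[of k i w x "?p y"] near_trans[of k i x w "?p y"] near_commute[of k i w x]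
              by (auto simp: mem_bl)
          qed
          show "(if w \<in> ?B then ?h (sec m k Y t y i w) * \<phi> w else 0) = (if x \<in> ?B then ?h (sec m k Y t y i x) * \<phi> x else 0)"
          proof (cases "x \<in> ?B")
            case True
            then have wB: "w \<in> ?B" using wx by simp
            have "\<phi> w = \<phi> x" by (rule J3[OF _ w x]) (simp add: J_def le_max_iff_disj)
            moreover have "?h (sec m k Y t y i w) = ?h (sec m k Y t y i x)"
            proof (rule smoothing_const)
              have "near m j (sec m k Y t y i w - sec m k Y t y i x)"
                using nice_iso[OF nice sec_mem[OF nice wB] sec_mem[OF nice True], of j] near_mono[OF n, of j]
                by (simp add: cp_sec[OF nice wB] cp_sec[OF nice True])
              then show "sec m k Y t y i w \<in> bl m Y (sec m k Y t y i x) j"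
                using sec_mem[OF nice wB] by (simp add: mem_bl)
              show "sec m k Y t y i x \<in> Y" using sec_mem[OF nice True] by (simp add: mem_bl)
            qed
            ultimately show ?thesis using True wB by simp
          qed (use wx in simp)
        qed
        finally show ?thesis .
      qed
      then show ?thesis unfolding f using np(2) by (simp add: smooth_distr_cint)
    qed
    then show ?thesis by blast
  qed
  moreover have "bl k (Kn k) (?p y) r \<subseteq> ?B" by (rule bl_mono[OF le bl_self[OF coord_proj_Kn]])
  ultimately have "smooth_at_open \<psi> \<Lambda> k ?B (pushforward ?b ?B ?p ` range ?v) (?p y) \<eta>"
    unfolding smooth_at_open_def
    by (intro exI[of _ "bl k (Kn k) (?p y) r"] exI[of _ "bl k (Kn k) \<eta> r'"] conjI openin_bl bl_self coord_proj_Kn \<eta> ballI)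
  then show ?thesis
    unfolding smooth_at_def using C1_chart_nice[OF nice sub] bl_self[OF nice_x[OF nice]] \<eta>(1)
    by (intro exI[of _ ?b] exI[of _ ?B] exI[of _ ?p] exI[of _ \<eta>]) (simp add: cov_def[OF nice T sub])
qed

section \<open>Pull-back of distributions\<close>

lemma smooth_at_mono:
  assumes sm: "smooth_at \<psi> \<Lambda> m k Y D y \<eta>" and sub: "D' \<subseteq> D"
  shows "smooth_at \<psi> \<Lambda> m k Y D' y \<eta>"
proof -
  obtain U W g \<eta>0 where ch: "C1_chart m k Y U W g" "y \<in> U" "\<eta>0 \<in> Kn k" "codifferential m k U k g y (covec k \<eta>0) = \<eta>"
    and "smooth_at_open \<psi> \<Lambda> k W (pushforward U W g ` D) (g y) \<eta>0"
    using sm unfolding smooth_at_def by blast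
  then obtain U0 V0 where o: "openin (top_of_set (Kn k)) U0" "U0 \<subseteq> W" "g y \<in> U0" "openin (top_of_set (Kn k)) V0" "\<eta>0 \<in> V0"
    and N: "\<forall>\<phi>\<in>test_functions U0. \<exists>N. \<forall>u\<in>pushforward U W g ` D. \<forall>c\<in>\<Lambda>. ord c < N \<longrightarrow> (\<forall>\<xi>\<in>V0. fourier \<psi> k \<phi> u (\<lambda>i. c * \<xi> i) = 0)"
    unfolding smooth_at_open_def by blast
  have "pushforward U W g ` D' \<subseteq> pushforward U W g ` D" using sub by (rule image_mono)
  then have "\<forall>\<phi>\<in>test_functions U0. \<exists>N. \<forall>u\<in>pushforward U W g ` D'. \<forall>c\<in>\<Lambda>. ord c < N \<longrightarrow> (\<forall>\<xi>\<in>V0. fourier \<psi> k \<phi> u (\<lambda>i. c * \<xi> i) = 0)"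
    using N by (meson subsetD)
  then have "smooth_at_open \<psi> \<Lambda> k W (pushforward U W g ` D') (g y) \<eta>0"
    unfolding smooth_at_open_def using o by blast
  then show ?thesis unfolding smooth_at_def using ch by blast
qed

context
  fixes \<psi> :: "'k::nonarch_local_field \<Rightarrow> complex" and \<Lambda> :: "'k set" and n l m k :: nat
    and X Y :: "'k kvec set" and f :: "'k kvec \<Rightarrow> 'k kvec" and \<Gamma> :: "('k kvec \<times> ('k kvec \<Rightarrow> 'k)) set"
  assumes psi: "additive_character \<psi>" and Lam: "open_finite_index_subgroup \<Lambda>"
    and subX: "submanifold n l X" and subY: "submanifold m k Y"
    and mor: "strict_C1_morphism n l X m k Y f"
    and con: "conormal_set n l X m k Y f \<inter> \<Gamma> = {}"
begin

abbreviation "avg j u \<phi> \<equiv> cint n l X (\<lambda>x. smoothing m k Y j u (f x) * \<phi> x)"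

lemma XK: "X \<subseteq> Kn n" and YK: "Y \<subseteq> Kn m"
  using subX subY by (auto simp: submanifold_def)

lemma f_mem: "x \<in> X \<Longrightarrow> f x \<in> Y"
  using mor by (auto simp: strict_C1_morphism_def)

lemma f_cont: "x \<in> X \<Longrightarrow> \<exists>J. \<forall>y\<in>bl n X x J. near m i (f y - f x)"
  by (rule morphism_cont[OF mor subX]) (use subY in \<open>simp_all add: submanifold_def\<close>)

lemma f_ball:
  assumes "x \<in> X"
  obtains J where "\<And>r y. J \<le> r \<Longrightarrow> y \<in> bl n X x r \<Longrightarrow> f y \<in> bl m Y (f x) i"
proof -
  obtain J where J: "\<And>y. y \<in> bl n X x J \<Longrightarrow> near m i (f y - f x)" using f_cont[OF assms] by blast
  have "f y \<in> bl m Y (f x) i" if "J \<le> r" "y \<in> bl n X x r" for r y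
  proof -
    have "y \<in> bl n X x J" using bl_mono[OF that(1) bl_self[OF assms]] that(2) by blast
    moreover have "y \<in> X" using that(2) by (simp add: mem_bl)
    ultimately show ?thesis using J f_mem by (simp add: mem_bl)
  qed
  then show ?thesis by (rule that)
qed

lemma avg_lc: "locally_constant_on X (\<lambda>x. smoothing m k Y j u (f x))"
  by (rule lc_compose[OF XK YK _ smoothing_lc[OF YK]]) (use f_mem f_cont in auto)

lemma avg_test: "\<phi> \<in> test_functions X \<Longrightarrow> (\<lambda>x. smoothing m k Y j u (f x) * \<phi> x) \<in> test_functions X"
  by (rule tf_mult_lc[OF XK _ avg_lc])

lemma avg_add: "\<phi> \<in> test_functions X \<Longrightarrow> \<phi>' \<in> test_functions X \<Longrightarrow> avg j u (\<lambda>x. \<phi> x + \<phi>' x) = avg j u \<phi> + avg j u \<phi>'"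
  using cint_add[OF subX avg_test avg_test] by (simp add: distrib_left)

lemma avg_scale: "avg j u (\<lambda>x. c * \<phi> x) = c * avg j u \<phi>"
  using cint_scale[of n l X c "\<lambda>x. smoothing m k Y j u (f x) * \<phi> x"] by (simp add: mult.left_commute)

text \<open>For fixed j the function u \<mapsto> \<open>avg j u\<close> \<phi> involves finitely
  many values of u, with coefficients independent of u. This is what lets it pass to weak
  limits.\<close>

lemma avg_finite:
  assumes \<phi>: "\<phi> \<in> test_functions X"
  shows "\<exists>I a. finite I \<and> I \<subseteq> X \<and> (\<forall>u. avg j u \<phi> = (\<Sum>x\<in>I. a x * smoothing m k Y j u (f x)))"
proof -
  let ?Q = "\<lambda>x i. (\<exists>s. nice n l X s x i) \<and> (\<forall>y\<in>bl n X x i. f y \<in> bl m Y (f x) j)"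
  have "\<exists>j0. (\<forall>x\<in>X. \<forall>i\<ge>j0. \<phi> x \<noteq> 0 \<longrightarrow> ?Q x i) \<and> (\<forall>x\<in>X. \<forall>i\<ge>j0. \<forall>y\<in>bl n X x i. \<phi> y = \<phi> x)"
  proof (rule tf_uniform[OF XK \<phi>])
    fix x assume x: "x \<in> X"
    obtain s i where n: "nice n l X s x i" using nice_exists[OF subX x] by blast
    obtain J where J: "\<And>r y. J \<le> r \<Longrightarrow> y \<in> bl n X x r \<Longrightarrow> f y \<in> bl m Y (f x) j" using f_ball[OF x] by metis
    show "\<exists>i. ?Q x i"
      using nice_sub[OF n bl_self[OF x], of "max i J"] J[of "max i J"] by (intro exI[of _ "max i J"]) auto
  next
    fix x i y i' assume Q: "?Q x i" and y: "y \<in> bl n X x i" and le: "i \<le> i'"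
    have "f z \<in> bl m Y (f y) j" if "z \<in> bl n X y i'" for z
    proof -
      have "f z \<in> bl m Y (f x) j" using Q bl_mono[OF le y] that by blast
      moreover have "bl m Y (f y) j = bl m Y (f x) j" by (rule bl_eq_mem) (use Q y in blast)
      ultimately show ?thesis by simp
    qed
    then show "?Q y i'" using Q nice_sub[OF _ y le] by blast
  qed
  then obtain i where i: "\<And>x. x \<in> X \<Longrightarrow> \<phi> x \<noteq> 0 \<Longrightarrow> ?Q x i" "\<And>x y. x \<in> X \<Longrightarrow> y \<in> bl n X x i \<Longrightarrow> \<phi> y = \<phi> x" by blast
  have "\<exists>I. finite I \<and> I \<subseteq> {x. \<phi> x \<noteq> 0} \<and> \<phi> = (\<lambda>y. \<Sum>x\<in>I. \<phi> x * ind n X x i y) \<and>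
    (\<forall>x\<in>I. \<forall>y\<in>I. x \<noteq> y \<longrightarrow> bl n X x i \<inter> bl n X y i = {})"
    by (rule tf_decomp[OF XK \<phi>]) (rule i(2))
  then obtain I where I: "finite I" "I \<subseteq> {x. \<phi> x \<noteq> 0}" "\<phi> = (\<lambda>y. \<Sum>x\<in>I. \<phi> x * ind n X x i y)" by blast
  have IX: "I \<subseteq> X" using I(2) tfD(4)[OF \<phi>] by blast
  have Q: "?Q x i" if "x \<in> I" for x using i(1)[of x] that IX I(2) by blast
  have t: "ind n X x i \<in> test_functions X" if "x \<in> I" for x
    using Q[OF that] ind_test[OF XK] nice_compact by blast
  have "avg j u \<phi> = (\<Sum>x\<in>I. (\<phi> x * cint n l X (ind n X x i)) * smoothing m k Y j u (f x))" for u
  proof -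
    have e: "smoothing m k Y j u (f y) * \<phi> y = (\<Sum>x\<in>I. (\<phi> x * smoothing m k Y j u (f x)) * ind n X x i y)" for y
    proof -
      have "smoothing m k Y j u (f y) * \<phi> y = (\<Sum>x\<in>I. smoothing m k Y j u (f y) * (\<phi> x * ind n X x i y))"
        by (subst I(3)) (simp add: sum_distrib_left)
      also have "\<dots> = (\<Sum>x\<in>I. (\<phi> x * smoothing m k Y j u (f x)) * ind n X x i y)"
      proof (rule sum.cong[OF refl])
        fix x assume x: "x \<in> I"
        show "smoothing m k Y j u (f y) * (\<phi> x * ind n X x i y) = (\<phi> x * smoothing m k Y j u (f x)) * ind n X x i y"
        proof (cases "y \<in> bl n X x i")
          case True
          then have "f y \<in> bl m Y (f x) j" using Q[OF x] by blast
          from smoothing_const[OF this, of k u] show ?thesis using f_mem x IX by auto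
        qed (simp add: ind_def)
      qed
      finally show ?thesis .
    qed
    show ?thesis unfolding e by (subst cint_sum[OF subX t]) (auto simp: mult_ac)
  qed
  then have "\<forall>u. avg j u \<phi> = (\<Sum>x\<in>I. (\<phi> x * cint n l X (ind n X x i)) * smoothing m k Y j u (f x))" by (rule allI)
  with I(1) IX show ?thesis by (intro exI[of _ I] exI[of _ "\<lambda>x. \<phi> x * cint n l X (ind n X x i)"] conjI)
qed

lemma avg_vanish:
  assumes "\<And>x. \<phi> x \<noteq> 0 \<Longrightarrow> smoothing m k Y j u (f x) = h x"
  shows "avg j u \<phi> = cint n l X (\<lambda>x. h x * \<phi> x)"
proof -
  have "(\<lambda>x. smoothing m k Y j u (f x) * \<phi> x) = (\<lambda>x. h x * \<phi> x)" using assms by fastforce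
  then show ?thesis by simp
qed

text \<open>For the distributions in question the sequence is eventually constant on test functions.
  On all other functions it is constantly 0, in accordance with the convention for
  distributions.\<close>

definition pull :: "'k distr \<Rightarrow> 'k distr" where
  "pull u \<phi> = lim (\<lambda>j::nat. smooth_distr n l X (smoothing m k Y (int j) u \<circ> f) \<phi>)"

lemma smooth_avg: "\<phi> \<in> test_functions X \<Longrightarrow> smooth_distr n l X (smoothing m k Y j u \<circ> f) \<phi> = avg j u \<phi>"
  by (simp add: smooth_distr_cint)

lemma pull_eq:
  assumes \<phi>: "\<phi> \<in> test_functions X" and ev: "\<And>j. j0 \<le> j \<Longrightarrow> avg j u \<phi> = c"
  shows "pull u \<phi> = c"
  unfolding pull_def
proof (rule limI, rule tendsto_eventually)
  have "smooth_distr n l X (smoothing m k Y (int j) u \<circ> f) \<phi> = c" if "nat j0 \<le> j" for j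
    unfolding smooth_avg[OF \<phi>] by (rule ev) (use that in linarith)
  then show "\<forall>\<^sub>F j in sequentially. smooth_distr n l X (smoothing m k Y (int j) u \<circ> f) \<phi> = c"
    unfolding eventually_sequentially by blast
qed

lemma pull_outside: "\<phi> \<notin> test_functions X \<Longrightarrow> pull u \<phi> = 0"
  by (simp add: pull_def smooth_distr_def)

abbreviation "lift s x j g \<equiv> \<lambda>z. if z \<in> bl n X x j then g (coord_proj l s z) else (0::complex)"

context
  fixes D :: "'k distr set"
  assumes D: "D \<subseteq> distributions Y"
    and sm: "\<And>y \<eta>. (y, \<eta>) \<in> cotangent_nz m k Y - \<Gamma> \<Longrightarrow> smooth_at \<psi> \<Lambda> m k Y D y \<eta>"
begin

text \<open>The coordinate estimates carried back to X. The level r is taken beyond j so that f maps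
  the small ball into the isometric chart of Y; the last claim has a level of its own, because it
  depends on the direction \<zeta>.\<close>

lemma local_pullback:
  assumes x: "x \<in> X"
  obtains s j S r where "nice n l X s x j" "sd l n (bl l (Kn l) (coord_proj l s x) j) (sec n l X s x j) S (coord_proj l s x)"
    "j \<le> r" "\<forall>g\<in>test_functions (bl l (Kn l) (coord_proj l s x) r). \<exists>j0. \<forall>j'\<ge>j0. \<forall>u\<in>D. avg j' u (lift s x j g) = avg j0 u (lift s x j g)"
    "\<forall>\<zeta>\<in>Kn l. \<zeta> \<noteq> 0 \<longrightarrow> (x, cov n l X s x j \<zeta>) \<notin> pullback_cone n l X m f \<Gamma> \<longrightarrow>
      (\<exists>j1 r i. j \<le> r \<and> (\<forall>g\<in>test_functions (bl l (Kn l) (coord_proj l s x) r). \<exists>N. \<forall>u\<in>D. \<forall>c\<in>\<Lambda>. ord c < N \<longrightarrow>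
        (\<forall>\<xi>\<in>bl l (Kn l) \<zeta> i. \<forall>j'\<ge>j1. avg j' u (lift s x j (\<lambda>w. g w * \<psi> (dotp l w (\<lambda>i. c * \<xi> i)))) = 0)))"
proof -
  obtain s j where nX: "nice n l X s x j" using nice_exists[OF subX x] by blast
  obtain t i where nY: "nice m k Y t (f x) i" using nice_exists[OF subY f_mem[OF x]] by blast
  let ?p = "coord_proj l s" let ?q = "coord_proj k t"
  let ?B = "bl l (Kn l) (?p x) j" let ?W = "bl k (Kn k) (?q (f x)) i" let ?bY = "bl m Y (f x) i"
  let ?\<sigma> = "sec n l X s x j"
  have pB: "?p x \<in> ?B" by (rule bl_self[OF coord_proj_Kn])
  obtain S where S: "sd l n ?B ?\<sigma> S (?p x)" using nice_sec_C1[OF nX] pB unfolding strict_C1_iff by blast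
  have qW: "?q (f x) \<in> ?W" by (rule bl_self[OF coord_proj_Kn])
  obtain T where T: "sd k m ?W (sec m k Y t (f x) i) T (?q (f x))"
    using nice_sec_C1[OF nY] qW unfolding strict_C1_iff by blast
  define F where "F = (\<lambda>w. ?q (f (?\<sigma> w)))"
  obtain A where A: "sd l k ?B F A (?p x)"
    and AT: "\<And>\<theta>. codifferential n l X m f x (cov m k Y t (f x) i \<theta>) = cov n l X s x j (tmapp k l A \<theta>)"
    using morphism_local[OF mor subX subY nX nY S T] unfolding F_def by metis
  obtain J where J: "\<And>r y. J \<le> r \<Longrightarrow> y \<in> bl n X x r \<Longrightarrow> f y \<in> ?bY" using f_ball[OF x] by metis
  define r where "r = max j J"
  have jr: "j \<le> r" by (simp add: r_def)
  define D' where "D' = pushforward ?bY ?W ?q ` D"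
  \<comment> \<open>The fibre of \<Gamma> over f x in coordinates of the isometric chart of
    Y.\<close>
  define G where "G = {\<theta>. (f x, cov m k Y t (f x) i \<theta>) \<in> \<Gamma>}"
  have D': "D' \<subseteq> distributions ?W"
    unfolding D'_def using pushforward_distr[OF C1_chart_nice[OF nY subY] subY] D by blast
  have Fx: "F (?p x) = ?q (f x)" unfolding F_def using sec_cp[OF nX bl_self[OF x]] by simp
  have FK: "F ` bl l (Kn l) (?p x) r \<subseteq> Kn k" by (auto simp: F_def coord_proj_Kn)
  have sF: "sd l k (bl l (Kn l) (?p x) r) F A (?p x)"
    by (rule sd_mono[OF A bl_mono[OF jr pB]])
  have GG: "smooth_at_open \<psi> \<Lambda> k ?W D' (?q (f x)) \<theta>" if \<theta>: "\<theta> \<in> Kn k" "\<theta> \<noteq> 0" "\<theta> \<notin> G" for \<theta>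
    unfolding D'_def
    by (rule smooth_at_nice[OF psi Lam nY subY T D \<theta>(1) sm])
      (use \<theta>(3) cov_cotangent[OF nY T subY \<theta>(1,2)] in \<open>simp add: G_def\<close>)
  \<comment> \<open>This is where disjointness of \<Gamma> from the conormal set enters.\<close>
  have G0: "tmapp k l A \<theta> \<noteq> 0" if \<theta>: "\<theta> \<in> Kn k" "\<theta> \<noteq> 0" "\<theta> \<in> G" for \<theta>
  proof
    assume "tmapp k l A \<theta> = 0"
    then have "codifferential n l X m f x (cov m k Y t (f x) i \<theta>) = (\<lambda>_. 0)"
      using AT[of \<theta>] cov_0[OF nX S subX] by simp
    then have "(f x, cov m k Y t (f x) i \<theta>) \<in> conormal_set n l X m k Y f"
      using cov_cotangent[OF nY T subY \<theta>(1,2)] x by (auto simp: conormal_set_def)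
    then show False using con \<theta>(3) by (auto simp: G_def)
  qed
  \<comment> \<open>For levels from i on, the ball around the image point lies inside the isometric
    chart of Y and projects onto a ball of the same level, so averages on Y become averages of the
    push-forward.\<close>
  have av: "avg j' u (\<lambda>z. if z \<in> bl n X x j then g (?p z) else 0) =
      iK l (\<lambda>w. g w * (qpow TYPE('k) (int k * j') * pushforward ?bY ?W ?q u (ind k (Kn k) (F w) j')))"
    if g: "g \<in> test_functions (bl l (Kn l) (?p x) r0)" and r0: "r \<le> r0" and j': "i \<le> j'" for g r0 j' u
  proof (rule nice_cint[OF psi Lam nX subX _ g avg_lc])
    show "j \<le> r0" using jr r0 by simp
    fix w assume w: "w \<in> bl l (Kn l) (?p x) r0"
    then have wB: "w \<in> ?B" using bl_mono[OF order_trans[OF jr r0] pB] by blast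
    have "near n r0 (?\<sigma> w - x)"
      using w nice_iso[OF nX sec_mem[OF nX wB] bl_self[OF x], of r0] cp_sec[OF nX wB] by (simp add: mem_bl)
    then have "?\<sigma> w \<in> bl n X x r0" using sec_mem[OF nX wB] by (simp add: mem_bl)
    then have y: "f (?\<sigma> w) \<in> ?bY" using J[of r0] r0 by (simp add: r_def)
    have "ind k (Kn k) (F w) j' \<in> test_functions ?W"
      unfolding F_def
      by (rule tf_bl_extend[OF psi Lam bl_mono[OF j' cp_mem[OF nY y]] bl_subset ind_test_bl[OF psi Lam]])
    moreover have "(\<lambda>z. if z \<in> ?bY then ind k (Kn k) (F w) j' (?q z) else 0) = ind m Y (f (?\<sigma> w)) j'"
    proof
      fix z show "(if z \<in> ?bY then ind k (Kn k) (F w) j' (?q z) else 0) = ind m Y (f (?\<sigma> w)) j' z"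
      proof (cases "z \<in> ?bY")
        case True
        then show ?thesis using nice_iso[OF nY True y, of j'] by (simp add: ind_def F_def mem_bl coord_proj_Kn)
      next
        case False
        then show ?thesis using bl_mono[OF j' y] by (auto simp: ind_def)
      qed
    qed
    ultimately show "smoothing m k Y j' u (f (?\<sigma> w)) = qpow TYPE('k) (int k * j') * pushforward ?bY ?W ?q u (ind k (Kn k) (F w) j')"
      using nice_sub[OF nY y j'] by (auto simp: smoothing_def pushforward_def)
  qed
  have "\<exists>r'\<ge>r. \<forall>g\<in>test_functions (bl l (Kn l) (?p x) r'). \<exists>j0. \<forall>j\<ge>j0. \<forall>u\<in>D'.
    iK l (\<lambda>x. g x * (qpow TYPE('k) (int k * j) * u (ind k (Kn k) (F x) j))) =
    iK l (\<lambda>x. g x * (qpow TYPE('k) (int k * j0) * u (ind k (Kn k) (F x) j0)))"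
    by (rule pullback_stable[OF psi Lam openin_bl D' qW coord_proj_Kn Fx FK sF]) (rule GG G0, assumption+)+
  then obtain r' where r': "r \<le> r'" "\<And>g. g \<in> test_functions (bl l (Kn l) (?p x) r') \<Longrightarrow> \<exists>j0. \<forall>j\<ge>j0. \<forall>u\<in>D'.
    iK l (\<lambda>x. g x * (qpow TYPE('k) (int k * j) * u (ind k (Kn k) (F x) j))) =
    iK l (\<lambda>x. g x * (qpow TYPE('k) (int k * j0) * u (ind k (Kn k) (F x) j0)))" by blast
  have stable: "\<exists>j0. \<forall>j'\<ge>j0. \<forall>u\<in>D.
      avg j' u (\<lambda>z. if z \<in> bl n X x j then g (?p z) else 0) = avg j0 u (\<lambda>z. if z \<in> bl n X x j then g (?p z) else 0)"
    if g: "g \<in> test_functions (bl l (Kn l) (?p x) r')" for g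
  proof -
    obtain j0 where j0: "\<And>j u. j0 \<le> j \<Longrightarrow> u \<in> D \<Longrightarrow>
      iK l (\<lambda>x. g x * (qpow TYPE('k) (int k * j) * pushforward ?bY ?W ?q u (ind k (Kn k) (F x) j))) =
      iK l (\<lambda>x. g x * (qpow TYPE('k) (int k * j0) * pushforward ?bY ?W ?q u (ind k (Kn k) (F x) j0)))"
      using r'(2)[OF g] unfolding D'_def by blast
    have "avg j' u (\<lambda>z. if z \<in> bl n X x j then g (?p z) else 0) =
        avg (max i j0) u (\<lambda>z. if z \<in> bl n X x j then g (?p z) else 0)" if "max i j0 \<le> j'" "u \<in> D" for j' u
    proof -
      have "i \<le> j'" "j0 \<le> j'" "i \<le> max i j0" "j0 \<le> max i j0" using that(1) by simp_all
      then show ?thesis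
        using av[OF g r'(1), of j' u] av[OF g r'(1), of "max i j0" u] j0[of j' u] j0[of "max i j0" u] that(2) by simp
    qed
    then show ?thesis by blast
  qed
  have smooth: "\<exists>j1 r i. j \<le> r \<and> (\<forall>g\<in>test_functions (bl l (Kn l) (?p x) r). \<exists>N. \<forall>u\<in>D. \<forall>c\<in>\<Lambda>. ord c < N \<longrightarrow>
        (\<forall>\<xi>\<in>bl l (Kn l) \<zeta> i. \<forall>j'\<ge>j1. avg j' u
          (\<lambda>z. if z \<in> bl n X x j then g (?p z) * \<psi> (dotp l (?p z) (\<lambda>i. c * \<xi> i)) else 0) = 0))"
    if \<zeta>: "\<zeta> \<in> Kn l" "\<zeta> \<noteq> 0" and out: "(x, cov n l X s x j \<zeta>) \<notin> pullback_cone n l X m f \<Gamma>" for \<zeta>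
  proof -
    have G1: "tmapp k l A \<theta> \<noteq> \<zeta>" if "\<theta> \<in> Kn k" "\<theta> \<noteq> 0" "\<theta> \<in> G" for \<theta>
    proof
      assume "tmapp k l A \<theta> = \<zeta>"
      then have "cov n l X s x j \<zeta> = codifferential n l X m f x (cov m k Y t (f x) i \<theta>)" using AT[of \<theta>] by simp
      moreover have "(f x, cov m k Y t (f x) i \<theta>) \<in> \<Gamma>" using that(3) by (simp add: G_def)
      ultimately have "(x, cov n l X s x j \<zeta>) \<in> pullback_cone n l X m f \<Gamma>"
        using cov_cotangent[OF nX S subX \<zeta>] unfolding pullback_cone_def by blast
      then show False using out by blast
    qed
    have "\<exists>j1 j2 i. r \<le> j2 \<and> (\<forall>g\<in>test_functions (bl l (Kn l) (?p x) j2). \<exists>N. \<forall>u\<in>D'. \<forall>c\<in>\<Lambda>. ord c < N \<longrightarrow>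
      (\<forall>\<xi>\<in>bl l (Kn l) \<zeta> i. \<forall>j\<ge>j1.
        iK l (\<lambda>x. g x * \<psi> (dotp l x (\<lambda>i. c * \<xi> i)) * (qpow TYPE('k) (int k * j) * u (ind k (Kn k) (F x) j))) = 0))"
      by (rule pullback_smooth[OF psi Lam openin_bl D' qW coord_proj_Kn Fx FK sF _ _ \<zeta>]) (rule GG G0 G1, assumption+)+
    then obtain j1 j2 i' where j: "r \<le> j2" and sm2: "\<And>g. g \<in> test_functions (bl l (Kn l) (?p x) j2) \<Longrightarrow> \<exists>N. \<forall>u\<in>D'. \<forall>c\<in>\<Lambda>. ord c < N \<longrightarrow>
      (\<forall>\<xi>\<in>bl l (Kn l) \<zeta> i'. \<forall>j\<ge>j1.
        iK l (\<lambda>x. g x * \<psi> (dotp l x (\<lambda>i. c * \<xi> i)) * (qpow TYPE('k) (int k * j) * u (ind k (Kn k) (F x) j))) = 0)"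
      by blast
    have "\<exists>N. \<forall>u\<in>D. \<forall>c\<in>\<Lambda>. ord c < N \<longrightarrow>
        (\<forall>\<xi>\<in>bl l (Kn l) \<zeta> i'. \<forall>j'\<ge>max i j1. avg j' u
          (\<lambda>z. if z \<in> bl n X x j then g (?p z) * \<psi> (dotp l (?p z) (\<lambda>i. c * \<xi> i)) else 0) = 0)"
      if g: "g \<in> test_functions (bl l (Kn l) (?p x) j2)" for g
    proof -
      obtain N where N: "\<And>u c \<xi> j. u \<in> D \<Longrightarrow> c \<in> \<Lambda> \<Longrightarrow> ord c < N \<Longrightarrow> \<xi> \<in> bl l (Kn l) \<zeta> i' \<Longrightarrow> j1 \<le> j \<Longrightarrow>
        iK l (\<lambda>x. g x * \<psi> (dotp l x (\<lambda>i. c * \<xi> i)) * (qpow TYPE('k) (int k * j) * pushforward ?bY ?W ?q u (ind k (Kn k) (F x) j))) = 0"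
        using sm2[OF g] unfolding D'_def by blast
      have "avg j' u (\<lambda>z. if z \<in> bl n X x j then g (?p z) * \<psi> (dotp l (?p z) (\<lambda>i. c * \<xi> i)) else 0) = 0"
        if "u \<in> D" "c \<in> \<Lambda>" "ord c < N" "\<xi> \<in> bl l (Kn l) \<zeta> i'" "max i j1 \<le> j'" for u c \<xi> j'
      proof -
        have "(\<lambda>w. g w * \<psi> (dotp l w (\<lambda>i. c * \<xi> i))) \<in> test_functions (bl l (Kn l) (?p x) j2)"
          using tf_mult_lc[OF bl_subset g lc_psi[OF psi bl_subset]] by (simp add: mult.commute)
        from av[OF this j, of j' u] N[OF that(1-4), of j'] that(5) show ?thesis by simp
      qed
      then show ?thesis by blast
    qed
    then have "\<forall>g\<in>test_functions (bl l (Kn l) (?p x) j2). \<exists>N. \<forall>u\<in>D. \<forall>c\<in>\<Lambda>. ord c < N \<longrightarrow>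
        (\<forall>\<xi>\<in>bl l (Kn l) \<zeta> i'. \<forall>j'\<ge>max i j1. avg j' u
          (\<lambda>z. if z \<in> bl n X x j then g (?p z) * \<psi> (dotp l (?p z) (\<lambda>i. c * \<xi> i)) else 0) = 0)" by (rule ballI)
    moreover have "j \<le> j2" using j jr by simp
    ultimately show ?thesis
      by (rule exI[of _ "max i j1", OF exI[of _ j2, OF exI[of _ i', OF conjI]], rotated])
  qed
  have "j \<le> r'" using jr r'(1) by simp
  moreover have "\<forall>g\<in>test_functions (bl l (Kn l) (?p x) r'). \<exists>j0. \<forall>j'\<ge>j0. \<forall>u\<in>D.
      avg j' u (lift s x j g) = avg j0 u (lift s x j g)" by (rule ballI) (rule stable)
  moreover have "\<forall>\<zeta>\<in>Kn l. \<zeta> \<noteq> 0 \<longrightarrow> (x, cov n l X s x j \<zeta>) \<notin> pullback_cone n l X m f \<Gamma> \<longrightarrow>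
      (\<exists>j1 r i. j \<le> r \<and> (\<forall>g\<in>test_functions (bl l (Kn l) (?p x) r). \<exists>N. \<forall>u\<in>D. \<forall>c\<in>\<Lambda>. ord c < N \<longrightarrow>
        (\<forall>\<xi>\<in>bl l (Kn l) \<zeta> i. \<forall>j'\<ge>j1. avg j' u (lift s x j (\<lambda>w. g w * \<psi> (dotp l w (\<lambda>i. c * \<xi> i)))) = 0)))"
    by (intro ballI impI) (rule smooth)
  ultimately show ?thesis by (rule that[OF nX S])
qed

text \<open>Localization: Q demands stability of every test function supported in the ball, which
  passes to smaller balls and holds near each point by \<open>local_pullback\<close>. A finite sum
  then takes the maximum of the levels.\<close>

lemma avg_stable:
  assumes \<phi>: "\<phi> \<in> test_functions X"
  shows "\<exists>j0. \<forall>j\<ge>j0. \<forall>u\<in>D. avg j u \<phi> = avg j0 u \<phi>"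
proof -
  define P where "P \<phi> \<longleftrightarrow> (\<exists>j0. \<forall>j\<ge>j0. \<forall>u\<in>D. avg j u \<phi> = avg j0 u \<phi>)" for \<phi>
  define Q where "Q x j \<longleftrightarrow> (\<exists>s. nice n l X s x j) \<and>
    (\<forall>\<phi>\<in>test_functions X. (\<forall>z. z \<notin> bl n X x j \<longrightarrow> \<phi> z = 0) \<longrightarrow> P \<phi>)" for x j
  have "P \<phi>"
  proof (rule tf_induct[OF XK \<phi>, of Q])
    fix x assume x: "x \<in> X"
    obtain s j S r where nX: "nice n l X s x j" and "sd l n (bl l (Kn l) (coord_proj l s x) j) (sec n l X s x j) S (coord_proj l s x)"
      and r: "j \<le> r" "\<forall>g\<in>test_functions (bl l (Kn l) (coord_proj l s x) r). \<exists>j0. \<forall>j'\<ge>j0. \<forall>u\<in>D. avg j' u (lift s x j g) = avg j0 u (lift s x j g)"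
      by (rule local_pullback[OF x]) (rule that)
    have "P \<phi>" if "\<phi> \<in> test_functions X" "\<forall>z. z \<notin> bl n X x r \<longrightarrow> \<phi> z = 0" for \<phi>
    proof -
      have "\<exists>g\<in>test_functions (bl l (Kn l) (coord_proj l s x) r). \<phi> = lift s x j g"
        by (rule nice_push[OF psi Lam nX subX r(1) that(1)]) (use that(2) in blast)
      then obtain g where g: "g \<in> test_functions (bl l (Kn l) (coord_proj l s x) r)" "\<phi> = lift s x j g" by (elim bexE)
      show ?thesis unfolding P_def g(2) by (rule bspec[OF r(2) g(1)])
    qed
    then have "Q x r" unfolding Q_def using nice_sub[OF nX bl_self[OF x] r(1)] by blast
    then show "\<exists>j. Q x j" by blast
  next
    fix x j y j' assume Q: "Q x j" and y: "y \<in> bl n X x j" and le: "j \<le> j'"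
    show "Q y j'" using Q nice_sub[OF _ y le] bl_mono[OF le y] unfolding Q_def by blast
  next
    show "compact (bl n X x j)" if "Q x j" for x j using that nice_compact unfolding Q_def by blast
    show "P (\<lambda>_. 0)" by (simp add: P_def cint_0)
    show "P (ind n X x j)" if "x \<in> X" "Q x j" for x j
    proof -
      have "ind n X x j \<in> test_functions X" using that nice_compact ind_test[OF XK] unfolding Q_def by blast
      then show ?thesis using that(2) unfolding Q_def by (auto simp: ind_def)
    qed
    show "P (\<lambda>x. \<phi> x + \<phi>' x)" if t: "\<phi> \<in> test_functions X" "\<phi>' \<in> test_functions X" and P: "P \<phi>" "P \<phi>'" for \<phi> \<phi>'
    proof -
      obtain j0 where j0: "\<And>j u. j0 \<le> j \<Longrightarrow> u \<in> D \<Longrightarrow> avg j u \<phi> = avg j0 u \<phi>" using P(1) unfolding P_def by blast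
      obtain j1 where j1: "\<And>j u. j1 \<le> j \<Longrightarrow> u \<in> D \<Longrightarrow> avg j u \<phi>' = avg j1 u \<phi>'" using P(2) unfolding P_def by blast
      have "avg j u (\<lambda>x. \<phi> x + \<phi>' x) = avg (max j0 j1) u (\<lambda>x. \<phi> x + \<phi>' x)" if "max j0 j1 \<le> j" "u \<in> D" for j u
        using j0[of j u] j0[of "max j0 j1" u] j1[of j u] j1[of "max j0 j1" u] that by (simp add: avg_add[OF t])
      then show ?thesis unfolding P_def by blast
    qed
    show "P (\<lambda>x. c * \<phi> x)" if "P \<phi>" for c \<phi> using that unfolding P_def by (simp add: avg_scale) metis
  qed
  then show ?thesis by (simp add: P_def)
qed

lemma pull_avg:
  assumes \<phi>: "\<phi> \<in> test_functions X"
  shows "\<exists>j0. \<forall>j\<ge>j0. \<forall>u\<in>D. avg j u \<phi> = pull u \<phi>"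
proof -
  obtain j0 where j0: "\<And>j u. j0 \<le> j \<Longrightarrow> u \<in> D \<Longrightarrow> avg j u \<phi> = avg j0 u \<phi>" using avg_stable[OF \<phi>] by blast
  have "pull u \<phi> = avg j0 u \<phi>" if "u \<in> D" for u by (rule pull_eq[OF \<phi> j0]) (use that in simp_all)
  then have "avg j u \<phi> = pull u \<phi>" if "j0 \<le> j" "u \<in> D" for j u using j0[OF that] that(2) by simp
  then show ?thesis by blast
qed

text \<open>In the local estimate neither N nor the starting level j1 depends on the averaging level
  j', so the vanishing of Fourier transforms passes from the averages to the pull-back, and it stays
  uniform over D.\<close>

lemma pull_smooth_at:
  assumes \<xi>: "(x, \<xi>) \<in> cotangent_nz n l X - pullback_cone n l X m f \<Gamma>"
  shows "smooth_at \<psi> \<Lambda> n l X (pull ` D) x \<xi>"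
proof -
  have x: "x \<in> X" and \<xi>c: "\<xi> \<in> covectors n l X x" and \<xi>0: "\<xi> \<noteq> (\<lambda>_. 0)" using \<xi> by (auto simp: cotangent_nz_def)
  obtain s j S r0 where nX: "nice n l X s x j" and S: "sd l n (bl l (Kn l) (coord_proj l s x) j) (sec n l X s x j) S (coord_proj l s x)"
    and "j \<le> r0" "\<forall>g\<in>test_functions (bl l (Kn l) (coord_proj l s x) r0). \<exists>j0. \<forall>j'\<ge>j0. \<forall>u\<in>D. avg j' u (lift s x j g) = avg j0 u (lift s x j g)"
    and loc: "\<forall>\<zeta>\<in>Kn l. \<zeta> \<noteq> 0 \<longrightarrow> (x, cov n l X s x j \<zeta>) \<notin> pullback_cone n l X m f \<Gamma> \<longrightarrow>
      (\<exists>j1 r i. j \<le> r \<and> (\<forall>g\<in>test_functions (bl l (Kn l) (coord_proj l s x) r). \<exists>N. \<forall>u\<in>D. \<forall>c\<in>\<Lambda>. ord c < N \<longrightarrow>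
        (\<forall>\<xi>\<in>bl l (Kn l) \<zeta> i. \<forall>j'\<ge>j1. avg j' u (lift s x j (\<lambda>w. g w * \<psi> (dotp l w (\<lambda>i. c * \<xi> i)))) = 0)))"
    by (rule local_pullback[OF x]) (rule that)
  let ?p = "coord_proj l s" let ?b = "bl n X x j" let ?B = "bl l (Kn l) (?p x) j"
  obtain \<zeta> where \<zeta>: "\<zeta> \<in> Kn l" "cov n l X s x j \<zeta> = \<xi>" using cov_surj[OF nX S subX \<xi>c] by blast
  have \<zeta>0: "\<zeta> \<noteq> 0" using \<zeta>(2) \<xi>0 cov_0[OF nX S subX] by blast
  obtain j1 r i where jr: "j \<le> r" and L: "\<And>g. g \<in> test_functions (bl l (Kn l) (?p x) r) \<Longrightarrow> \<exists>N. \<forall>u\<in>D. \<forall>c\<in>\<Lambda>. ord c < N \<longrightarrow>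
        (\<forall>\<xi>\<in>bl l (Kn l) \<zeta> i. \<forall>j'\<ge>j1. avg j' u
          (\<lambda>z. if z \<in> ?b then g (?p z) * \<psi> (dotp l (?p z) (\<lambda>i. c * \<xi> i)) else 0) = 0)"
  proof -
    have "(x, cov n l X s x j \<zeta>) \<notin> pullback_cone n l X m f \<Gamma>" using \<zeta>(2) \<xi> by simp
    from bspec[OF loc \<zeta>(1), rule_format, OF \<zeta>0 this] show ?thesis using that by (elim exE conjE) blast
  qed
  have "\<exists>N. \<forall>v\<in>pushforward ?b ?B ?p ` pull ` D. \<forall>c\<in>\<Lambda>. ord c < N \<longrightarrow>
      (\<forall>\<xi>\<in>bl l (Kn l) \<zeta> i. fourier \<psi> l \<phi> v (\<lambda>i. c * \<xi> i) = 0)"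
    if \<phi>: "\<phi> \<in> test_functions (bl l (Kn l) (?p x) r)" for \<phi>
  proof -
    obtain N where N: "\<And>u c \<xi> j'. u \<in> D \<Longrightarrow> c \<in> \<Lambda> \<Longrightarrow> ord c < N \<Longrightarrow> \<xi> \<in> bl l (Kn l) \<zeta> i \<Longrightarrow> j1 \<le> j' \<Longrightarrow>
      avg j' u (\<lambda>z. if z \<in> ?b then \<phi> (?p z) * \<psi> (dotp l (?p z) (\<lambda>i. c * \<xi> i)) else 0) = 0"
      using L[OF \<phi>] by blast
    have "fourier \<psi> l \<phi> (pushforward ?b ?B ?p (pull u)) (\<lambda>i. c * \<xi> i) = 0"
      if "u \<in> D" "c \<in> \<Lambda>" "ord c < N" "\<xi> \<in> bl l (Kn l) \<zeta> i" for u c \<xi>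
    proof -
      have "(\<lambda>w. \<phi> w * \<psi> (dotp l w (\<lambda>i. c * \<xi> i))) \<in> test_functions (bl l (Kn l) (?p x) r)"
        using tf_mult_lc[OF bl_subset \<phi> lc_psi[OF psi bl_subset]] by (simp add: mult.commute)
      note np = nice_pull[OF psi Lam nX subX jr this]
      have "pull u (\<lambda>z. if z \<in> ?b then \<phi> (?p z) * \<psi> (dotp l (?p z) (\<lambda>i. c * \<xi> i)) else 0) = 0"
        by (rule pull_eq[OF np(2) N[OF that]])
      then show ?thesis using np(1) by (simp add: fourier_def pushforward_def)
    qed
    then show ?thesis by blast
  qed
  moreover have "bl l (Kn l) (?p x) r \<subseteq> ?B" by (rule bl_mono[OF jr bl_self[OF coord_proj_Kn]])
  ultimately have "smooth_at_open \<psi> \<Lambda> l ?B (pushforward ?b ?B ?p ` pull ` D) (?p x) \<zeta>"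
    unfolding smooth_at_open_def
    by (intro exI[of _ "bl l (Kn l) (?p x) r"] exI[of _ "bl l (Kn l) \<zeta> i"] conjI openin_bl bl_self coord_proj_Kn \<zeta>(1) ballI)
  then show ?thesis
    unfolding smooth_at_def using C1_chart_nice[OF nX subX] bl_self[OF x] \<zeta>
    by (intro exI[of _ ?b] exI[of _ ?B] exI[of _ ?p] exI[of _ \<zeta>]) (simp add: cov_def[OF nX S subX])
qed

end

section \<open>Properties of the pull-back\<close>

lemma distributions_WF_smooth:
  assumes "u \<in> distributions_WF \<psi> \<Lambda> m k Y \<Gamma>"
  shows "{u} \<subseteq> distributions Y" "\<And>y \<eta>. (y, \<eta>) \<in> cotangent_nz m k Y - \<Gamma> \<Longrightarrow> smooth_at \<psi> \<Lambda> m k Y {u} y \<eta>"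
  using assms by (auto simp: distributions_WF_def WF_def)

lemma pull_avg_WF:
  assumes u: "u \<in> distributions_WF \<psi> \<Lambda> m k Y \<Gamma>" and \<phi>: "\<phi> \<in> test_functions X"
  obtains j0 where "\<And>j. j0 \<le> j \<Longrightarrow> avg j u \<phi> = pull u \<phi>"
proof -
  have "\<exists>j0. \<forall>j\<ge>j0. \<forall>v\<in>{u}. avg j v \<phi> = pull v \<phi>"
    by (rule pull_avg[OF distributions_WF_smooth(1)[OF u] _ \<phi>]) (rule distributions_WF_smooth(2)[OF u])
  then show ?thesis using that by blast
qed

lemma pull_distr:
  assumes u: "u \<in> distributions_WF \<psi> \<Lambda> m k Y \<Gamma>"
  shows "pull u \<in> distributions X"
proof -
  have "pull u (\<lambda>x. \<phi> x + \<phi>' x) = pull u \<phi> + pull u \<phi>'" if t: "\<phi> \<in> test_functions X" "\<phi>' \<in> test_functions X" for \<phi> \<phi>'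
  proof -
    obtain j0 where j0: "\<And>j. j0 \<le> j \<Longrightarrow> avg j u \<phi> = pull u \<phi>" using pull_avg_WF[OF u t(1)] by blast
    obtain j1 where j1: "\<And>j. j1 \<le> j \<Longrightarrow> avg j u \<phi>' = pull u \<phi>'" using pull_avg_WF[OF u t(2)] by blast
    show ?thesis
      by (rule pull_eq[OF tf_add[OF XK t], of "max j0 j1"]) (simp add: avg_add[OF t] j0 j1)
  qed
  moreover have "pull u (\<lambda>x. c * \<phi> x) = c * pull u \<phi>" if t: "\<phi> \<in> test_functions X" for \<phi> c
  proof -
    obtain j0 where j0: "\<And>j. j0 \<le> j \<Longrightarrow> avg j u \<phi> = pull u \<phi>" using pull_avg_WF[OF u t] by blast
    show ?thesis by (rule pull_eq[OF tf_scale[OF XK t], of j0]) (simp add: avg_scale j0)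
  qed
  ultimately show ?thesis using pull_outside by (simp add: distributions_def)
qed

text \<open>On a ball where h is constant, integrating h against the indicator and dividing by the
  volume returns h.\<close>

lemma smoothing_of_smooth:
  assumes h: "locally_constant_on Y h" and nice: "nice m k Y t y j" and c: "\<And>z. z \<in> bl m Y y j \<Longrightarrow> h z = h y"
  shows "smoothing m k Y j (smooth_distr m k Y h) y = h y"
proof -
  have "ind m Y y j \<in> test_functions Y" by (rule ind_test[OF YK nice_compact[OF nice]])
  moreover have "(\<lambda>z. h z * ind m Y y j z) = (\<lambda>z. h y * ind m Y y j z)" using c by (auto simp: ind_def)
  ultimately have "smooth_distr m k Y h (ind m Y y j) = h y * qpow TYPE('k) (- (int k * j))"
    using integral_ind(2)[OF subY nice] by (simp add: smooth_distr_cint cint_scale)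
  moreover have "qpow TYPE('k) (int k * j) * qpow TYPE('k) (- (int k * j)) = 1" by (simp flip: qpow_add)
  ultimately show ?thesis using nice by (auto simp: smoothing_def mult.left_commute)
qed

lemma pull_smooth:
  assumes h: "locally_constant_on Y h"
  shows "pull (smooth_distr m k Y h) = smooth_distr n l X (h \<circ> f)"
proof
  fix \<phi>
  show "pull (smooth_distr m k Y h) \<phi> = smooth_distr n l X (h \<circ> f) \<phi>"
  proof (cases "\<phi> \<in> test_functions X")
    case False
    then show ?thesis using pull_outside[OF False] by (simp add: smooth_distr_def)
  next
    case True
    let ?R = "\<lambda>y i. (\<exists>t. nice m k Y t y i) \<and> (\<forall>z\<in>bl m Y y i. h z = h y)"
    have Rmono: "?R y' i'" if "?R y i" "y' \<in> bl m Y y i" "i \<le> i'" for y y' i i'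
      using that nice_sub[OF _ that(2,3)] bl_mono[OF that(3,2)] by (metis (no_types, lifting) subsetD)
    \<comment> \<open>The level i on Y may be coarser than j: f only needs to map the ball of level
      j into one fixed ball of Y, and the property then passes to the ball of level j around f
      x.\<close>
    let ?Q = "\<lambda>x j. \<exists>i\<le>j. ?R (f x) i \<and> (\<forall>z\<in>bl n X x j. f z \<in> bl m Y (f x) i)"
    have "\<exists>j0. (\<forall>x\<in>X. \<forall>j\<ge>j0. \<phi> x \<noteq> 0 \<longrightarrow> ?Q x j) \<and> (\<forall>x\<in>X. \<forall>j\<ge>j0. \<forall>y\<in>bl n X x j. \<phi> y = \<phi> x)"
    proof (rule tf_uniform[OF XK True])
      fix x assume x: "x \<in> X"
      have y: "f x \<in> Y" by (rule f_mem[OF x])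
      obtain t i where n: "nice m k Y t (f x) i" using nice_exists[OF subY y] by blast
      obtain i1 where i1: "\<And>z. z \<in> bl m Y (f x) i1 \<Longrightarrow> h z = h (f x)" using h y unfolding lc_iff[OF YK] by blast
      have "bl m Y (f x) (max i i1) \<subseteq> bl m Y (f x) i1" by (rule bl_mono[OF _ bl_self[OF y]]) simp
      then have R: "?R (f x) (max i i1)" using nice_sub[OF n bl_self[OF y], of "max i i1"] i1 by auto
      obtain J where J: "\<And>r z. J \<le> r \<Longrightarrow> z \<in> bl n X x r \<Longrightarrow> f z \<in> bl m Y (f x) (max i i1)"
        using f_ball[OF x, of "max i i1"] by metis
      have "max i i1 \<le> max J (max i i1)" "J \<le> max J (max i i1)" by simp_all
      then show "\<exists>j. ?Q x j" using R J by blast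
    next
      fix x j y j' assume Q: "?Q x j" and y: "y \<in> bl n X x j" and le: "j \<le> j'"
      then obtain i where i: "i \<le> j" "?R (f x) i" "\<And>z. z \<in> bl n X x j \<Longrightarrow> f z \<in> bl m Y (f x) i" by blast
      have e: "bl m Y (f y) i = bl m Y (f x) i" by (rule bl_eq_mem[OF i(3)[OF y]])
      have "?R (f y) i" by (rule Rmono[OF i(2) i(3)[OF y] order_refl])
      moreover have "f z \<in> bl m Y (f y) i" if "z \<in> bl n X y j'" for z
        unfolding e by (rule i(3)) (use bl_mono[OF le y] that in blast)
      moreover have "i \<le> j'" using i(1) le by simp
      ultimately show "?Q y j'" by blast
    qed
    then obtain j0 where j0: "\<And>x j. x \<in> X \<Longrightarrow> \<phi> x \<noteq> 0 \<Longrightarrow> j0 \<le> j \<Longrightarrow> ?Q x j" by blast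
    have "avg j (smooth_distr m k Y h) \<phi> = cint n l X (\<lambda>x. h (f x) * \<phi> x)" if j: "j0 \<le> j" for j
    proof (rule avg_vanish)
      fix x assume nz: "\<phi> x \<noteq> 0"
      then have x: "x \<in> X" using tfD(2)[OF True] by blast
      obtain i where i: "i \<le> j" "?R (f x) i" using j0[OF x nz j] by blast
      have "?R (f x) j" by (rule Rmono[OF i(2) bl_self[OF f_mem[OF x]] i(1)])
      then obtain t where "nice m k Y t (f x) j" "\<And>z. z \<in> bl m Y (f x) j \<Longrightarrow> h z = h (f x)" by blast
      then show "smoothing m k Y j (smooth_distr m k Y h) (f x) = h (f x)" by (rule smoothing_of_smooth[OF h])
    qed
    then have "pull (smooth_distr m k Y h) \<phi> = cint n l X (\<lambda>x. h (f x) * \<phi> x)" by (rule pull_eq[OF True])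
    then show ?thesis using True by (simp add: smooth_distr_cint)
  qed
qed

text \<open>Near a point that f maps outside the support of u, small balls around image points lie
  in an open set where u vanishes, so every sufficiently fine average is 0 there.\<close>

lemma pull_support:
  assumes u: "u \<in> distributions_WF \<psi> \<Lambda> m k Y \<Gamma>"
  shows "Supp X (pull u) \<subseteq> {x \<in> X. f x \<in> Supp Y u}"
proof
  fix x assume xs: "x \<in> Supp X (pull u)"
  then have x: "x \<in> X" by (simp add: Supp_def)
  have "f x \<in> Supp Y u"
  proof (rule ccontr)
    assume "f x \<notin> Supp Y u"
    then obtain U where U: "openin (top_of_set Y) U" "f x \<in> U" "\<And>\<phi>. \<phi> \<in> test_functions Y \<Longrightarrow> u (\<lambda>y. indicator U y * \<phi> y) = 0"
      using f_mem[OF x] unfolding Supp_def by blast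
    obtain i0 where i0: "bl m Y (f x) i0 \<subseteq> U" using U(1,2) openin_iff_near[OF YK] by blast
    obtain J where J: "\<And>r y. J \<le> r \<Longrightarrow> y \<in> bl n X x r \<Longrightarrow> f y \<in> bl m Y (f x) i0" using f_ball[OF x] by metis
    obtain s j where n: "nice n l X s x j" using nice_exists[OF subX x] by blast
    let ?V = "bl n X x (max j J)"
    have V: "compact ?V" by (rule nice_compact[OF nice_sub[OF n bl_self[OF x]]]) simp
    have "pull u (\<lambda>y. indicator ?V y * \<phi> y) = 0" if \<phi>: "\<phi> \<in> test_functions X" for \<phi>
    proof -
      have e: "(\<lambda>y. indicator ?V y * \<phi> y) = (\<lambda>y. ind n X x (max j J) y * \<phi> y)"
        by (auto simp: ind_def indicator_def)
      show ?thesis unfolding e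
      proof (rule pull_eq[OF tf_mult_lc[OF XK \<phi> lc_ind[OF XK]]])
        fix i assume i: "i0 \<le> i"
        have "avg i u (\<lambda>y. ind n X x (max j J) y * \<phi> y) = cint n l X (\<lambda>y. 0 * (ind n X x (max j J) y * \<phi> y))"
        proof (rule avg_vanish)
          fix y assume "ind n X x (max j J) y * \<phi> y \<noteq> 0"
          then have "y \<in> ?V" by (auto simp: ind_def split: if_splits)
          then have "f y \<in> bl m Y (f x) i0" using J[of "max j J"] by simp
          then have sub: "bl m Y (f y) i \<subseteq> U" using bl_mono[OF i] i0 by blast
          show "smoothing m k Y i u (f y) = 0"
          proof (cases "\<exists>t. nice m k Y t (f y) i")
            case True
            then have "ind m Y (f y) i \<in> test_functions Y" using ind_test[OF YK] nice_compact by blast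
            moreover have "(\<lambda>z. indicator U z * ind m Y (f y) i z) = ind m Y (f y) i"
              by (rule ext) (use sub in \<open>auto simp: ind_def\<close>)
            ultimately show ?thesis using U(3)[of "ind m Y (f y) i"] by (simp add: smoothing_def)
          qed (simp add: smoothing_def)
        qed
        then show "avg i u (\<lambda>y. ind n X x (max j J) y * \<phi> y) = 0" by (simp add: cint_0)
      qed
    qed
    then have "\<exists>U. openin (top_of_set X) U \<and> compact U \<and> x \<in> U \<and> (\<forall>\<phi>\<in>test_functions X. pull u (\<lambda>y. indicator U y * \<phi> y) = 0)"
      using V by (intro exI[of _ ?V] conjI openin_bl bl_self[OF x] ballI)
    then have "x \<notin> Supp X (pull u)" unfolding Supp_def by (simp only: mem_Collect_eq simp_thms)
    then show False using xs by blast
  qed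
  then show "x \<in> {x \<in> X. f x \<in> Supp Y u}" using x by simp
qed

lemma pull_WF:
  assumes u: "u \<in> distributions_WF \<psi> \<Lambda> m k Y \<Gamma>"
  shows "pull u \<in> distributions_WF \<psi> \<Lambda> n l X (pullback_cone n l X m f \<Gamma>)"
proof -
  have "smooth_at \<psi> \<Lambda> n l X (pull ` {u}) x \<xi>" if "(x, \<xi>) \<in> cotangent_nz n l X - pullback_cone n l X m f \<Gamma>" for x \<xi>
    by (rule pull_smooth_at[OF distributions_WF_smooth(1)[OF u] _ that]) (rule distributions_WF_smooth(2)[OF u])
  then show ?thesis using pull_distr[OF u] by (auto simp: distributions_WF_def WF_def)
qed

text \<open>With D = \<open>range us\<close> one averaging level computes the pull-backs of all
  members on a given test function. At that level only finitely many values of \<open>us j\<close>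
  occur, and weak convergence finishes the argument.\<close>

lemma pull_converges:
  assumes us: "\<And>j. us j \<in> distributions_WF \<psi> \<Lambda> m k Y \<Gamma>" and u: "u \<in> distributions_WF \<psi> \<Lambda> m k Y \<Gamma>"
    and c: "WF_converges \<psi> \<Lambda> m k Y \<Gamma> us u"
  shows "WF_converges \<psi> \<Lambda> n l X (pullback_cone n l X m f \<Gamma>) (\<lambda>j. pull (us j)) (pull u)"
proof -
  have D: "range us \<subseteq> distributions Y" using us by (auto simp: distributions_WF_def)
  have sm: "smooth_at \<psi> \<Lambda> m k Y (range us) y \<eta>" if "(y, \<eta>) \<in> cotangent_nz m k Y - \<Gamma>" for y \<eta>
    using c that unfolding WF_converges_def by blast
  have "(\<lambda>j. pull (us j) \<phi>) \<longlonglongrightarrow> pull u \<phi>" if \<phi>: "\<phi> \<in> test_functions X" for \<phi>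
  proof -
    have "\<exists>j0. \<forall>j\<ge>j0. \<forall>v\<in>range us. avg j v \<phi> = pull v \<phi>" by (rule pull_avg[OF D _ \<phi>]) (rule sm)
    then obtain j0 where j0: "\<And>j i. j0 \<le> j \<Longrightarrow> avg j (us i) \<phi> = pull (us i) \<phi>" by blast
    obtain j1 where j1: "\<And>j. j1 \<le> j \<Longrightarrow> avg j u \<phi> = pull u \<phi>" using pull_avg_WF[OF u \<phi>] by blast
    let ?j = "max j0 j1"
    obtain I a where I: "\<And>u. avg ?j u \<phi> = (\<Sum>x\<in>I. a x * smoothing m k Y ?j u (f x))"
      using avg_finite[OF \<phi>, of ?j] by blast
    have "(\<lambda>i. smoothing m k Y ?j (us i) (f x)) \<longlonglongrightarrow> smoothing m k Y ?j u (f x)" for x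
    proof (cases "\<exists>t. nice m k Y t (f x) ?j")
      case True
      then have "ind m Y (f x) ?j \<in> test_functions Y" using ind_test[OF YK] nice_compact by blast
      then have "(\<lambda>i. us i (ind m Y (f x) ?j)) \<longlonglongrightarrow> u (ind m Y (f x) ?j)"
        using c unfolding WF_converges_def distr_converges_def by blast
      then show ?thesis using True unfolding smoothing_def by (simp add: tendsto_mult_left)
    qed (simp add: smoothing_def)
    then have "(\<lambda>i. avg ?j (us i) \<phi>) \<longlonglongrightarrow> avg ?j u \<phi>" unfolding I by (intro tendsto_sum tendsto_mult_left)
    then show ?thesis by (simp add: j0 j1)
  qed
  moreover have "smooth_at \<psi> \<Lambda> n l X (range (\<lambda>j. pull (us j))) x \<xi>"
    if "(x, \<xi>) \<in> cotangent_nz n l X - pullback_cone n l X m f \<Gamma>" for x \<xi>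
  proof -
    have "smooth_at \<psi> \<Lambda> n l X (pull ` range us) x \<xi>" by (rule pull_smooth_at[OF D _ that]) (rule sm)
    then show ?thesis by (simp add: image_image)
  qed
  ultimately show ?thesis unfolding WF_converges_def distr_converges_def by blast
qed

lemma pull_extension: "continuous_extension \<psi> \<Lambda> n l X m k Y f \<Gamma> pull"
  unfolding continuous_extension_def seq_continuous_def
proof (intro conjI allI impI)
  show "pull \<in> distributions_WF \<psi> \<Lambda> m k Y \<Gamma> \<rightarrow> distributions X" using pull_distr by blast
  show "pull (smooth_distr m k Y h) = smooth_distr n l X (h \<circ> f)" if "locally_constant_on Y h" for h
    by (rule pull_smooth[OF that])
  show "distr_converges X (\<lambda>j. pull (us j)) (pull u)"
    if "\<forall>j. us j \<in> distributions_WF \<psi> \<Lambda> m k Y \<Gamma>" "u \<in> distributions_WF \<psi> \<Lambda> m k Y \<Gamma>" "WF_converges \<psi> \<Lambda> m k Y \<Gamma> us u" for us u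
    using pull_converges[OF _ that(2,3)] that(1) unfolding WF_converges_def by blast
qed

text \<open>Every \<open>u\<close> with wave front set in \<open>\<Gamma>\<close> is the limit of its averages, and these are smooth.\<close>

lemma pull_unique:
  assumes H: "continuous_extension \<psi> \<Lambda> n l X m k Y f \<Gamma> H" and u: "u \<in> distributions_WF \<psi> \<Lambda> m k Y \<Gamma>"
  shows "H u = pull u"
proof -
  define v where "v j = smooth_distr m k Y (smoothing m k Y (int j) u)" for j :: nat
  have uD: "u \<in> distributions Y" using u by (simp add: distributions_WF_def)
  have sm: "smooth_at \<psi> \<Lambda> m k Y (range (\<lambda>j. smooth_distr m k Y (smoothing m k Y j u))) y \<eta>"
    if \<eta>: "(y, \<eta>) \<in> cotangent_nz m k Y - \<Gamma>" for y \<eta>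
  proof -
    have y: "y \<in> Y" "\<eta> \<in> covectors m k Y y" "\<eta> \<noteq> (\<lambda>_. 0)" using \<eta> by (auto simp: cotangent_nz_def)
    obtain t i where n: "nice m k Y t y i" using nice_exists[OF subY y(1)] by blast
    obtain T where T: "sd k m (bl k (Kn k) (coord_proj k t y) i) (sec m k Y t y i) T (coord_proj k t y)"
      using nice_sec_C1[OF n] bl_self[OF coord_proj_Kn] unfolding strict_C1_iff by blast
    obtain \<theta> where \<theta>: "\<theta> \<in> Kn k" "cov m k Y t y i \<theta> = \<eta>" using cov_surj[OF n T subY y(2)] by blast
    have "\<theta> \<noteq> 0" using \<theta>(2) y(3) cov_0[OF n T subY] by blast
    from smoothing_smooth[OF psi Lam n subY T uD \<theta>(1) this] show ?thesis
      using distributions_WF_smooth(2)[OF u \<eta>] \<theta>(2) by simp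
  qed
  have smv: "smooth_at \<psi> \<Lambda> m k Y (range v) y \<eta>" if "(y, \<eta>) \<in> cotangent_nz m k Y - \<Gamma>" for y \<eta>
    by (rule smooth_at_mono[OF sm[OF that]]) (auto simp: v_def)
  have v: "v j \<in> distributions_WF \<psi> \<Lambda> m k Y \<Gamma>" for j
  proof -
    have "smooth_at \<psi> \<Lambda> m k Y {v j} y \<eta>" if "(y, \<eta>) \<in> cotangent_nz m k Y - \<Gamma>" for y \<eta>
      by (rule smooth_at_mono[OF smv[OF that]]) simp
    moreover have "v j \<in> distributions Y" unfolding v_def by (rule smooth_distr_distr[OF subY smoothing_lc[OF YK]])
    ultimately show ?thesis by (auto simp: distributions_WF_def WF_def)
  qed
  have "(\<lambda>j. v j \<phi>) \<longlonglongrightarrow> u \<phi>" if \<phi>: "\<phi> \<in> test_functions Y" for \<phi>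
  proof (rule tendsto_eventually)
    obtain j0 where j0: "\<And>j. j0 \<le> j \<Longrightarrow> cint m k Y (\<lambda>y. smoothing m k Y j u y * \<phi> y) = u \<phi>"
      using smoothing_converges[OF subY \<phi>] uD by blast
    have "v j \<phi> = u \<phi>" if "nat j0 \<le> j" for j
      unfolding v_def smooth_distr_cint[OF \<phi>] by (rule j0) (use that in linarith)
    then show "\<forall>\<^sub>F j in sequentially. v j \<phi> = u \<phi>" unfolding eventually_sequentially by blast
  qed
  then have "WF_converges \<psi> \<Lambda> m k Y \<Gamma> v u" using smv unfolding WF_converges_def distr_converges_def by blast
  then have conv: "distr_converges X (\<lambda>j. H (v j)) (H u)"
    using H v u unfolding continuous_extension_def seq_continuous_def by blast
  \<comment> \<open>On smooth averages H is prescribed, so H u is the limit of the very sequence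
    that defines \<open>pull\<close>.\<close>
  have Hv: "H (v j) = smooth_distr n l X (smoothing m k Y (int j) u \<circ> f)" for j
    using H smoothing_lc[OF YK] unfolding continuous_extension_def v_def by blast
  show ?thesis
  proof
    fix \<phi> show "H u \<phi> = pull u \<phi>"
    proof (cases "\<phi> \<in> test_functions X")
      case True
      then have "(\<lambda>j. smooth_distr n l X (smoothing m k Y (int j) u \<circ> f) \<phi>) \<longlonglongrightarrow> H u \<phi>"
        using conv unfolding distr_converges_def Hv by blast
      then show ?thesis unfolding pull_def by (rule limI[symmetric])
    next
      case False
      have "H u \<in> distributions X" using H u unfolding continuous_extension_def by blast
      then show ?thesis using False pull_outside[OF False] by (simp add: distributions_def)
    qed
  qed
qed

lemma pullback_exists:
  "\<exists>F. continuous_extension \<psi> \<Lambda> n l X m k Y f \<Gamma> F \<and>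
    (\<forall>G. continuous_extension \<psi> \<Lambda> n l X m k Y f \<Gamma> G \<longrightarrow>
       (\<forall>u\<in>distributions_WF \<psi> \<Lambda> m k Y \<Gamma>. G u = F u)) \<and>
    (\<forall>u\<in>distributions_WF \<psi> \<Lambda> m k Y \<Gamma>.
       Supp X (F u) \<subseteq> {x \<in> X. f x \<in> Supp Y u} \<and>
       F u \<in> distributions_WF \<psi> \<Lambda> n l X (pullback_cone n l X m f \<Gamma>)) \<and>
    seq_continuous (distributions_WF \<psi> \<Lambda> m k Y \<Gamma>)
      (WF_converges \<psi> \<Lambda> m k Y \<Gamma>)
      (WF_converges \<psi> \<Lambda> n l X (pullback_cone n l X m f \<Gamma>)) F"
proof (intro exI[of _ pull] conjI ballI allI impI)
  show "seq_continuous (distributions_WF \<psi> \<Lambda> m k Y \<Gamma>) (WF_converges \<psi> \<Lambda> m k Y \<Gamma>)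
      (WF_converges \<psi> \<Lambda> n l X (pullback_cone n l X m f \<Gamma>)) pull"
    unfolding seq_continuous_def using pull_converges by blast
qed (fact pull_extension | rule pull_unique pull_WF pull_support, assumption+)+

end

theorem theorem2p9p3:
  fixes \<psi> :: "'k::nonarch_local_field \<Rightarrow> complex"
    and \<Lambda> :: "'k set"
    and n l m k :: nat
    and X Y :: "'k kvec set"
    and f :: "'k kvec \<Rightarrow> 'k kvec"
    and \<Gamma> :: "('k kvec \<times> ('k kvec \<Rightarrow> 'k)) set"
  assumes "additive_character \<psi>"
    and "open_finite_index_subgroup \<Lambda>"
    and "submanifold n l X"
    and "submanifold m k Y"
    and "strict_C1_morphism n l X m k Y f"
    and "closed_cone \<Lambda> m k Y \<Gamma>"
    and "conormal_set n l X m k Y f \<inter> \<Gamma> = {}"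
  shows "\<exists>F. continuous_extension \<psi> \<Lambda> n l X m k Y f \<Gamma> F \<and>
    (\<forall>G. continuous_extension \<psi> \<Lambda> n l X m k Y f \<Gamma> G \<longrightarrow>
       (\<forall>u\<in>distributions_WF \<psi> \<Lambda> m k Y \<Gamma>. G u = F u)) \<and>
    (\<forall>u\<in>distributions_WF \<psi> \<Lambda> m k Y \<Gamma>.
       Supp X (F u) \<subseteq> {x \<in> X. f x \<in> Supp Y u} \<and>
       F u \<in> distributions_WF \<psi> \<Lambda> n l X (pullback_cone n l X m f \<Gamma>)) \<and>
    seq_continuous (distributions_WF \<psi> \<Lambda> m k Y \<Gamma>)
      (WF_converges \<psi> \<Lambda> m k Y \<Gamma>)
      (WF_converges \<psi> \<Lambda> n l X (pullback_cone n l X m f \<Gamma>)) F"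
  by (rule pullback_exists[OF assms(1-5,7)])

end
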